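(* Let $L$ satisfy assumptions i)–viii) of the context. For any $c\in\mathbb{R}^d$, with $U$ and $\bar H(c)$ as defined in the context, there exist $(U,c,L)$-calibrated curves $\mathbf{x}\in AC^2_{loc}(\mathbb{R};L^2(I;\mathbb{R}^d))$ defined on $\mathbb{R}$, that is, curves such that $$U(\mathbf{x}(t_1))=\int_{t_1}^{t_2}\left(L_c(\mathbf{x}(s),\dot{\mathbf{x}}(s))+\bar H(c)\right)ds+U(\mathbf{x}(t_2))$$ for all $-\infty<t_1<t_2<\infty$.
   Context: Let $d\ge 1$, $I=[0,1]^d$, and let $\lambda_0$ be Lebesgue measure on $I$. $L^2(I;\mathbb{R}^d)$ is taken with respect to $\lambda_0$, with its inner product $\langle\cdot,\cdot\rangle$ and norm $\|\cdot\|$. $L^2(I;\mathbb{Z}^d)$ is the set of $M\in L^2(I;\mathbb{R}^d)$ with $M(z)\in\mathbb{Z}^d$ for $\lambda_0$-a.e. $z$. $\mathcal{G}$ is the group of bijections $G:I\to I$ such that $G$ and $G^{-1}$ are Borel measurable and push $\lambda_0$ forward to itself. The Lagrangian $L:L^2(I;\mathbb{R}^d)\times L^2(I;\mathbb{R}^d)\to\mathbb{R}$ satisfies, for some constants $C,K_L,\gamma>0$ and all $M,N,H_1,H_2\in L^2(I;\mathbb{R}^d)$, $G\in\mathcal{G}$, $Z\in L^2(I;\mathbb{Z}^d)$: i) $L(M+Z,N)=L(M,N)$; ii) $L(M\circ G,N\circ G)=L(M,N)$; iii) $L\ge 0$; iv) $L$ is $C^1$ in the Fréchet sense and $L,DL$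 are locally uniformly continuous ($DL$ is the full Fréchet derivative); v) $L(M,N)\le C(1+\|M\|^2+\|N\|^2)$ and $|L(M,0)|\le C$; vi) $\|DL\|\le C+CL$; vii) $L(M+H_1,N+H_2)-L(M,N)-\langle D_xL(M,N),H_1\rangle-\langle D_vL(M,N),H_2\rangle\ge\gamma\|H_2\|^2-K_L\|H_1\|^2$; viii) $L(M+H_1,N+H_2)-L(M,N)-\langle D_xL(M,N),H_1\rangle-\langle D_vL(M,N),H_2\rangle\le K_L\|H_2\|^2+K_L\|H_1\|^2$. Here $D_x,D_v$ are the partial Fréchet derivatives in the first and second variable. For $c\in\mathbb{R}^d$, $L_c(M,N)=L(M,N)+\int_I c\cdot N\,d\lambda_0$. A curve $\sigma:(a,b)\to L^2(I;\mathbb{R}^d)$ is in $AC^2((a,b);L^2(I;\mathbb{R}^d))$ if there is $\beta\in L^2(a,b)$ with $\|\sigma_t-\sigma_s\|\le\int_s^t\beta(u)\,du$ for all $s<t$ in $(a,b)$. $AC^2_{loc}((0,\infty);L^2(I;\mathbb{R}^d))$ (resp. $AC^2_{loc}(\mathbb{R};L^2(I;\mathbb{R}^d))$) is the set of curves on $(0,\infty)$ (resp. $\mathbb{R}$) whose restriction to $(0,T)$ for every $T>0$ (resp. to every bounded open interval) is in the corresponding $AC^2$. $\dot{\mathbf{x}}$ is the a.e. derivative; values at $0$ are understood through the continuous extension. For $\varepsilon>0$, $V_{\varepsilon}(M)=\inf\{\int_0^\infty e^{-\varepsilon t}L_c(\mathbf{x},\dot{\mathbf{x}})\,dt:\mathbf{x}\in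 AC^2_{loc}((0,\infty);L^2(I;\mathbb{R}^d)),\ \mathbf{x}(0)=M\}$ and $U_\varepsilon=V_\varepsilon-\inf V_\varepsilon$. There is a sequence $\varepsilon_j\to0^+$ along which $\varepsilon_jV_{\varepsilon_j}$ converges uniformly to a constant, denoted $-\bar H(c)$, and $U_{\varepsilon_j}$ converges uniformly to a Lipschitz function, denoted $U:L^2(I;\mathbb{R}^d)\to\mathbb{R}$; $U$ and $\bar H(c)$ denote the limits along any such fixed sequence. *)

theory Defs
  imports "HOL-Analysis.Analysis"
begin

section \<open>The Hilbert space \<open>L\<^sup>2(I;\<real>\<^sup>d)\<close>\<close>

text \<open>
  The dimension \<open>d \<ge> 1\<close> is the cardinality of the index type \<^typ>\<open>'d::finite\<close>, and
  \<open>1 :: real ^ 'd\<close> is the vector all of whose coordinates are 1.  The measure is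
  Lebesgue measure on the Borel sets of the cube; completing it would not change the
  space of equivalence classes below.
\<close>

definition cube :: "(real ^ 'd) set"
  where "cube = cbox 0 1"

lemma mem_cube: "z \<in> cube \<longleftrightarrow> (\<forall>i. 0 \<le> z $ i \<and> z $ i \<le> 1)"
  by (simp add: cube_def mem_box_cart)

definition cube_measure :: "(real ^ 'd) measure" (\<open>\<lambda>\<^sub>0\<close>)
  where "\<lambda>\<^sub>0 = restrict_space lborel cube"

definition square_integrable :: "(real ^ 'd \<Rightarrow> real ^ 'd) \<Rightarrow> bool"
  where "square_integrable f \<longleftrightarrow>
    f \<in> borel_measurable \<lambda>\<^sub>0 \<and> integrable \<lambda>\<^sub>0 (\<lambda>z. (norm (f z))\<^sup>2)"

definition L2_rel :: "(real ^ 'd \<Rightarrow> real ^ 'd) \<Rightarrow> (real ^ 'd \<Rightarrow> real ^ 'd) \<Rightarrow> bool"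
  where "L2_rel f g \<longleftrightarrow>
    square_integrable f \<and> square_integrable g \<and> (AE z in \<lambda>\<^sub>0. f z = g z)"

lemma square_integrable_zero: "square_integrable (\<lambda>_. 0)"
  by (simp add: square_integrable_def)

lemma square_integrable_scaleR:
  assumes "square_integrable f"
  shows "square_integrable (\<lambda>z. r *\<^sub>R f z)"
  using assms by (auto simp: square_integrable_def power_mult_distrib)

lemma square_integrable_add:
  assumes "square_integrable f" "square_integrable g"
  shows "square_integrable (\<lambda>z. f z + g z)"
  unfolding square_integrable_def
proof
  have f[measurable]: "f \<in> borel_measurable \<lambda>\<^sub>0" and g[measurable]: "g \<in> borel_measurable \<lambda>\<^sub>0"
    using assms by (auto simp: square_integrable_def)
  show "(\<lambda>z. f z + g z) \<in> borel_measurable \<lambda>\<^sub>0" by measurable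
  show "integrable \<lambda>\<^sub>0 (\<lambda>z. (norm (f z + g z))\<^sup>2)"
  proof (rule Bochner_Integration.integrable_bound)
    show "integrable \<lambda>\<^sub>0 (\<lambda>z. 2 * (norm (f z))\<^sup>2 + 2 * (norm (g z))\<^sup>2)"
      using assms by (auto simp: square_integrable_def)
    have "(norm (f z + g z))\<^sup>2 \<le> 2 * (norm (f z))\<^sup>2 + 2 * (norm (g z))\<^sup>2" for z
    proof -
      have "(norm (f z + g z))\<^sup>2 \<le> (norm (f z) + norm (g z))\<^sup>2"
        by (simp add: norm_triangle_ineq power_mono)
      also have "\<dots> \<le> 2 * (norm (f z))\<^sup>2 + 2 * (norm (g z))\<^sup>2"
        using sum_squares_bound[of "norm (f z)" "norm (g z)"] by (simp add: power2_sum)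
      finally show ?thesis .
    qed
    then show "AE z in \<lambda>\<^sub>0. norm ((norm (f z + g z))\<^sup>2)
        \<le> norm (2 * (norm (f z))\<^sup>2 + 2 * (norm (g z))\<^sup>2)"
      by (intro AE_I2) (simp add: order_trans[OF _ abs_ge_self])
  qed measurable
qed

lemma square_integrable_inner:
  assumes "square_integrable f" "square_integrable g"
  shows "integrable \<lambda>\<^sub>0 (\<lambda>z. f z \<bullet> g z)"
proof (rule Bochner_Integration.integrable_bound)
  have f[measurable]: "f \<in> borel_measurable \<lambda>\<^sub>0" and g[measurable]: "g \<in> borel_measurable \<lambda>\<^sub>0"
    using assms by (auto simp: square_integrable_def)
  show "(\<lambda>z. f z \<bullet> g z) \<in> borel_measurable \<lambda>\<^sub>0" by measurable
  show "integrable \<lambda>\<^sub>0 (\<lambda>z. (norm (f z))\<^sup>2 + (norm (g z))\<^sup>2)"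
    using assms by (auto simp: square_integrable_def)
  have "\<bar>f z \<bullet> g z\<bar> \<le> (norm (f z))\<^sup>2 + (norm (g z))\<^sup>2" for z
  proof -
    have "\<bar>f z \<bullet> g z\<bar> \<le> norm (f z) * norm (g z)" by (rule Cauchy_Schwarz_ineq2)
    also have "\<dots> \<le> 2 * norm (f z) * norm (g z)" by simp
    also have "\<dots> \<le> (norm (f z))\<^sup>2 + (norm (g z))\<^sup>2" by (rule sum_squares_bound)
    finally show ?thesis .
  qed
  then show "AE z in \<lambda>\<^sub>0. norm (f z \<bullet> g z) \<le> norm ((norm (f z))\<^sup>2 + (norm (g z))\<^sup>2)"
    by (intro AE_I2) (simp add: order_trans[OF _ abs_ge_self])
qed

lemma part_equivp_L2_rel: "part_equivp L2_rel"
proof (rule part_equivpI)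
  show "\<exists>f. L2_rel f f"
    by (rule exI[of _ "\<lambda>_. 0"]) (simp add: L2_rel_def square_integrable_zero)
  show "symp L2_rel"
    by (rule sympI) (auto simp: L2_rel_def elim: eventually_mono)
  show "transp L2_rel"
  proof (rule transpI)
    fix f g h :: "real ^ 'd \<Rightarrow> real ^ 'd"
    assume "L2_rel f g" "L2_rel g h"
    then show "L2_rel f h"
      by (auto simp: L2_rel_def elim: eventually_elim2)
  qed
qed

quotient_type 'd L2 = "(real ^ 'd) \<Rightarrow> (real ^ 'd)" / partial: L2_rel
  morphisms rep_L2 abs_L2
  by (rule part_equivp_L2_rel)

instantiation L2 :: (finite) real_inner
begin

lift_definition zero_L2 :: "'a L2" is "\<lambda>_. 0"
  by (simp add: L2_rel_def square_integrable_zero)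

lift_definition plus_L2 :: "'a L2 \<Rightarrow> 'a L2 \<Rightarrow> 'a L2" is "\<lambda>f g z. f z + g z"
  by (auto simp: L2_rel_def square_integrable_add elim: eventually_elim2)

lift_definition scaleR_L2 :: "real \<Rightarrow> 'a L2 \<Rightarrow> 'a L2" is "\<lambda>r f z. r *\<^sub>R f z"
  by (auto simp: L2_rel_def square_integrable_scaleR elim: eventually_mono)

definition uminus_L2 :: "'a L2 \<Rightarrow> 'a L2" where "- M = (-1) *\<^sub>R (M :: 'a L2)"

definition minus_L2 :: "'a L2 \<Rightarrow> 'a L2 \<Rightarrow> 'a L2" where "M - N = M + (- N :: 'a L2)"

lift_definition inner_L2 :: "'a L2 \<Rightarrow> 'a L2 \<Rightarrow> real" is "\<lambda>f g. \<integral>z. f z \<bullet> g z \<partial>\<lambda>\<^sub>0"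
proof -
  fix f f' g g' :: "real ^ 'a \<Rightarrow> real ^ 'a"
  assume f: "L2_rel f f'" and g: "L2_rel g g'"
  have "AE z in \<lambda>\<^sub>0. f z \<bullet> g z = f' z \<bullet> g' z"
    using f g by (auto simp: L2_rel_def elim: eventually_elim2)
  then show "(\<integral>z. f z \<bullet> g z \<partial>\<lambda>\<^sub>0) = (\<integral>z. f' z \<bullet> g' z \<partial>\<lambda>\<^sub>0)"
    using f g
    by (intro integral_cong_AE borel_measurable_integrable square_integrable_inner)
       (auto simp: L2_rel_def)
qed

definition norm_L2 :: "'a L2 \<Rightarrow> real" where "norm_L2 M = sqrt (M \<bullet> M)"

definition sgn_L2 :: "'a L2 \<Rightarrow> 'a L2" where "sgn_L2 M = inverse (norm M) *\<^sub>R M"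

definition dist_L2 :: "'a L2 \<Rightarrow> 'a L2 \<Rightarrow> real" where "dist_L2 M N = norm (M - N)"

definition uniformity_L2 :: "('a L2 \<times> 'a L2) filter"
  where "uniformity_L2 = (INF e\<in>{0<..}. principal {(M, N). dist M N < e})"

definition open_L2 :: "'a L2 set \<Rightarrow> bool"
  where "open_L2 S \<longleftrightarrow> (\<forall>M\<in>S. \<forall>\<^sub>F (M', N) in uniformity. M' = M \<longrightarrow> N \<in> S)"

instance
proof
  fix M N K :: "'a L2" and r s :: real and S :: "'a L2 set"
  note si = square_integrable_zero square_integrable_add square_integrable_scaleR
  show "M + N + K = M + (N + K)"
    by transfer (auto simp: L2_rel_def si add.assoc)
  show "M + N = N + M"
    by transfer (auto simp: L2_rel_def si add.commute)
  show "0 + M = M"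
    by transfer (auto simp: L2_rel_def si)
  show "- M + M = 0"
    unfolding uminus_L2_def by transfer (auto simp: L2_rel_def si)
  show "M - N = M + - N" by (fact minus_L2_def)
  show "r *\<^sub>R (M + N) = r *\<^sub>R M + r *\<^sub>R N"
    by transfer (auto simp: L2_rel_def si scaleR_add_right)
  show "(r + s) *\<^sub>R M = r *\<^sub>R M + s *\<^sub>R M"
    by transfer (auto simp: L2_rel_def si scaleR_add_left)
  show "r *\<^sub>R s *\<^sub>R M = (r * s) *\<^sub>R M"
    by transfer (auto simp: L2_rel_def si)
  show "1 *\<^sub>R M = M"
    by transfer (auto simp: L2_rel_def si)
  show "dist M N = norm (M - N)" by (fact dist_L2_def)
  show "sgn M = inverse (norm M) *\<^sub>R M" by (fact sgn_L2_def)
  show "uniformity = (INF e\<in>{0<..}. principal {(M :: 'a L2, N). dist M N < e})"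
    by (fact uniformity_L2_def)
  show "open S \<longleftrightarrow> (\<forall>M\<in>S. \<forall>\<^sub>F (M', N) in uniformity. M' = M \<longrightarrow> N \<in> S)"
    by (fact open_L2_def)
  show "M \<bullet> N = N \<bullet> M"
    by transfer (simp add: inner_commute)
  show "(M + N) \<bullet> K = M \<bullet> K + N \<bullet> K"
    by transfer (auto simp: L2_rel_def inner_add_left square_integrable_inner)
  show "(r *\<^sub>R M) \<bullet> N = r * (M \<bullet> N)"
    by transfer simp
  show "0 \<le> M \<bullet> M"
    by transfer simp
  show "M \<bullet> M = 0 \<longleftrightarrow> M = 0"
  proof transfer
    fix f :: "real ^ 'a \<Rightarrow> real ^ 'a"
    assume "L2_rel f f"
    then have f: "square_integrable f" by (simp add: L2_rel_def)
    have "(\<integral>z. f z \<bullet> f z \<partial>\<lambda>\<^sub>0) = 0 \<longleftrightarrow> (AE z in \<lambda>\<^sub>0. f z \<bullet> f z = 0)"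
      using square_integrable_inner[OF f f] by (intro integral_nonneg_eq_0_iff_AE) auto
    then show "(\<integral>z. f z \<bullet> f z \<partial>\<lambda>\<^sub>0) = 0 \<longleftrightarrow> L2_rel f (\<lambda>_. 0)"
      using f by (simp add: L2_rel_def square_integrable_zero)
  qed
  show "norm M = sqrt (M \<bullet> M)" by (fact norm_L2_def)
qed

end

lift_definition integer_valued :: "('d::finite) L2 \<Rightarrow> bool"
  is "\<lambda>f. AE z in \<lambda>\<^sub>0. \<forall>i. f z $ i \<in> \<int>"
  unfolding L2_rel_def by (auto elim: eventually_elim2)

lift_definition integral_dot :: "real ^ 'd \<Rightarrow> ('d::finite) L2 \<Rightarrow> real"
  is "\<lambda>c f. \<integral>z. c \<bullet> f z \<partial>\<lambda>\<^sub>0"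
  unfolding L2_rel_def square_integrable_def
  by (intro integral_cong_AE) (auto elim: eventually_mono)

section \<open>Rearrangements of the cube\<close>

text \<open>Elements of \<open>\<G>\<close> are total functions of which only the values on the cube matter.\<close>

definition rearrangements :: "(real ^ 'd \<Rightarrow> real ^ 'd) set" (\<open>\<G>\<close>)
  where "\<G> = {G. bij_betw G cube cube \<and>
    G \<in> \<lambda>\<^sub>0 \<rightarrow>\<^sub>M \<lambda>\<^sub>0 \<and> the_inv_into cube G \<in> \<lambda>\<^sub>0 \<rightarrow>\<^sub>M \<lambda>\<^sub>0 \<and>
    distr \<lambda>\<^sub>0 \<lambda>\<^sub>0 G = \<lambda>\<^sub>0 \<and> distr \<lambda>\<^sub>0 \<lambda>\<^sub>0 (the_inv_into cube G) = \<lambda>\<^sub>0}"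

definition L2_comp :: "('d::finite) L2 \<Rightarrow> (real ^ 'd \<Rightarrow> real ^ 'd) \<Rightarrow> 'd L2" (infixl \<open>\<circ>\<^sub>L\<close> 70)
  where "M \<circ>\<^sub>L G = abs_L2 (rep_L2 M \<circ> G)"

text \<open>For \<open>G \<in> \<G>\<close> the class \<open>M \<circ>\<^sub>L G\<close> does not depend on the representative of \<open>M\<close>.\<close>

lemma L2_rel_comp:
  assumes "G \<in> \<G>" "L2_rel f g"
  shows "L2_rel (f \<circ> G) (g \<circ> G)"
proof -
  have G[measurable]: "G \<in> \<lambda>\<^sub>0 \<rightarrow>\<^sub>M \<lambda>\<^sub>0" and d: "distr \<lambda>\<^sub>0 \<lambda>\<^sub>0 G = \<lambda>\<^sub>0"
    using assms by (auto simp: rearrangements_def)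
  have si: "square_integrable (h \<circ> G)" if h: "square_integrable h" for h
  proof -
    have [measurable]: "h \<in> borel_measurable \<lambda>\<^sub>0"
      using h by (simp add: square_integrable_def)
    have "integrable (distr \<lambda>\<^sub>0 \<lambda>\<^sub>0 G) (\<lambda>z. (norm (h z))\<^sup>2)"
      using h by (simp add: d square_integrable_def)
    then have "integrable \<lambda>\<^sub>0 (\<lambda>z. (norm (h (G z)))\<^sup>2)"
      by (subst (asm) integrable_distr_eq) auto
    then show ?thesis
      by (simp add: square_integrable_def o_def)
  qed
  have "AE z in distr \<lambda>\<^sub>0 \<lambda>\<^sub>0 G. f z = g z"
    using assms(2) by (simp only: d L2_rel_def)
  then have "AE z in \<lambda>\<^sub>0. f (G z) = g (G z)"
    by (rule AE_distrD[OF G])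
  then show ?thesis
    using assms si by (simp add: L2_rel_def)
qed

lemma L2_comp_abs:
  assumes "G \<in> \<G>" "square_integrable f"
  shows "abs_L2 f \<circ>\<^sub>L G = abs_L2 (f \<circ> G)"
proof -
  have "L2_rel (rep_L2 (abs_L2 f)) f"
    using assms(2) by (intro Quotient3_rep_abs[OF Quotient3_L2]) (simp add: L2_rel_def)
  from L2_rel_comp[OF assms(1) this] show ?thesis
    unfolding L2_comp_def using Quotient3_rel_abs[OF Quotient3_L2] by blast
qed

section \<open>Lagrangians\<close>

definition locally_uniformly_continuous :: "('a::metric_space \<Rightarrow> 'b::metric_space) \<Rightarrow> bool"
  where "locally_uniformly_continuous f \<longleftrightarrow>
    (\<forall>p. \<exists>r>0. uniformly_continuous_on (ball p r) f)"

text \<open>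
  \<open>\<D> L (M, N)\<close> is the full Frechet derivative, as a bounded functional with its operator
  norm.  The partial derivatives \<open>D\<^sub>x L M N\<close> and \<open>D\<^sub>v L M N\<close> are kept as functionals, so
  \<open>D\<^sub>x L M N H\<close> is what is otherwise written as the inner product of the gradient with \<open>H\<close>.
\<close>

definition full_deriv ::
    "(('d::finite) L2 \<Rightarrow> 'd L2 \<Rightarrow> real) \<Rightarrow> 'd L2 \<times> 'd L2 \<Rightarrow> ('d L2 \<times> 'd L2) \<Rightarrow>\<^sub>L real" (\<open>\<D>\<close>)
  where "\<D> L p = Blinfun (frechet_derivative (\<lambda>(M, N). L M N) (at p))"

definition partial_x :: "(('d::finite) L2 \<Rightarrow> 'd L2 \<Rightarrow> real) \<Rightarrow> 'd L2 \<Rightarrow> 'd L2 \<Rightarrow> 'd L2 \<Rightarrow> real"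
    (\<open>D\<^sub>x\<close>)
  where "D\<^sub>x L M N = frechet_derivative (\<lambda>M'. L M' N) (at M)"

definition partial_v :: "(('d::finite) L2 \<Rightarrow> 'd L2 \<Rightarrow> real) \<Rightarrow> 'd L2 \<Rightarrow> 'd L2 \<Rightarrow> 'd L2 \<Rightarrow> real"
    (\<open>D\<^sub>v\<close>)
  where "D\<^sub>v L M N = frechet_derivative (\<lambda>N'. L M N') (at N)"

definition lagrangian :: "(('d::finite) L2 \<Rightarrow> 'd L2 \<Rightarrow> real) \<Rightarrow> bool"
  where "lagrangian L \<longleftrightarrow>
    (\<forall>M N Z. integer_valued Z \<longrightarrow> L (M + Z) N = L M N) \<and>
    (\<forall>M N. \<forall>G\<in>\<G>. L (M \<circ>\<^sub>L G) (N \<circ>\<^sub>L G) = L M N) \<and>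
    (\<forall>M N. 0 \<le> L M N) \<and>
    (\<forall>p. (\<lambda>(M, N). L M N) differentiable at p) \<and> continuous_on UNIV (\<D> L) \<and>
    locally_uniformly_continuous (\<lambda>(M, N). L M N) \<and> locally_uniformly_continuous (\<D> L) \<and>
    (\<exists>C>0. \<exists>K\<^sub>L>0. \<exists>\<gamma>>0.
      (\<forall>M N. L M N \<le> C * (1 + (norm M)\<^sup>2 + (norm N)\<^sup>2)) \<and>
      (\<forall>M. \<bar>L M 0\<bar> \<le> C) \<and>
      (\<forall>M N. norm (\<D> L (M, N)) \<le> C + C * L M N) \<and>
      (\<forall>M N H\<^sub>1 H\<^sub>2. L (M + H\<^sub>1) (N + H\<^sub>2) - L M N - D\<^sub>x L M N H\<^sub>1 - D\<^sub>v L M N H\<^sub>2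
          \<ge> \<gamma> * (norm H\<^sub>2)\<^sup>2 - K\<^sub>L * (norm H\<^sub>1)\<^sup>2) \<and>
      (\<forall>M N H\<^sub>1 H\<^sub>2. L (M + H\<^sub>1) (N + H\<^sub>2) - L M N - D\<^sub>x L M N H\<^sub>1 - D\<^sub>v L M N H\<^sub>2
          \<le> K\<^sub>L * (norm H\<^sub>2)\<^sup>2 + K\<^sub>L * (norm H\<^sub>1)\<^sup>2))"

definition shifted_lagrangian ::
    "(('d::finite) L2 \<Rightarrow> 'd L2 \<Rightarrow> real) \<Rightarrow> real ^ 'd \<Rightarrow> 'd L2 \<Rightarrow> 'd L2 \<Rightarrow> real"
  where "shifted_lagrangian L c M N = L M N + integral_dot c N"

section \<open>Absolutely continuous curves and the discounted value function\<close>

definition AC2 :: "real \<Rightarrow> real \<Rightarrow> (real \<Rightarrow> 'a::real_normed_vector) \<Rightarrow> bool"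
  where "AC2 a b \<sigma> \<longleftrightarrow>
    (\<exists>\<beta> :: real \<Rightarrow> real. set_borel_measurable lebesgue {a<..<b} \<beta> \<and>
      set_integrable lebesgue {a<..<b} (\<lambda>u. (\<beta> u)\<^sup>2) \<and>
      (\<forall>s t. a < s \<longrightarrow> s < t \<longrightarrow> t < b \<longrightarrow>
        norm (\<sigma> t - \<sigma> s) \<le> (LINT u:{s..t}|lebesgue. \<beta> u)))"

definition AC2_loc_pos :: "(real \<Rightarrow> 'a::real_normed_vector) \<Rightarrow> bool"
  where "AC2_loc_pos \<sigma> \<longleftrightarrow> (\<forall>T>0. AC2 0 T \<sigma>)"

definition AC2_loc :: "(real \<Rightarrow> 'a::real_normed_vector) \<Rightarrow> bool"
  where "AC2_loc \<sigma> \<longleftrightarrow> (\<forall>a b. a < b \<longrightarrow> AC2 a b \<sigma>)"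

text \<open>
  Integral with values in \<open>[-\<infinity>, \<infinity>]\<close>.  The action integrals below have finite negative
  part, so the case \<open>\<infinity> - \<infinity>\<close> does not arise.
\<close>

definition ereal_integral :: "'a measure \<Rightarrow> ('a \<Rightarrow> real) \<Rightarrow> ereal"
  where "ereal_integral \<mu> f =
    enn2ereal (\<integral>\<^sup>+ t. ennreal (f t) \<partial>\<mu>) - enn2ereal (\<integral>\<^sup>+ t. ennreal (- f t) \<partial>\<mu>)"

text \<open>
  Curves in the infimum are functions on \<open>\<real>\<close> of which only the values on \<open>(0, \<infinity>)\<close> matter;
  the value at 0 is the one-sided limit.  For a Lagrangian in the above sense the infimum
  is a real number: the integrand is bounded below by a multiple of \<open>exp (- \<epsilon> t)\<close>,
  and constant curves have finite action.
\<close>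

definition value_fun :: "(('d::finite) L2 \<Rightarrow> 'd L2 \<Rightarrow> real) \<Rightarrow> real ^ 'd \<Rightarrow> real \<Rightarrow> 'd L2 \<Rightarrow> real"
  where "value_fun L c \<epsilon> M = real_of_ereal
    (INF x \<in> {x. AC2_loc_pos x \<and> (x \<longlongrightarrow> M) (at_right 0)}.
      ereal_integral (lebesgue_on {0<..})
        (\<lambda>t. exp (- \<epsilon> * t) * shifted_lagrangian L c (x t) (vector_derivative x (at t))))"

text \<open>
  \<open>U\<close> and \<open>H\<close> (the effective Hamiltonian at \<open>c\<close>) arise as vanishing discount limits along
  a common sequence.
\<close>

definition vanishing_discount_limit ::
    "(('d::finite) L2 \<Rightarrow> 'd L2 \<Rightarrow> real) \<Rightarrow> real ^ 'd \<Rightarrow> ('d L2 \<Rightarrow> real) \<Rightarrow> real \<Rightarrow> bool"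
  where "vanishing_discount_limit L c U H \<longleftrightarrow>
    (\<exists>\<epsilon> :: nat \<Rightarrow> real. (\<forall>j. 0 < \<epsilon> j) \<and> \<epsilon> \<longlonglongrightarrow> 0 \<and>
      uniform_limit UNIV (\<lambda>j M. \<epsilon> j * value_fun L c (\<epsilon> j) M) (\<lambda>_. - H) sequentially \<and>
      uniform_limit UNIV (\<lambda>j M. value_fun L c (\<epsilon> j) M - (INF N. value_fun L c (\<epsilon> j) N)) U sequentially \<and>
      (\<exists>B. B-lipschitz_on UNIV U))"

definition calibrated ::
    "('d L2 \<Rightarrow> real) \<Rightarrow> real ^ 'd \<Rightarrow> (('d::finite) L2 \<Rightarrow> 'd L2 \<Rightarrow> real) \<Rightarrow> real \<Rightarrow> (real \<Rightarrow> 'd L2) \<Rightarrow> bool"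
  where "calibrated U c L H x \<longleftrightarrow>
    (\<forall>t\<^sub>1 t\<^sub>2. t\<^sub>1 < t\<^sub>2 \<longrightarrow>
      set_integrable lebesgue {t\<^sub>1..t\<^sub>2}
        (\<lambda>s. shifted_lagrangian L c (x s) (vector_derivative x (at s)) + H) \<and>
      U (x t\<^sub>1) = (LINT s:{t\<^sub>1..t\<^sub>2}|lebesgue.
        shifted_lagrangian L c (x s) (vector_derivative x (at s)) + H) + U (x t\<^sub>2))"

end

theory Submission
  imports Defs "HOL-Library.Diagonal_Subsequence"
begin

text \<open>
  A calibrated curve is obtained as a limit of curves that are calibrated up to a small
  error on longer and longer intervals.  The space \<open>L\<^sup>2\<close> is not locally compact and a
  Lagrangian is only continuous for the norm, so neither the extraction of a limit nor the
  passage to the limit in the action can rely on weak convergence.  Two facts replace it.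

  The first is compactness modulo symmetries.  Adding an integer-valued element and composing with a
  rearrangement are isometries that preserve the shifted Lagrangian, hence the value
  functions, hence \<open>U\<close>.  Modulo these isometries \<open>L\<^sup>2\<close> is totally bounded: modulo integers an
  element has values in the unit cube, it is close to a step function on a grid with
  values in a fixed finite set, and two such step functions can be matched by permuting the
  cells of a common refinement as soon as their level sets have almost equal measure
  (\<open>rearrange_to_match\<close>, \<open>lagrangian_totally_bounded_modulo_symmetry\<close>).  Every sequence of
  points therefore has a subsequence that converges after applying symmetries
  (\<open>convergent_modulo_symmetry\<close>).

  The second is stability.  Let \<open>x\<close> and \<open>y\<close> be almost calibrated, \<open>x\<close> on a longer interval
  than \<open>y\<close>.  If they are close at one time of a short interval of fixed length, then they
  are close there in \<open>H\<^sup>1\<close> (\<open>stability\<close>).  To see this, let \<open>x\<close> and \<open>y\<close> cross over: one competitor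
  starts on \<open>y\<close> and ends on \<open>x\<close>, another one starts on \<open>x\<close> and ends on \<open>y\<close>.  Since \<open>U\<close> is a
  subsolution, neither of them beats the calibrated curves, and the uniform convexity of the
  Lagrangian in the velocity turns this into a bound for \<open>\<integral> \<parallel>y' - x'\<parallel>\<^sup>2\<close>
  (\<open>crossing_inequality\<close>).  The first variation of the action is estimated by comparing
  values only, so no Euler-Lagrange equation and no regularity of minimizers enters.

  The dynamic programming principle for the discounted problem yields, in the vanishing
  discount limit, the inequality \<open>U (x a) \<le> \<integral> (L\<^sub>c + H) + U (x b)\<close> for all curves and, for
  every time horizon, curves for which it is an equality up to an arbitrarily small error
  (\<open>U_dominated\<close>, \<open>U_almost_attained\<close>).  Such curves are centred at time 0 and moved by
  symmetries so that their values at time 0 converge.  Stability, applied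
  on successive short intervals, makes them a Cauchy sequence in \<open>H\<^sup>1\<close> on every bounded
  interval; Fatou's lemma bounds the action of the limit from above, and the
  domination inequality bounds it from below (\<open>calibrated_limit\<close>, \<open>calibrated_curve_exists\<close>).

  The a.e. derivative of a curve with values in a Hilbert space is under control because a
  curve whose dyadic interpolations have bounded energy is differentiable almost everywhere
  and satisfies the fundamental theorem of calculus as an inequality
  (\<open>AE_differentiable_of_energy\<close>, \<open>energy_norm_diff_le\<close>).  Bounded energies characterize the
  curves that have a locally square integrable speed, and bounds on the energies pass to
  pointwise limits.
\<close>

section \<open>Almost everywhere differentiability of curves of finite energy\<close>

definition dyadic :: "real \<Rightarrow> real \<Rightarrow> nat \<Rightarrow> nat \<Rightarrow> real"
  where "dyadic a b n k = a + (b - a) * real k / 2 ^ n"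

text \<open>
  This is the integral of the squared speed of the polygon that interpolates \<open>x\<close> at the dyadic
  points of level \<open>n\<close> (\<open>slope_integral_sq\<close>).
\<close>

definition dyadic_energy :: "(real \<Rightarrow> 'a::real_normed_vector) \<Rightarrow> real \<Rightarrow> real \<Rightarrow> nat \<Rightarrow> real"
  where "dyadic_energy x a b n =
    (\<Sum>k<2^n. (norm (x (dyadic a b n (Suc k)) - x (dyadic a b n k)))\<^sup>2) * 2 ^ n / (b - a)"

lemma dyadic_0[simp]: "dyadic a b n 0 = a"
  by (simp add: dyadic_def)

lemma dyadic_last[simp]: "dyadic a b n (2 ^ n) = b"
  by (simp add: dyadic_def)

lemma dyadic_Suc: "dyadic a b n (Suc k) = dyadic a b n k + (b - a) / 2 ^ n"
  by (simp add: dyadic_def field_simps)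

lemma dyadic_mono: "a < b \<Longrightarrow> i \<le> j \<Longrightarrow> dyadic a b n i \<le> dyadic a b n j"
  by (simp add: dyadic_def divide_right_mono)

lemma dyadic_refine: "dyadic a b (n + m) (k * 2 ^ m) = dyadic a b n k"
  by (simp add: dyadic_def power_add field_simps)

lemma dyadic_double: "dyadic a b (Suc n) (2 * k) = dyadic a b n k"
  using dyadic_refine[of a b n 1 k] by (simp add: mult.commute)

lemma sum_lessThan_double:
  fixes f :: "nat \<Rightarrow> 'a::comm_monoid_add"
  shows "(\<Sum>k<2*N. f k) = (\<Sum>k<N. f (2 * k) + f (Suc (2 * k)))"
  by (induction N) (simp_all add: ac_simps)

text \<open>
  The parallelogram law splits the two increments over the halves of an interval
  into the increment over the whole interval and a second difference.
\<close>

lemma dyadic_energy_Suc: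
  fixes x :: "real \<Rightarrow> 'a::real_inner"
  assumes "a < b"
  shows "dyadic_energy x a b (Suc n) = dyadic_energy x a b n +
    (\<Sum>k<2^n. (norm (x (dyadic a b n (Suc k)) + x (dyadic a b n k)
        - 2 *\<^sub>R x (dyadic a b (Suc n) (Suc (2 * k)))))\<^sup>2) * 2 ^ n / (b - a)"
proof -
  have par: "2 * ((norm (q - p))\<^sup>2 + (norm (r - q))\<^sup>2)
      = (norm (r - p))\<^sup>2 + (norm (r + p - 2 *\<^sub>R q))\<^sup>2" for p q r :: 'a
    by (simp add: power2_norm_eq_inner algebra_simps inner_commute)
  have "dyadic a b (Suc n) (Suc (Suc (2 * k))) = dyadic a b n (Suc k)" for k
    using dyadic_double[of a b n "Suc k"] by simp
  then have "2 * (\<Sum>k<2 ^ Suc n. (norm (x (dyadic a b (Suc n) (Suc k)) - x (dyadic a b (Suc n) k)))\<^sup>2)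
     = (\<Sum>k<2^n. (norm (x (dyadic a b n (Suc k)) - x (dyadic a b n k)))\<^sup>2)
     + (\<Sum>k<2^n. (norm (x (dyadic a b n (Suc k)) + x (dyadic a b n k)
        - 2 *\<^sub>R x (dyadic a b (Suc n) (Suc (2 * k)))))\<^sup>2)"
    unfolding power_Suc sum_lessThan_double sum_distrib_left dyadic_double sum.distrib[symmetric]
    by (intro sum.cong refl) (simp only: par)
  moreover have "S * (2 * N) / c = A * N / c + B * N / c" if "2 * S = A + B" for S N c A B :: real
  proof -
    have "S * (2 * N) / c = (2 * S) * N / c" by simp
    also have "\<dots> = A * N / c + B * N / c" unfolding that by (simp add: distrib_right add_divide_distrib)
    finally show ?thesis .
  qed
  ultimately show ?thesis
    unfolding dyadic_energy_def by (simp only: power_Suc)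
qed

lemma dyadic_energy_mono:
  fixes x :: "real \<Rightarrow> 'a::real_inner"
  assumes "a < b" "n \<le> m"
  shows "dyadic_energy x a b n \<le> dyadic_energy x a b m"
  using assms(2)
proof (induction m rule: dec_induct)
  case (step m)
  have "dyadic_energy x a b m \<le> dyadic_energy x a b (Suc m)"
    unfolding dyadic_energy_Suc[OF assms(1)] using assms(1) by (simp add: sum_nonneg)
  with step show ?case by simp
qed simp

definition polygon :: "(real \<Rightarrow> 'a::real_normed_vector) \<Rightarrow> real \<Rightarrow> real \<Rightarrow> nat \<Rightarrow> real \<Rightarrow> 'a"
  where "polygon x a b n t = (let k = nat \<lfloor>(t - a) * 2 ^ n / (b - a)\<rfloor> in
    x (dyadic a b n k) + ((t - dyadic a b n k) * 2 ^ n / (b - a)) *\<^sub>R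
      (x (dyadic a b n (Suc k)) - x (dyadic a b n k)))"

lemma polygon_eq:
  assumes ab: "a < b" and t: "dyadic a b n k \<le> t" "t \<le> dyadic a b n (Suc k)"
  shows "polygon x a b n t = x (dyadic a b n k) + ((t - dyadic a b n k) * 2 ^ n / (b - a)) *\<^sub>R
      (x (dyadic a b n (Suc k)) - x (dyadic a b n k))"
proof -
  define u where "u = (t - a) * 2 ^ n / (b - a)"
  have u: "real k \<le> u" "u \<le> real (Suc k)"
    using t ab by (simp_all add: u_def dyadic_def field_simps)
  have tu: "t = a + (b - a) * u / 2 ^ n"
    using ab by (simp add: u_def)
  show ?thesis
  proof (cases "u = real (Suc k)")
    case True
    then have "t = dyadic a b n (Suc k)" by (simp add: tu dyadic_def)
    moreover have "nat \<lfloor>u\<rfloor> = Suc k" unfolding True by (simp only: floor_of_nat nat_int)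
    ultimately show ?thesis
      using ab unfolding polygon_def u_def[symmetric] by (simp add: dyadic_Suc)
  next
    case False
    then have "nat \<lfloor>u\<rfloor> = k" using u by linarith
    then show ?thesis by (simp add: polygon_def u_def[symmetric])
  qed
qed

lemma polygon_at_dyadic:
  assumes "a < b" shows "polygon x a b n (dyadic a b n k) = x (dyadic a b n k)"
  using polygon_eq[OF assms, of n k "dyadic a b n k" x] assms by (simp add: dyadic_Suc)

text \<open>
  The polygon is affine between neighbouring dyadic points of any finer level, so subtracting
  it changes no second difference: the residual carries exactly the energy that is gained
  beyond level \<open>n\<close>.
\<close>

lemma dyadic_energy_minus_polygon:
  fixes x :: "real \<Rightarrow> 'a::real_inner"
  assumes ab: "a < b" and "n \<le> m"
  shows "dyadic_energy (\<lambda>t. x t - polygon x a b n t) a b m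
    = dyadic_energy x a b m - dyadic_energy x a b n"
  using assms(2)
proof (induction m rule: dec_induct)
  case base
  show ?case by (simp add: dyadic_energy_def polygon_at_dyadic[OF ab])
next
  case (step m)
  let ?P = "polygon x a b n"
  have "?P (dyadic a b m (Suc k)) + ?P (dyadic a b m k) - 2 *\<^sub>R ?P (dyadic a b (Suc m) (Suc (2 * k))) = 0"
    for k
  proof -
    define j where "j = k div 2 ^ (m - n)"
    have j: "j * 2 ^ (m - n) \<le> k" "Suc k \<le> Suc j * 2 ^ (m - n)"
      by (simp_all add: j_def Suc_le_eq dividend_less_div_times)
    define p q where "p = dyadic a b m k" and "q = dyadic a b m (Suc k)"
    have e: "dyadic a b n i = dyadic a b m (i * 2 ^ (m - n))" for i
      using dyadic_refine[of a b n "m - n" i] step by simp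
    have pq: "dyadic a b n j \<le> p" "q \<le> dyadic a b n (Suc j)" "p \<le> q"
      using j unfolding e p_def q_def by (auto intro!: dyadic_mono[OF ab])
    have mid: "dyadic a b (Suc m) (Suc (2 * k)) = (p + q) / 2"
      by (simp add: p_def q_def dyadic_def field_simps)
    define A where "A = x (dyadic a b n j)"
    define B where "B = x (dyadic a b n (Suc j)) - x (dyadic a b n j)"
    define d where "d = dyadic a b n j"
    have P: "?P t = A + ((t - d) * 2 ^ n / (b - a)) *\<^sub>R B" if "p \<le> t" "t \<le> q" for t
      unfolding A_def B_def d_def using that pq by (intro polygon_eq[OF ab]) auto
    have "?P q + ?P p - 2 *\<^sub>R ?P ((p + q) / 2)
       = ((q - d) * 2 ^ n / (b - a) + (p - d) * 2 ^ n / (b - a) - 2 * (((p + q) / 2 - d) * 2 ^ n / (b - a))) *\<^sub>R B"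
      using pq by (simp add: P algebra_simps scaleR_2)
    also have "(q - d) * 2 ^ n / (b - a) + (p - d) * 2 ^ n / (b - a) - 2 * (((p + q) / 2 - d) * 2 ^ n / (b - a))
      = ((q - d) + (p - d) - 2 * ((p + q) / 2 - d)) * (2 ^ n / (b - a))"
    proof -
      have "X * N / c + Y * N / c - 2 * (Z * N / c) = (X + Y - 2 * Z) * (N / c)" for X Y Z N c :: real
        by (simp only: times_divide_eq_right[symmetric] mult.assoc[symmetric] left_diff_distrib distrib_right times_divide_eq_left)
      then show ?thesis .
    qed
    also have "\<dots> *\<^sub>R B = 0" by (simp add: field_simps)
    finally show ?thesis by (simp add: mid p_def q_def)
  qed
  then have eq: "x (dyadic a b m (Suc k)) - ?P (dyadic a b m (Suc k)) + (x (dyadic a b m k) - ?P (dyadic a b m k))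
     - 2 *\<^sub>R (x (dyadic a b (Suc m) (Suc (2 * k))) - ?P (dyadic a b (Suc m) (Suc (2 * k))))
   = x (dyadic a b m (Suc k)) + x (dyadic a b m k) - 2 *\<^sub>R x (dyadic a b (Suc m) (Suc (2 * k)))" for k
    by (simp add: algebra_simps)
  then show ?case
    unfolding dyadic_energy_Suc[OF ab] eq step.IH by simp
qed

lemma norm_diff_dyadic_le:
  assumes "k \<le> l"
  shows "(norm (y (dyadic a b m l) - y (dyadic a b m k)))\<^sup>2
    \<le> (real l - real k) * (\<Sum>j\<in>{k..<l}. (norm (y (dyadic a b m (Suc j)) - y (dyadic a b m j)))\<^sup>2)"
proof -
  let ?f = "\<lambda>j. norm (y (dyadic a b m (Suc j)) - y (dyadic a b m j))"
  have "y (dyadic a b m l) - y (dyadic a b m k) = (\<Sum>j\<in>{k..<l}. y (dyadic a b m (Suc j)) - y (dyadic a b m j))"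
    by (subst sum_Suc_diff'[OF assms]) simp
  then have "norm (y (dyadic a b m l) - y (dyadic a b m k)) \<le> (\<Sum>j\<in>{k..<l}. ?f j)"
    by (metis norm_sum)
  then have "(norm (y (dyadic a b m l) - y (dyadic a b m k)))\<^sup>2 \<le> (\<Sum>j\<in>{k..<l}. ?f j)\<^sup>2"
    by (simp add: power_mono)
  also have "\<dots> \<le> (\<Sum>j\<in>{k..<l}. (?f j)\<^sup>2) * (\<Sum>j\<in>{k..<l}. 1\<^sup>2)"
    using Cauchy_Schwarz_ineq_sum[of ?f "\<lambda>_. 1" "{k..<l}"] by simp
  also have "\<dots> = (real l - real k) * (\<Sum>j\<in>{k..<l}. (?f j)\<^sup>2)"
    using assms by (simp add: of_nat_diff mult.commute)
  finally show ?thesis .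
qed

lemma dyadic_floor:
  assumes ab: "a < b" and t: "a \<le> t" "t \<le> b"
  defines "k \<equiv> \<lambda>m. nat \<lfloor>(t - a) * 2 ^ m / (b - a)\<rfloor>"
  shows "dyadic a b m (k m) \<le> t" "t < dyadic a b m (Suc (k m))" "k m \<le> 2 ^ m"
    "(\<lambda>m. dyadic a b m (k m)) \<longlonglongrightarrow> t" "(\<lambda>m. dyadic a b m (Suc (k m))) \<longlonglongrightarrow> t"
proof -
  have *: "dyadic a b m (k m) \<le> t \<and> t < dyadic a b m (Suc (k m)) \<and> k m \<le> 2 ^ m" for m
  proof -
    define u where "u = (t - a) * 2 ^ m / (b - a)"
    have u: "0 \<le> u" "u \<le> 2 ^ m" using assms by (simp_all add: u_def field_simps)
    have tu: "t = a + (b - a) * u / 2 ^ m"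
      using ab by (simp add: u_def)
    have k: "real (k m) \<le> u" "u < real (Suc (k m))"
      unfolding k_def u_def[symmetric] using u by linarith+
    have "real (k m) \<le> real (2 ^ m)" using k u by (simp only: of_nat_power of_nat_numeral)
    moreover have "(b - a) * real (k m) / 2 ^ m \<le> (b - a) * u / 2 ^ m"
      "(b - a) * u / 2 ^ m < (b - a) * real (Suc (k m)) / 2 ^ m"
      using k ab by (auto intro!: divide_right_mono mult_left_mono divide_strict_right_mono mult_strict_left_mono)
    ultimately show ?thesis
      unfolding dyadic_def by (subst (1 2) tu) (auto simp del: of_nat_power simp: of_nat_le_iff)
  qed
  then show "dyadic a b m (k m) \<le> t" "t < dyadic a b m (Suc (k m))" "k m \<le> 2 ^ m" by auto
  have z: "(\<lambda>m. (b - a) / 2 ^ m) \<longlonglongrightarrow> 0"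
    using LIMSEQ_divide_realpow_zero[of 2 "b - a"] by simp
  have "(\<lambda>m. t - dyadic a b m (k m)) \<longlonglongrightarrow> 0"
    by (rule tendsto_sandwich[OF _ _ tendsto_const z]) (use * in \<open>auto simp: dyadic_Suc intro!: always_eventually less_imp_le simp: less_diff_eq diff_less_eq add.commute\<close>)
  then show 1: "(\<lambda>m. dyadic a b m (k m)) \<longlonglongrightarrow> t"
    using tendsto_diff[OF tendsto_const[of t]] by fastforce
  show "(\<lambda>m. dyadic a b m (Suc (k m))) \<longlonglongrightarrow> t"
    unfolding dyadic_Suc using tendsto_add[OF 1 z] by simp
qed

text \<open>
  If the end points are dyadic, the Cauchy-Schwarz inequality bounds each quotient by the
  energy of the dyadic intervals in between, and these are different for different \<open>i\<close>.
  Continuity gives the general case.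
\<close>

lemma energy_disjoint_intervals:
  fixes y :: "real \<Rightarrow> 'a::real_normed_vector"
  assumes ab: "a < b" and cont: "continuous_on {a..b} y" and \<rho>: "\<And>m. dyadic_energy y a b m \<le> \<rho>"
    and I: "finite I" "\<And>i. i \<in> I \<Longrightarrow> a \<le> s i \<and> s i < t i \<and> t i \<le> b"
    and disj: "\<And>i j. i \<in> I \<Longrightarrow> j \<in> I \<Longrightarrow> i \<noteq> j \<Longrightarrow> t i \<le> s j \<or> t j \<le> s i"
  shows "(\<Sum>i\<in>I. (norm (y (t i) - y (s i)))\<^sup>2 / (t i - s i)) \<le> \<rho>"
proof -
  define K where "K u m = nat \<lfloor>(u - a) * 2 ^ m / (b - a)\<rfloor>" for u and m :: nat
  define d where "d u m = dyadic a b m (K u m)" for u m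
  have K_mono: "K u m \<le> K v m" if "u \<le> v" for u v m
    unfolding K_def using that ab by (intro nat_mono floor_mono divide_right_mono mult_right_mono) auto
  have d: "(\<lambda>m. d u m) \<longlonglongrightarrow> u" "\<And>m. d u m \<in> {a..b}" if "a \<le> u" "u \<le> b" for u
    using dyadic_floor[OF ab that] dyadic_mono[OF ab, of 0] that unfolding d_def K_def
    by (auto, smt (verit) dyadic_0)
  have yd: "(\<lambda>m. y (d u m)) \<longlonglongrightarrow> y u" if "a \<le> u" "u \<le> b" for u
    by (rule continuous_on_tendsto_compose[OF cont]) (use d[OF that] that in auto)
  have bound: "(\<Sum>i\<in>I. (norm (y (d (t i) m) - y (d (s i) m)))\<^sup>2 / (d (t i) m - d (s i) m)) \<le> \<rho>" for m
  proof -
    let ?e = "\<lambda>j. (norm (y (dyadic a b m (Suc j)) - y (dyadic a b m j)))\<^sup>2"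
    have 1: "(norm (y (d (t i) m) - y (d (s i) m)))\<^sup>2 / (d (t i) m - d (s i) m)
       \<le> (\<Sum>j\<in>{K (s i) m..<K (t i) m}. ?e j) * (2 ^ m / (b - a))" if "i \<in> I" for i
    proof (cases "K (s i) m = K (t i) m")
      case False
      with K_mono[of "s i" "t i" m] I(2)[OF that] have less: "K (s i) m < K (t i) m" by simp
      have "d (t i) m - d (s i) m = (b - a) * (real (K (t i) m) - real (K (s i) m)) / 2 ^ m"
        by (simp add: d_def dyadic_def field_simps)
      moreover have "(norm (y (d (t i) m) - y (d (s i) m)))\<^sup>2 \<le> (real (K (t i) m) - real (K (s i) m)) * (\<Sum>j\<in>{K (s i) m..<K (t i) m}. ?e j)"
        unfolding d_def by (rule norm_diff_dyadic_le[OF less_imp_le[OF less]])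
      moreover have "n / (c * l / m) \<le> S * (m / c)" if "n \<le> l * S" "0 < c" "0 < l" "0 < m" for n c l m S :: real
        using that by (simp add: field_simps)
      ultimately show ?thesis using less ab by simp
    qed (use ab in \<open>simp add: d_def\<close>)
    have "(\<Sum>i\<in>I. (norm (y (d (t i) m) - y (d (s i) m)))\<^sup>2 / (d (t i) m - d (s i) m))
      \<le> (\<Sum>i\<in>I. (\<Sum>j\<in>{K (s i) m..<K (t i) m}. ?e j)) * (2 ^ m / (b - a))"
      unfolding sum_distrib_right by (intro sum_mono) (rule 1[unfolded sum_distrib_right])
    also have "(\<Sum>i\<in>I. (\<Sum>j\<in>{K (s i) m..<K (t i) m}. ?e j)) = (\<Sum>j\<in>(\<Union>i\<in>I. {K (s i) m..<K (t i) m}). ?e j)"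
    proof (rule sum.UNION_disjoint[symmetric])
      show "\<forall>i\<in>I. \<forall>j\<in>I. i \<noteq> j \<longrightarrow> {K (s i) m..<K (t i) m} \<inter> {K (s j) m..<K (t j) m} = {}"
      proof (intro ballI impI)
        fix i j assume "i \<in> I" "j \<in> I" "i \<noteq> j"
        then have "K (t i) m \<le> K (s j) m \<or> K (t j) m \<le> K (s i) m" using disj K_mono by blast
        then show "{K (s i) m..<K (t i) m} \<inter> {K (s j) m..<K (t j) m} = {}" by auto
      qed
    qed (use I in auto)
    also have "\<dots> \<le> (\<Sum>j<2^m. ?e j)"
    proof (rule sum_mono2)
      have "K (t i) m \<le> 2 ^ m" if "i \<in> I" for i
        using dyadic_floor(3)[OF ab, of "t i" m] I(2)[OF that] by (simp add: K_def)
      then show "(\<Union>i\<in>I. {K (s i) m..<K (t i) m}) \<subseteq> {..<2 ^ m}" by fastforce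
    qed auto
    also have "(\<Sum>j<2^m. ?e j) * (2 ^ m / (b - a)) = dyadic_energy y a b m"
      by (simp add: dyadic_energy_def)
    finally show ?thesis using \<rho>[of m] ab by (simp add: divide_right_mono mult_right_mono)
  qed
  have "(\<lambda>m. \<Sum>i\<in>I. (norm (y (d (t i) m) - y (d (s i) m)))\<^sup>2 / (d (t i) m - d (s i) m))
      \<longlonglongrightarrow> (\<Sum>i\<in>I. (norm (y (t i) - y (s i)))\<^sup>2 / (t i - s i))"
    using I(2) by (intro tendsto_intros yd d) force+
  then show ?thesis
    by (rule LIMSEQ_le_const2) (use bound in auto)
qed

text \<open>
  A weak type estimate for the maximal difference quotient.  Every \<open>t\<close> in \<open>B\<close> spans with some
  \<open>s\<close> an interval over which the energy is at least \<open>l\<^sup>2\<close> times the length.  By Vitali's lemma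
  disjoint ones among these intervals can be chosen whose fivefold enlargements cover \<open>B\<close>.
\<close>

lemma energy_maximal_inequality:
  fixes y :: "real \<Rightarrow> 'a::real_normed_vector"
  assumes ab: "a < b" and cont: "continuous_on {a..b} y" and \<rho>: "\<And>m. dyadic_energy y a b m \<le> \<rho>"
    and l: "0 < l"
  defines "B \<equiv> {t \<in> {a<..<b}. \<exists>s\<in>{a<..<b}. l * \<bar>s - t\<bar> < norm (y s - y t)}"
  shows "B \<in> sets lebesgue" "emeasure lebesgue B \<le> ennreal (5 * \<rho> / l\<^sup>2)"
proof -
  have "open ({a<..<b} \<inter> (\<lambda>t. norm (y s - y t) - l * \<bar>s - t\<bar>) -` {0<..})" for s
    by (intro continuous_open_preimage continuous_intros continuous_on_subset[OF cont]) auto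
  then have "open (\<Union>s\<in>{a<..<b}. {a<..<b} \<inter> (\<lambda>t. norm (y s - y t) - l * \<bar>s - t\<bar>) -` {0<..})"
    by blast
  also have "(\<Union>s\<in>{a<..<b}. {a<..<b} \<inter> (\<lambda>t. norm (y s - y t) - l * \<bar>s - t\<bar>) -` {0<..}) = B"
    by (auto simp: B_def)
  finally show Bm: "B \<in> sets lebesgue" by auto
  have \<rho>0: "0 \<le> \<rho>"
    using \<rho>[of 0] ab by (smt (verit) dyadic_energy_def divide_nonneg_pos mult_nonneg_nonneg sum_nonneg zero_le_power zero_le_power2)
  have "\<exists>\<sigma>. \<forall>t\<in>B. \<sigma> t \<in> {a<..<b} \<and> l * \<bar>\<sigma> t - t\<bar> < norm (y (\<sigma> t) - y t)"
    by (rule bchoice) (auto simp: B_def)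
  then obtain \<sigma> where \<sigma>: "\<And>t. t \<in> B \<Longrightarrow> \<sigma> t \<in> {a<..<b}"
    "\<And>t. t \<in> B \<Longrightarrow> l * \<bar>\<sigma> t - t\<bar> < norm (y (\<sigma> t) - y t)" by blast
  define c r where "c t = (t + \<sigma> t) / 2" and "r t = \<bar>\<sigma> t - t\<bar> / 2" for t
  have r: "0 < r t \<and> r t \<le> b - a" if "t \<in> B" for t
  proof -
    have "\<sigma> t \<noteq> t" using \<sigma>(2)[OF that] by auto
    then show ?thesis using \<sigma>(1)[OF that] that by (auto simp: r_def B_def)
  qed
  have cb: "cball (c t) (r t) = {min t (\<sigma> t)..max t (\<sigma> t)}" for t
    by (auto simp: c_def r_def cball_eq_atLeastAtMost min_def max_def abs_if field_simps)
  have "B \<subseteq> (\<Union>t\<in>B. cball (c t) (r t))" unfolding cb by auto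
  from Vitali_covering_lemma_cballs[OF this r] obtain C where C: "countable C" "C \<subseteq> B"
     "pairwise (\<lambda>i j. disjnt (cball (c i) (r i)) (cball (c j) (r j))) C"
     "B \<subseteq> (\<Union>i\<in>C. cball (c i) (5 * r i))" by blast
  have fin: "(\<Sum>i\<in>J. 10 * r i) \<le> 5 * \<rho> / l\<^sup>2" if J: "finite J" "J \<subseteq> C" for J
  proof -
    let ?s = "\<lambda>i. min i (\<sigma> i)" and ?t = "\<lambda>i. max i (\<sigma> i)"
    have ts: "?t i - ?s i = 2 * r i" for i by (auto simp: r_def)
    have "(\<Sum>i\<in>J. (norm (y (?t i) - y (?s i)))\<^sup>2 / (?t i - ?s i)) \<le> \<rho>"
    proof (rule energy_disjoint_intervals[OF ab cont \<rho> J(1)])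
      fix i assume "i \<in> J"
      then have "i \<in> B" using J C by auto
      from r[OF this] \<sigma>(1)[OF this] this show "a \<le> ?s i \<and> ?s i < ?t i \<and> ?t i \<le> b"
        by (auto simp: r_def B_def)
    next
      fix i j assume "i \<in> J" "j \<in> J" "i \<noteq> j"
      then have "disjnt {?s i..?t i} {?s j..?t j}"
        using C(3) J by (auto simp: pairwise_def cb[symmetric])
      then show "?t i \<le> ?s j \<or> ?t j \<le> ?s i"
        unfolding disjnt_iff by (metis atLeastAtMost_iff linear max.cobounded1 max_def min.coboundedI1 order_refl)
    qed
    moreover have "l\<^sup>2 * (2 * r i) \<le> (norm (y (?t i) - y (?s i)))\<^sup>2 / (?t i - ?s i)" if "i \<in> J" for i
    proof -
      have i: "i \<in> B" using that J C by auto
      have "norm (y (?t i) - y (?s i)) = norm (y (\<sigma> i) - y i)"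
        by (auto simp: min_def max_def norm_minus_commute)
      then have "l * (2 * r i) \<le> norm (y (?t i) - y (?s i))" using \<sigma>(2)[OF i] by (simp add: r_def)
      then have "(l * (2 * r i))\<^sup>2 \<le> (norm (y (?t i) - y (?s i)))\<^sup>2"
        using l r[OF i] by (intro power_mono) auto
      then show ?thesis
        unfolding ts using r[OF i] by (simp add: field_simps power2_eq_square)
    qed
    ultimately have le: "(\<Sum>i\<in>J. l\<^sup>2 * (2 * r i)) \<le> \<rho>"
      by (meson order_trans sum_mono)
    have "(\<Sum>i\<in>J. l\<^sup>2 * (2 * r i)) = l\<^sup>2 * 2 * (\<Sum>i\<in>J. r i)" "(\<Sum>i\<in>J. 10 * r i) = 10 * (\<Sum>i\<in>J. r i)"
      by (simp_all add: sum_distrib_left mult.assoc)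
    then have "(\<Sum>i\<in>J. 10 * r i) * l\<^sup>2 = 5 * (\<Sum>i\<in>J. l\<^sup>2 * (2 * r i))" by simp
    with le have "(\<Sum>i\<in>J. 10 * r i) * l\<^sup>2 \<le> 5 * \<rho>" by linarith
    then show ?thesis using l by (simp add: field_simps)
  qed
  have "emeasure lebesgue B \<le> emeasure lebesgue (\<Union>i\<in>C. cball (c i) (5 * r i))"
    using C(1,4) by (intro emeasure_mono sets.countable_UN') auto
  also have "\<dots> \<le> ennreal (5 * \<rho> / l\<^sup>2)"
  proof (cases "C = {}")
    case False
    define f where "f n = (if n \<in> to_nat_on C ` C then cball (c (from_nat_into C n)) (5 * r (from_nat_into C n)) else {})" for n
    have "(\<Union>i\<in>C. cball (c i) (5 * r i)) = (\<Union>n. f n)"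
      using C(1) False by (auto simp: f_def from_nat_into split: if_splits)
    moreover have "emeasure lebesgue (\<Union>n. f n) \<le> (\<Sum>n. emeasure lebesgue (f n))"
      by (rule emeasure_subadditive_countably) (auto simp: f_def)
    moreover have "(\<Sum>n. emeasure lebesgue (f n)) \<le> ennreal (5 * \<rho> / l\<^sup>2)"
      unfolding suminf_eq_SUP
    proof (rule SUP_least)
      fix n
      define J where "J = from_nat_into C ` ({..<n} \<inter> to_nat_on C ` C)"
      have inj: "inj_on (from_nat_into C) ({..<n} \<inter> to_nat_on C ` C)"
        using C(1) by (auto simp: inj_on_def)
      have J: "finite J" "J \<subseteq> C" using C(1) by (auto simp: J_def)
      have "(\<Sum>i<n. emeasure lebesgue (f i)) = (\<Sum>i\<in>{..<n} \<inter> to_nat_on C ` C. emeasure lebesgue (f i))"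
        by (rule sum.mono_neutral_right) (auto simp: f_def)
      also have "\<dots> = (\<Sum>i\<in>J. emeasure lebesgue (cball (c i) (5 * r i)))"
        unfolding J_def by (subst sum.reindex[OF inj]) (auto simp: f_def intro!: sum.cong)
      also have "\<dots> = (\<Sum>i\<in>J. ennreal (10 * r i))"
      proof (intro sum.cong refl)
        fix i assume "i \<in> J"
        then have "0 < r i" using J C r by blast
        then show "emeasure lebesgue (cball (c i) (5 * r i)) = ennreal (10 * r i)"
          by (simp add: cball_eq_atLeastAtMost)
      qed
      also have "\<dots> = ennreal (\<Sum>i\<in>J. 10 * r i)"
        using J C r by (intro sum_ennreal) (meson less_imp_le mult_nonneg_nonneg subsetD zero_le_numeral)
      also have "\<dots> \<le> ennreal (5 * \<rho> / l\<^sup>2)" using fin[OF J] by (rule ennreal_leI)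
      finally show "(\<Sum>i<n. emeasure lebesgue (f i)) \<le> ennreal (5 * \<rho> / l\<^sup>2)" .
    qed
    ultimately show ?thesis by simp
  qed (use \<rho>0 in simp)
  finally show "emeasure lebesgue B \<le> ennreal (5 * \<rho> / l\<^sup>2)" .
qed

text \<open>
  Slopes of approximating affine functions with relative error \<open>2\<^sup>-\<^sup>k\<close> differ from each other by at
  most the sum of the errors.  So they converge, and the limit is the derivative.
\<close>

lemma has_vector_derivative_of_slopes:
  fixes x :: "real \<Rightarrow> 'a::{real_normed_vector,complete_space}"
  assumes c: "\<And>k. k \<ge> k0 \<Longrightarrow>
    \<exists>d>0. \<forall>s. \<bar>s - t\<bar> < d \<longrightarrow> norm (x s - x t - (s - t) *\<^sub>R c k) \<le> (1/2)^k * \<bar>s - t\<bar>"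
  shows "\<exists>v. (x has_vector_derivative v) (at t)"
proof -
  have z: "(\<lambda>k. 2 * (1/2::real)^k) \<longlonglongrightarrow> 0"
    using tendsto_mult_right_zero[OF LIMSEQ_realpow_zero[of "1/2::real"]] by simp
  have near: "norm (c k - c l) \<le> (1/2)^k + (1/2)^l" if kl: "k \<ge> k0" "l \<ge> k0" for k l
  proof -
    obtain d e where d: "d > 0" "\<forall>s. \<bar>s - t\<bar> < d \<longrightarrow> norm (x s - x t - (s - t) *\<^sub>R c k) \<le> (1/2)^k * \<bar>s - t\<bar>"
      and e: "e > 0" "\<forall>s. \<bar>s - t\<bar> < e \<longrightarrow> norm (x s - x t - (s - t) *\<^sub>R c l) \<le> (1/2)^l * \<bar>s - t\<bar>"
      using c kl by meson
    define h where "h = min d e / 2"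
    have h: "h > 0" "h < d" "h < e" using d e by (auto simp: h_def)
    have "norm (h *\<^sub>R (c k - c l)) = norm ((x (t + h) - x t - h *\<^sub>R c l) - (x (t + h) - x t - h *\<^sub>R c k))"
      by (simp add: algebra_simps)
    also have "\<dots> \<le> (1/2)^l * h + (1/2)^k * h"
      using d(2)[rule_format, of "t + h"] e(2)[rule_format, of "t + h"] h
      by (intro order_trans[OF norm_triangle_ineq4 add_mono]) simp_all
    finally have "h * norm (c k - c l) \<le> h * ((1/2)^k + (1/2)^l)"
      using h by (simp only: norm_scaleR abs_of_pos) (simp add: algebra_simps)
    then show ?thesis using h by simp
  qed
  have "Cauchy c"
  proof (rule metric_CauchyI)
    fix e :: real assume "0 < e"
    then have "eventually (\<lambda>k. 2 * (1/2::real)^k < e) sequentially"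
      using order_tendstoD(2)[OF z] by auto
    then obtain M where M: "\<And>k. k \<ge> M \<Longrightarrow> 2 * (1/2::real)^k < e" by (auto simp: eventually_sequentially)
    show "\<exists>M. \<forall>m\<ge>M. \<forall>n\<ge>M. dist (c m) (c n) < e"
    proof (intro exI allI impI)
      fix m n assume "m \<ge> max M k0" "n \<ge> max M k0"
      then show "dist (c m) (c n) < e" using near[of m n] M[of m] M[of n] by (auto simp: dist_norm)
    qed
  qed
  then obtain v where v: "c \<longlonglongrightarrow> v" using Cauchy_convergent_iff convergent_def by blast
  have cv: "norm (c k - v) \<le> (1/2)^k" if "k \<ge> k0" for k
  proof -
    have "(\<lambda>l. norm (c k - c l)) \<longlonglongrightarrow> norm (c k - v)" by (intro tendsto_intros v)
    moreover have "(\<lambda>l. (1/2)^k + (1/2::real)^l) \<longlonglongrightarrow> (1/2)^k + 0"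
      by (intro tendsto_intros LIMSEQ_realpow_zero) auto
    ultimately show ?thesis
      using near[OF that] by (intro LIMSEQ_le[of _ _ _ "(1/2)^k", simplified]) auto
  qed
  have "(x has_derivative (\<lambda>h. h *\<^sub>R v)) (at t)"
    unfolding has_derivative_at_alt
  proof (intro conjI allI impI bounded_linear_scaleR_left)
    fix e :: real assume "0 < e"
    then have "eventually (\<lambda>k. 2 * (1/2::real)^k < e) sequentially"
      using order_tendstoD(2)[OF z] by auto
    then obtain M where M: "\<And>k. k \<ge> M \<Longrightarrow> 2 * (1/2::real)^k < e" by (auto simp: eventually_sequentially)
    define k where "k = max M k0"
    have k: "k \<ge> k0" "2 * (1/2::real)^k < e" using M by (auto simp: k_def)
    obtain d where d: "d > 0" "\<forall>s. \<bar>s - t\<bar> < d \<longrightarrow> norm (x s - x t - (s - t) *\<^sub>R c k) \<le> (1/2)^k * \<bar>s - t\<bar>"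
      using c k by meson
    show "\<exists>d>0. \<forall>s. norm (s - t) < d \<longrightarrow> norm (x s - x t - (s - t) *\<^sub>R v) \<le> e * norm (s - t)"
    proof (intro exI conjI allI impI)
      fix s assume s: "norm (s - t) < d"
      have "norm (x s - x t - (s - t) *\<^sub>R v) = norm ((x s - x t - (s - t) *\<^sub>R c k) + (s - t) *\<^sub>R (c k - v))"
        by (simp add: algebra_simps)
      also have "\<dots> \<le> (1/2)^k * \<bar>s - t\<bar> + \<bar>s - t\<bar> * (1/2)^k"
        using d(2)[rule_format, of s] s cv[OF k(1)]
        by (intro order_trans[OF norm_triangle_ineq] add_mono) (auto intro!: mult_left_mono)
      also have "\<dots> = (2 * (1/2)^k) * \<bar>s - t\<bar>" by simp
      also have "\<dots> \<le> e * \<bar>s - t\<bar>" using k by (intro mult_right_mono) auto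
      finally show "norm (x s - x t - (s - t) *\<^sub>R v) \<le> e * norm (s - t)" by simp
    qed (use d in auto)
  qed
  then show ?thesis by (auto simp: has_vector_derivative_def)
qed

lemma dyadic_interval_floor:
  assumes ab: "a < b" and t: "dyadic a b n j \<le> t" "t < dyadic a b n (Suc j)"
  shows "nat \<lfloor>(t - a) * 2 ^ n / (b - a)\<rfloor> = j"
proof -
  have "real j \<le> (t - a) * 2 ^ n / (b - a)" "(t - a) * 2 ^ n / (b - a) < real (Suc j)"
    using t ab by (simp_all add: dyadic_def field_simps)
  then show ?thesis by linarith
qed

text \<open>
  The derivative of the polygon of level \<open>n\<close> at all points that are not nodes.
\<close>

definition slope :: "(real \<Rightarrow> 'a::real_normed_vector) \<Rightarrow> real \<Rightarrow> real \<Rightarrow> nat \<Rightarrow> real \<Rightarrow> 'a"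
  where "slope x a b n t = (let k = nat \<lfloor>(t - a) * 2 ^ n / (b - a)\<rfloor> in
    (2 ^ n / (b - a)) *\<^sub>R (x (dyadic a b n (Suc k)) - x (dyadic a b n k)))"

lemma polygon_affine:
  assumes ab: "a < b" and t: "t \<in> {a<..<b}" "t \<notin> range (dyadic a b n)"
  shows "\<exists>d>0. \<forall>s. \<bar>s - t\<bar> < d \<longrightarrow> polygon x a b n s - polygon x a b n t = (s - t) *\<^sub>R slope x a b n t"
proof -
  define j where "j = nat \<lfloor>(t - a) * 2 ^ n / (b - a)\<rfloor>"
  have j: "dyadic a b n j < t" "t < dyadic a b n (Suc j)"
  proof -
    have "dyadic a b n j \<le> t" "t < dyadic a b n (Suc j)"
      using dyadic_floor(1,2)[OF ab, of t n] t unfolding j_def by auto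
    moreover have "dyadic a b n j \<noteq> t" using t(2) by blast
    ultimately show "dyadic a b n j < t" "t < dyadic a b n (Suc j)" by auto
  qed
  define d where "d = min (t - dyadic a b n j) (dyadic a b n (Suc j) - t)"
  show ?thesis
  proof (intro exI conjI allI impI)
    show "d > 0" using j by (simp add: d_def)
    fix s assume "\<bar>s - t\<bar> < d"
    then have s: "dyadic a b n j \<le> s" "s \<le> dyadic a b n (Suc j)" by (auto simp: d_def)
    show "polygon x a b n s - polygon x a b n t = (s - t) *\<^sub>R slope x a b n t"
      unfolding polygon_eq[OF ab s] polygon_eq[OF ab less_imp_le[OF j(1)] less_imp_le[OF j(2)]]
        slope_def j_def[symmetric] Let_def
      by (simp add: diff_divide_distrib left_diff_distrib scaleR_diff_left)
  qed
qed

text \<open>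
  The difference quotient is taken over an interval that shrinks to \<open>t\<close> and contains \<open>t\<close>, so
  the errors at its two end points add up to a multiple of its length.
\<close>

lemma slope_straddle:
  assumes ab: "a < b" and t: "t \<in> {a<..<b}" and v: "(x has_vector_derivative v) (at t)"
  shows "(\<lambda>n. slope x a b n t) \<longlonglongrightarrow> v"
proof (rule LIMSEQ_I)
  fix e :: real assume e: "0 < e"
  from v have "\<forall>e>0. \<exists>d>0. \<forall>s. norm (s - t) < d \<longrightarrow> norm (x s - x t - (s - t) *\<^sub>R v) \<le> e * norm (s - t)"
    unfolding has_vector_derivative_def has_derivative_at_alt by blast
  then obtain d where d: "d > 0" "\<And>s. \<bar>s - t\<bar> < d \<Longrightarrow> norm (x s - x t - (s - t) *\<^sub>R v) \<le> e/2 * \<bar>s - t\<bar>"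
    using e by (metis half_gt_zero real_norm_def)
  define k where "k n = nat \<lfloor>(t - a) * 2 ^ n / (b - a)\<rfloor>" for n :: nat
  define p q where "p n = dyadic a b n (k n)" and "q n = dyadic a b n (Suc (k n))" for n
  have pq: "p n \<le> t" "t < q n" "p \<longlonglongrightarrow> t" "q \<longlonglongrightarrow> t" "q n - p n = (b - a) / 2 ^ n" for n
    using dyadic_floor[OF ab, of t] t unfolding p_def q_def k_def by (auto simp: dyadic_Suc)
  have "eventually (\<lambda>n. \<bar>p n - t\<bar> < d \<and> \<bar>q n - t\<bar> < d) sequentially"
    using pq(3,4) d(1) by (auto simp: tendsto_iff dist_real_def eventually_conj_iff)
  then obtain N where N: "\<And>n. n \<ge> N \<Longrightarrow> \<bar>p n - t\<bar> < d \<and> \<bar>q n - t\<bar> < d"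
    by (auto simp: eventually_sequentially)
  show "\<exists>N. \<forall>n\<ge>N. norm (slope x a b n t - v) < e"
  proof (intro exI allI impI)
    fix n assume n: "n \<ge> N"
    have pos: "q n - p n > 0" using pq(1,2)[of n] by linarith
    have "norm ((x (q n) - x t - (q n - t) *\<^sub>R v) - (x (p n) - x t - (p n - t) *\<^sub>R v))
      \<le> e/2 * \<bar>q n - t\<bar> + e/2 * \<bar>p n - t\<bar>"
      using N[OF n] d(2) by (intro order_trans[OF norm_triangle_ineq4 add_mono]) auto
    also have "\<dots> = e/2 * ((q n - t) + (t - p n))"
      using pq(1,2)[of n] by (simp only: distrib_left) simp
    also have "\<dots> = e/2 * (q n - p n)" by simp
    finally have *: "norm (x (q n) - x (p n) - (q n - p n) *\<^sub>R v) \<le> e/2 * (q n - p n)"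
      by (simp add: algebra_simps)
    have "slope x a b n t = (1 / (q n - p n)) *\<^sub>R (x (q n) - x (p n))"
      unfolding slope_def Let_def pq(5) k_def[symmetric] p_def[symmetric] q_def[symmetric] by simp
    then have "slope x a b n t - v = (1 / (q n - p n)) *\<^sub>R (x (q n) - x (p n) - (q n - p n) *\<^sub>R v)"
      using pos by (simp add: scaleR_diff_right)
    then have "norm (slope x a b n t - v) = norm (x (q n) - x (p n) - (q n - p n) *\<^sub>R v) / (q n - p n)"
      using pos by simp
    also have "\<dots> \<le> e/2" using * pos by (simp add: field_simps)
    finally show "norm (slope x a b n t - v) < e" using e by simp
  qed
qed

lemma slope_step:
  assumes ab: "a < b" and t: "t \<in> {a..<b}"
  shows "\<phi> (slope x a b n t) = (\<Sum>k<2^n. indicator {dyadic a b n k..<dyadic a b n (Suc k)} t *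
     \<phi> ((2 ^ n / (b - a)) *\<^sub>R (x (dyadic a b n (Suc k)) - x (dyadic a b n k))) :: real)"
proof -
  define j where "j = nat \<lfloor>(t - a) * 2 ^ n / (b - a)\<rfloor>"
  have j: "dyadic a b n j \<le> t" "t < dyadic a b n (Suc j)"
    using dyadic_floor(1,2)[OF ab, of t n] t unfolding j_def by auto
  have "j < 2 ^ n"
  proof (rule ccontr)
    assume "\<not> j < 2 ^ n"
    then have "dyadic a b n (2 ^ n) \<le> dyadic a b n j" by (intro dyadic_mono[OF ab]) auto
    then show False using j t by simp
  qed
  moreover have "t \<in> {dyadic a b n k..<dyadic a b n (Suc k)} \<longleftrightarrow> k = j" for k
    using dyadic_interval_floor[OF ab, of n k t] j by (auto simp: j_def)
  ultimately show ?thesis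
    by (simp add: slope_def j_def[symmetric] indicator_def if_distrib[of "\<lambda>y. y * _"] cong: if_cong)
qed

lemma slope_integral:
  fixes \<phi> :: "'a::real_normed_vector \<Rightarrow> real"
  assumes ab: "a < b"
  shows "set_integrable lebesgue {a..<b} (\<lambda>t. \<phi> (slope x a b n t))"
    and "(LINT t:{a..<b}|lebesgue. \<phi> (slope x a b n t)) = (\<Sum>k<2^n. (b - a) / 2 ^ n *
     \<phi> ((2 ^ n / (b - a)) *\<^sub>R (x (dyadic a b n (Suc k)) - x (dyadic a b n k))))"
proof -
  let ?c = "\<lambda>k. \<phi> ((2 ^ n / (b - a)) *\<^sub>R (x (dyadic a b n (Suc k)) - x (dyadic a b n k)))"
  have sub: "{dyadic a b n k..<dyadic a b n (Suc k)} \<subseteq> {a..<b}" if "k < 2 ^ n" for k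
    using dyadic_mono[OF ab, of 0 k n] dyadic_mono[OF ab, of "Suc k" "2 ^ n" n] that by auto
  have eq: "indicator {a..<b} t *\<^sub>R \<phi> (slope x a b n t)
     = (\<Sum>k<2^n. indicator {dyadic a b n k..<dyadic a b n (Suc k)} t * ?c k)" for t
  proof (cases "t \<in> {a..<b}")
    case True then show ?thesis using slope_step[OF ab True, of \<phi>] by simp
  next
    case False
    then have "t \<notin> {dyadic a b n k..<dyadic a b n (Suc k)}" if "k < 2 ^ n" for k
      using sub[OF that] by blast
    then have "(\<Sum>k<2^n. indicator {dyadic a b n k..<dyadic a b n (Suc k)} t * ?c k) = (\<Sum>k<(2::nat)^n. 0)"
      by (intro sum.cong) auto
    with False show ?thesis by simp
  qed
  have hb: "has_bochner_integral lebesgue (\<lambda>t. indicator {dyadic a b n k..<dyadic a b n (Suc k)} t * ?c k)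
     ((b - a) / 2 ^ n * ?c k)" for k
  proof -
    have "has_bochner_integral lebesgue (indicator {dyadic a b n k..<dyadic a b n (Suc k)})
       (measure lebesgue {dyadic a b n k..<dyadic a b n (Suc k)})"
      by (rule has_bochner_integral_real_indicator) (use dyadic_mono[OF ab, of k "Suc k" n] in auto)
    moreover have "measure lebesgue {dyadic a b n k..<dyadic a b n (Suc k)} = (b - a) / 2 ^ n"
      using ab by (simp add: dyadic_Suc)
    ultimately show ?thesis
      using has_bochner_integral_mult_left[of "?c k"] by fastforce
  qed
  have "has_bochner_integral lebesgue (\<lambda>t. indicator {a..<b} t *\<^sub>R \<phi> (slope x a b n t)) (\<Sum>k<2^n. (b - a) / 2 ^ n * ?c k)"
    unfolding eq by (intro has_bochner_integral_sum hb)
  then show "set_integrable lebesgue {a..<b} (\<lambda>t. \<phi> (slope x a b n t))"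
    and "(LINT t:{a..<b}|lebesgue. \<phi> (slope x a b n t)) = (\<Sum>k<2^n. (b - a) / 2 ^ n * ?c k)"
    unfolding set_integrable_def set_lebesgue_integral_def
    by (auto simp: has_bochner_integral_iff)
qed

lemma slope_integral_sq:
  assumes ab: "a < b"
  shows "(LINT t:{a..<b}|lebesgue. (norm (slope x a b n t))\<^sup>2) = dyadic_energy x a b n"
proof -
  have "(b - a) / 2 ^ n * (norm ((2 ^ n / (b - a)) *\<^sub>R v))\<^sup>2 = (norm v)\<^sup>2 * 2 ^ n / (b - a)" for v :: 'a
    using ab by (simp add: power_mult_distrib power2_eq_square)
  then show ?thesis
    using slope_integral(2)[OF ab, of "\<lambda>v. (norm v)\<^sup>2" x n]
    unfolding dyadic_energy_def sum_distrib_right sum_divide_distrib by simp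
qed

lemma slope_integral_norm:
  assumes ab: "a < b"
  shows "norm (x b - x a) \<le> (LINT t:{a..<b}|lebesgue. norm (slope x a b n t))"
proof -
  have "x b - x a = (\<Sum>k<2^n. x (dyadic a b n (Suc k)) - x (dyadic a b n k))"
    by (subst sum_lessThan_telescope) simp
  then have "norm (x b - x a) \<le> (\<Sum>k<2^n. norm (x (dyadic a b n (Suc k)) - x (dyadic a b n k)))"
    by (metis norm_sum)
  also have "\<dots> = (\<Sum>k<2^n. (b - a) / 2 ^ n * norm ((2 ^ n / (b - a)) *\<^sub>R (x (dyadic a b n (Suc k)) - x (dyadic a b n k))))"
    using ab by (intro sum.cong) auto
  finally show ?thesis unfolding slope_integral(2)[OF ab] .
qed

lemma continuous_on_polygon:
  assumes ab: "a < b"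
  shows "continuous_on {a..b} (polygon x a b n)"
proof -
  have "continuous_on {a..dyadic a b n k} (polygon x a b n)" for k
  proof (induction k)
    case (Suc k)
    have "continuous_on {dyadic a b n k..dyadic a b n (Suc k)} (\<lambda>t. x (dyadic a b n k) +
      ((t - dyadic a b n k) * 2 ^ n / (b - a)) *\<^sub>R (x (dyadic a b n (Suc k)) - x (dyadic a b n k)))"
      using ab by (intro continuous_intros) auto
    then have "continuous_on {dyadic a b n k..dyadic a b n (Suc k)} (polygon x a b n)"
      by (rule continuous_on_eq) (rule polygon_eq[OF ab, symmetric]; simp)
    with Suc have "continuous_on ({a..dyadic a b n k} \<union> {dyadic a b n k..dyadic a b n (Suc k)}) (polygon x a b n)"
      by (intro continuous_on_closed_Un) auto
    also have "{a..dyadic a b n k} \<union> {dyadic a b n k..dyadic a b n (Suc k)} = {a..dyadic a b n (Suc k)}"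
      using dyadic_mono[OF ab, of 0 k n] dyadic_mono[OF ab, of k "Suc k" n] by (simp add: ivl_disj_un)
    finally show ?case .
  qed simp
  from this[of "2 ^ n"] show ?thesis by simp
qed

text \<open>
  Energies increase with the level, so a bounded sequence of energies converges, and
  the residual of a polygon carries no more than the tail.
\<close>

lemma dyadic_energy_residual:
  fixes x :: "real \<Rightarrow> 'a::real_inner"
  assumes ab: "a < b" and \<rho>: "\<And>m. dyadic_energy x a b m \<le> \<rho>" and e: "e > 0"
  shows "\<exists>n. \<forall>m. dyadic_energy (\<lambda>t. x t - polygon x a b n t) a b m \<le> e"
proof -
  have "bdd_above (range (dyadic_energy x a b))" using \<rho> by (auto simp: bdd_above_def)
  then obtain n where n: "dyadic_energy x a b n > (SUP m. dyadic_energy x a b m) - e"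
    and le: "\<And>m. dyadic_energy x a b m \<le> (SUP m. dyadic_energy x a b m)"
    using e less_cSUP_iff[of UNIV "dyadic_energy x a b" "(SUP m. dyadic_energy x a b m) - e"]
    by (auto intro: cSUP_upper)
  have "dyadic_energy (\<lambda>t. x t - polygon x a b n t) a b m \<le> e" for m
  proof -
    have "dyadic_energy (\<lambda>t. x t - polygon x a b n t) a b m
      \<le> dyadic_energy (\<lambda>t. x t - polygon x a b n t) a b (max n m)"
      by (rule dyadic_energy_mono[OF ab]) simp
    also have "\<dots> = dyadic_energy x a b (max n m) - dyadic_energy x a b n"
      by (rule dyadic_energy_minus_polygon[OF ab]) simp
    also have "\<dots> \<le> e" using n le[of "max n m"] by linarith
    finally show ?thesis .
  qed
  then show ?thesis by blast
qed

lemma borel_measurable_lebesgue_AE_limit: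
  fixes u :: "nat \<Rightarrow> 'a::euclidean_space \<Rightarrow> real"
  assumes u: "\<And>n. u n \<in> borel_measurable lebesgue" and lim: "AE t in lebesgue. (\<lambda>n. u n t) \<longlonglongrightarrow> f t"
  shows "f \<in> borel_measurable lebesgue"
proof (rule borel_measurable_AE)
  show "(\<lambda>t. lim (\<lambda>n. u n t)) \<in> borel_measurable lebesgue"
    by (rule borel_measurable_lim_metric[OF u])
  show "AE t in lebesgue. lim (\<lambda>n. u n t) = f t"
    using lim by eventually_elim (rule limI)
qed

lemma Fatou_integral:
  fixes u :: "nat \<Rightarrow> 'a \<Rightarrow> real"
  assumes u: "\<And>n. integrable M (u n)" "\<And>n. AE x in M. 0 \<le> u n x" "\<And>n. integral\<^sup>L M (u n) \<le> \<rho>"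
    and f: "f \<in> borel_measurable M" "AE x in M. (\<lambda>n. u n x) \<longlonglongrightarrow> f x"
  shows "integrable M f" "integral\<^sup>L M f \<le> \<rho>"
proof -
  have nn: "AE x in M. \<forall>n. 0 \<le> u n x" using u(2) by (simp add: AE_all_countable)
  have f0: "AE x in M. 0 \<le> f x"
    using nn f(2) by eventually_elim (auto intro: LIMSEQ_le_const)
  have \<rho>: "0 \<le> \<rho>" using integral_nonneg_AE[OF u(2)] u(3) order_trans by blast
  have "(\<integral>\<^sup>+x. ennreal (f x) \<partial>M) = (\<integral>\<^sup>+x. liminf (\<lambda>n. ennreal (u n x)) \<partial>M)"
    using f(2) by (intro nn_integral_cong_AE) (auto elim!: eventually_mono intro!: lim_imp_Liminf[symmetric] tendsto_ennrealI)
  also have "\<dots> \<le> liminf (\<lambda>n. \<integral>\<^sup>+x. ennreal (u n x) \<partial>M)"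
    using u(1) by (intro nn_integral_liminf) auto
  also have "\<dots> \<le> ennreal \<rho>"
    using u by (auto intro!: Liminf_le always_eventually ennreal_leI simp: nn_integral_eq_integral)
  finally have le: "(\<integral>\<^sup>+x. ennreal (f x) \<partial>M) \<le> ennreal \<rho>" .
  then show "integrable M f"
    using f(1) f0 by (intro integrableI_nonneg) (auto simp: order_le_less_trans)
  then have "ennreal (integral\<^sup>L M f) \<le> ennreal \<rho>"
    using le f0 by (simp add: nn_integral_eq_integral)
  then show "integral\<^sup>L M f \<le> \<rho>" using \<rho> by simp
qed

lemma AE_not_dyadic: "AE t in lebesgue. \<forall>n. t \<notin> range (dyadic a b n)"
proof -
  have "countable (\<Union>n. range (dyadic a b n))" by auto
  then have "(\<Union>n. range (dyadic a b n)) \<in> null_sets lebesgue"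
    using countable_imp_null_set_lborel null_sets_completionI by blast
  then show ?thesis using AE_not_in by force
qed

text \<open>
  Choose polygons whose residuals have energy at most \<open>8\<^sup>-\<^sup>k\<close>.  By the maximal inequality, the
  difference quotients of the \<open>k\<close>th residual exceed \<open>2\<^sup>-\<^sup>k\<close> only on a set of measure at most
  \<open>5 / 2\<^sup>k\<close>.  By Borel-Cantelli almost every \<open>t\<close> lies in only finitely many of these sets, and at
  such a \<open>t\<close> the slopes of the polygons approximate \<open>x\<close> to first order.
\<close>

theorem AE_differentiable_of_energy:
  fixes x :: "real \<Rightarrow> 'a::{real_inner,complete_space}"
  assumes ab: "a < b" and cont: "continuous_on {a..b} x" and \<rho>: "\<And>m. dyadic_energy x a b m \<le> \<rho>"
  shows "AE t in lebesgue. t \<in> {a<..<b} \<longrightarrow> x differentiable (at t)"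
proof -
  have "\<exists>n. \<forall>m. dyadic_energy (\<lambda>t. x t - polygon x a b n t) a b m \<le> (1/8)^k" for k :: nat
    by (rule dyadic_energy_residual[OF ab \<rho>]) auto
  then obtain n where n: "\<And>k m. dyadic_energy (\<lambda>t. x t - polygon x a b (n k) t) a b m \<le> (1/8)^k"
    by metis
  define r where "r k t = x t - polygon x a b (n k) t" for k t
  define B where "B k = {t \<in> {a<..<b}. \<exists>s\<in>{a<..<b}. (1/2)^k * \<bar>s - t\<bar> < norm (r k s - r k t)}" for k
  have contr: "continuous_on {a..b} (r k)" for k
    unfolding r_def by (intro continuous_intros cont continuous_on_polygon ab)
  have Bm: "B k \<in> sets lebesgue" and Be: "emeasure lebesgue (B k) \<le> ennreal (5 * (1/2)^k)" for k
  proof -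
    have "5 * (1/8)^k / ((1/2)^k)\<^sup>2 = 5 * (1/2::real)^k"
    proof -
      have "(1/8::real)^k = (1/2)^k * ((1/2)^k)\<^sup>2"
        unfolding power2_eq_square by (simp only: power_mult_distrib[symmetric]) simp
      then show ?thesis by simp
    qed
    then show "B k \<in> sets lebesgue" "emeasure lebesgue (B k) \<le> ennreal (5 * (1/2)^k)"
      using energy_maximal_inequality[OF ab contr n[of k, folded r_def], of "(1/2)^k"]
      unfolding B_def by auto
  qed
  have Bme: "measure lebesgue (B k) \<le> 5 * (1/2)^k" for k
    using Be[of k] unfolding measure_def by (metis enn2real_ennreal enn2real_mono ennreal_less_top mult_nonneg_nonneg zero_le_numeral zero_le_divide_1_iff zero_le_power)
  have "AE t in lebesgue. eventually (\<lambda>k. t \<in> space lebesgue - B k) sequentially"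
  proof (rule borel_cantelli_AE1[OF Bm])
    show "emeasure lebesgue (B k) < \<infinity>" for k
      using Be[of k] by (simp add: order_le_less_trans)
    show "summable (\<lambda>k. measure lebesgue (B k))"
      by (rule summable_comparison_test'[where g="\<lambda>k. 5 * (1/2)^k" and N=0])
        (use Bme in \<open>auto intro!: summable_mult summable_geometric\<close>)
  qed
  with AE_not_dyadic[of a b] show ?thesis
  proof eventually_elim
    case (elim t)
    then obtain k0 where k0: "\<And>k. k \<ge> k0 \<Longrightarrow> t \<notin> B k" by (auto simp: eventually_sequentially)
    show ?case
    proof
      assume t: "t \<in> {a<..<b}"
      have "\<exists>v. (x has_vector_derivative v) (at t)"
      proof (rule has_vector_derivative_of_slopes)
        fix k assume k: "k \<ge> k0"
        obtain d where d: "d > 0" "\<And>s. \<bar>s - t\<bar> < d \<Longrightarrow>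
          polygon x a b (n k) s - polygon x a b (n k) t = (s - t) *\<^sub>R slope x a b (n k) t"
          using polygon_affine[OF ab t] elim by blast
        define e where "e = min d (min (t - a) (b - t))"
        show "\<exists>d>0. \<forall>s. \<bar>s - t\<bar> < d \<longrightarrow>
          norm (x s - x t - (s - t) *\<^sub>R slope x a b (n k) t) \<le> (1/2)^k * \<bar>s - t\<bar>"
        proof (intro exI conjI allI impI)
          show "e > 0" using d t by (auto simp: e_def)
          fix s assume "\<bar>s - t\<bar> < e"
          then have s: "\<bar>s - t\<bar> < d" "s \<in> {a<..<b}" by (auto simp: e_def)
          have "norm (r k s - r k t) \<le> (1/2)^k * \<bar>s - t\<bar>"
            using k0[OF k] s t by (auto simp: B_def not_less)
          then show "norm (x s - x t - (s - t) *\<^sub>R slope x a b (n k) t) \<le> (1/2)^k * \<bar>s - t\<bar>"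
            unfolding d(2)[OF s(1), symmetric] r_def by (simp add: algebra_simps)
        qed
      qed
      then show "x differentiable (at t)" using differentiableI_vector by blast
    qed
  qed
qed

lemma AE_lebesgue_neq: "AE t in lebesgue. t \<noteq> (c::real)"
proof -
  have "{c} \<in> null_sets lebesgue" by (intro null_sets_completionI) auto
  from AE_not_in[OF this] show ?thesis by simp
qed

text \<open>
  At points of differentiability the derivative is the limit of the slopes, whose squares have
  the energies as integrals; Fatou's lemma applies.
\<close>

lemma energy_derivative_square:
  fixes x :: "real \<Rightarrow> 'a::real_normed_vector"
  assumes ab: "a < b" and \<rho>: "\<And>m. dyadic_energy x a b m \<le> \<rho>"
    and diff: "AE t in lebesgue. t \<in> {a<..<b} \<longrightarrow> x differentiable (at t)"
  defines "x' \<equiv> \<lambda>t. norm (vector_derivative x (at t))"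
  shows "set_integrable lebesgue {a..b} (\<lambda>t. (x' t)\<^sup>2)"
    "(LINT t:{a..b}|lebesgue. (x' t)\<^sup>2) \<le> \<rho>"
    "set_integrable lebesgue {a..b} x'"
proof -
  have lim: "AE t in lebesgue. (\<lambda>n. indicator {a..<b} t *\<^sub>R \<phi> (norm (slope x a b n t))) \<longlonglongrightarrow> indicator {a..b} t *\<^sub>R \<phi> (x' t)"
    if \<phi>: "\<And>r. isCont \<phi> r" for \<phi> :: "real \<Rightarrow> real"
    using diff AE_lebesgue_neq[of a] AE_lebesgue_neq[of b]
  proof eventually_elim
    case (elim t)
    show ?case
    proof (cases "t \<in> {a<..<b}")
      case True
      then have "(x has_vector_derivative vector_derivative x (at t)) (at t)"
        using elim by (simp add: vector_derivative_works)
      from slope_straddle[OF ab True this] True show ?thesis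
        unfolding x'_def by (auto intro!: isCont_tendsto_compose[OF \<phi>] tendsto_norm)
    next
      case False
      then have "indicator {a..<b} t = (0::real)" "indicator {a..b} t = (0::real)" using elim by (auto simp: indicator_def)
      then show ?thesis by simp
    qed
  qed
  note si = slope_integral(1)[OF ab, of _ x, unfolded set_integrable_def]
  have meas: "(\<lambda>t. indicator {a..b} t *\<^sub>R \<phi> (x' t)) \<in> borel_measurable lebesgue"
    if "\<And>r. isCont \<phi> r" for \<phi> :: "real \<Rightarrow> real"
    by (rule borel_measurable_lebesgue_AE_limit[OF _ lim[OF that]])
      (rule borel_measurable_integrable[OF si[of "\<lambda>v. \<phi> (norm v)"]])
  have *: "integrable lebesgue (\<lambda>t. indicator {a..b} t *\<^sub>R (x' t)\<^sup>2)"
    "(LINT t|lebesgue. indicator {a..b} t *\<^sub>R (x' t)\<^sup>2) \<le> \<rho>"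
  proof -
    have nn: "AE t in lebesgue. 0 \<le> indicator {a..<b} t *\<^sub>R (norm (slope x a b n t))\<^sup>2" for n by simp
    have le: "(LINT t|lebesgue. indicator {a..<b} t *\<^sub>R (norm (slope x a b n t))\<^sup>2) \<le> \<rho>" for n
      using slope_integral_sq[OF ab, of x n] \<rho>[of n] by (simp add: set_lebesgue_integral_def)
    have cont: "isCont (\<lambda>r::real. r\<^sup>2) r" for r by (intro continuous_intros)
    note F = Fatou_integral[OF si[of "\<lambda>v. (norm v)\<^sup>2"] nn le meas[OF cont] lim[OF cont]]
    show "integrable lebesgue (\<lambda>t. indicator {a..b} t *\<^sub>R (x' t)\<^sup>2)"
      "(LINT t|lebesgue. indicator {a..b} t *\<^sub>R (x' t)\<^sup>2) \<le> \<rho>" by (fact F)+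
  qed
  then show sq: "set_integrable lebesgue {a..b} (\<lambda>t. (x' t)\<^sup>2)"
    "(LINT t:{a..b}|lebesgue. (x' t)\<^sup>2) \<le> \<rho>"
    by (simp_all add: set_integrable_def set_lebesgue_integral_def)
  show "set_integrable lebesgue {a..b} x'"
    unfolding set_integrable_def
  proof (rule Bochner_Integration.integrable_bound)
    show "integrable lebesgue (\<lambda>t. indicator {a..b} t *\<^sub>R (1::real) + indicator {a..b} t *\<^sub>R (x' t)\<^sup>2)"
      using *(1) by (intro Bochner_Integration.integrable_add) (auto simp: emeasure_lborel_Icc_eq)
    show "(\<lambda>t. indicator {a..b} t *\<^sub>R x' t) \<in> borel_measurable lebesgue"
      using meas[of "\<lambda>r. r"] by simp
    have "r \<le> 1 + r\<^sup>2" for r :: real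
      using sum_squares_bound[of r 1] zero_le_power2[of r] by (simp, linarith)
    then show "AE t in lebesgue. norm (indicator {a..b} t *\<^sub>R x' t)
      \<le> norm (indicator {a..b} t *\<^sub>R (1::real) + indicator {a..b} t *\<^sub>R (x' t)\<^sup>2)"
      by (intro AE_I2) (auto simp: indicator_def x'_def abs_of_nonneg)
  qed
qed

text \<open>
  The increment of \<open>x\<close> is at most the integral of the norm of the slope of a polygon, and the slope
  differs from the derivative of \<open>x\<close> by the derivative of a residual of small energy.
\<close>

theorem energy_norm_diff_le:
  fixes x :: "real \<Rightarrow> 'a::{real_inner,complete_space}"
  assumes ab: "a < b" and cont: "continuous_on {a..b} x" and \<rho>: "\<And>m. dyadic_energy x a b m \<le> \<rho>"
  shows "norm (x b - x a) \<le> (LINT t:{a..b}|lebesgue. norm (vector_derivative x (at t)))"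
proof (rule field_le_epsilon)
  fix e :: real assume e: "e > 0"
  \<comment> \<open>the residual gets energy at most \<open>c\<^sup>2\<close>, and \<open>w \<le> c + w\<^sup>2 / c\<close> then bounds the integral of its speed by \<open>e\<close>\<close>
  define c where "c = e / (b - a + 1)"
  have c: "c > 0" "c * (b - a + 1) = e" using e ab by (auto simp: c_def)
  obtain n where n: "\<And>m. dyadic_energy (\<lambda>t. x t - polygon x a b n t) a b m \<le> c\<^sup>2"
    using dyadic_energy_residual[OF ab \<rho>, of "c\<^sup>2"] c by auto
  define r where "r t = x t - polygon x a b n t" for t
  have diff: "AE t in lebesgue. t \<in> {a<..<b} \<longrightarrow> x differentiable (at t)"
    by (rule AE_differentiable_of_energy[OF ab cont \<rho>])
  have r': "AE t in lebesgue. t \<in> {a<..<b} \<longrightarrow>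
    (r has_vector_derivative (vector_derivative x (at t) - slope x a b n t)) (at t)"
    using diff AE_not_dyadic[of a b]
  proof eventually_elim
    case (elim t)
    show ?case
    proof
      assume t: "t \<in> {a<..<b}"
      obtain d where d: "d > 0" "\<And>s. \<bar>s - t\<bar> < d \<Longrightarrow>
        polygon x a b n s - polygon x a b n t = (s - t) *\<^sub>R slope x a b n t"
        using polygon_affine[OF ab t] elim by blast
      have "((\<lambda>s. polygon x a b n t + (s - t) *\<^sub>R slope x a b n t) has_vector_derivative slope x a b n t) (at t)"
        by (auto intro!: derivative_eq_intros)
      then have "(polygon x a b n has_vector_derivative slope x a b n t) (at t)"
      proof (rule has_vector_derivative_transform_within_open[of _ _ _ "ball t d"])
        fix s assume "s \<in> ball t d"
        then show "polygon x a b n t + (s - t) *\<^sub>R slope x a b n t = polygon x a b n s"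
          using d(2)[of s] by (simp add: dist_real_def abs_minus_commute algebra_simps)
      qed (use d in auto)
      then show "(r has_vector_derivative (vector_derivative x (at t) - slope x a b n t)) (at t)"
        unfolding r_def using elim t by (intro has_vector_derivative_diff) (simp_all add: vector_derivative_works)
    qed
  qed
  have rdiff: "AE t in lebesgue. t \<in> {a<..<b} \<longrightarrow> r differentiable (at t)"
    using r' by eventually_elim (auto intro: differentiableI_vector)
  note R = energy_derivative_square[OF ab n[folded r_def] rdiff]
  note X = energy_derivative_square[OF ab \<rho> diff]
  have "(LINT t:{a..<b}|lebesgue. norm (slope x a b n t)) \<le>
     (LINT t|lebesgue. indicator {a..b} t *\<^sub>R norm (vector_derivative x (at t))
        + (indicator {a..b} t *\<^sub>R c + indicator {a..b} t *\<^sub>R (norm (vector_derivative r (at t)))\<^sup>2 / c))"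
    unfolding set_lebesgue_integral_def
  proof (rule integral_mono_AE)
    show "integrable lebesgue (\<lambda>t. indicator {a..<b} t *\<^sub>R norm (slope x a b n t))"
      using slope_integral(1)[OF ab] by (simp add: set_integrable_def)
    show "integrable lebesgue (\<lambda>t. indicator {a..b} t *\<^sub>R norm (vector_derivative x (at t))
        + (indicator {a..b} t *\<^sub>R c + indicator {a..b} t *\<^sub>R (norm (vector_derivative r (at t)))\<^sup>2 / c))"
      using R(1) X(3) by (auto simp: set_integrable_def emeasure_lborel_Icc_eq)
    show "AE t in lebesgue. indicator {a..<b} t *\<^sub>R norm (slope x a b n t)
      \<le> indicator {a..b} t *\<^sub>R norm (vector_derivative x (at t))
        + (indicator {a..b} t *\<^sub>R c + indicator {a..b} t *\<^sub>R (norm (vector_derivative r (at t)))\<^sup>2 / c)"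
      using r' AE_lebesgue_neq[of a] AE_lebesgue_neq[of b]
    proof eventually_elim
      case (elim t)
      show ?case
      proof (cases "t \<in> {a<..<b}")
        case True
        have "vector_derivative r (at t) = vector_derivative x (at t) - slope x a b n t"
          using elim True by (simp add: vector_derivative_at)
        then have "norm (slope x a b n t) \<le> norm (vector_derivative x (at t)) + norm (vector_derivative r (at t))"
          using norm_triangle_ineq4[of "vector_derivative x (at t)" "vector_derivative r (at t)"] by simp
        moreover have "w \<le> c + w\<^sup>2 / c" if "0 \<le> w" for w
        proof -
          have "c * w \<le> c\<^sup>2 + w\<^sup>2"
            using sum_squares_bound[of c w] mult_nonneg_nonneg[of c w] c that by linarith
          then show ?thesis using c by (simp add: field_simps power2_eq_square)
        qed
        ultimately show ?thesis using True by (simp add: add_increasing2 order_trans[OF _ add_left_mono])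
      next
        case False
        then have "indicator {a..<b} t = (0::real)" "indicator {a..b} t = (0::real)" using elim by (auto simp: indicator_def)
        then show ?thesis by simp
      qed
    qed
  qed
  also have "\<dots> = (LINT t:{a..b}|lebesgue. norm (vector_derivative x (at t)))
     + ((b - a) * c + (LINT t:{a..b}|lebesgue. (norm (vector_derivative r (at t)))\<^sup>2) / c)"
    using R(1) X(3) ab unfolding set_integrable_def set_lebesgue_integral_def
    by (subst Bochner_Integration.integral_add; (subst Bochner_Integration.integral_add)?)
      (auto simp: emeasure_lborel_Icc_eq)
  also have "\<dots> \<le> (LINT t:{a..b}|lebesgue. norm (vector_derivative x (at t))) + ((b - a) * c + c\<^sup>2 / c)"
    using R(2) c by (intro add_left_mono divide_right_mono) auto
  also have "(b - a) * c + c\<^sup>2 / c = e" using c by (simp add: power2_eq_square algebra_simps)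
  finally show "norm (x b - x a) \<le> (LINT t:{a..b}|lebesgue. norm (vector_derivative x (at t))) + e"
    using slope_integral_norm[OF ab, of x n] by linarith
qed

section \<open>Completeness of \<open>L\<^sup>2\<close>\<close>

lemma norm_abs_L2:
  assumes "square_integrable f"
  shows "(norm (abs_L2 f))\<^sup>2 = (\<integral>z. (norm (f z))\<^sup>2 \<partial>\<lambda>\<^sub>0)"
proof -
  have f: "L2_rel f f" using assms by (simp add: L2_rel_def)
  have "(norm (abs_L2 f))\<^sup>2 = abs_L2 f \<bullet> abs_L2 f" by (rule power2_norm_eq_inner)
  also have "\<dots> = (\<integral>z. f z \<bullet> f z \<partial>\<lambda>\<^sub>0)" by (rule inner_L2.abs_eq[OF f f])
  finally show ?thesis by (simp add: power2_norm_eq_inner)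
qed

lemma abs_L2_add:
  "square_integrable f \<Longrightarrow> square_integrable g \<Longrightarrow> abs_L2 f + abs_L2 g = abs_L2 (\<lambda>z. f z + g z)"
  by (simp add: plus_L2.abs_eq L2_rel_def)

lemma abs_L2_scaleR: "square_integrable f \<Longrightarrow> r *\<^sub>R abs_L2 f = abs_L2 (\<lambda>z. r *\<^sub>R f z)"
  by (simp add: scaleR_L2.abs_eq L2_rel_def)

lemma square_integrable_diff:
  "square_integrable f \<Longrightarrow> square_integrable g \<Longrightarrow> square_integrable (\<lambda>z. f z - g z)"
  using square_integrable_add[of f "\<lambda>z. (-1) *\<^sub>R g z"] square_integrable_scaleR[of g "-1"] by simp

lemma abs_L2_diff:
  assumes "square_integrable f" "square_integrable g"
  shows "abs_L2 f - abs_L2 g = abs_L2 (\<lambda>z. f z - g z)"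
proof -
  have "abs_L2 f - abs_L2 g = abs_L2 f + (-1) *\<^sub>R abs_L2 g" by simp
  also have "\<dots> = abs_L2 (\<lambda>z. f z + (-1) *\<^sub>R g z)"
    using assms square_integrable_scaleR[of g "-1"] by (simp only: abs_L2_scaleR abs_L2_add)
  finally show ?thesis by simp
qed

lemma rep_L2: "square_integrable (rep_L2 M)" "abs_L2 (rep_L2 M) = M"
proof -
  show "abs_L2 (rep_L2 M) = M" by (rule Quotient3_abs_rep[OF Quotient3_L2])
  have "L2_rel (rep_L2 M) (rep_L2 M)" by (rule Quotient3_rep_reflp[OF Quotient3_L2])
  then show "square_integrable (rep_L2 M)" by (simp add: L2_rel_def)
qed

lemma norm_L2_rep: "(norm (M - N))\<^sup>2 = (\<integral>z. (norm (rep_L2 M z - rep_L2 N z))\<^sup>2 \<partial>\<lambda>\<^sub>0)"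
  using norm_abs_L2[OF square_integrable_diff[OF rep_L2(1)[of M] rep_L2(1)[of N]]]
  by (simp add: rep_L2(2) flip: abs_L2_diff[OF rep_L2(1) rep_L2(1)])

text \<open>
  The increment \<open>d\<close> of step \<open>k\<close> satisfies \<open>d \<le> 2\<^sup>-\<^sup>k + 2\<^sup>k d\<^sup>2\<close>, so the increments are absolutely summable.
\<close>

lemma convergent_of_summable_weighted_squares:
  fixes f :: "nat \<Rightarrow> 'b::banach"
  assumes "summable (\<lambda>k. 2 ^ k * (norm (f (Suc k) - f k))\<^sup>2)"
  shows "convergent f"
proof -
  have "summable (\<lambda>k. norm (f (Suc k) - f k))"
  proof (rule summable_comparison_test')
    show "summable (\<lambda>k. (1/2) ^ k + 2 ^ k * (norm (f (Suc k) - f k))\<^sup>2)"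
      by (intro summable_add assms summable_geometric) auto
    fix k :: nat assume "k \<ge> 0"
    define d where "d = norm (f (Suc k) - f k)"
    have "2 * (1 * (2 ^ k * d)) \<le> 1\<^sup>2 + (2 ^ k * d)\<^sup>2" using sum_squares_bound[of 1 "2 ^ k * d"] by simp
    moreover have "0 \<le> 2 ^ k * d" by (simp add: d_def)
    ultimately have "2 ^ k * d \<le> 1 + (2 ^ k * d)\<^sup>2" by simp
    then have "(1/2) ^ k * (2 ^ k * d) \<le> (1/2) ^ k * (1 + (2 ^ k * d)\<^sup>2)" by (intro mult_left_mono) auto
    also have "(1/2) ^ k * (2 ^ k * d) = d" by (simp add: power_divide)
    also have "(1/2) ^ k * (1 + (2 ^ k * d)\<^sup>2) = (1/2) ^ k + 2 ^ k * d\<^sup>2"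
      by (simp add: power_divide power2_eq_square field_simps)
    finally show "norm (norm (f (Suc k) - f k)) \<le> (1/2) ^ k + 2 ^ k * (norm (f (Suc k) - f k))\<^sup>2"
      by (simp add: d_def)
  qed
  then have "summable (\<lambda>k. f (Suc k) - f k)" by (rule summable_norm_cancel)
  then obtain l where "(\<lambda>n. \<Sum>k<n. f (Suc k) - f k) \<longlonglongrightarrow> l" by (auto simp: summable_def sums_def)
  then have "(\<lambda>n. (f n - f 0) + f 0) \<longlonglongrightarrow> l + f 0"
    unfolding sum_lessThan_telescope by (intro tendsto_intros)
  then show ?thesis by (auto simp: convergent_def)
qed

text \<open>
  The Riesz-Fischer argument.  The weights \<open>2\<^sup>k\<close> leave the squared increments summable in the
  mean, so representatives converge pointwise almost everywhere, and Fatou's lemma identifies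
  the pointwise limit as the limit in norm.
\<close>

lemma L2_Cauchy_fast_convergent:
  fixes M :: "nat \<Rightarrow> ('d::finite) L2"
  assumes fast: "\<And>k m. k \<le> m \<Longrightarrow> norm (M m - M k) \<le> (1/2)^k"
  shows "convergent M"
proof -
  define f where "f k = rep_L2 (M k)" for k
  have f: "square_integrable (f k)" for k by (simp add: f_def rep_L2)
  then have fm[measurable]: "f k \<in> borel_measurable \<lambda>\<^sub>0" for k by (simp add: square_integrable_def)
  have sq: "integrable \<lambda>\<^sub>0 (\<lambda>z. (norm (f m z - f k z))\<^sup>2)" for m k
    using square_integrable_diff[OF f f] by (simp add: square_integrable_def)
  have le: "(\<integral>z. (norm (f m z - f k z))\<^sup>2 \<partial>\<lambda>\<^sub>0) \<le> ((1/2)^k)\<^sup>2" if "k \<le> m" for k m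
    unfolding f_def norm_L2_rep[symmetric] using fast[OF that] by (intro power_mono) auto
  have "(\<integral>\<^sup>+z. (\<Sum>k. ennreal (2 ^ k * (norm (f (Suc k) z - f k z))\<^sup>2)) \<partial>\<lambda>\<^sub>0)
     = (\<Sum>k. \<integral>\<^sup>+z. ennreal (2 ^ k * (norm (f (Suc k) z - f k z))\<^sup>2) \<partial>\<lambda>\<^sub>0)"
    by (intro nn_integral_suminf) measurable
  also have "\<dots> \<le> (\<Sum>k. ennreal ((1/2)^k))"
  proof (intro suminf_le allI)
    fix k
    have "(\<integral>\<^sup>+z. ennreal (2 ^ k * (norm (f (Suc k) z - f k z))\<^sup>2) \<partial>\<lambda>\<^sub>0) = ennreal (2 ^ k * (\<integral>z. (norm (f (Suc k) z - f k z))\<^sup>2 \<partial>\<lambda>\<^sub>0))"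
      using sq by (subst nn_integral_eq_integral) auto
    also have "\<dots> \<le> ennreal (2 ^ k * ((1/2)^k)\<^sup>2)"
      using le[of k "Suc k"] by (intro ennreal_leI mult_left_mono) auto
    also have "2 ^ k * ((1/2::real)^k)\<^sup>2 = (1/2)^k"
      by (simp add: power_divide power2_eq_square)
    finally show "(\<integral>\<^sup>+z. ennreal (2 ^ k * (norm (f (Suc k) z - f k z))\<^sup>2) \<partial>\<lambda>\<^sub>0) \<le> ennreal ((1/2)^k)" .
  qed auto
  also have "\<dots> < \<infinity>" by (simp add: suminf_ennreal2 summable_geometric)
  finally have "AE z in \<lambda>\<^sub>0. (\<Sum>k. ennreal (2 ^ k * (norm (f (Suc k) z - f k z))\<^sup>2)) \<noteq> \<infinity>"
    by (intro nn_integral_PInf_AE) auto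
  then have conv: "AE z in \<lambda>\<^sub>0. convergent (\<lambda>k. f k z)"
  proof eventually_elim
    case (elim z)
    then have "summable (\<lambda>k. 2 ^ k * (norm (f (Suc k) z - f k z))\<^sup>2)"
      by (intro summable_suminf_not_top) (auto simp: top_ennreal_def)
    then show ?case by (rule convergent_of_summable_weighted_squares)
  qed
  define g where "g z = lim (\<lambda>k. f k z)" for z
  have g[measurable]: "g \<in> borel_measurable \<lambda>\<^sub>0" unfolding g_def by measurable
  have lim: "AE z in \<lambda>\<^sub>0. (\<lambda>m. (norm (f m z - f k z))\<^sup>2) \<longlonglongrightarrow> (norm (g z - f k z))\<^sup>2" for k
    using conv by eventually_elim (auto simp: g_def convergent_LIMSEQ_iff intro!: tendsto_intros)
  have F: "integrable \<lambda>\<^sub>0 (\<lambda>z. (norm (g z - f k z))\<^sup>2)" "(\<integral>z. (norm (g z - f k z))\<^sup>2 \<partial>\<lambda>\<^sub>0) \<le> ((1/2)^k)\<^sup>2" for k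
  proof -
    have lim': "AE z in \<lambda>\<^sub>0. (\<lambda>m. (norm (f (m + k) z - f k z))\<^sup>2) \<longlonglongrightarrow> (norm (g z - f k z))\<^sup>2"
      using lim[of k] by eventually_elim (rule LIMSEQ_ignore_initial_segment)
    show "integrable \<lambda>\<^sub>0 (\<lambda>z. (norm (g z - f k z))\<^sup>2)" "(\<integral>z. (norm (g z - f k z))\<^sup>2 \<partial>\<lambda>\<^sub>0) \<le> ((1/2)^k)\<^sup>2"
      by (rule Fatou_integral[OF sq _ le _ lim']; simp)+
  qed
  have "square_integrable (\<lambda>z. g z - f 0 z)" using F(1)[of 0] by (simp add: square_integrable_def)
  from square_integrable_add[OF this f[of 0]] have gs: "square_integrable g" by simp
  have d: "norm (M k - abs_L2 g) \<le> (1/2)^k" for k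
  proof -
    have "(norm (abs_L2 g - M k))\<^sup>2 = (\<integral>z. (norm (g z - f k z))\<^sup>2 \<partial>\<lambda>\<^sub>0)"
    proof -
      have "abs_L2 (f k) = M k" by (simp add: f_def rep_L2(2))
      then have "abs_L2 g - M k = abs_L2 (\<lambda>z. g z - f k z)" using abs_L2_diff[OF gs f[of k]] by simp
      then show ?thesis using norm_abs_L2[OF square_integrable_diff[OF gs f[of k]]] by simp
    qed
    then have "(norm (abs_L2 g - M k))\<^sup>2 \<le> ((1/2)^k)\<^sup>2" using F(2) by simp
    from power2_le_imp_le[OF this] show ?thesis by (simp add: norm_minus_commute)
  qed
  have "(\<lambda>k. M k - abs_L2 g) \<longlonglongrightarrow> 0"
    by (rule Lim_null_comparison[of _ "\<lambda>k. (1/2)^k"]) (use d in \<open>auto intro!: LIMSEQ_realpow_zero\<close>)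
  then have "M \<longlonglongrightarrow> abs_L2 g" by (rule LIM_zero_cancel)
  then show ?thesis by (auto simp: convergent_def)
qed

instance L2 :: (finite) complete_space
proof
  fix M :: "nat \<Rightarrow> 'a L2" assume C: "Cauchy M"
  have "\<exists>r. \<forall>k. (\<forall>m\<ge>r k. \<forall>n\<ge>r k. norm (M m - M n) < (1/2)^k) \<and> r k < r (Suc k)"
  proof (rule dependent_nat_choice[where P="\<lambda>k N. \<forall>m\<ge>N. \<forall>n\<ge>N. norm (M m - M n) < (1/2)^k" and Q="\<lambda>_ N N'. N < N'", simplified all_conj_distrib[symmetric]])
    show "\<exists>N. \<forall>m\<ge>N. \<forall>n\<ge>N. norm (M m - M n) < (1/2)^0"
      using C unfolding Cauchy_def dist_norm by (metis power_0 zero_less_one)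
    fix N k
    obtain N' where "\<forall>m\<ge>N'. \<forall>n\<ge>N'. norm (M m - M n) < (1/2)^Suc k"
      using C unfolding Cauchy_def dist_norm by (metis zero_less_power half_gt_zero zero_less_one)
    then show "\<exists>y. (\<forall>m\<ge>y. \<forall>n\<ge>y. norm (M m - M n) < (1/2)^Suc k) \<and> N < y"
      by (intro exI[of _ "max N' (Suc N)"]) auto
  qed
  then obtain r where r: "\<And>k m n. m \<ge> r k \<Longrightarrow> n \<ge> r k \<Longrightarrow> norm (M m - M n) < (1/2)^k" and rm: "\<And>k. r k < r (Suc k)"
    by blast
  have sm: "strict_mono r" by (rule strict_monoI_Suc) (rule rm)
  have "convergent (M \<circ> r)"
  proof (rule L2_Cauchy_fast_convergent)
    fix k m :: nat assume "k \<le> m"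
    then have "r k \<le> r m" using sm by (simp add: strict_mono_less_eq)
    from r[OF this order_refl] show "norm ((M \<circ> r) m - (M \<circ> r) k) \<le> (1/2)^k" by simp
  qed
  then obtain l where "(M \<circ> r) \<longlonglongrightarrow> l" by (auto simp: convergent_def)
  then show "convergent M"
    using Cauchy_converges_subseq[OF C sm] by (auto simp: convergent_def comp_def)
qed

section \<open>Curves of locally finite energy\<close>

lemma distr_lebesgue_shift: "distr lebesgue lebesgue ((+) r) = (lebesgue :: real measure)"
  using lebesgue_real_affine[of 1 r] by (simp add: density_1)

lemma measurable_lebesgue_shift: "(+) r \<in> lebesgue \<rightarrow>\<^sub>M (lebesgue :: real measure)"
  using lebesgue_affine_measurable[of "\<lambda>_. 1" r] by (simp add: euclidean_representation)

lemma set_integral_shift: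
  fixes f :: "real \<Rightarrow> real"
  assumes "f \<in> borel_measurable lebesgue"
  shows "set_integrable lebesgue {a..b} (\<lambda>t. f (r + t)) \<longleftrightarrow> set_integrable lebesgue {r + a..r + b} f"
    and "(LINT t:{a..b}|lebesgue. f (r + t)) = (LINT t:{r + a..r + b}|lebesgue. f t)"
proof -
  let ?g = "\<lambda>t. indicator {r + a..r + b} t *\<^sub>R f t"
  have g: "?g \<in> borel_measurable lebesgue" by (intro borel_measurable_scaleR borel_measurable_indicator assms) auto
  have eq: "?g (r + t) = indicator {a..b} t *\<^sub>R f (r + t)" for t
    by (auto simp: indicator_def)
  show "set_integrable lebesgue {a..b} (\<lambda>t. f (r + t)) \<longleftrightarrow> set_integrable lebesgue {r + a..r + b} f"
    using integrable_distr_eq[OF measurable_lebesgue_shift[of r] g] unfolding distr_lebesgue_shift eq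
    by (simp add: set_integrable_def)
  show "(LINT t:{a..b}|lebesgue. f (r + t)) = (LINT t:{r + a..r + b}|lebesgue. f t)"
    using integral_distr[OF measurable_lebesgue_shift[of r] g] unfolding distr_lebesgue_shift eq
    by (simp add: set_lebesgue_integral_def)
qed

lemma set_integral_Icc_combine:
  fixes f :: "real \<Rightarrow> real"
  assumes "a \<le> c" "c \<le> b" "set_integrable lebesgue {a..b} f"
  shows "(LINT t:{a..b}|lebesgue. f t) = (LINT t:{a..c}|lebesgue. f t) + (LINT t:{c..b}|lebesgue. f t)"
  using assms integral_combine[of a b f c]
  by (simp add: set_lebesgue_integral_def set_integrable_def integrable_restrict_space integral_restrict_space)

lemma set_integrable_Icc_const: "set_integrable lebesgue {a..b::real} (\<lambda>_. c::real)"
  by (simp add: set_integrable_def emeasure_lborel_Icc_eq)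

lemma set_integral_Icc_const: "a \<le> b \<Longrightarrow> (LINT t:{a..b::real}|lebesgue. c::real) = c * (b - a)"
  by (simp add: set_lebesgue_integral_def)

lemma set_Icc_degenerate:
  fixes f :: "real \<Rightarrow> real"
  assumes "b \<le> a"
  shows "set_integrable lebesgue {a..b} f" "(LINT t:{a..b}|lebesgue. f t) = 0"
proof -
  have eq: "indicator {a..b} t *\<^sub>R f t = indicator {a..b} t *\<^sub>R f a" for t
  proof (cases "t \<in> {a..b}")
    case True
    then have "t = a" using assms by auto
    then show ?thesis by simp
  qed simp
  show "set_integrable lebesgue {a..b} f"
    using set_integrable_Icc_const[of a b "f a"] unfolding set_integrable_def eq .
  show "(LINT t:{a..b}|lebesgue. f t) = 0"
    using assms unfolding set_lebesgue_integral_def eq by simp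
qed

lemma set_integral_Cauchy_Schwarz:
  fixes f :: "real \<Rightarrow> real"
  assumes ab: "a \<le> b" and f: "set_integrable lebesgue {a..b} f" "set_integrable lebesgue {a..b} (\<lambda>t. (f t)\<^sup>2)"
  shows "(LINT t:{a..b}|lebesgue. f t)\<^sup>2 \<le> (b - a) * (LINT t:{a..b}|lebesgue. (f t)\<^sup>2)"
proof (cases "a = b")
  case False
  define c where "c = (LINT t:{a..b}|lebesgue. f t) / (b - a)"
  have "0 \<le> (LINT t:{a..b}|lebesgue. (f t - c)\<^sup>2)"
    unfolding set_lebesgue_integral_def by (intro integral_nonneg_AE) auto
  also have "\<dots> = (LINT t:{a..b}|lebesgue. (f t)\<^sup>2 - (2 * c) * f t + c\<^sup>2)"
    by (simp add: power2_diff algebra_simps)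
  also have "\<dots> = (LINT t:{a..b}|lebesgue. (f t)\<^sup>2) - (2 * c) * (LINT t:{a..b}|lebesgue. f t) + c\<^sup>2 * (b - a)"
    using f ab
    by (subst set_integral_add(2); (subst set_integral_diff(2))?) (auto simp: set_integral_Icc_const set_integrable_Icc_const)
  finally have "(b - a) * (2 * c * (LINT t:{a..b}|lebesgue. f t) - c\<^sup>2 * (b - a)) \<le> (b - a) * (LINT t:{a..b}|lebesgue. (f t)\<^sup>2)"
    using ab by (intro mult_left_mono) auto
  moreover have alg: "d * (2 * c * S - c\<^sup>2 * d) = S\<^sup>2" if "c * d = S" for d S c :: real
    unfolding that[symmetric] by (simp add: power2_eq_square algebra_simps)
  have "(b - a) * (2 * c * (LINT t:{a..b}|lebesgue. f t) - c\<^sup>2 * (b - a)) = (LINT t:{a..b}|lebesgue. f t)\<^sup>2"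
    by (rule alg) (use False in \<open>simp add: c_def\<close>)
  ultimately show ?thesis by simp
qed (use set_Icc_degenerate(2)[of b a f] in simp)

definition loc_L2 :: "(real \<Rightarrow> real) \<Rightarrow> bool"
  where "loc_L2 f \<longleftrightarrow> f \<in> borel_measurable lebesgue \<and> (\<forall>a b. set_integrable lebesgue {a..b} (\<lambda>t. (f t)\<^sup>2))"

lemma set_integrable_Icc_bound:
  fixes f g :: "real \<Rightarrow> real"
  assumes "f \<in> borel_measurable lebesgue" "set_integrable lebesgue {a..b} g"
    "AE t in lebesgue. t \<in> {a..b} \<longrightarrow> \<bar>f t\<bar> \<le> g t"
  shows "set_integrable lebesgue {a..b} f"
proof (rule set_integrable_bound[OF assms(2)])
  show "set_borel_measurable lebesgue {a..b} f"
    using assms(1) unfolding set_borel_measurable_def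
    by (intro borel_measurable_scaleR borel_measurable_indicator) auto
  show "AE x in lebesgue. x \<in> {a..b} \<longrightarrow> norm (f x) \<le> norm (g x)"
    using assms(3) by eventually_elim auto
qed

lemma loc_L2_integrable:
  assumes "loc_L2 f" shows "set_integrable lebesgue {a..b} f"
proof (rule set_integrable_Icc_bound)
  show "set_integrable lebesgue {a..b} (\<lambda>t. 1 + (f t)\<^sup>2)"
    using assms by (intro set_integral_add(1) set_integrable_Icc_const) (auto simp: loc_L2_def)
  have "\<bar>r\<bar> \<le> 1 + r\<^sup>2" for r :: real
  proof -
    have "2 * \<bar>r\<bar> \<le> r\<^sup>2 + 1" using sum_squares_bound[of "\<bar>r\<bar>" 1] by simp
    then show ?thesis using abs_ge_zero[of r] by linarith
  qed
  then show "AE t in lebesgue. t \<in> {a..b} \<longrightarrow> \<bar>f t\<bar> \<le> 1 + (f t)\<^sup>2" by simp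
qed (use assms in \<open>simp add: loc_L2_def\<close>)

lemma loc_L2_add:
  assumes "loc_L2 f" "loc_L2 g" shows "loc_L2 (\<lambda>t. f t + g t)"
  unfolding loc_L2_def
proof (intro conjI allI)
  show m: "(\<lambda>t. f t + g t) \<in> borel_measurable lebesgue" using assms by (auto simp: loc_L2_def)
  fix a b
  show "set_integrable lebesgue {a..b} (\<lambda>t. (f t + g t)\<^sup>2)"
  proof (rule set_integrable_Icc_bound)
    show "set_integrable lebesgue {a..b} (\<lambda>t. 2 * (f t)\<^sup>2 + 2 * (g t)\<^sup>2)"
      using assms by (intro set_integral_add(1)) (auto simp: loc_L2_def)
    show "AE t in lebesgue. t \<in> {a..b} \<longrightarrow> \<bar>(f t + g t)\<^sup>2\<bar> \<le> 2 * (f t)\<^sup>2 + 2 * (g t)\<^sup>2"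
    proof (intro AE_I2 impI)
      fix t
      have "(f t + g t)\<^sup>2 \<le> 2 * (f t)\<^sup>2 + 2 * (g t)\<^sup>2"
        using sum_squares_bound[of "f t" "g t"] power2_sum[of "f t" "g t"] by linarith
      then show "\<bar>(f t + g t)\<^sup>2\<bar> \<le> 2 * (f t)\<^sup>2 + 2 * (g t)\<^sup>2" by simp
    qed
    show "(\<lambda>t. (f t + g t)\<^sup>2) \<in> borel_measurable lebesgue" by (rule borel_measurable_power[OF m])
  qed
qed

lemma loc_L2_const: "loc_L2 (\<lambda>_. c)"
  by (simp add: loc_L2_def set_integrable_Icc_const)

lemma loc_L2_cmult: "loc_L2 f \<Longrightarrow> loc_L2 (\<lambda>t. c * f t)"
  by (auto simp: loc_L2_def power_mult_distrib intro!: borel_measurable_times)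

lemma loc_L2_shift: "loc_L2 f \<Longrightarrow> loc_L2 (\<lambda>t. f (r + t))"
  unfolding loc_L2_def using measurable_compose[OF measurable_lebesgue_shift]
  by (auto simp: set_integral_shift(1)[of "\<lambda>t. (f t)\<^sup>2"])

lemma loc_L2_continuous:
  assumes "continuous_on UNIV f" shows "loc_L2 f"
  unfolding loc_L2_def
proof (intro conjI allI)
  show "f \<in> borel_measurable lebesgue"
    using assms by (intro measurable_completion) (auto intro: borel_measurable_continuous_onI)
  fix a b
  have "set_integrable lborel {a..b} (\<lambda>t. (f t)\<^sup>2)"
    by (rule borel_integrable_atLeastAtMost') (intro continuous_intros continuous_on_subset[OF assms], simp)
  then show "set_integrable lebesgue {a..b} (\<lambda>t. (f t)\<^sup>2)"
    unfolding set_integrable_def by (simp add: integrable_completion borel_measurable_integrable)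
qed

text \<open>
  Here \<open>I\<close> plays the role of a primitive of the squared speed; its increments telescope.
\<close>

lemma Holder_energy_bound:
  assumes ab: "a < b" and I: "\<And>s t. a \<le> s \<Longrightarrow> s < t \<Longrightarrow> t \<le> b \<Longrightarrow> (norm (x t - x s))\<^sup>2 \<le> (t - s) * (I t - I s)"
  shows "dyadic_energy x a b m \<le> I b - I a"
proof -
  have "(norm (x (dyadic a b m (Suc k)) - x (dyadic a b m k)))\<^sup>2 \<le> ((b - a) / 2 ^ m) * (I (dyadic a b m (Suc k)) - I (dyadic a b m k))"
    if k: "k < 2 ^ m" for k
  proof -
    have "dyadic a b m (Suc k) - dyadic a b m k = (b - a) / 2 ^ m" by (simp add: dyadic_Suc)
    moreover have "a \<le> dyadic a b m k" "dyadic a b m k < dyadic a b m (Suc k)" "dyadic a b m (Suc k) \<le> b"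
      using dyadic_mono[OF ab, of 0 k m] dyadic_mono[OF ab, of "Suc k" "2 ^ m" m] k ab
      by (auto simp: dyadic_Suc)
    ultimately show ?thesis using I by metis
  qed
  then have "(\<Sum>k<2^m. (norm (x (dyadic a b m (Suc k)) - x (dyadic a b m k)))\<^sup>2)
     \<le> (\<Sum>k<2^m. ((b - a) / 2 ^ m) * (I (dyadic a b m (Suc k)) - I (dyadic a b m k)))"
    by (intro sum_mono) auto
  also have "\<dots> = ((b - a) / 2 ^ m) * (I b - I a)"
    unfolding sum_distrib_left[symmetric] by (subst sum_lessThan_telescope) simp
  finally show ?thesis using ab by (simp add: dyadic_energy_def field_simps)
qed

lemma continuous_on_Holder:
  assumes "\<And>s t. s \<in> S \<Longrightarrow> t \<in> S \<Longrightarrow> s < t \<Longrightarrow> (norm (x t - x s))\<^sup>2 \<le> (t - s) * C"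
  shows "continuous_on S (x :: real \<Rightarrow> 'a::real_normed_vector)"
unfolding continuous_on_def
proof
    fix t assume t: "t \<in> S"
    have b: "norm (x s - x t) \<le> sqrt (\<bar>s - t\<bar> * \<bar>C\<bar>)" if "s \<in> S" for s
    proof -
      have "(norm (x s - x t))\<^sup>2 \<le> \<bar>s - t\<bar> * \<bar>C\<bar>"
      proof (cases s t rule: linorder_cases)
        case less
        have "(norm (x t - x s))\<^sup>2 \<le> (t - s) * C" using assms that t less by blast
        also have "\<dots> \<le> (t - s) * \<bar>C\<bar>" using less by (intro mult_left_mono) auto
        finally show ?thesis using less by (simp add: norm_minus_commute)
      next
        case greater
        have "(norm (x s - x t))\<^sup>2 \<le> (s - t) * C" using assms that t greater by blast
        also have "\<dots> \<le> (s - t) * \<bar>C\<bar>" using greater by (intro mult_left_mono) auto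
        finally show ?thesis using greater by simp
      qed simp
      then show ?thesis by (rule real_le_rsqrt)
    qed
    have "((\<lambda>s. sqrt (\<bar>s - t\<bar> * \<bar>C\<bar>)) \<longlongrightarrow> sqrt (\<bar>t - t\<bar> * \<bar>C\<bar>)) (at t within S)"
      by (intro tendsto_intros)
    then have z: "((\<lambda>s. sqrt (\<bar>s - t\<bar> * \<bar>C\<bar>)) \<longlongrightarrow> 0) (at t within S)" by simp
    have "\<forall>\<^sub>F s in at t within S. norm (x s - x t) \<le> sqrt (\<bar>s - t\<bar> * \<bar>C\<bar>)"
      unfolding eventually_at_filter using b by (intro always_eventually) blast
    then have "((\<lambda>s. x s - x t) \<longlongrightarrow> 0) (at t within S)"
      by (rule Lim_null_comparison[OF _ z])
    then show "(x \<longlongrightarrow> x t) (at t within S)" by (rule LIM_zero_cancel)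
qed

lemma AC2_Holder:
  assumes "AC2 a' b' x" "a' < a" "b < b'"
  obtains I where "\<And>s t. a \<le> s \<Longrightarrow> s \<le> t \<Longrightarrow> t \<le> b \<Longrightarrow> (norm (x t - x s))\<^sup>2 \<le> (t - s) * (I t - I s)"
    "\<And>s t. a \<le> s \<Longrightarrow> s \<le> t \<Longrightarrow> t \<le> b \<Longrightarrow> I s \<le> I t"
proof -
  obtain \<beta> where \<beta>: "set_borel_measurable lebesgue {a'<..<b'} \<beta>"
      "set_integrable lebesgue {a'<..<b'} (\<lambda>u. (\<beta> u)\<^sup>2)"
      "\<And>s t. a' < s \<Longrightarrow> s < t \<Longrightarrow> t < b' \<Longrightarrow> norm (x t - x s) \<le> (LINT u:{s..t}|lebesgue. \<beta> u)"
    using assms(1) unfolding AC2_def by blast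
  define f where "f t = indicator {a'<..<b'} t *\<^sub>R \<beta> t" for t
  have f2: "(\<lambda>t. (f t)\<^sup>2) = (\<lambda>t. indicator {a'<..<b'} t *\<^sub>R (\<beta> t)\<^sup>2)"
    by (auto simp: f_def fun_eq_iff indicator_def)
  have "loc_L2 f"
    unfolding loc_L2_def
  proof (intro conjI allI)
    show "f \<in> borel_measurable lebesgue" using \<beta>(1) by (simp add: set_borel_measurable_def f_def[abs_def])
    show "set_integrable lebesgue {c..d} (\<lambda>t. (f t)\<^sup>2)" for c d
      unfolding f2 set_integrable_def
      by (rule integrable_mult_indicator) (use \<beta>(2) in \<open>auto simp: set_integrable_def\<close>)
  qed
  then have sq: "set_integrable lebesgue {s..t} (\<lambda>t. (f t)\<^sup>2)" and fi: "set_integrable lebesgue {s..t} f" for s t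
    using loc_L2_integrable by (auto simp: loc_L2_def)
  define I where "I t = (LINT u:{a..t}|lebesgue. (f u)\<^sup>2)" for t
  have I: "I t - I s = (LINT u:{s..t}|lebesgue. (f u)\<^sup>2)" if "a \<le> s" "s \<le> t" for s t
    unfolding I_def using set_integral_Icc_combine[OF that sq] by simp
  show thesis
  proof
    fix s t assume st: "a \<le> s" "s \<le> t" "t \<le> b"
    show "I s \<le> I t"
    proof -
      have "0 \<le> (LINT u:{s..t}|lebesgue. (f u)\<^sup>2)"
        unfolding set_lebesgue_integral_def by (intro integral_nonneg_AE) auto
      then show ?thesis using I[OF st(1,2)] by linarith
    qed
    show "(norm (x t - x s))\<^sup>2 \<le> (t - s) * (I t - I s)"
    proof (cases "s = t")
      case False
      have "norm (x t - x s) \<le> (LINT u:{s..t}|lebesgue. \<beta> u)" using \<beta>(3) st assms False by auto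
      also have "\<dots> = (LINT u:{s..t}|lebesgue. f u)"
        using st assms by (intro set_lebesgue_integral_cong) (auto simp: f_def)
      finally have "(norm (x t - x s))\<^sup>2 \<le> (LINT u:{s..t}|lebesgue. f u)\<^sup>2" by (simp add: power_mono)
      also have "\<dots> \<le> (t - s) * (I t - I s)"
        unfolding I[OF st(1,2)] by (rule set_integral_Cauchy_Schwarz[OF st(2) fi sq])
      finally show ?thesis .
    qed simp
  qed
qed

text \<open>
  For curves in a complete inner product space this is equivalent to \<open>AC2_loc\<close>
  (\<open>AC2_loc_iff_finite_energy\<close>).  Bounds on the energies pass to pointwise limits of curves,
  unlike statements about a.e. derivatives.
\<close>

definition finite_energy :: "(real \<Rightarrow> 'a::real_normed_vector) \<Rightarrow> bool"
  where "finite_energy x \<longleftrightarrow> continuous_on UNIV x \<and> (\<forall>a b. a < b \<longrightarrow> (\<exists>\<rho>. \<forall>m. dyadic_energy x a b m \<le> \<rho>))"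

definition speed :: "(real \<Rightarrow> 'a::real_normed_vector) \<Rightarrow> real \<Rightarrow> real"
  where "speed x t = norm (vector_derivative x (at t))"

lemma speed_nonneg [simp]: "0 \<le> speed x t" by (simp add: speed_def)

lemma AC2_loc_finite_energy:
  assumes "AC2_loc x" shows "finite_energy x"
  unfolding finite_energy_def
proof (intro conjI allI impI)
  have "continuous_on {-r<..<r} x" for r :: real
  proof -
    have "AC2 (-\<bar>r\<bar> - 1) (\<bar>r\<bar> + 1) x" using assms by (simp add: AC2_loc_def)
    then obtain I where I: "\<And>s t. -\<bar>r\<bar> \<le> s \<Longrightarrow> s \<le> t \<Longrightarrow> t \<le> \<bar>r\<bar> \<Longrightarrow> (norm (x t - x s))\<^sup>2 \<le> (t - s) * (I t - I s)"
      "\<And>s t. -\<bar>r\<bar> \<le> s \<Longrightarrow> s \<le> t \<Longrightarrow> t \<le> \<bar>r\<bar> \<Longrightarrow> I s \<le> I t"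
      by (rule AC2_Holder[of _ _ x "-\<bar>r\<bar>" "\<bar>r\<bar>"]) auto
    show ?thesis
    proof (rule continuous_on_Holder)
      fix s t assume st: "s \<in> {-r<..<r}" "t \<in> {-r<..<r}" "s < t"
      have "(norm (x t - x s))\<^sup>2 \<le> (t - s) * (I t - I s)" using I(1)[of s t] st by auto
      also have "\<dots> \<le> (t - s) * (I \<bar>r\<bar> - I (-\<bar>r\<bar>))"
        using st I(2)[of "-\<bar>r\<bar>" s] I(2)[of t "\<bar>r\<bar>"] by (intro mult_left_mono) auto
      finally show "(norm (x t - x s))\<^sup>2 \<le> (t - s) * (I \<bar>r\<bar> - I (-\<bar>r\<bar>))" .
    qed
  qed
  then have "continuous_on (\<Union>r. {-r<..<r::real}) x"
    by (intro continuous_on_open_UN) auto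
  moreover have "(\<Union>r. {-r<..<r::real}) = UNIV"
  proof -
    have "t \<in> (\<Union>r. {-r<..<r})" for t :: real
      by (auto intro!: exI[of _ "\<bar>t\<bar> + 1"])
    then show ?thesis by blast
  qed
  ultimately show "continuous_on UNIV x" by simp
  fix a b :: real assume ab: "a < b"
  have "AC2 (a - 1) (b + 1) x" using assms ab by (simp add: AC2_loc_def)
  then obtain I where I: "\<And>s t. a \<le> s \<Longrightarrow> s \<le> t \<Longrightarrow> t \<le> b \<Longrightarrow> (norm (x t - x s))\<^sup>2 \<le> (t - s) * (I t - I s)"
    by (rule AC2_Holder[of _ _ x a b]) auto
  show "\<exists>\<rho>. \<forall>m. dyadic_energy x a b m \<le> \<rho>"
    using Holder_energy_bound[OF ab, of x I] I by (meson less_imp_le)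
qed

lemma finite_energy_AE_differentiable:
  fixes x :: "real \<Rightarrow> 'a::{real_inner,complete_space}"
  assumes "finite_energy x"
  shows "AE t in lebesgue. x differentiable (at t)"
proof -
  have "AE t in lebesgue. t \<in> {- real (Suc n)<..<real (Suc n)} \<longrightarrow> x differentiable (at t)" for n
  proof -
    obtain \<rho> where "\<And>m. dyadic_energy x (- real (Suc n)) (real (Suc n)) m \<le> \<rho>"
      using assms unfolding finite_energy_def by (metis less_le_trans neg_less_0_iff_less of_nat_0_less_iff of_nat_0_le_iff zero_less_Suc)
    moreover have "continuous_on {- real (Suc n)..real (Suc n)} x"
      using assms continuous_on_subset by (auto simp: finite_energy_def)
    ultimately show ?thesis by (intro AE_differentiable_of_energy) auto
  qed
  then have "AE t in lebesgue. \<forall>n. t \<in> {- real (Suc n)<..<real (Suc n)} \<longrightarrow> x differentiable (at t)"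
    unfolding AE_all_countable by blast
  then show ?thesis
  proof eventually_elim
    case (elim t)
    obtain n where "\<bar>t\<bar> < real n" using reals_Archimedean2 by blast
    then have "- real (Suc n) < t \<and> t < real (Suc n)" by (simp only: of_nat_Suc) linarith
    then show ?case using elim by auto
  qed
qed

text \<open>
  The derivative is replaced by difference quotients, along which \<open>F\<close> is continuous in time.
  The limit is taken after composing with \<open>F\<close>, so only real-valued functions are involved and
  measurability of a curve with values in a possibly nonseparable space is never at issue.
\<close>

lemma finite_energy_measurable_along:
  fixes x :: "real \<Rightarrow> 'a::{real_inner,complete_space}" and F :: "'a \<Rightarrow> 'a \<Rightarrow> real"
  assumes x: "finite_energy x" and F: "continuous_on UNIV (\<lambda>(M, N). F M N)"
  shows "(\<lambda>t. F (x t) (vector_derivative x (at t))) \<in> borel_measurable lebesgue"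
proof (rule borel_measurable_lebesgue_AE_limit)
  let ?q = "\<lambda>n t. real (Suc n) *\<^sub>R (x (t + 1 / real (Suc n)) - x t)"
  have c: "continuous_on UNIV x" using x by (simp add: finite_energy_def)
  show "(\<lambda>t. F (x t) (?q n t)) \<in> borel_measurable lebesgue" for n
  proof -
    have "continuous_on UNIV (\<lambda>t. (\<lambda>(M, N). F M N) (x t, ?q n t))"
      by (rule continuous_on_compose2[OF F]) (auto intro!: continuous_intros continuous_on_compose2[OF c])
    then show ?thesis
      by (intro measurable_completion) (auto intro: borel_measurable_continuous_onI)
  qed
  show "AE t in lebesgue. (\<lambda>n. F (x t) (?q n t)) \<longlonglongrightarrow> F (x t) (vector_derivative x (at t))"
    using finite_energy_AE_differentiable[OF x]
  proof eventually_elim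
    case (elim t)
    then have "(x has_vector_derivative vector_derivative x (at t)) (at t)" by (simp add: vector_derivative_works)
    then have "((\<lambda>h. norm (x (t + h) - x t - h *\<^sub>R vector_derivative x (at t)) / norm h) \<longlongrightarrow> 0) (at 0)"
      by (simp add: has_vector_derivative_def has_derivative_at)
    moreover have "filterlim (\<lambda>n. 1 / real (Suc n)) (at 0) sequentially"
      using LIMSEQ_inverse_real_of_nat by (intro filterlim_atI) (auto simp: inverse_eq_divide)
    ultimately have "(\<lambda>n. norm (x (t + 1 / real (Suc n)) - x t - (1 / real (Suc n)) *\<^sub>R vector_derivative x (at t)) / norm (1 / real (Suc n))) \<longlonglongrightarrow> 0"
      by (rule filterlim_compose)
    moreover have "norm (y - (1 / real (Suc n)) *\<^sub>R v) / norm (1 / real (Suc n)) = norm (real (Suc n) *\<^sub>R y - v)" for y v :: 'a and n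
    proof -
      have "real (Suc n) *\<^sub>R y - v = real (Suc n) *\<^sub>R (y - (1 / real (Suc n)) *\<^sub>R v)"
        by (simp add: scaleR_diff_right)
      then show ?thesis by (simp del: of_nat_Suc)
    qed
    ultimately have "(\<lambda>n. ?q n t - vector_derivative x (at t)) \<longlonglongrightarrow> 0"
      by (simp only: tendsto_norm_zero_iff)
    then have "(\<lambda>n. ?q n t) \<longlonglongrightarrow> vector_derivative x (at t)" by (rule LIM_zero_cancel)
    then have "(\<lambda>n. (x t, ?q n t)) \<longlonglongrightarrow> (x t, vector_derivative x (at t))" by (intro tendsto_intros)
    from continuous_on_tendsto_compose[OF F this] show ?case by simp
  qed
qed

lemma finite_energy_speed:
  fixes x :: "real \<Rightarrow> 'a::{real_inner,complete_space}"
  assumes x: "finite_energy x"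
  shows "loc_L2 (speed x)"
    and "a < b \<Longrightarrow> (\<And>m. dyadic_energy x a b m \<le> \<rho>) \<Longrightarrow> (LINT t:{a..b}|lebesgue. (speed x t)\<^sup>2) \<le> \<rho>"
    and "s \<le> t \<Longrightarrow> norm (x t - x s) \<le> (LINT u:{s..t}|lebesgue. speed x u)"
    and "s \<le> t \<Longrightarrow> (norm (x t - x s))\<^sup>2 \<le> (t - s) * (LINT u:{s..t}|lebesgue. (speed x u)\<^sup>2)"
proof -
  have d: "AE t in lebesgue. t \<in> {a<..<b} \<longrightarrow> x differentiable (at t)" for a b
    using finite_energy_AE_differentiable[OF x] by eventually_elim simp
  have c: "continuous_on S x" for S using x continuous_on_subset by (auto simp: finite_energy_def)
  show 1: "loc_L2 (speed x)"
    unfolding loc_L2_def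
  proof (intro conjI allI)
    show "speed x \<in> borel_measurable lebesgue"
      using finite_energy_measurable_along[OF x, of "\<lambda>M N. norm N"]
      by (simp add: speed_def[abs_def] case_prod_beta continuous_on_norm continuous_on_snd continuous_on_id)
    show "set_integrable lebesgue {a..b} (\<lambda>t. (speed x t)\<^sup>2)" for a b
    proof (cases "a < b")
      case True
      with x obtain \<rho> where "\<And>m. dyadic_energy x a b m \<le> \<rho>" unfolding finite_energy_def by blast
      from energy_derivative_square(1)[OF True this d] show ?thesis by (simp add: speed_def)
    qed (simp add: set_Icc_degenerate)
  qed
  show "a < b \<Longrightarrow> (\<And>m. dyadic_energy x a b m \<le> \<rho>) \<Longrightarrow> (LINT t:{a..b}|lebesgue. (speed x t)\<^sup>2) \<le> \<rho>"
    using energy_derivative_square(2)[OF _ _ d] by (simp add: speed_def)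
  show 3: "norm (x t - x s) \<le> (LINT u:{s..t}|lebesgue. speed x u)" if "s \<le> t" for s t
  proof (cases "s = t")
    case True
    then show ?thesis using set_Icc_degenerate(2)[of t s "speed x"] by simp
  next
    case False
    with that have st: "s < t" by simp
    with x obtain \<rho> where "\<And>m. dyadic_energy x s t m \<le> \<rho>" unfolding finite_energy_def by blast
    from energy_norm_diff_le[OF st c this] show ?thesis by (simp add: speed_def)
  qed
  show "(norm (x t - x s))\<^sup>2 \<le> (t - s) * (LINT u:{s..t}|lebesgue. (speed x u)\<^sup>2)" if "s \<le> t"
  proof -
    have "(norm (x t - x s))\<^sup>2 \<le> (LINT u:{s..t}|lebesgue. speed x u)\<^sup>2"
      using 3[OF that] by (intro power_mono) auto
    also have "\<dots> \<le> (t - s) * (LINT u:{s..t}|lebesgue. (speed x u)\<^sup>2)"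
      by (rule set_integral_Cauchy_Schwarz[OF that loc_L2_integrable[OF 1]]) (use 1 in \<open>simp add: loc_L2_def\<close>)
    finally show ?thesis .
  qed
qed

lemma AC2_locI:
  assumes \<beta>: "loc_L2 \<beta>" and x: "\<And>s t. s < t \<Longrightarrow> norm (x t - x s) \<le> (LINT u:{s..t}|lebesgue. \<beta> u)"
  shows "AC2_loc x"
  unfolding AC2_loc_def AC2_def
proof (intro allI impI exI conjI)
  fix a b :: real
  show "set_borel_measurable lebesgue {a<..<b} \<beta>"
    using \<beta> unfolding loc_L2_def set_borel_measurable_def
    by (intro borel_measurable_scaleR borel_measurable_indicator) auto
  show "set_integrable lebesgue {a<..<b} (\<lambda>u. (\<beta> u)\<^sup>2)"
    using \<beta> unfolding loc_L2_def by (meson set_integrable_subset greaterThanLessThan_subseteq_atLeastAtMost_iff order_refl lmeasurable_interval(2) fmeasurableD)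
qed (use x in auto)

theorem AC2_loc_iff_finite_energy:
  fixes x :: "real \<Rightarrow> 'a::{real_inner,complete_space}"
  shows "AC2_loc x \<longleftrightarrow> finite_energy x"
  using AC2_loc_finite_energy AC2_locI[OF finite_energy_speed(1) finite_energy_speed(3)] by (metis less_imp_le)

section \<open>Calculus of curves\<close>

lemma AC2_loc_continuous: "AC2_loc x \<Longrightarrow> continuous_on UNIV x"
  using AC2_loc_finite_energy by (auto simp: finite_energy_def)

lemma AC2_loc_const: "AC2_loc (\<lambda>_. v)"
  by (rule AC2_locI[OF loc_L2_const[of 0]]) (simp add: set_lebesgue_integral_def)

lemma AC2_loc_linear: "AC2_loc (\<lambda>t. t *\<^sub>R v)"
proof (rule AC2_locI[OF loc_L2_const[of "norm v"]])
  fix s t :: real assume "s < t"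
  then show "norm (t *\<^sub>R v - s *\<^sub>R v) \<le> (LINT u:{s..t}|lebesgue. norm v)"
    by (simp add: set_integral_Icc_const flip: scaleR_diff_left)
qed

context
  fixes x :: "real \<Rightarrow> 'a::{real_inner,complete_space}"
  assumes x: "AC2_loc x"
begin

lemma AC2_loc_AE_differentiable: "AE t in lebesgue. x differentiable (at t)"
  using x finite_energy_AE_differentiable by (simp add: AC2_loc_iff_finite_energy)

lemma AC2_loc_speed: "loc_L2 (speed x)"
  using x finite_energy_speed(1) by (simp add: AC2_loc_iff_finite_energy)

lemma AC2_loc_norm_diff_le: "s \<le> t \<Longrightarrow> norm (x t - x s) \<le> (LINT u:{s..t}|lebesgue. speed x u)"
  using x finite_energy_speed(3) by (simp add: AC2_loc_iff_finite_energy)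

lemma AC2_loc_norm_diff_sq_le:
  "s \<le> t \<Longrightarrow> (norm (x t - x s))\<^sup>2 \<le> (t - s) * (LINT u:{s..t}|lebesgue. (speed x u)\<^sup>2)"
  using x finite_energy_speed(4) by (simp add: AC2_loc_iff_finite_energy)

lemma AC2_loc_measurable_along:
  fixes F :: "'a \<Rightarrow> 'a \<Rightarrow> real"
  shows "continuous_on UNIV (\<lambda>(M, N). F M N) \<Longrightarrow>
    (\<lambda>t. F (x t) (vector_derivative x (at t))) \<in> borel_measurable lebesgue"
  by (rule finite_energy_measurable_along[OF x[unfolded AC2_loc_iff_finite_energy], where F=F])

lemma AC2_loc_scaleR: "AC2_loc (\<lambda>t. c *\<^sub>R x t)"
proof (rule AC2_locI[OF loc_L2_cmult[OF AC2_loc_speed]])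
  fix s t :: real assume "s < t"
  then have "\<bar>c\<bar> * norm (x t - x s) \<le> \<bar>c\<bar> * (LINT u:{s..t}|lebesgue. speed x u)"
    by (intro mult_left_mono AC2_loc_norm_diff_le) auto
  then show "norm (c *\<^sub>R x t - c *\<^sub>R x s) \<le> (LINT u:{s..t}|lebesgue. \<bar>c\<bar> * speed x u)"
    by (simp flip: scaleR_diff_right)
qed

lemma AC2_loc_isometry:
  assumes f: "linear f" "\<And>v. norm (f v) = norm v"
  shows "AC2_loc (\<lambda>t. f (x t))"
proof (rule AC2_locI[OF AC2_loc_speed])
  fix s t :: real assume "s < t"
  then show "norm (f (x t) - f (x s)) \<le> (LINT u:{s..t}|lebesgue. speed x u)"
    using AC2_loc_norm_diff_le[of s t] by (simp add: f(2) flip: linear_diff[OF f(1)])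
qed

lemma AC2_loc_shift: "AC2_loc (\<lambda>t. x (r + t))"
proof (rule AC2_locI[OF loc_L2_shift[OF AC2_loc_speed, of r]])
  fix s t :: real assume "s < t"
  then show "norm (x (r + t) - x (r + s)) \<le> (LINT u:{s..t}|lebesgue. speed x (r + u))"
    using AC2_loc_norm_diff_le[of "r + s" "r + t"] AC2_loc_speed
    by (simp add: set_integral_shift(2) loc_L2_def)
qed

end

lemma vector_derivative_shift: "vector_derivative (\<lambda>t. x (r + t)) (at t) = vector_derivative x (at (r + t))"
proof -
  have 1: "((\<lambda>t. y (r + t)) has_vector_derivative v) (at t)" if "(y has_vector_derivative v) (at (r + t))"
    for y :: "real \<Rightarrow> 'a" and r t v
  proof -
    have "((\<lambda>t. r + t) has_vector_derivative 1) (at t)" by (auto intro!: derivative_eq_intros)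
    from vector_diff_chain_at[OF this, of y v] that show ?thesis by (simp add: o_def)
  qed
  have "((\<lambda>t. x (r + t)) has_vector_derivative v) (at t) \<longleftrightarrow> (x has_vector_derivative v) (at (r + t))" for v
    using 1[of x v r t] 1[of "\<lambda>t. x (r + t)" v "-r" "r + t"] by auto
  then show ?thesis by (simp add: vector_derivative_def)
qed

lemma vector_derivative_local:
  assumes "open S" "t \<in> S" "\<And>s. s \<in> S \<Longrightarrow> f s = g s"
  shows "vector_derivative f (at t) = vector_derivative g (at t)"
proof -
  have "(f has_vector_derivative v) (at t) \<longleftrightarrow> (g has_vector_derivative v) (at t)" for v
    using has_vector_derivative_transform_within_open[OF _ assms(1,2), of _ v] assms(3) by metis
  then show ?thesis by (simp add: vector_derivative_def)
qed

lemma set_integral_Icc_mono: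
  fixes f g :: "real \<Rightarrow> real"
  assumes "set_integrable lebesgue {a..b} f" "set_integrable lebesgue {a..b} g"
    "AE t in lebesgue. a \<le> t \<longrightarrow> t \<le> b \<longrightarrow> f t \<le> g t"
  shows "(LINT t:{a..b}|lebesgue. f t) \<le> (LINT t:{a..b}|lebesgue. g t)"
  using assms unfolding set_lebesgue_integral_def set_integrable_def
  by (intro integral_mono_AE) (auto elim!: eventually_mono simp: indicator_def)

lemma set_integral_Icc_cong:
  fixes f g :: "real \<Rightarrow> real"
  assumes "set_integrable lebesgue {a..b} f" "g \<in> borel_measurable lebesgue"
    "AE t in lebesgue. a \<le> t \<longrightarrow> t \<le> b \<longrightarrow> f t = g t"
  shows "set_integrable lebesgue {a..b} g" "(LINT t:{a..b}|lebesgue. g t) = (LINT t:{a..b}|lebesgue. f t)"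
proof -
  show g: "set_integrable lebesgue {a..b} g"
    by (rule set_integrable_Icc_bound[OF assms(2) set_integrable_abs[OF assms(1)]])
      (use assms(3) in \<open>auto elim!: eventually_mono\<close>)
  show "(LINT t:{a..b}|lebesgue. g t) = (LINT t:{a..b}|lebesgue. f t)"
    by (intro antisym set_integral_Icc_mono g assms(1)) (use assms(3) in \<open>auto elim!: eventually_mono\<close>)
qed

lemma AC2_loc_add:
  fixes x y :: "real \<Rightarrow> 'a::{real_inner,complete_space}"
  assumes x: "AC2_loc x" and y: "AC2_loc y"
  shows "AC2_loc (\<lambda>t. x t + y t)"
proof (rule AC2_locI[OF loc_L2_add[OF AC2_loc_speed[OF x] AC2_loc_speed[OF y]]])
  fix s t :: real assume st: "s < t"
  have "norm (x t + y t - (x s + y s)) \<le> norm (x t - x s) + norm (y t - y s)"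
    using norm_triangle_ineq[of "x t - x s" "y t - y s"] by (simp add: algebra_simps)
  also have "\<dots> \<le> (LINT u:{s..t}|lebesgue. speed x u) + (LINT u:{s..t}|lebesgue. speed y u)"
    using st by (intro add_mono AC2_loc_norm_diff_le x y) auto
  also have "\<dots> = (LINT u:{s..t}|lebesgue. speed x u + speed y u)"
    by (intro set_integral_add(2)[symmetric] loc_L2_integrable AC2_loc_speed x y)
  finally show "norm (x t + y t - (x s + y s)) \<le> (LINT u:{s..t}|lebesgue. speed x u + speed y u)" .
qed

lemma AC2_loc_diff:
  fixes x y :: "real \<Rightarrow> 'a::{real_inner,complete_space}"
  assumes "AC2_loc x" "AC2_loc y"
  shows "AC2_loc (\<lambda>t. x t - y t)"
  using AC2_loc_add[OF assms(1) AC2_loc_scaleR[OF assms(2), of "-1"]] by simp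

lemma AC2_loc_glue:
  fixes x y :: "real \<Rightarrow> 'a::{real_inner,complete_space}"
  assumes x: "AC2_loc x" and y: "AC2_loc y" and c: "x c = y c"
  shows "AC2_loc (\<lambda>t. if t \<le> c then x t else y t)"
proof -
  let ?\<beta> = "\<lambda>t. speed x t + speed y t"
  have \<beta>: "loc_L2 ?\<beta>" by (intro loc_L2_add AC2_loc_speed x y)
  have lex: "norm (x t - x s) \<le> (LINT u:{s..t}|lebesgue. ?\<beta> u)"
    and ley: "norm (y t - y s) \<le> (LINT u:{s..t}|lebesgue. ?\<beta> u)" if "s \<le> t" for s t
    using AC2_loc_norm_diff_le[OF x that] AC2_loc_norm_diff_le[OF y that]
      set_integral_Icc_mono[OF loc_L2_integrable[OF AC2_loc_speed[OF x]] loc_L2_integrable[OF \<beta>], of s t]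
      set_integral_Icc_mono[OF loc_L2_integrable[OF AC2_loc_speed[OF y]] loc_L2_integrable[OF \<beta>], of s t]
    by simp_all
  show ?thesis
  proof (rule AC2_locI[OF \<beta>])
    fix s t :: real assume st: "s < t"
    consider "t \<le> c" | "c < s" | "s \<le> c" "c < t" by linarith
    then show "norm ((if t \<le> c then x t else y t) - (if s \<le> c then x s else y s)) \<le> (LINT u:{s..t}|lebesgue. ?\<beta> u)"
    proof cases
      case 3
      have "norm (y t - x s) \<le> norm (y t - y c) + norm (x c - x s)"
        using norm_triangle_ineq[of "y t - y c" "x c - x s"] c by simp
      also have "\<dots> \<le> (LINT u:{c..t}|lebesgue. ?\<beta> u) + (LINT u:{s..c}|lebesgue. ?\<beta> u)"
        using 3 by (intro add_mono lex ley) auto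
      also have "\<dots> = (LINT u:{s..t}|lebesgue. ?\<beta> u)"
        using set_integral_Icc_combine[OF _ _ loc_L2_integrable[OF \<beta>], of s c t] 3 by simp
      finally show ?thesis using 3 by simp
    qed (use st lex ley in auto)
  qed
qed

lemma AE_vector_derivative_combination:
  fixes x k :: "real \<Rightarrow> 'a::{real_inner,complete_space}"
  assumes x: "AC2_loc x" and k: "AC2_loc k"
  shows "AE t in lebesgue. vector_derivative (\<lambda>t. x t + c *\<^sub>R k t) (at t)
    = vector_derivative x (at t) + c *\<^sub>R vector_derivative k (at t)"
  using AC2_loc_AE_differentiable[OF x] AC2_loc_AE_differentiable[OF k]
  by eventually_elim
    (auto intro!: vector_derivative_at has_vector_derivative_add simp: vector_derivative_works
      has_vector_derivative_scaleR[of "\<lambda>_. c" 0, simplified])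

lemma AE_vector_derivative_isometry:
  fixes x :: "real \<Rightarrow> 'a::{real_inner,complete_space}"
  assumes x: "AC2_loc x" and f: "bounded_linear f"
  shows "AE t in lebesgue. vector_derivative (\<lambda>t. f (x t) + v) (at t) = f (vector_derivative x (at t))"
  using AC2_loc_AE_differentiable[OF x]
proof eventually_elim
  case (elim t)
  then have "(x has_vector_derivative vector_derivative x (at t)) (at t)" by (simp add: vector_derivative_works)
  from bounded_linear.has_vector_derivative[OF f this]
  have "((\<lambda>t. f (x t) + v) has_vector_derivative f (vector_derivative x (at t)) + 0) (at t)"
    by (intro has_vector_derivative_add has_vector_derivative_const)
  then show ?case by (simp add: vector_derivative_at)
qed

section \<open>The action and its first variation\<close>

definition action :: "('a::real_normed_vector \<Rightarrow> 'a \<Rightarrow> real) \<Rightarrow> (real \<Rightarrow> 'a) \<Rightarrow> real \<Rightarrow> real \<Rightarrow> real"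
  where "action F x a b = (LINT t:{a..b}|lebesgue. F (x t) (vector_derivative x (at t)))"

definition H1_sq :: "(real \<Rightarrow> 'a::real_normed_vector) \<Rightarrow> real \<Rightarrow> real \<Rightarrow> real"
  where "H1_sq k a b = (LINT t:{a..b}|lebesgue. (norm (k t))\<^sup>2 + (speed k t)\<^sup>2)"

lemma H1_integrable:
  fixes k :: "real \<Rightarrow> 'a::{real_inner,complete_space}"
  assumes "AC2_loc k"
  shows "set_integrable lebesgue {a..b} (\<lambda>t. (norm (k t))\<^sup>2)"
    and "set_integrable lebesgue {a..b} (\<lambda>t. (speed k t)\<^sup>2)"
proof -
  have "continuous_on UNIV (\<lambda>t. norm (k t))"
    using AC2_loc_continuous[OF assms] by (intro continuous_intros)
  from loc_L2_continuous[OF this] show "set_integrable lebesgue {a..b} (\<lambda>t. (norm (k t))\<^sup>2)"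
    by (simp add: loc_L2_def)
  show "set_integrable lebesgue {a..b} (\<lambda>t. (speed k t)\<^sup>2)"
    using AC2_loc_speed[OF assms] by (simp add: loc_L2_def)
qed

text \<open>
  The form \<open>D M N\<close> stands for the derivative of \<open>F\<close> at \<open>(M, N)\<close>.  Then \<open>lower\<close> says that \<open>F\<close> is
  uniformly convex in the velocity up to a quadratic error in the position, and \<open>upper\<close> is
  semiconcavity.
\<close>

locale tonelli =
  fixes F :: "'h::{real_inner,complete_space} \<Rightarrow> 'h \<Rightarrow> real"
    and D :: "'h \<Rightarrow> 'h \<Rightarrow> 'h \<Rightarrow> 'h \<Rightarrow> real"
    and \<gamma> K \<kappa> C0 C1 :: real
  assumes pos: "0 < \<gamma>" "0 < K" "0 < \<kappa>" "0 \<le> C0"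
    and cont: "continuous_on UNIV (\<lambda>(M, N). F M N)"
    and D_add: "D M N (H\<^sub>1 + H\<^sub>1') (H\<^sub>2 + H\<^sub>2') = D M N H\<^sub>1 H\<^sub>2 + D M N H\<^sub>1' H\<^sub>2'"
    and D_scale: "D M N (c *\<^sub>R H\<^sub>1) (c *\<^sub>R H\<^sub>2) = c * D M N H\<^sub>1 H\<^sub>2"
    and lower: "\<gamma> * (norm H\<^sub>2)\<^sup>2 - K * (norm H\<^sub>1)\<^sup>2 \<le> F (M + H\<^sub>1) (N + H\<^sub>2) - F M N - D M N H\<^sub>1 H\<^sub>2"
    and upper: "F (M + H\<^sub>1) (N + H\<^sub>2) - F M N - D M N H\<^sub>1 H\<^sub>2 \<le> K * ((norm H\<^sub>1)\<^sup>2 + (norm H\<^sub>2)\<^sup>2)"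
    and coercive: "\<kappa> * (norm N)\<^sup>2 - C0 \<le> F M N"
    and growth: "F M N \<le> C1 * (1 + (norm M)\<^sup>2 + (norm N)\<^sup>2)"
begin

lemma two_sided: "\<bar>F (M + H\<^sub>1) (N + H\<^sub>2) - F M N - D M N H\<^sub>1 H\<^sub>2\<bar> \<le> K * ((norm H\<^sub>1)\<^sup>2 + (norm H\<^sub>2)\<^sup>2)"
proof -
  have "- (K * ((norm H\<^sub>1)\<^sup>2 + (norm H\<^sub>2)\<^sup>2)) \<le> \<gamma> * (norm H\<^sub>2)\<^sup>2 - K * (norm H\<^sub>1)\<^sup>2"
  proof -
    have "0 \<le> \<gamma> * (norm H\<^sub>2)\<^sup>2" "0 \<le> K * (norm H\<^sub>2)\<^sup>2" using pos by auto
    then show ?thesis unfolding distrib_left by linarith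
  qed
  then show ?thesis using upper lower by (smt (verit))
qed

definition "lag x t = F (x t) (vector_derivative x (at t))"
text \<open>
  The integrand of the first variation of the action at \<open>x\<close> in direction \<open>k\<close>.
\<close>

definition "var x k t = D (x t) (vector_derivative x (at t)) (k t) (vector_derivative k (at t))"

lemma action_lag: "action F x a b = (LINT t:{a..b}|lebesgue. lag x t)"
  by (simp add: action_def lag_def)

lemma lag_measurable: "AC2_loc x \<Longrightarrow> lag x \<in> borel_measurable lebesgue"
  unfolding lag_def[abs_def] by (rule AC2_loc_measurable_along[OF _ cont])

lemma lag_nonneg: "0 \<le> lag x t + C0"
proof -
  have "0 \<le> \<kappa> * (norm (vector_derivative x (at t)))\<^sup>2" using pos by simp
  then show ?thesis using coercive[of "vector_derivative x (at t)" "x t"] by (simp add: lag_def)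
qed

lemma lag_integrable:
  assumes x: "AC2_loc x"
  shows "set_integrable lebesgue {a..b} (lag x)"
proof (rule set_integrable_Icc_bound[OF lag_measurable[OF x]])
  show "set_integrable lebesgue {a..b} (\<lambda>t. (\<bar>C1\<bar> + C0) + \<bar>C1\<bar> * (norm (x t))\<^sup>2 + \<bar>C1\<bar> * (speed x t)\<^sup>2)"
    using H1_integrable[OF x] by (intro set_integral_add(1) set_integrable_Icc_const set_integrable_mult_right)
  have "\<bar>lag x t\<bar> \<le> (\<bar>C1\<bar> + C0) + \<bar>C1\<bar> * (norm (x t))\<^sup>2 + \<bar>C1\<bar> * (speed x t)\<^sup>2" for t
  proof -
    have "lag x t \<le> C1 * (1 + (norm (x t))\<^sup>2 + (speed x t)\<^sup>2)"
      unfolding lag_def speed_def by (rule growth)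
    also have "\<dots> \<le> \<bar>C1\<bar> * (1 + (norm (x t))\<^sup>2 + (speed x t)\<^sup>2)" by (intro mult_right_mono) auto
    finally have u: "lag x t \<le> \<bar>C1\<bar> + \<bar>C1\<bar> * (norm (x t))\<^sup>2 + \<bar>C1\<bar> * (speed x t)\<^sup>2" by (simp add: distrib_left)
    have "\<kappa> * (speed x t)\<^sup>2 - C0 \<le> lag x t" unfolding lag_def speed_def by (rule coercive)
    moreover have "0 \<le> \<kappa> * (speed x t)\<^sup>2" "0 \<le> \<bar>C1\<bar> * (norm (x t))\<^sup>2" "0 \<le> \<bar>C1\<bar> * (speed x t)\<^sup>2" using pos by auto
    ultimately show ?thesis using u pos by linarith
  qed
  then show "AE t in lebesgue. t \<in> {a..b} \<longrightarrow> \<bar>lag x t\<bar> \<le> (\<bar>C1\<bar> + C0) + \<bar>C1\<bar> * (norm (x t))\<^sup>2 + \<bar>C1\<bar> * (speed x t)\<^sup>2"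
    by simp
qed

lemma AE_lag_expansion:
  assumes x: "AC2_loc x" and k: "AC2_loc k"
  shows "AE t in lebesgue. lag (\<lambda>t. x t + c *\<^sub>R k t) t
    = F (x t + c *\<^sub>R k t) (vector_derivative x (at t) + c *\<^sub>R vector_derivative k (at t))"
  using AE_vector_derivative_combination[OF x k, of c] by eventually_elim (simp add: lag_def)

text \<open>
  The integrand is the limit of difference quotients of \<open>lag\<close> in the direction \<open>k\<close>, which are
  measurable and converge by \<open>two_sided\<close>.
\<close>

lemma var_measurable:
  assumes x: "AC2_loc x" and k: "AC2_loc k"
  shows "var x k \<in> borel_measurable lebesgue"
proof (rule borel_measurable_lebesgue_AE_limit)
  let ?c = "\<lambda>n. 1 / real (Suc n)"
  let ?y = "\<lambda>n t. x t + ?c n *\<^sub>R k t"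
  have y: "AC2_loc (?y n)" for n by (intro AC2_loc_add AC2_loc_scaleR x k)
  show "(\<lambda>t. real (Suc n) * (lag (?y n) t - lag x t)) \<in> borel_measurable lebesgue" for n
    using lag_measurable[OF y[of n]] lag_measurable[OF x] by (intro borel_measurable_times borel_measurable_diff) auto
  have "AE t in lebesgue. \<forall>n. lag (?y n) t = F (x t + ?c n *\<^sub>R k t) (vector_derivative x (at t) + ?c n *\<^sub>R vector_derivative k (at t))"
    unfolding AE_all_countable using AE_lag_expansion[OF x k] by blast
  then show "AE t in lebesgue. (\<lambda>n. real (Suc n) * (lag (?y n) t - lag x t)) \<longlonglongrightarrow> var x k t"
  proof eventually_elim
    case (elim t)
    define W where "W = K * ((norm (k t))\<^sup>2 + (speed k t)\<^sup>2)"
    have "(\<lambda>n. W * inverse (real (Suc n))) \<longlonglongrightarrow> W * 0"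
      by (intro tendsto_mult tendsto_const LIMSEQ_inverse_real_of_nat)
    then have lim: "(\<lambda>n. W * inverse (real (Suc n))) \<longlonglongrightarrow> 0" by simp
    have "norm (real (Suc n) * (lag (?y n) t - lag x t) - var x k t) \<le> W * inverse (real (Suc n))" for n
    proof -
      define c where "c = ?c n"
      have c: "c > 0" "real (Suc n) = 1 / c" by (simp_all add: c_def)
      have e: "lag (?y n) t = F (x t + c *\<^sub>R k t) (vector_derivative x (at t) + c *\<^sub>R vector_derivative k (at t))"
        using elim unfolding c_def by blast
      have "\<bar>lag (?y n) t - lag x t - c * var x k t\<bar> \<le> K * (c\<^sup>2 * (norm (k t))\<^sup>2 + c\<^sup>2 * (speed k t)\<^sup>2)"
        unfolding e using two_sided[of "x t" "c *\<^sub>R k t" "vector_derivative x (at t)" "c *\<^sub>R vector_derivative k (at t)"]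
        by (simp add: D_scale lag_def var_def speed_def power_mult_distrib)
      also have "\<dots> = c\<^sup>2 * W" by (simp add: W_def algebra_simps)
      finally have *: "\<bar>lag (?y n) t - lag x t - c * var x k t\<bar> \<le> c\<^sup>2 * W" .
      have "real (Suc n) * (lag (?y n) t - lag x t) - var x k t = (lag (?y n) t - lag x t - c * var x k t) / c"
        using c by (simp add: diff_divide_distrib)
      then have "norm (real (Suc n) * (lag (?y n) t - lag x t) - var x k t) = \<bar>lag (?y n) t - lag x t - c * var x k t\<bar> / c"
        using c by simp
      also have "\<dots> \<le> c\<^sup>2 * W / c" using * c by (intro divide_right_mono) auto
      also have "\<dots> = W * inverse (real (Suc n))" unfolding c(2) using c(1) by (simp add: power2_eq_square)
      finally show ?thesis .
    qed
    then have "(\<lambda>n. real (Suc n) * (lag (?y n) t - lag x t) - var x k t) \<longlonglongrightarrow> 0"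
      by (intro Lim_null_comparison[OF always_eventually lim]) auto
    then show ?case by (rule LIM_zero_cancel)
  qed
qed

lemma AE_two_sided:
  assumes x: "AC2_loc x" and k: "AC2_loc k"
  shows "AE t in lebesgue. \<gamma> * (speed k t)\<^sup>2 - K * (norm (k t))\<^sup>2 \<le> lag (\<lambda>t. x t + k t) t - lag x t - var x k t"
    and "AE t in lebesgue. \<bar>lag (\<lambda>t. x t + k t) t - lag x t - var x k t\<bar> \<le> K * ((norm (k t))\<^sup>2 + (speed k t)\<^sup>2)"
proof -
  have e: "AE t in lebesgue. lag (\<lambda>t. x t + k t) t = F (x t + k t) (vector_derivative x (at t) + vector_derivative k (at t))"
    using AE_lag_expansion[OF x k, of 1] by simp
  show "AE t in lebesgue. \<gamma> * (speed k t)\<^sup>2 - K * (norm (k t))\<^sup>2 \<le> lag (\<lambda>t. x t + k t) t - lag x t - var x k t"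
    using e by eventually_elim (use lower in \<open>simp add: speed_def lag_def var_def\<close>)
  show "AE t in lebesgue. \<bar>lag (\<lambda>t. x t + k t) t - lag x t - var x k t\<bar> \<le> K * ((norm (k t))\<^sup>2 + (speed k t)\<^sup>2)"
    using e by eventually_elim (use two_sided in \<open>simp add: speed_def lag_def var_def\<close>)
qed

lemma var_integrable:
  assumes x: "AC2_loc x" and k: "AC2_loc k"
  shows "set_integrable lebesgue {a..b} (var x k)"
proof (rule set_integrable_Icc_bound[OF var_measurable[OF x k]])
  show "set_integrable lebesgue {a..b} (\<lambda>t. \<bar>lag (\<lambda>t. x t + k t) t\<bar> + \<bar>lag x t\<bar> + K * ((norm (k t))\<^sup>2 + (speed k t)\<^sup>2))"
    using H1_integrable[OF k] lag_integrable[OF x] lag_integrable[OF AC2_loc_add[OF x k]]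
    by (intro set_integral_add(1) set_integrable_mult_right set_integrable_abs)
  show "AE t in lebesgue. t \<in> {a..b} \<longrightarrow> \<bar>var x k t\<bar> \<le> \<bar>lag (\<lambda>t. x t + k t) t\<bar> + \<bar>lag x t\<bar> + K * ((norm (k t))\<^sup>2 + (speed k t)\<^sup>2)"
    using AE_two_sided(2)[OF x k] by eventually_elim linarith
qed

lemma action_expansion_upper:
  assumes x: "AC2_loc x" and k: "AC2_loc k"
  shows "action F (\<lambda>t. x t + k t) a b \<le> action F x a b + (LINT t:{a..b}|lebesgue. var x k t) + K * H1_sq k a b"
proof -
  note I = lag_integrable[OF x, of a b] var_integrable[OF x k, of a b] H1_integrable[OF k, of a b]
  have "action F (\<lambda>t. x t + k t) a b \<le> (LINT t:{a..b}|lebesgue. (lag x t + var x k t) + K * ((norm (k t))\<^sup>2 + (speed k t)\<^sup>2))"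
    unfolding action_lag
  proof (rule set_integral_Icc_mono)
    show "set_integrable lebesgue {a..b} (lag (\<lambda>t. x t + k t))" by (rule lag_integrable[OF AC2_loc_add[OF x k]])
    show "set_integrable lebesgue {a..b} (\<lambda>t. (lag x t + var x k t) + K * ((norm (k t))\<^sup>2 + (speed k t)\<^sup>2))"
      by (intro set_integral_add(1) set_integrable_mult_right I)
    show "AE t in lebesgue. a \<le> t \<longrightarrow> t \<le> b \<longrightarrow>
      lag (\<lambda>t. x t + k t) t \<le> (lag x t + var x k t) + K * ((norm (k t))\<^sup>2 + (speed k t)\<^sup>2)"
      using AE_two_sided(2)[OF x k] by eventually_elim linarith
  qed
  also have "\<dots> = action F x a b + (LINT t:{a..b}|lebesgue. var x k t) + K * H1_sq k a b"
  proof -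
    have "(LINT t:{a..b}|lebesgue. (lag x t + var x k t) + K * ((norm (k t))\<^sup>2 + (speed k t)\<^sup>2))
      = (LINT t:{a..b}|lebesgue. lag x t + var x k t) + (LINT t:{a..b}|lebesgue. K * ((norm (k t))\<^sup>2 + (speed k t)\<^sup>2))"
      by (rule set_integral_add(2)) (intro set_integral_add(1) set_integrable_mult_right I)+
    also have "(LINT t:{a..b}|lebesgue. lag x t + var x k t) = (LINT t:{a..b}|lebesgue. lag x t) + (LINT t:{a..b}|lebesgue. var x k t)"
      by (rule set_integral_add(2)) (rule I)+
    finally show ?thesis by (simp add: action_lag H1_sq_def)
  qed
  finally show ?thesis .
qed

lemma action_expansion_lower:
  assumes x: "AC2_loc x" and k: "AC2_loc k"
  shows "action F x a b + (LINT t:{a..b}|lebesgue. var x k t)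
     + (\<gamma> * (LINT t:{a..b}|lebesgue. (speed k t)\<^sup>2) - K * (LINT t:{a..b}|lebesgue. (norm (k t))\<^sup>2))
    \<le> action F (\<lambda>t. x t + k t) a b"
proof -
  note I = lag_integrable[OF x, of a b] var_integrable[OF x k, of a b] H1_integrable[OF k, of a b]
  have "(LINT t:{a..b}|lebesgue. (lag x t + var x k t) + (\<gamma> * (speed k t)\<^sup>2 - K * (norm (k t))\<^sup>2)) \<le> action F (\<lambda>t. x t + k t) a b"
    unfolding action_lag
  proof (rule set_integral_Icc_mono)
    show "set_integrable lebesgue {a..b} (lag (\<lambda>t. x t + k t))" by (rule lag_integrable[OF AC2_loc_add[OF x k]])
    show "set_integrable lebesgue {a..b} (\<lambda>t. (lag x t + var x k t) + (\<gamma> * (speed k t)\<^sup>2 - K * (norm (k t))\<^sup>2))"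
      by (intro set_integral_add(1) set_integral_diff(1) set_integrable_mult_right I)
    show "AE t in lebesgue. a \<le> t \<longrightarrow> t \<le> b \<longrightarrow>
      (lag x t + var x k t) + (\<gamma> * (speed k t)\<^sup>2 - K * (norm (k t))\<^sup>2) \<le> lag (\<lambda>t. x t + k t) t"
      using AE_two_sided(1)[OF x k] by eventually_elim linarith
  qed
  also have "(LINT t:{a..b}|lebesgue. (lag x t + var x k t) + (\<gamma> * (speed k t)\<^sup>2 - K * (norm (k t))\<^sup>2))
    = action F x a b + (LINT t:{a..b}|lebesgue. var x k t)
     + (\<gamma> * (LINT t:{a..b}|lebesgue. (speed k t)\<^sup>2) - K * (LINT t:{a..b}|lebesgue. (norm (k t))\<^sup>2))"
  proof -
    have "(LINT t:{a..b}|lebesgue. (lag x t + var x k t) + (\<gamma> * (speed k t)\<^sup>2 - K * (norm (k t))\<^sup>2))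
      = (LINT t:{a..b}|lebesgue. lag x t + var x k t) + (LINT t:{a..b}|lebesgue. \<gamma> * (speed k t)\<^sup>2 - K * (norm (k t))\<^sup>2)"
      by (rule set_integral_add(2)) (intro set_integral_add(1) set_integral_diff(1) set_integrable_mult_right I)+
    also have "(LINT t:{a..b}|lebesgue. lag x t + var x k t) = (LINT t:{a..b}|lebesgue. lag x t) + (LINT t:{a..b}|lebesgue. var x k t)"
      by (rule set_integral_add(2)) (rule I)+
    also have "(LINT t:{a..b}|lebesgue. \<gamma> * (speed k t)\<^sup>2 - K * (norm (k t))\<^sup>2)
      = (LINT t:{a..b}|lebesgue. \<gamma> * (speed k t)\<^sup>2) - (LINT t:{a..b}|lebesgue. K * (norm (k t))\<^sup>2)"
      by (rule set_integral_diff(2)) (intro set_integrable_mult_right I)+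
    finally show ?thesis by (simp add: action_lag)
  qed
  finally show ?thesis .
qed

lemma action_combine:
  assumes x: "AC2_loc x" and "a \<le> b" "b \<le> c"
  shows "action F x a c = action F x a b + action F x b c"
  unfolding action_lag by (rule set_integral_Icc_combine[OF assms(2,3) lag_integrable[OF x]])

lemma AE_var_linear:
  assumes x: "AC2_loc x" and k: "AC2_loc k" and l: "AC2_loc l"
  shows "AE t in lebesgue. var x (\<lambda>t. k t + c *\<^sub>R l t) t = var x k t + c * var x l t"
  using AE_vector_derivative_combination[OF k l, of c]
  by eventually_elim (simp add: var_def D_add D_scale)

lemma integral_var_linear:
  assumes x: "AC2_loc x" and k: "AC2_loc k" and l: "AC2_loc l"
  shows "(LINT t:{a..b}|lebesgue. var x (\<lambda>t. k t + c *\<^sub>R l t) t)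
    = (LINT t:{a..b}|lebesgue. var x k t) + c * (LINT t:{a..b}|lebesgue. var x l t)"
proof -
  have "AC2_loc (\<lambda>t. k t + c *\<^sub>R l t)" by (intro AC2_loc_add AC2_loc_scaleR k l)
  note I = var_integrable[OF x this, of a b] var_integrable[OF x k, of a b] var_integrable[OF x l, of a b]
  note M = var_measurable[OF x k] var_measurable[OF x l]
  have "(LINT t:{a..b}|lebesgue. var x k t + c * var x l t) = (LINT t:{a..b}|lebesgue. var x (\<lambda>t. k t + c *\<^sub>R l t) t)"
  proof (rule set_integral_Icc_cong(2)[OF I(1)])
    show "(\<lambda>t. var x k t + c * var x l t) \<in> borel_measurable lebesgue"
      using M by (intro borel_measurable_add borel_measurable_times) auto
    show "AE t in lebesgue. a \<le> t \<longrightarrow> t \<le> b \<longrightarrow> var x (\<lambda>t. k t + c *\<^sub>R l t) t = var x k t + c * var x l t"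
      using AE_var_linear[OF x k l, of c] by eventually_elim simp
  qed
  moreover have "(LINT t:{a..b}|lebesgue. var x k t + c * var x l t)
    = (LINT t:{a..b}|lebesgue. var x k t) + (LINT t:{a..b}|lebesgue. c * var x l t)"
    by (rule set_integral_add(2)) (intro set_integrable_mult_right I)+
  ultimately show ?thesis by simp
qed

end

lemma AE_Icc_interior:
  assumes "\<And>t. a < t \<Longrightarrow> t < b \<Longrightarrow> P t"
  shows "AE t in lebesgue. a \<le> t \<longrightarrow> t \<le> (b::real) \<longrightarrow> P t"
  using AE_lebesgue_neq[of a] AE_lebesgue_neq[of b] by eventually_elim (use assms in force)

lemma vector_derivative_Ioo:
  assumes "\<And>t. a < t \<Longrightarrow> t < b \<Longrightarrow> k t = l t" "a < t" "t < b"
  shows "vector_derivative k (at t) = vector_derivative l (at t)"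
  by (rule vector_derivative_local[of "{a<..<b}"]) (use assms in auto)

lemma H1_sq_nonneg: "0 \<le> H1_sq k a b"
  unfolding H1_sq_def set_lebesgue_integral_def by (intro integral_nonneg_AE) auto

lemma H1_sq_integrable:
  fixes k :: "real \<Rightarrow> 'a::{real_inner,complete_space}"
  assumes "AC2_loc k"
  shows "set_integrable lebesgue {a..b} (\<lambda>t. (norm (k t))\<^sup>2 + (speed k t)\<^sup>2)"
  by (intro set_integral_add(1) H1_integrable assms)

lemma H1_sq_combine:
  fixes k :: "real \<Rightarrow> 'a::{real_inner,complete_space}"
  assumes "AC2_loc k" "a \<le> b" "b \<le> c"
  shows "H1_sq k a c = H1_sq k a b + H1_sq k b c"
  unfolding H1_sq_def by (rule set_integral_Icc_combine[OF assms(2,3) H1_sq_integrable[OF assms(1)]])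

lemma H1_sq_cong:
  fixes k :: "real \<Rightarrow> 'a::{real_inner,complete_space}"
  assumes k: "AC2_loc k" and l: "AC2_loc l" and eq: "\<And>t. a < t \<Longrightarrow> t < b \<Longrightarrow> k t = l t"
  shows "H1_sq k a b = H1_sq l a b"
proof -
  have "AE t in lebesgue. a \<le> t \<longrightarrow> t \<le> b \<longrightarrow> (norm (k t))\<^sup>2 + (speed k t)\<^sup>2 = (norm (l t))\<^sup>2 + (speed l t)\<^sup>2"
    by (rule AE_Icc_interior) (use eq vector_derivative_Ioo[of a b k l] in \<open>auto simp: speed_def\<close>)
  then show ?thesis unfolding H1_sq_def
    by (intro antisym set_integral_Icc_mono H1_sq_integrable k l) (auto elim!: eventually_mono)
qed

lemma H1_sq_add3:
  fixes k :: "real \<Rightarrow> 'a::{real_inner,complete_space}"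
  assumes k: "AC2_loc k" and l: "AC2_loc l" and h: "AC2_loc h"
  shows "H1_sq (\<lambda>t. k t + l t - h t) a b \<le> 3 * (H1_sq k a b + H1_sq l a b + H1_sq h a b)"
proof -
  have three: "(norm (u + v - w))\<^sup>2 \<le> 3 * ((norm u)\<^sup>2 + (norm v)\<^sup>2 + (norm w)\<^sup>2)" for u v w :: 'a
  proof -
    have "norm (u + v - w) \<le> norm u + norm v + norm w"
      using norm_triangle_ineq4[of "u + v" w] norm_triangle_ineq[of u v] by linarith
    then have "(norm (u + v - w))\<^sup>2 \<le> (norm u + norm v + norm w)\<^sup>2" by (intro power_mono) auto
    also have "\<dots> \<le> 3 * ((norm u)\<^sup>2 + (norm v)\<^sup>2 + (norm w)\<^sup>2)"
      using sum_squares_bound[of "norm u" "norm v"] sum_squares_bound[of "norm u" "norm w"] sum_squares_bound[of "norm v" "norm w"]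
      by (simp add: power2_eq_square algebra_simps)
    finally show ?thesis .
  qed
  let ?i = "\<lambda>k t. (norm (k t))\<^sup>2 + (speed k t)\<^sup>2"
  note I = H1_sq_integrable[OF k, of a b] H1_sq_integrable[OF l, of a b] H1_sq_integrable[OF h, of a b]
  have d: "AE t in lebesgue. vector_derivative (\<lambda>t. k t + l t - h t) (at t)
    = vector_derivative k (at t) + vector_derivative l (at t) - vector_derivative h (at t)"
    using AE_vector_derivative_combination[OF AC2_loc_add[OF k l] h, of "-1"] AE_vector_derivative_combination[OF k l, of 1]
    by eventually_elim simp
  have "H1_sq (\<lambda>t. k t + l t - h t) a b \<le> (LINT t:{a..b}|lebesgue. 3 * ((?i k t + ?i l t) + ?i h t))"
    unfolding H1_sq_def
  proof (rule set_integral_Icc_mono)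
    show "set_integrable lebesgue {a..b} (?i (\<lambda>t. k t + l t - h t))"
      by (intro H1_sq_integrable AC2_loc_diff AC2_loc_add k l h)
    show "set_integrable lebesgue {a..b} (\<lambda>t. 3 * ((?i k t + ?i l t) + ?i h t))"
      by (intro set_integrable_mult_right set_integral_add(1) H1_integrable k l h)
    show "AE t in lebesgue. a \<le> t \<longrightarrow> t \<le> b \<longrightarrow> ?i (\<lambda>t. k t + l t - h t) t \<le> 3 * ((?i k t + ?i l t) + ?i h t)"
      using d
    proof eventually_elim
      case (elim t)
      show ?case
        using three[of "k t" "l t" "h t"]
          three[of "vector_derivative k (at t)" "vector_derivative l (at t)" "vector_derivative h (at t)"]
        by (simp add: speed_def elim)
    qed
  qed
  also have "\<dots> = 3 * ((LINT t:{a..b}|lebesgue. ?i k t + ?i l t) + H1_sq h a b)"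
    unfolding H1_sq_def set_integral_mult_right by (subst set_integral_add(2)) (intro set_integral_add(1) I refl)+
  also have "(LINT t:{a..b}|lebesgue. ?i k t + ?i l t) = H1_sq k a b + H1_sq l a b"
    unfolding H1_sq_def by (rule set_integral_add(2)[OF I(1,2)])
  finally show ?thesis .
qed

lemma AC2_loc_affine: "AC2_loc (\<lambda>t. (\<alpha> + \<beta> * t) *\<^sub>R (v::'a::{real_inner,complete_space}))"
  using AC2_loc_add[OF AC2_loc_const[of "\<alpha> *\<^sub>R v"] AC2_loc_scaleR[OF AC2_loc_linear[of v], of \<beta>]]
  by (simp add: scaleR_add_left)

lemma H1_sq_affine:
  fixes v :: "'a::{real_inner,complete_space}"
  assumes "a \<le> b" "\<And>t. a \<le> t \<Longrightarrow> t \<le> b \<Longrightarrow> \<bar>\<alpha> + \<beta> * t\<bar> \<le> 1" "\<bar>\<beta>\<bar> \<le> 1"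
  shows "H1_sq (\<lambda>t. (\<alpha> + \<beta> * t) *\<^sub>R v) a b \<le> 2 * (b - a) * (norm v)\<^sup>2"
proof -
  have d: "vector_derivative (\<lambda>t. (\<alpha> + \<beta> * t) *\<^sub>R v) (at t) = \<beta> *\<^sub>R v" for t
    by (rule vector_derivative_at) (auto intro!: derivative_eq_intros)
  have "H1_sq (\<lambda>t. (\<alpha> + \<beta> * t) *\<^sub>R v) a b \<le> (LINT t:{a..b}|lebesgue. 2 * (norm v)\<^sup>2)"
    unfolding H1_sq_def
  proof (rule set_integral_Icc_mono[OF H1_sq_integrable[OF AC2_loc_affine] set_integrable_Icc_const])
    have le1: "r\<^sup>2 * (norm v)\<^sup>2 \<le> 1 * (norm v)\<^sup>2" if "\<bar>r\<bar> \<le> 1" for r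
      using that by (intro mult_right_mono) (auto simp: abs_square_le_1)
    show "AE t in lebesgue. a \<le> t \<longrightarrow> t \<le> b \<longrightarrow>
      (norm ((\<alpha> + \<beta> * t) *\<^sub>R v))\<^sup>2 + (speed (\<lambda>t. (\<alpha> + \<beta> * t) *\<^sub>R v) t)\<^sup>2 \<le> 2 * (norm v)\<^sup>2"
    proof (intro AE_I2 impI)
      fix t assume "a \<le> t" "t \<le> b"
      from add_mono[OF le1[OF assms(2)[OF this]] le1[OF assms(3)]]
      show "(norm ((\<alpha> + \<beta> * t) *\<^sub>R v))\<^sup>2 + (speed (\<lambda>t. (\<alpha> + \<beta> * t) *\<^sub>R v) t)\<^sup>2 \<le> 2 * (norm v)\<^sup>2"
        by (simp add: speed_def d power_mult_distrib)
    qed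
  qed
  also have "\<dots> = 2 * (b - a) * (norm v)\<^sup>2" using assms(1) by (simp add: set_integral_Icc_const)
  finally show ?thesis .
qed

lemma square_integral_mono_interval:
  fixes h :: "real \<Rightarrow> 'a::{real_inner,complete_space}"
  assumes h: "AC2_loc h" and "a \<le> c" "c \<le> d" "d \<le> b"
  shows "(LINT u:{c..d}|lebesgue. (speed h u)\<^sup>2) \<le> (LINT u:{a..b}|lebesgue. (speed h u)\<^sup>2)"
proof -
  have nn: "0 \<le> (LINT u:{a..b}|lebesgue. (speed h u)\<^sup>2)" for a b
    unfolding set_lebesgue_integral_def by (intro integral_nonneg_AE) auto
  show ?thesis
    using set_integral_Icc_combine[of a c b, OF _ _ H1_integrable(2)[OF h]]
      set_integral_Icc_combine[of c d b, OF _ _ H1_integrable(2)[OF h]] nn[of a c] nn[of d b] assms by simp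
qed

section \<open>Stability of almost calibrated curves\<close>

text \<open>
  Domination by the action says that \<open>U\<close> is a subsolution of the Hamilton-Jacobi equation.  It makes the
  reverse inequality, up to an error \<open>\<eta>\<close>, an almost minimality property of a curve among the
  curves with the same end points.
\<close>

locale dominated = tonelli +
  fixes U :: "'a \<Rightarrow> real"
  assumes dom: "AC2_loc x \<Longrightarrow> a \<le> b \<Longrightarrow> U (x a) \<le> action F x a b + U (x b)"
    and contU: "continuous_on UNIV U"
begin

definition almost_calibrated :: "(real \<Rightarrow> 'a) \<Rightarrow> real \<Rightarrow> real \<Rightarrow> real \<Rightarrow> bool"
  where "almost_calibrated x a b \<eta> \<longleftrightarrow> AC2_loc x \<and> action F x a b + U (x b) \<le> U (x a) + \<eta>"

lemma almost_calibrated_nonneg: "almost_calibrated x a b \<eta> \<Longrightarrow> a \<le> b \<Longrightarrow> 0 \<le> \<eta>"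
  using dom[of x a b] by (auto simp: almost_calibrated_def)

lemma almost_calibrated_mono: "almost_calibrated x a b \<eta> \<Longrightarrow> \<eta> \<le> \<eta>' \<Longrightarrow> almost_calibrated x a b \<eta>'"
  by (auto simp: almost_calibrated_def)

text \<open>
  On the two intervals that are cut off, domination bounds the action from below.
\<close>

lemma almost_calibrated_subinterval:
  assumes x: "almost_calibrated x a b \<eta>" and "a \<le> a'" "a' \<le> b'" "b' \<le> b"
  shows "almost_calibrated x a' b' \<eta>"
proof -
  have AC: "AC2_loc x" using x by (simp add: almost_calibrated_def)
  show ?thesis
    using x dom[OF AC \<open>a \<le> a'\<close>] dom[OF AC \<open>b' \<le> b\<close>] assms(2-)
      action_combine[OF AC, of a a' b] action_combine[OF AC, of a' b' b]
    by (auto simp: almost_calibrated_def)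
qed

text \<open>
  The curve \<open>x - s k\<close> has the end points of \<open>x\<close>, so its action is at most \<open>\<eta>\<close> below that
  of \<open>x\<close>.  Expand it to second order and divide by \<open>s\<close>.
\<close>

lemma first_variation_le:
  assumes x: "almost_calibrated x a b \<eta>" and ab: "a \<le> b" and k: "AC2_loc k" "k a = 0" "k b = 0" and s: "0 < s"
  shows "(LINT t:{a..b}|lebesgue. var x k t) \<le> K * s * H1_sq k a b + \<eta> / s"
proof -
  have AC: "AC2_loc x" using x by (simp add: almost_calibrated_def)
  define l where "l t = 0 *\<^sub>R k t + (- s) *\<^sub>R k t" for t
  have l: "AC2_loc l" unfolding l_def by (intro AC2_loc_add AC2_loc_scaleR k)
  have z: "AC2_loc (\<lambda>t. 0 *\<^sub>R k t)" by (intro AC2_loc_scaleR k)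
  have "(LINT t:{a..b}|lebesgue. var x l t) = (LINT t:{a..b}|lebesgue. var x (\<lambda>t. 0 *\<^sub>R k t) t) + (- s) * (LINT t:{a..b}|lebesgue. var x k t)"
    unfolding l_def by (rule integral_var_linear[OF AC z k(1)])
  also have "(LINT t:{a..b}|lebesgue. var x (\<lambda>t. 0 *\<^sub>R k t) t) = 0"
    using D_scale[of _ _ 0 0 0] by (simp add: var_def set_lebesgue_integral_def)
  finally have vl: "(LINT t:{a..b}|lebesgue. var x l t) = - s * (LINT t:{a..b}|lebesgue. var x k t)" by simp
  have "AE t in lebesgue. speed l t = s * speed k t"
    using AE_vector_derivative_combination[OF z k(1), of "-s"]
    by eventually_elim (use s in \<open>simp add: speed_def l_def[abs_def]\<close>)
  then have "AE t in lebesgue. a \<le> t \<longrightarrow> t \<le> b \<longrightarrow> (norm (l t))\<^sup>2 + (speed l t)\<^sup>2 = s\<^sup>2 * ((norm (k t))\<^sup>2 + (speed k t)\<^sup>2)"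
    by eventually_elim (use s in \<open>simp add: l_def power_mult_distrib distrib_left\<close>)
  then have "H1_sq l a b \<le> (LINT t:{a..b}|lebesgue. s\<^sup>2 * ((norm (k t))\<^sup>2 + (speed k t)\<^sup>2))"
    unfolding H1_sq_def
    by (intro set_integral_Icc_mono set_integrable_mult_right H1_sq_integrable l k(1)) (auto elim!: eventually_mono)
  then have Hl: "H1_sq l a b \<le> s\<^sup>2 * H1_sq k a b" by (simp only: H1_sq_def set_integral_mult_right)
  have "U (x a) \<le> action F (\<lambda>t. x t + l t) a b + U (x b)"
    using dom[OF AC2_loc_add[OF AC l] ab] k by (simp add: l_def)
  also have "action F (\<lambda>t. x t + l t) a b \<le> action F x a b + - s * (LINT t:{a..b}|lebesgue. var x k t) + K * (s\<^sup>2 * H1_sq k a b)"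
  proof -
    have "K * H1_sq l a b \<le> K * (s\<^sup>2 * H1_sq k a b)" using Hl pos by (intro mult_left_mono) auto
    then show ?thesis using action_expansion_upper[OF AC l, of a b] unfolding vl by linarith
  qed
  finally have "s * (LINT t:{a..b}|lebesgue. var x k t) \<le> K * (s\<^sup>2 * H1_sq k a b) + \<eta>"
    using x by (simp add: almost_calibrated_def)
  then have "(LINT t:{a..b}|lebesgue. var x k t) \<le> (K * (s\<^sup>2 * H1_sq k a b) + \<eta>) / s"
    using s by (simp add: pos_le_divide_eq mult.commute)
  also have "\<dots> = K * s * H1_sq k a b + \<eta> / s"
    using s by (simp add: add_divide_distrib power2_eq_square)
  finally show ?thesis .
qed

lemma integral_var_cong:
  assumes x: "AC2_loc x" and k: "AC2_loc k" and l: "AC2_loc l" and eq: "\<And>t. a < t \<Longrightarrow> t < b \<Longrightarrow> k t = l t"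
  shows "(LINT t:{a..b}|lebesgue. var x k t) = (LINT t:{a..b}|lebesgue. var x l t)"
proof -
  have "AE t in lebesgue. a \<le> t \<longrightarrow> t \<le> b \<longrightarrow> var x k t = var x l t"
    by (rule AE_Icc_interior) (use eq vector_derivative_Ioo[of a b k l] in \<open>auto simp: var_def\<close>)
  then show ?thesis
    by (intro antisym set_integral_Icc_mono var_integrable x k l) (auto elim!: eventually_mono)
qed

text \<open>
  Let \<open>h = y - x\<close> and \<open>\<sigma>' = \<sigma> + \<tau>\<close>.  The affine interpolations \<open>kw\<close> and \<open>kz\<close> make \<open>x + kw\<close> a
  curve from \<open>y \<sigma>\<close> to \<open>x (\<sigma>' + 1)\<close> and \<open>x + kz\<close> a curve from \<open>x (\<sigma> - 1)\<close> to \<open>y \<sigma>'\<close>.  Domination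
  along both, together with the almost calibration of \<open>x\<close> on the long and of \<open>y\<close> on the short
  interval, shows that the action of \<open>y\<close> exceeds that of \<open>x\<close> on the short interval by no more
  than the first variations at \<open>x\<close> in the directions \<open>kw\<close> and \<open>kz\<close>, up to errors of order
  \<open>Q\<close> and \<open>\<eta>\<close>.  The lower expansion of the action of \<open>y = x + h\<close> contributes the first variation in
  direction \<open>h\<close> and the term \<open>\<gamma> * E\<close>.  The three first variations together are that of a
  single \<open>k\<close> that vanishes at both ends of the long interval, and \<open>x\<close> almost minimizes there,
  so \<open>first_variation_le\<close> applies.  The unit margins on both sides keep the slopes of \<open>kw\<close>
  and \<open>kz\<close> at most \<open>1\<close>.
\<close>

lemma crossing_inequality:
  assumes x: "almost_calibrated x (\<sigma> - 1) (\<sigma> + \<tau> + 1) \<eta>" and y: "almost_calibrated y \<sigma> (\<sigma> + \<tau>) \<eta>"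
    and \<tau>: "0 < \<tau>" "\<tau> \<le> 1" and s: "0 < s" "27 * s \<le> 1"
    and Q: "\<And>t. \<sigma> \<le> t \<Longrightarrow> t \<le> \<sigma> + \<tau> \<Longrightarrow> (norm (y t - x t))\<^sup>2 \<le> Q"
  defines "E \<equiv> (LINT t:{\<sigma>..\<sigma> + \<tau>}|lebesgue. (speed (\<lambda>t. y t - x t) t)\<^sup>2)"
  shows "\<gamma> * E \<le> 10 * K * Q + 3 * K * s * E + (2 + 1 / s) * \<eta>"
proof -
  define p q \<sigma>' T where "p = \<sigma> - 1" and "q = \<sigma> + \<tau> + 1" and "\<sigma>' = \<sigma> + \<tau>" and "T = 1 + \<tau>"
  have ord: "p \<le> \<sigma>" "\<sigma> \<le> \<sigma>'" "\<sigma>' \<le> q" "p \<le> \<sigma>'" "\<sigma> \<le> q" "p \<le> q" "q - \<sigma> = T" "\<sigma>' - p = T"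
    and T: "1 \<le> T" "T \<le> 2"
    using \<tau> by (simp_all add: p_def q_def \<sigma>'_def T_def)
  have X: "AC2_loc x" and Y: "AC2_loc y" using x y by (auto simp: almost_calibrated_def)
  define h where "h t = y t - x t" for t
  have h: "AC2_loc h" unfolding h_def by (intro AC2_loc_diff X Y)
  define kw where "kw t = (q / T + (- 1 / T) * t) *\<^sub>R h \<sigma>" for t
  define kz where "kz t = (- p / T + (1 / T) * t) *\<^sub>R h \<sigma>'" for t
  have kw: "AC2_loc kw" and kz: "AC2_loc kz" unfolding kw_def kz_def by (rule AC2_loc_affine)+
  have co: "q / T + (- 1 / T) * t = (q - t) / T" "- p / T + (1 / T) * t = (t - p) / T" for t
    by (simp_all add: diff_divide_distrib)
  have kwv: "kw \<sigma> = h \<sigma>" "kw q = 0" and kzv: "kz \<sigma>' = h \<sigma>'" "kz p = 0"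
    unfolding kw_def kz_def co using T ord(7,8) by simp_all
  have Q0: "0 \<le> Q" using Q[of \<sigma>] \<tau> by (simp add: order_trans[OF zero_le_power2])
  have hQ: "(norm (h \<sigma>))\<^sup>2 \<le> Q" "(norm (h \<sigma>'))\<^sup>2 \<le> Q" using Q \<tau> by (auto simp: h_def \<sigma>'_def)
  have four: "2 * T * r \<le> 4 * Q" if "r \<le> Q" "0 \<le> r" for r
    using mult_mono[of "2 * T" 4 r Q] T that Q0 by simp
  have Hw: "H1_sq kw \<sigma> q \<le> 4 * Q"
  proof -
    have "H1_sq kw \<sigma> q \<le> 2 * (q - \<sigma>) * (norm (h \<sigma>))\<^sup>2"
      unfolding kw_def
    proof (rule H1_sq_affine[OF ord(5)])
      show "\<bar>q / T + (- 1 / T) * t\<bar> \<le> 1" if "\<sigma> \<le> t" "t \<le> q" for t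
        unfolding co using that ord T by (simp add: field_simps)
    qed (use T in simp)
    also have "\<dots> \<le> 4 * Q" unfolding ord(7) by (rule four[OF hQ(1)]) simp
    finally show ?thesis .
  qed
  have Hz: "H1_sq kz p \<sigma>' \<le> 4 * Q"
  proof -
    have "H1_sq kz p \<sigma>' \<le> 2 * (\<sigma>' - p) * (norm (h \<sigma>'))\<^sup>2"
      unfolding kz_def
    proof (rule H1_sq_affine[OF ord(4)])
      show "\<bar>- p / T + (1 / T) * t\<bar> \<le> 1" if "p \<le> t" "t \<le> \<sigma>'" for t
        unfolding co using that ord T by (simp add: field_simps)
    qed (use T in simp)
    also have "\<dots> \<le> 4 * Q" unfolding ord(8) by (rule four[OF hQ(2)]) simp
    finally show ?thesis .
  qed
  define S where "S = (LINT t:{\<sigma>..\<sigma>'}|lebesgue. (norm (h t))\<^sup>2)"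
  have "S \<le> (LINT t:{\<sigma>..\<sigma>'}|lebesgue. Q)"
    unfolding S_def by (intro set_integral_Icc_mono H1_integrable h set_integrable_Icc_const)
      (use Q in \<open>auto simp: h_def \<sigma>'_def\<close>)
  also have "\<dots> = Q * \<tau>" using ord by (simp add: set_integral_Icc_const \<sigma>'_def)
  also have "\<dots> \<le> Q" using \<tau> Q0 by (simp add: mult_left_le)
  finally have SQ: "S \<le> Q" .
  have E: "E = (LINT t:{\<sigma>..\<sigma>'}|lebesgue. (speed h t)\<^sup>2)" by (simp add: E_def h_def[abs_def] \<sigma>'_def)
  have Hh: "H1_sq h \<sigma> \<sigma>' = S + E"
    unfolding H1_sq_def S_def E by (rule set_integral_add(2)[OF H1_integrable[OF h]])
  \<comment> \<open>\<open>kz\<close>, \<open>kz + kw - h\<close> and \<open>kw\<close> fit together at \<open>\<sigma>\<close> and \<open>\<sigma>'\<close>, where \<open>kw\<close> respectively \<open>kz\<close> equals \<open>h\<close>\<close>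
  define m where "m t = kz t + kw t - h t" for t
  have m: "AC2_loc m" unfolding m_def by (intro AC2_loc_diff AC2_loc_add kz kw h)
  define k1 where "k1 t = (if t \<le> \<sigma>' then m t else kw t)" for t
  have k1: "AC2_loc k1" unfolding k1_def by (rule AC2_loc_glue[OF m kw]) (simp add: m_def kzv)
  define k where "k t = (if t \<le> \<sigma> then kz t else k1 t)" for t
  have k: "AC2_loc k" unfolding k_def
    by (rule AC2_loc_glue[OF kz k1]) (use ord in \<open>simp add: k1_def m_def kwv\<close>)
  have kpq: "k p = 0" "k q = 0" using ord \<tau> by (simp_all add: k_def k1_def kwv kzv) (simp_all add: q_def \<sigma>'_def)
  have c1: "k t = kz t" if "p < t" "t < \<sigma>" for t using that by (simp add: k_def)
  have c2: "k t = m t" if "\<sigma> < t" "t < \<sigma>'" for t using that by (simp add: k_def k1_def)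
  have c3: "k t = kw t" if "\<sigma>' < t" "t < q" for t using that ord by (simp add: k_def k1_def)
  have Hm: "H1_sq m \<sigma> \<sigma>' \<le> 3 * (H1_sq kz \<sigma> \<sigma>' + H1_sq kw \<sigma> \<sigma>' + (S + E))"
    unfolding m_def Hh[symmetric] by (rule H1_sq_add3[OF kz kw h])
  have Hk: "H1_sq k p q \<le> 3 * (9 * Q + E)"
  proof -
    have "H1_sq k p q = H1_sq kz p \<sigma> + H1_sq m \<sigma> \<sigma>' + H1_sq kw \<sigma>' q"
      using H1_sq_combine[OF k, of p \<sigma> q] H1_sq_combine[OF k, of \<sigma> \<sigma>' q] ord
        H1_sq_cong[OF k kz c1] H1_sq_cong[OF k m c2] H1_sq_cong[OF k kw c3] by simp
    moreover have "H1_sq kz p \<sigma>' = H1_sq kz p \<sigma> + H1_sq kz \<sigma> \<sigma>'" "H1_sq kw \<sigma> q = H1_sq kw \<sigma> \<sigma>' + H1_sq kw \<sigma>' q"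
      using H1_sq_combine[OF kz, of p \<sigma> \<sigma>'] H1_sq_combine[OF kw, of \<sigma> \<sigma>' q] ord by simp_all
    ultimately show ?thesis
      using Hm Hw Hz SQ H1_sq_nonneg[of kz p \<sigma>] H1_sq_nonneg[of kw \<sigma>' q] unfolding distrib_left by linarith
  qed
  let ?V = "\<lambda>k a b. (LINT t:{a..b}|lebesgue. var x k t)"
  have Vc: "?V l a c = ?V l a b + ?V l b c" if "AC2_loc l" "a \<le> b" "b \<le> c" for l a b c
    by (rule set_integral_Icc_combine[OF that(2,3) var_integrable[OF X that(1)]])
  have Vm: "?V m \<sigma> \<sigma>' = ?V kz \<sigma> \<sigma>' + ?V kw \<sigma> \<sigma>' - ?V h \<sigma> \<sigma>'"
  proof -
    have "?V (\<lambda>t. (\<lambda>t. kz t + 1 *\<^sub>R kw t) t + (-1) *\<^sub>R h t) \<sigma> \<sigma>' = ?V (\<lambda>t. kz t + 1 *\<^sub>R kw t) \<sigma> \<sigma>' + (-1) * ?V h \<sigma> \<sigma>'"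
      by (rule integral_var_linear[OF X _ h]) (intro AC2_loc_add AC2_loc_scaleR kz kw)
    moreover have "?V (\<lambda>t. kz t + 1 *\<^sub>R kw t) \<sigma> \<sigma>' = ?V kz \<sigma> \<sigma>' + 1 * ?V kw \<sigma> \<sigma>'"
      by (rule integral_var_linear[OF X kz kw])
    ultimately show ?thesis by (simp add: m_def[abs_def])
  qed
  have Vk: "?V k p q = ?V kz p \<sigma>' + ?V kw \<sigma> q - ?V h \<sigma> \<sigma>'"
    using Vc[OF k, of p \<sigma> q] Vc[OF k, of \<sigma> \<sigma>' q] Vc[OF kz, of p \<sigma> \<sigma>'] Vc[OF kw, of \<sigma> \<sigma>' q] ord Vm
      integral_var_cong[OF X k kz c1] integral_var_cong[OF X k m c2] integral_var_cong[OF X k kw c3] by simp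
  have V: "?V k p q \<le> K * s * H1_sq k p q + \<eta> / s"
    by (rule first_variation_le[OF x[folded p_def q_def] ord(6) k kpq s(1)])
  also have "\<dots> \<le> K * s * (3 * (9 * Q + E)) + \<eta> / s"
    using pos s Hk by (intro add_right_mono mult_left_mono) auto
  \<comment> \<open>the factor \<open>3 * 9\<close> is the reason for the hypothesis \<open>27 * s \<le> 1\<close>\<close>
  also have "K * s * (3 * (9 * Q + E)) = K * Q * (27 * s) + 3 * K * s * E" by (simp add: algebra_simps)
  also have "K * Q * (27 * s) \<le> K * Q * 1" using pos Q0 s by (intro mult_left_mono) auto
  finally have V: "?V k p q \<le> K * Q + 3 * K * s * E + \<eta> / s" by simp
  have "action F x \<sigma> \<sigma>' + ?V h \<sigma> \<sigma>' + (\<gamma> * E - K * S) \<le> action F y \<sigma> \<sigma>'"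
    using action_expansion_lower[OF X h, of \<sigma> \<sigma>'] by (simp add: E S_def h_def)
  moreover have "action F (\<lambda>t. x t + kw t) \<sigma> q \<le> action F x \<sigma> q + ?V kw \<sigma> q + K * H1_sq kw \<sigma> q"
    by (rule action_expansion_upper[OF X kw])
  moreover have "action F (\<lambda>t. x t + kz t) p \<sigma>' \<le> action F x p \<sigma>' + ?V kz p \<sigma>' + K * H1_sq kz p \<sigma>'"
    by (rule action_expansion_upper[OF X kz])
  moreover have "U (y \<sigma>) \<le> action F (\<lambda>t. x t + kw t) \<sigma> q + U (x q)"
    using dom[OF AC2_loc_add[OF X kw] ord(5)] by (simp add: kwv h_def)
  moreover have "U (x p) \<le> action F (\<lambda>t. x t + kz t) p \<sigma>' + U (y \<sigma>')"
    using dom[OF AC2_loc_add[OF X kz] ord(4)] by (simp add: kzv h_def)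
  moreover have "action F y \<sigma> \<sigma>' + U (y \<sigma>') \<le> U (y \<sigma>) + \<eta>" "action F x p q + U (x q) \<le> U (x p) + \<eta>"
    using x y by (simp_all add: almost_calibrated_def p_def q_def \<sigma>'_def)
  moreover have "action F x p q = action F x p \<sigma>' + action F x \<sigma>' q" "action F x \<sigma> q = action F x \<sigma> \<sigma>' + action F x \<sigma>' q"
    by (rule action_combine[OF X ord(4,3)], rule action_combine[OF X ord(2,3)])
  moreover have "K * S \<le> K * Q" "K * H1_sq kw \<sigma> q \<le> K * (4 * Q)" "K * H1_sq kz p \<sigma>' \<le> K * (4 * Q)"
    using pos SQ Hw Hz by simp_all
  ultimately have "\<gamma> * E \<le> K * Q + K * (4 * Q) + K * (4 * Q) + (K * Q + 3 * K * s * E + \<eta> / s) + 2 * \<eta>"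
    using V Vk by linarith
  moreover have "K * (4 * Q) = 4 * (K * Q)" "10 * K * Q = 10 * (K * Q)" "(2 + 1 / s) * \<eta> = 2 * \<eta> + \<eta> / s"
    by (simp_all add: distrib_right)
  ultimately show ?thesis by linarith
qed

lemma norm_sq_le_of_point:
  fixes h :: "real \<Rightarrow> 'a"
  assumes h: "AC2_loc h" and e: "a \<le> e" "e \<le> b" and t: "a \<le> t" "t \<le> b"
  shows "(norm (h t))\<^sup>2 \<le> 2 * (norm (h e))\<^sup>2 + 2 * (b - a) * (LINT u:{a..b}|lebesgue. (speed h u)\<^sup>2)"
proof -
  let ?I = "\<lambda>a b. (LINT u:{a..b}|lebesgue. (speed h u)\<^sup>2)"
  have nn: "0 \<le> ?I a b" for a b unfolding set_lebesgue_integral_def by (intro integral_nonneg_AE) auto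
  note mono = square_integral_mono_interval[OF h, of a _ _ b]
  have "(norm (h t - h e))\<^sup>2 \<le> (b - a) * ?I a b"
  proof (cases "e \<le> t")
    case True
    have "(norm (h t - h e))\<^sup>2 \<le> (t - e) * ?I e t" by (rule AC2_loc_norm_diff_sq_le[OF h True])
    also have "\<dots> \<le> (b - a) * ?I a b" using e t True nn mono by (intro mult_mono) auto
    finally show ?thesis .
  next
    case False
    have "(norm (h t - h e))\<^sup>2 \<le> (e - t) * ?I t e"
      using AC2_loc_norm_diff_sq_le[OF h, of t e] False by (simp add: norm_minus_commute)
    also have "\<dots> \<le> (b - a) * ?I a b" using e t False nn mono by (intro mult_mono) auto
    finally show ?thesis .
  qed
  moreover have "(norm (h t))\<^sup>2 \<le> 2 * (norm (h e))\<^sup>2 + 2 * (norm (h t - h e))\<^sup>2"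
  proof -
    have "norm (h t) \<le> norm (h e) + norm (h t - h e)" using norm_triangle_ineq[of "h e" "h t - h e"] by simp
    then have "(norm (h t))\<^sup>2 \<le> (norm (h e) + norm (h t - h e))\<^sup>2" by (intro power_mono) auto
    then show ?thesis using sum_squares_bound[of "norm (h e)" "norm (h t - h e)"] by (simp add: power2_sum)
  qed
  ultimately show ?thesis unfolding mult.assoc by linarith
qed

text \<open>
  On an interval of length \<open>\<tau>\<close> the supremum of \<open>\<parallel>h\<parallel>\<^sup>2\<close> is at most \<open>2 \<parallel>h e\<parallel>\<^sup>2 + 2 \<tau> E\<close>.  If \<open>\<tau>\<close> and
  \<open>s\<close> are small, the terms with \<open>E\<close> on the right of the crossing inequality are absorbed by
  \<open>\<gamma> * E\<close>.
\<close>

theorem stability: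
  obtains \<tau> C where "0 < \<tau>" "\<tau> \<le> 1" "0 < C"
    "\<And>x y \<sigma> e \<eta>. almost_calibrated x (\<sigma> - 1) (\<sigma> + \<tau> + 1) \<eta> \<Longrightarrow> almost_calibrated y \<sigma> (\<sigma> + \<tau>) \<eta> \<Longrightarrow>
      \<sigma> \<le> e \<Longrightarrow> e \<le> \<sigma> + \<tau> \<Longrightarrow>
      (LINT t:{\<sigma>..\<sigma> + \<tau>}|lebesgue. (speed (\<lambda>t. y t - x t) t)\<^sup>2) \<le> C * ((norm (y e - x e))\<^sup>2 + \<eta>)"
proof -
  \<comment> \<open>each of the two terms to be absorbed becomes at most \<open>\<gamma> / 4 * E\<close>\<close>
  define \<tau> where "\<tau> = min 1 (\<gamma> / (80 * K))"
  define s where "s = min (1/27) (\<gamma> / (12 * K))"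
  define C where "C = (2 / \<gamma>) * (20 * K + (2 + 1 / s))"
  have \<tau>: "0 < \<tau>" "\<tau> \<le> 1" "20 * K * \<tau> \<le> \<gamma> / 4"
  proof -
    show "0 < \<tau>" "\<tau> \<le> 1" using pos by (auto simp: \<tau>_def)
    have "\<tau> \<le> \<gamma> / (80 * K)" by (simp add: \<tau>_def)
    then show "20 * K * \<tau> \<le> \<gamma> / 4" using pos by (simp add: field_simps)
  qed
  have s: "0 < s" "27 * s \<le> 1" "3 * K * s \<le> \<gamma> / 4"
  proof -
    show "0 < s" "27 * s \<le> 1" using pos by (auto simp: s_def)
    have "s \<le> \<gamma> / (12 * K)" by (simp add: s_def)
    then show "3 * K * s \<le> \<gamma> / 4" using pos by (simp add: field_simps)
  qed
  show thesis
  proof (rule that[OF \<tau>(1,2)])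
    show "0 < C" using pos s by (simp add: C_def add_pos_pos)
    fix x y \<sigma> e \<eta>
    assume x: "almost_calibrated x (\<sigma> - 1) (\<sigma> + \<tau> + 1) \<eta>" and y: "almost_calibrated y \<sigma> (\<sigma> + \<tau>) \<eta>"
      and e: "\<sigma> \<le> e" "e \<le> \<sigma> + \<tau>"
    define h where "h = (\<lambda>t. y t - x t)"
    define E where "E = (LINT t:{\<sigma>..\<sigma> + \<tau>}|lebesgue. (speed h t)\<^sup>2)"
    define d where "d = (norm (y e - x e))\<^sup>2"
    have \<eta>: "0 \<le> \<eta>" using almost_calibrated_nonneg[OF y] \<tau> by simp
    have h: "AC2_loc h" unfolding h_def using x y by (intro AC2_loc_diff) (auto simp: almost_calibrated_def)
    have E0: "0 \<le> E" unfolding E_def set_lebesgue_integral_def by (intro integral_nonneg_AE) auto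
    have "\<gamma> * E \<le> 10 * K * (2 * d + 2 * \<tau> * E) + 3 * K * s * E + (2 + 1 / s) * \<eta>"
      unfolding E_def h_def
    proof (rule crossing_inequality[OF x y \<tau>(1,2) s(1,2)])
      fix t assume "\<sigma> \<le> t" "t \<le> \<sigma> + \<tau>"
      from norm_sq_le_of_point[OF h e this]
      show "(norm (y t - x t))\<^sup>2 \<le> 2 * d + 2 * \<tau> * (LINT t:{\<sigma>..\<sigma> + \<tau>}|lebesgue. (speed (\<lambda>t. y t - x t) t)\<^sup>2)"
        by (simp add: h_def d_def)
    qed
    also have "\<dots> = 20 * K * d + 20 * K * \<tau> * E + 3 * K * s * E + (2 + 1 / s) * \<eta>"
      by (simp add: algebra_simps)
    also have "\<dots> \<le> 20 * K * d + \<gamma> / 4 * E + \<gamma> / 4 * E + (2 + 1 / s) * \<eta>"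
      using \<tau>(3) s(3) E0 by (intro add_mono order_refl mult_right_mono) auto
    finally have "\<gamma> * E \<le> 20 * K * d + \<gamma> / 4 * E + \<gamma> / 4 * E + (2 + 1 / s) * \<eta>" .
    moreover have "\<gamma> * E = \<gamma> / 4 * E + \<gamma> / 4 * E + \<gamma> / 2 * E" by (simp add: field_simps)
    ultimately have "\<gamma> / 2 * E \<le> 20 * K * d + (2 + 1 / s) * \<eta>" by linarith
    also have "\<dots> \<le> (20 * K + (2 + 1 / s)) * (d + \<eta>)"
    proof -
      have "0 \<le> 20 * K * \<eta>" "0 \<le> (2 + 1 / s) * d" using pos \<eta> s by (auto simp: d_def)
      then show ?thesis unfolding distrib_left distrib_right by linarith
    qed
    finally have "(2 / \<gamma>) * (\<gamma> / 2 * E) \<le> (2 / \<gamma>) * ((20 * K + (2 + 1 / s)) * (d + \<eta>))"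
      using pos by (intro mult_left_mono) auto
    also have "(2 / \<gamma>) * ((20 * K + (2 + 1 / s)) * (d + \<eta>)) = C * (d + \<eta>)" by (simp only: C_def mult.assoc)
    also have "(2 / \<gamma>) * (\<gamma> / 2 * E) = E" using pos by simp
    finally show "(LINT t:{\<sigma>..\<sigma> + \<tau>}|lebesgue. (speed (\<lambda>t. y t - x t) t)\<^sup>2) \<le> C * ((norm (y e - x e))\<^sup>2 + \<eta>)"
      unfolding E_def d_def h_def .
  qed
qed

end

section \<open>Limits of almost calibrated curves\<close>

lemma dyadic_energy_le_speed:
  fixes h :: "real \<Rightarrow> 'a::{real_inner,complete_space}"
  assumes h: "AC2_loc h" and ab: "a < b"
  shows "dyadic_energy h a b m \<le> (LINT u:{a..b}|lebesgue. (speed h u)\<^sup>2)"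
proof -
  define I where "I t = (LINT u:{a..t}|lebesgue. (speed h u)\<^sup>2)" for t
  have "dyadic_energy h a b m \<le> I b - I a"
  proof (rule Holder_energy_bound[OF ab])
    fix s t assume "a \<le> s" "s < t" "t \<le> b"
    then show "(norm (h t - h s))\<^sup>2 \<le> (t - s) * (I t - I s)"
      using AC2_loc_norm_diff_sq_le[OF h, of s t] set_integral_Icc_combine[of a s t, OF _ _ H1_integrable(2)[OF h]]
      by (simp add: I_def)
  qed
  also have "I a = 0" unfolding I_def by (rule set_Icc_degenerate) simp
  finally show ?thesis by (simp add: I_def)
qed

lemma dyadic_energy_tendsto:
  assumes "\<And>t. (\<lambda>k. h k t) \<longlonglongrightarrow> r t"
  shows "(\<lambda>k. dyadic_energy (h k) a b m) \<longlonglongrightarrow> dyadic_energy r a b m"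
  unfolding dyadic_energy_def by (cases "a = b") (auto intro!: tendsto_intros assms)

lemma dyadic_energy_add_le:
  fixes x y :: "real \<Rightarrow> 'a::real_normed_vector"
  assumes ab: "a < b"
  shows "dyadic_energy (\<lambda>t. x t + y t) a b m \<le> 2 * dyadic_energy x a b m + 2 * dyadic_energy y a b m"
proof -
  have two: "(norm (u + v))\<^sup>2 \<le> 2 * (norm u)\<^sup>2 + 2 * (norm v)\<^sup>2" for u v :: 'a
  proof -
    have "(norm (u + v))\<^sup>2 \<le> (norm u + norm v)\<^sup>2" by (intro power_mono norm_triangle_ineq) auto
    then show ?thesis using sum_squares_bound[of "norm u" "norm v"] by (simp add: power2_sum)
  qed
  let ?d = "\<lambda>z k. z (dyadic a b m (Suc k)) - z (dyadic a b m k)"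
  have "(\<Sum>k<2^m. (norm (?d (\<lambda>t. x t + y t) k))\<^sup>2) \<le> (\<Sum>k<2^m. 2 * (norm (?d x k))\<^sup>2 + 2 * (norm (?d y k))\<^sup>2)"
    using two[of "?d x k" "?d y k" for k] by (intro sum_mono) (simp add: algebra_simps)
  also have "\<dots> = 2 * (\<Sum>k<2^m. (norm (?d x k))\<^sup>2) + 2 * (\<Sum>k<2^m. (norm (?d y k))\<^sup>2)"
    by (simp only: sum.distrib sum_distrib_left)
  finally have "(\<Sum>k<2^m. (norm (?d (\<lambda>t. x t + y t) k))\<^sup>2) * (2 ^ m / (b - a))
    \<le> (2 * (\<Sum>k<2^m. (norm (?d x k))\<^sup>2) + 2 * (\<Sum>k<2^m. (norm (?d y k))\<^sup>2)) * (2 ^ m / (b - a))"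
    using ab by (intro mult_right_mono) auto
  then show ?thesis unfolding dyadic_energy_def distrib_right by (simp add: mult.assoc)
qed

context dominated
begin

text \<open>
  Closeness at time 0 propagates in both directions by intervals of length \<open>\<tau>\<close>: stability
  bounds the energy of the difference on the next interval, and the energy bounds the
  difference at its far end.
\<close>

lemma almost_calibrated_Cauchy:
  assumes y: "\<And>n. almost_calibrated (y n) (- real n) (real n) (\<eta> n)" and \<eta>: "\<eta> \<longlonglongrightarrow> 0"
    and conv: "convergent (\<lambda>n. y n 0)" and e: "0 < e"
  shows "\<exists>N. \<forall>m\<ge>N. \<forall>n\<ge>N. \<forall>t\<in>{-r..r}. (norm (y n t - y m t))\<^sup>2 < e \<and>
    (LINT t:{-r..r}|lebesgue. (speed (\<lambda>t. y n t - y m t) t)\<^sup>2) < e"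
proof -
  obtain \<tau> C where \<tau>: "0 < \<tau>" "\<tau> \<le> 1" and C: "0 < C" and stab: "\<And>x y \<sigma> e \<eta>. almost_calibrated x (\<sigma> - 1) (\<sigma> + \<tau> + 1) \<eta> \<Longrightarrow> almost_calibrated y \<sigma> (\<sigma> + \<tau>) \<eta> \<Longrightarrow>
      \<sigma> \<le> e \<Longrightarrow> e \<le> \<sigma> + \<tau> \<Longrightarrow>
      (LINT t:{\<sigma>..\<sigma> + \<tau>}|lebesgue. (speed (\<lambda>t. y t - x t) t)\<^sup>2) \<le> C * ((norm (y e - x e))\<^sup>2 + \<eta>)"
    using stability by blast
  let ?I = "\<lambda>n m a b. (LINT t:{a..b}|lebesgue. (speed (\<lambda>t. y n t - y m t) t)\<^sup>2)"
  have AC: "AC2_loc (\<lambda>t. y n t - y m t)" for n m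
    using y by (intro AC2_loc_diff) (auto simp: almost_calibrated_def)
  have I0: "0 \<le> ?I n m a b" for n m a b unfolding set_lebesgue_integral_def by (intro integral_nonneg_AE) auto
  have P: "\<exists>N. \<forall>m\<ge>N. \<forall>n\<ge>N. (norm (y n (real j * \<tau>) - y m (real j * \<tau>)))\<^sup>2 < e \<and>
    (norm (y n (- (real j * \<tau>)) - y m (- (real j * \<tau>))))\<^sup>2 < e \<and> ?I n m (- (real j * \<tau>)) (real j * \<tau>) < e"
    if "0 < e" for j e
    using that
  proof (induction j arbitrary: e)
    case 0
    have "Cauchy (\<lambda>n. y n 0)" by (rule convergent_Cauchy[OF conv])
    moreover have "0 < sqrt e" using 0 by simp
    ultimately obtain N where N: "\<And>m n. m \<ge> N \<Longrightarrow> n \<ge> N \<Longrightarrow> norm (y n 0 - y m 0) < sqrt e"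
      unfolding Cauchy_def dist_norm by blast
    have "(norm (y n 0 - y m 0))\<^sup>2 < e" if "m \<ge> N" "n \<ge> N" for m n
      using power_strict_mono[OF N[OF that], of 2] 0 by simp
    moreover have "?I n m 0 0 = 0" for n m by (rule set_Icc_degenerate) simp
    ultimately show ?case using 0 by (intro exI[of _ N]) auto
  next
    case (Suc j)
    \<comment> \<open>one step multiplies a bound on the squared distances and the energy by at most \<open>2 + 4 * C\<close>\<close>
    define \<delta> where "\<delta> = e / (3 + 4 * C)"
    have \<delta>: "0 < \<delta>" "(3 + 4 * C) * \<delta> = e" using Suc.prems C by (simp_all add: \<delta>_def add_pos_pos)
    obtain N1 where N1: "\<And>m n. m \<ge> N1 \<Longrightarrow> n \<ge> N1 \<Longrightarrow> (norm (y n (real j * \<tau>) - y m (real j * \<tau>)))\<^sup>2 < \<delta> \<and>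
      (norm (y n (- (real j * \<tau>)) - y m (- (real j * \<tau>))))\<^sup>2 < \<delta> \<and> ?I n m (- (real j * \<tau>)) (real j * \<tau>) < \<delta>"
      using Suc.IH[OF \<delta>(1)] by blast
    have "eventually (\<lambda>n. \<eta> n < \<delta>) sequentially" using order_tendstoD(2)[OF \<eta> \<delta>(1)] .
    then obtain N2 where N2: "\<And>n. n \<ge> N2 \<Longrightarrow> \<eta> n < \<delta>" by (auto simp: eventually_sequentially)
    obtain N3 :: nat where N3: "real (Suc j) * \<tau> + 1 \<le> real N3" using real_arch_simple by blast
    show ?case
    proof (intro exI allI impI)
      fix m n assume "m \<ge> max N1 (max N2 N3)" "n \<ge> max N1 (max N2 N3)"
      then have mn: "m \<ge> N1" "n \<ge> N1" "m \<ge> N2" "n \<ge> N2" "m \<ge> N3" "n \<ge> N3" by auto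
      have cal: "almost_calibrated (y i) a b \<delta>" if "i = m \<or> i = n" "- real N3 \<le> a" "a \<le> b" "b \<le> real N3" for i a b
      proof (rule almost_calibrated_mono)
        show "almost_calibrated (y i) a b (\<eta> i)"
          by (rule almost_calibrated_subinterval[OF y]) (use that mn in auto)
        show "\<eta> i \<le> \<delta>" using N2[of i] that mn by auto
      qed
      let ?s = "real j * \<tau>" and ?s' = "real (Suc j) * \<tau>"
      have s: "?s' = ?s + \<tau>" "0 \<le> ?s" using \<tau> by (simp_all add: algebra_simps)
      note N3' = N3[unfolded s(1)]
      have E1: "?I n m ?s (?s + \<tau>) \<le> C * ((norm (y n ?s - y m ?s))\<^sup>2 + \<delta>)"
        by (rule stab; (intro cal)?; ((simp; fail) | (insert N3' s \<tau>, linarith)))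
      have E2: "?I n m (- ?s') (- ?s' + \<tau>) \<le> C * ((norm (y n (- ?s) - y m (- ?s)))\<^sup>2 + \<delta>)"
        by (rule stab; (intro cal)?; ((simp; fail) | (insert N3' s \<tau>, linarith)))
      have le: "C * (w + \<delta>) \<le> 2 * (C * \<delta>)" if "w < \<delta>" for w
      proof -
        have "C * (w + \<delta>) \<le> C * (\<delta> + \<delta>)" using that C by (intro mult_left_mono) auto
        then show ?thesis by simp
      qed
      have E: "?I n m ?s ?s' \<le> 2 * (C * \<delta>)" "?I n m (- ?s') (- ?s) \<le> 2 * (C * \<delta>)"
        using E1 E2 le N1[OF mn(1,2)] s(1) by (auto intro: order_trans)
      have e: "2 * \<delta> + 4 * (C * \<delta>) < e" "\<delta> + 4 * (C * \<delta>) < e"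
        using \<delta> unfolding distrib_right by (simp_all add: mult.assoc)
      have \<tau>E: "2 * \<tau> * i \<le> 4 * (C * \<delta>)" if "i \<le> 2 * (C * \<delta>)" "0 \<le> i" for i
      proof -
        have "2 * \<tau> * i \<le> 2 * 1 * i" using \<tau> that by (intro mult_right_mono) auto
        then show ?thesis using that by simp
      qed
      have "(norm (y n ?s' - y m ?s'))\<^sup>2 \<le> 2 * (norm (y n ?s - y m ?s))\<^sup>2 + 2 * (?s' - ?s) * ?I n m ?s ?s'"
        using \<tau> s by (intro norm_sq_le_of_point[OF AC]) auto
      then have A: "(norm (y n ?s' - y m ?s'))\<^sup>2 < e"
        using N1[OF mn(1,2)] \<tau>E[OF E(1) I0] e s(1) by simp
      have "(norm (y n (- ?s') - y m (- ?s')))\<^sup>2 \<le> 2 * (norm (y n (- ?s) - y m (- ?s)))\<^sup>2 + 2 * (- ?s - - ?s') * ?I n m (- ?s') (- ?s)"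
        using \<tau> s by (intro norm_sq_le_of_point[OF AC]) auto
      then have A': "(norm (y n (- ?s') - y m (- ?s')))\<^sup>2 < e"
        using N1[OF mn(1,2)] \<tau>E[OF E(2) I0] e s(1) by simp
      have "?I n m (- ?s') ?s' = ?I n m (- ?s') (- ?s) + ?I n m (- ?s) ?s'"
        by (rule set_integral_Icc_combine[OF _ _ H1_integrable(2)[OF AC]]) (use s \<tau> in auto)
      also have "?I n m (- ?s) ?s' = ?I n m (- ?s) ?s + ?I n m ?s ?s'"
        by (rule set_integral_Icc_combine[OF _ _ H1_integrable(2)[OF AC]]) (use s \<tau> in auto)
      finally have "?I n m (- ?s') ?s' < e" using E N1[OF mn(1,2)] e by simp
      with A A' show "(norm (y n ?s' - y m ?s'))\<^sup>2 < e \<and> (norm (y n (- ?s') - y m (- ?s')))\<^sup>2 < e \<and> ?I n m (- ?s') ?s' < e"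
        by simp
    qed
  qed
  obtain j :: nat where "\<bar>r\<bar> / \<tau> \<le> real j" using real_arch_simple by blast
  then have j: "\<bar>r\<bar> \<le> real j * \<tau>" using \<tau> by (simp add: field_simps)
  let ?s = "real j * \<tau>"
  define \<delta> where "\<delta> = e / (3 + 4 * ?s)"
  have s0: "0 \<le> ?s" using \<tau> by simp
  have \<delta>: "0 < \<delta>" "(3 + 4 * ?s) * \<delta> = e" using e s0 by (simp_all add: \<delta>_def add_pos_nonneg)
  obtain N where N: "\<And>m n. m \<ge> N \<Longrightarrow> n \<ge> N \<Longrightarrow> (norm (y n ?s - y m ?s))\<^sup>2 < \<delta> \<and> ?I n m (- ?s) ?s < \<delta>"
    using P[OF \<delta>(1), of j] by blast
  have "(norm (y n t - y m t))\<^sup>2 < e \<and> ?I n m (-r) r < e" if mn: "m \<ge> N" "n \<ge> N" and t: "t \<in> {-r..r}" for m n t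
  proof -
    have r: "\<bar>t\<bar> \<le> ?s" "- ?s \<le> - r" "- r \<le> r" "r \<le> ?s" using t j by auto
    have "(norm (y n t - y m t))\<^sup>2 \<le> 2 * (norm (y n ?s - y m ?s))\<^sup>2 + 2 * (?s - - ?s) * ?I n m (- ?s) ?s"
      using s0 r by (intro norm_sq_le_of_point[OF AC]) auto
    also have "2 * (?s - - ?s) * ?I n m (- ?s) ?s \<le> 4 * ?s * \<delta>"
    proof -
      have "2 * (S - - S) * I \<le> 4 * S * \<delta>" if "0 \<le> S" "I < \<delta>" for S I
        using that mult_left_mono[of I \<delta> "4 * S"] by simp
      then show ?thesis using N[OF mn] s0 by blast
    qed
    finally have "(norm (y n t - y m t))\<^sup>2 < e" using N[OF mn] \<delta> unfolding distrib_right by linarith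
    moreover have "?I n m (-r) r \<le> ?I n m (- ?s) ?s"
      by (rule square_integral_mono_interval[OF AC r(2,3,4)])
    moreover have "\<delta> \<le> e" using \<delta> s0 mult_nonneg_nonneg[of ?s \<delta>] unfolding distrib_right by linarith
    ultimately show ?thesis using N[OF mn] by force
  qed
  then show ?thesis by blast
qed

text \<open>
  The energies of \<open>y k - y n\<close> pass to the limit in \<open>k\<close>, so the pointwise limit \<open>x\<close> has
  locally finite energy and the velocities converge in \<open>L\<^sup>2\<close> on bounded intervals, hence almost
  everywhere along a subsequence.  Fatou's lemma, applied to the nonnegative function
  \<open>lag + C0\<close>, bounds the action of \<open>x\<close> from above, and domination bounds it from below.
\<close>

theorem calibrated_limit:
  assumes y: "\<And>n. almost_calibrated (y n) (- real n) (real n) (\<eta> n)" and \<eta>: "\<eta> \<longlonglongrightarrow> 0"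
    and conv: "convergent (\<lambda>n. y n 0)"
  shows "\<exists>x. AC2_loc x \<and> (\<forall>a b. a \<le> b \<longrightarrow> U (x a) = action F x a b + U (x b))"
proof -
  note Cau = almost_calibrated_Cauchy[OF y \<eta> conv]
  have ACy: "AC2_loc (y n)" for n using y by (simp add: almost_calibrated_def)
  have AC: "AC2_loc (\<lambda>t. y n t - y m t)" for n m by (intro AC2_loc_diff ACy)
  have "convergent (\<lambda>n. y n t)" for t
  proof -
    have "Cauchy (\<lambda>n. y n t)"
    proof (rule metric_CauchyI)
      fix e :: real assume e: "0 < e"
      then obtain N where N: "\<And>m n. m \<ge> N \<Longrightarrow> n \<ge> N \<Longrightarrow> (norm (y n t - y m t))\<^sup>2 < e\<^sup>2"
        using Cau[of "e\<^sup>2" "\<bar>t\<bar>"] by (auto simp: Ball_def) (smt (verit))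
      show "\<exists>M. \<forall>m\<ge>M. \<forall>n\<ge>M. dist (y m t) (y n t) < e"
        using N e by (intro exI[of _ N]) (auto simp: dist_norm intro: power2_less_imp_less)
    qed
    then show ?thesis by (simp add: Cauchy_convergent_iff)
  qed
  then obtain x where x: "\<And>t. (\<lambda>n. y n t) \<longlonglongrightarrow> x t" unfolding convergent_def by metis
  have close: "\<exists>N. \<forall>n\<ge>N. (\<forall>m. dyadic_energy (\<lambda>t. x t - y n t) a b m \<le> e) \<and>
      continuous_on {a..b} (\<lambda>t. x t - y n t)" if e: "0 < e" and ab: "a < b" for e a b
  proof -
    define r where "r = max \<bar>a\<bar> \<bar>b\<bar>"
    have r: "-r \<le> a" "b \<le> r" "a \<in> {-r..r}" using ab by (auto simp: r_def)
    obtain N where N: "\<And>m n. m \<ge> N \<Longrightarrow> n \<ge> N \<Longrightarrow> (LINT t:{-r..r}|lebesgue. (speed (\<lambda>t. y n t - y m t) t)\<^sup>2) < e"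
      using Cau[OF e, of r] r(3) by blast
    have le: "(LINT t:{c..d}|lebesgue. (speed (\<lambda>t. y k t - y n t) t)\<^sup>2) \<le> e"
      if "n \<ge> N" "k \<ge> N" "a \<le> c" "c \<le> d" "d \<le> b" for k n c d
      using square_integral_mono_interval[OF AC, of "-r" c d r k n] N[OF that(1,2)] r that by simp
    have lim: "(\<lambda>k. y k t - y n t) \<longlonglongrightarrow> x t - y n t" for n t by (intro tendsto_intros x)
    show ?thesis
    proof (intro exI allI impI conjI)
      fix n assume n: "n \<ge> N"
      show "dyadic_energy (\<lambda>t. x t - y n t) a b m \<le> e" for m
      proof (rule LIMSEQ_le_const2[OF dyadic_energy_tendsto[OF lim]], intro exI allI impI)
        fix k assume "k \<ge> N"
        then show "dyadic_energy (\<lambda>t. y k t - y n t) a b m \<le> e"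
          using dyadic_energy_le_speed[OF AC ab, of k n m] le[OF n, of k a b] ab by simp
      qed
      show "continuous_on {a..b} (\<lambda>t. x t - y n t)"
      proof (rule continuous_on_Holder)
        fix s t assume st: "s \<in> {a..b}" "t \<in> {a..b}" "s < t"
        show "(norm ((x t - y n t) - (x s - y n s)))\<^sup>2 \<le> (t - s) * e"
        proof (rule LIMSEQ_le_const2)
          show "(\<lambda>k. (norm ((y k t - y n t) - (y k s - y n s)))\<^sup>2) \<longlonglongrightarrow> (norm ((x t - y n t) - (x s - y n s)))\<^sup>2"
            by (intro tendsto_intros lim)
          have "(norm ((y k t - y n t) - (y k s - y n s)))\<^sup>2 \<le> (t - s) * e" if "k \<ge> N" for k
            by (rule order_trans[OF AC2_loc_norm_diff_sq_le[OF AC] mult_left_mono[OF le[OF n that]]]) (use st in auto)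
          then show "\<exists>N. \<forall>k\<ge>N. (norm ((y k t - y n t) - (y k s - y n s)))\<^sup>2 \<le> (t - s) * e" by blast
        qed
      qed
    qed
  qed
  have "finite_energy x"
    unfolding finite_energy_def
  proof (intro conjI allI impI)
    have "continuous_on {-r<..<r} x" for r :: real
    proof (cases "-r < r")
      case True
      then obtain n where "continuous_on {-r..r} (\<lambda>t. x t - y n t)" using close[of 1 "-r" r] by auto
      moreover have "continuous_on {-r..r} (y n)" using AC2_loc_continuous[OF ACy] continuous_on_subset by blast
      ultimately have "continuous_on {-r..r} (\<lambda>t. (x t - y n t) + y n t)" by (rule continuous_on_add)
      then have "continuous_on {-r..r} x" by simp
      then show ?thesis by (rule continuous_on_subset) auto
    qed simp
    then have "continuous_on (\<Union>r. {-r<..<r::real}) x"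
      by (intro continuous_on_open_UN) auto
    moreover have "t \<in> (\<Union>r. {-r<..<r})" for t :: real
      by (auto intro!: exI[of _ "\<bar>t\<bar> + 1"])
    then have "(\<Union>r. {-r<..<r::real}) = UNIV" by blast
    ultimately show "continuous_on UNIV x" by simp
    fix a b :: real assume ab: "a < b"
    obtain n where n: "\<And>m. dyadic_energy (\<lambda>t. x t - y n t) a b m \<le> 1" using close[OF _ ab, of 1] by auto
    obtain \<rho> where \<rho>: "\<And>m. dyadic_energy (y n) a b m \<le> \<rho>"
      using AC2_loc_finite_energy[OF ACy] ab unfolding finite_energy_def by blast
    have "dyadic_energy x a b m \<le> 2 * 1 + 2 * \<rho>" for m
      using dyadic_energy_add_le[OF ab, of "\<lambda>t. x t - y n t" "y n" m] n[of m] \<rho>[of m] by simp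
    then show "\<exists>\<rho>. \<forall>m. dyadic_energy x a b m \<le> \<rho>" by blast
  qed
  then have ACx: "AC2_loc x" by (simp add: AC2_loc_iff_finite_energy)
  have ACr: "AC2_loc (\<lambda>t. x t - y n t)" for n by (intro AC2_loc_diff ACx ACy)
  have le: "action F x a b + U (x b) \<le> U (x a)" if ab: "a < b" for a b
  proof -
    let ?v = "\<lambda>n t. indicator {a..b} t *\<^sub>R (speed (\<lambda>t. x t - y n t) t)\<^sup>2"
    have "(\<lambda>n. LINT t|lebesgue. norm (?v n t)) \<longlonglongrightarrow> 0"
    proof (rule LIMSEQ_I)
      fix e :: real assume e: "0 < e"
      then obtain N where N: "\<And>n m. n \<ge> N \<Longrightarrow> dyadic_energy (\<lambda>t. x t - y n t) a b m \<le> e / 2"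
        using close[OF _ ab, of "e/2"] by auto
      have le: "(LINT t|lebesgue. norm (?v n t)) \<le> e / 2" if "n \<ge> N" for n
        using finite_energy_speed(2)[OF AC2_loc_finite_energy[OF ACr] ab N[OF that]]
        by (simp add: set_lebesgue_integral_def)
      have nn: "0 \<le> (LINT t|lebesgue. norm (?v n t))" for n by (intro integral_nonneg_AE) auto
      have "norm ((LINT t|lebesgue. norm (?v n t)) - 0) < e" if "n \<ge> N" for n
        using le[OF that] nn[of n] e unfolding diff_zero real_norm_def by linarith
      then show "\<exists>N. \<forall>n\<ge>N. norm ((LINT t|lebesgue. norm (?v n t)) - 0) < e" by blast
    qed
    moreover have "integrable lebesgue (?v n)" for n
      using H1_integrable(2)[OF ACr, of a b n] by (simp add: set_integrable_def)
    ultimately obtain r where r: "strict_mono r" "AE t in lebesgue. (\<lambda>n. ?v (r n) t) \<longlonglongrightarrow> 0"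
      using tendsto_L1_AE_subseq[of lebesgue ?v] by blast
    have diff: "AE t in lebesgue. \<forall>n. vector_derivative (\<lambda>t. x t - y n t) (at t) = vector_derivative x (at t) - vector_derivative (y n) (at t)"
      unfolding AE_all_countable using AE_vector_derivative_combination[OF ACx ACy, of "-1"] by simp
    have yr: "(\<lambda>n. y (r n) t) \<longlonglongrightarrow> x t" for t
      using LIMSEQ_subseq_LIMSEQ[OF x r(1)] by (simp add: o_def)
    let ?u = "\<lambda>z t. indicator {a..b} t *\<^sub>R (lag z t + C0)"
    have lim: "AE t in lebesgue. (\<lambda>n. ?u (y (r n)) t) \<longlonglongrightarrow> ?u x t"
      using r(2) diff
    proof eventually_elim
      case (elim t)
      show ?case
      proof (cases "t \<in> {a..b}")
        case True
        then have "(\<lambda>n. (speed (\<lambda>t. x t - y (r n) t) t)\<^sup>2) \<longlonglongrightarrow> 0" using elim(1) by simp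
        then have "(\<lambda>n. sqrt ((speed (\<lambda>t. x t - y (r n) t) t)\<^sup>2)) \<longlonglongrightarrow> sqrt 0" by (intro tendsto_real_sqrt)
        then have "(\<lambda>n. vector_derivative x (at t) - vector_derivative (y (r n)) (at t)) \<longlonglongrightarrow> 0"
          using elim(2) by (simp add: speed_def tendsto_norm_zero_iff)
        from tendsto_diff[OF tendsto_const this, of "vector_derivative x (at t)"]
        have "(\<lambda>n. vector_derivative (y (r n)) (at t)) \<longlonglongrightarrow> vector_derivative x (at t)" by simp
        then have "(\<lambda>n. (y (r n) t, vector_derivative (y (r n)) (at t))) \<longlonglongrightarrow> (x t, vector_derivative x (at t))"
          by (intro tendsto_Pair yr)
        from continuous_on_tendsto_compose[OF cont this] show ?thesis
          by (auto simp: lag_def intro!: tendsto_intros)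
      qed simp
    qed
    have ui: "set_integrable lebesgue {a..b} (\<lambda>t. lag z t + C0)" if "AC2_loc z" for z :: "real \<Rightarrow> 'a"
      by (intro set_integral_add(1) set_integrable_Icc_const lag_integrable that)
    have uI: "(LINT t|lebesgue. ?u z t) = action F z a b + C0 * (b - a)" if "AC2_loc z" for z :: "real \<Rightarrow> 'a"
      using set_integral_add(2)[OF lag_integrable[OF that] set_integrable_Icc_const, of a b C0] ab
      by (simp add: set_integral_Icc_const action_lag) (simp add: set_lebesgue_integral_def)
    have u0: "AE t in lebesgue. 0 \<le> ?u z t" for z :: "real \<Rightarrow> 'a"
      using lag_nonneg[of z] by (intro AE_I2) simp
    have "action F x a b + C0 * (b - a) \<le> (U (x a) - U (x b) + C0 * (b - a)) + e" if e: "0 < e" for e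
    proof -
      have Ulim: "(\<lambda>n. U (y (r n) t)) \<longlonglongrightarrow> U (x t)" for t
        by (rule continuous_on_tendsto_compose[OF contU yr]) auto
      have "(\<lambda>n. U (y (r n) a) - U (y (r n) b) + \<eta> (r n)) \<longlonglongrightarrow> U (x a) - U (x b) + 0"
        using LIMSEQ_subseq_LIMSEQ[OF \<eta> r(1)] by (intro tendsto_intros Ulim) (simp add: o_def)
      then have "eventually (\<lambda>n. U (y (r n) a) - U (y (r n) b) + \<eta> (r n) < U (x a) - U (x b) + e) sequentially"
        using e by (intro order_tendstoD(2)) auto
      then obtain N1 where N1: "\<And>n. n \<ge> N1 \<Longrightarrow> U (y (r n) a) - U (y (r n) b) + \<eta> (r n) < U (x a) - U (x b) + e"
        by (auto simp: eventually_sequentially)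
      obtain N2 :: nat where N2: "max \<bar>a\<bar> \<bar>b\<bar> \<le> real N2" using real_arch_simple by blast
      define N where "N = max N1 N2"
      have "(LINT t|lebesgue. ?u (y (r (n + N))) t) \<le> (U (x a) - U (x b) + C0 * (b - a)) + e" for n
      proof -
        have "real N2 \<le> real (r (n + N))" using seq_suble[OF r(1), of "n + N"] by (simp add: N_def)
        then have "almost_calibrated (y (r (n + N))) a b (\<eta> (r (n + N)))"
          using N2 ab by (intro almost_calibrated_subinterval[OF y]) auto
        then show ?thesis
          using N1[of "n + N"] unfolding uI[OF ACy] almost_calibrated_def by (simp add: N_def max.coboundedI1 trans_le_add2)
      qed
      note le = this
      have lim': "AE t in lebesgue. (\<lambda>n. ?u (y (r (n + N))) t) \<longlonglongrightarrow> ?u x t"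
        using lim by eventually_elim (rule LIMSEQ_ignore_initial_segment)
      have "(LINT t|lebesgue. ?u x t) \<le> (U (x a) - U (x b) + C0 * (b - a)) + e"
        by (rule Fatou_integral(2)[where u="\<lambda>n. ?u (y (r (n + N)))", OF ui[OF ACy, unfolded set_integrable_def] u0 le
          borel_measurable_integrable[OF ui[OF ACx, unfolded set_integrable_def]] lim'])
      then show ?thesis unfolding uI[OF ACx] .
    qed
    then have "action F x a b + C0 * (b - a) \<le> U (x a) - U (x b) + C0 * (b - a)" by (rule field_le_epsilon)
    then show ?thesis by simp
  qed
  have zero: "action F x a a = 0" for a unfolding action_def by (rule set_Icc_degenerate) simp
  have "U (x a) = action F x a b + U (x b)" if "a \<le> b" for a b
  proof (cases "a = b")
    case False
    with that le[of a b] dom[OF ACx that] show ?thesis by simp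
  qed (simp add: zero)
  with ACx show ?thesis by blast
qed

end

section \<open>The discounted value function\<close>

text \<open>
  With an integrable \<open>g\<close> that dominates the negative part of \<open>f\<close>, the extended integral becomes
  that of a nonnegative function up to a real constant.
\<close>

lemma ereal_integral_shift:
  fixes f g :: "'a \<Rightarrow> real"
  assumes f: "f \<in> borel_measurable M" and g: "integrable M g" "\<And>t. t \<in> space M \<Longrightarrow> 0 \<le> g t"
    "\<And>t. t \<in> space M \<Longrightarrow> 0 \<le> f t + g t"
  shows "ereal_integral M f = enn2ereal (\<integral>\<^sup>+t. ennreal (f t + g t) \<partial>M) - ereal (integral\<^sup>L M g)"
proof -
  let ?p = "\<integral>\<^sup>+t. ennreal (f t) \<partial>M" and ?n = "\<integral>\<^sup>+t. ennreal (- f t) \<partial>M" and ?s = "\<integral>\<^sup>+t. ennreal (f t + g t) \<partial>M"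
  have gm: "g \<in> borel_measurable M" using g(1) by auto
  have G: "(\<integral>\<^sup>+t. ennreal (g t) \<partial>M) = ennreal (integral\<^sup>L M g)"
    using g by (intro nn_integral_eq_integral) auto
  have g0: "0 \<le> integral\<^sup>L M g" using g by (intro integral_nonneg_AE) auto
  have "?p + ennreal (integral\<^sup>L M g) = (\<integral>\<^sup>+t. ennreal (f t) + ennreal (g t) \<partial>M)"
    unfolding G[symmetric] using f gm by (intro nn_integral_add[symmetric]) auto
  also have "\<dots> = (\<integral>\<^sup>+t. ennreal (f t + g t) + ennreal (- f t) \<partial>M)"
  proof (rule nn_integral_cong)
    fix t assume t: "t \<in> space M"
    show "ennreal (f t) + ennreal (g t) = ennreal (f t + g t) + ennreal (- f t)"
      using g(2,3)[OF t] by (cases "0 \<le> f t") (simp_all add: ennreal_neg flip: ennreal_plus)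
  qed
  also have "\<dots> = ?s + ?n" using f gm by (intro nn_integral_add) auto
  finally have eq: "?p + ennreal (integral\<^sup>L M g) = ?s + ?n" .
  have "?n \<le> (\<integral>\<^sup>+t. ennreal (g t) \<partial>M)"
  proof (rule nn_integral_mono)
    fix t assume "t \<in> space M"
    from g(3)[OF this] show "ennreal (- f t) \<le> ennreal (g t)" by (intro ennreal_leI) simp
  qed
  then have "?n < \<infinity>" unfolding G by (simp add: order_le_less_trans)
  then obtain n where n: "?n = ennreal n" "0 \<le> n" by (cases ?n) auto
  show ?thesis
  proof (cases "?p = \<infinity>")
    case True
    with eq have "?s + ?n = \<infinity>" by simp
    with n have "?s = \<infinity>" by (simp add: ennreal_add_eq_top)
    with True show ?thesis by (simp add: ereal_integral_def n enn2ereal_ennreal)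
  next
    case False
    then obtain p where p: "?p = ennreal p" "0 \<le> p" by (cases ?p) auto
    have "?s \<noteq> \<infinity>"
    proof
      assume "?s = \<infinity>"
      with eq have "?p + ennreal (integral\<^sup>L M g) = \<infinity>" by simp
      with p show False by (simp add: ennreal_add_eq_top)
    qed
    then obtain s where s: "?s = ennreal s" "0 \<le> s" by (cases ?s) auto
    have "p + integral\<^sup>L M g = s + n"
      using eq g0 unfolding p(1) s(1) n(1) using p(2) s(2) n(2) by (simp flip: ennreal_plus)
    then show ?thesis by (simp add: ereal_integral_def n p s enn2ereal_ennreal)
  qed
qed

lemma has_bochner_integral_exp:
  fixes \<epsilon> c :: real
  assumes "0 < \<epsilon>"
  shows "has_bochner_integral (lebesgue_on {0<..}) (\<lambda>t. exp (- \<epsilon> * t) * c) (c / \<epsilon>)"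
proof -
  have "((\<lambda>t::real. exp (- \<epsilon> * t)) has_integral exp (- \<epsilon> * 0) / \<epsilon>) {0..}"
    using assms by (rule has_integral_exp_minus_to_infinity)
  then have hi: "((\<lambda>t::real. exp (- \<epsilon> * t)) has_integral (1 / \<epsilon>)) {0<..}"
    by (subst has_integral_spike_set_eq[of "{0<..}" "{0..}"]) (auto intro: negligible_subset[of "{0}"])
  then have ab: "(\<lambda>t::real. exp (- \<epsilon> * t)) absolutely_integrable_on {0<..}"
    by (intro nonnegative_absolutely_integrable_1) (auto simp: integrable_on_def)
  then have "has_bochner_integral (lebesgue_on {0<..}) (\<lambda>t. exp (- \<epsilon> * t)) (1 / \<epsilon>)"
    using has_integral_unique[OF has_integral_set_lebesgue[OF ab] hi]
    by (simp add: has_bochner_integral_iff set_integrable_def set_lebesgue_integral_def integrable_restrict_space integral_restrict_space)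
  then have "has_bochner_integral (lebesgue_on {0<..}) (\<lambda>t. exp (- \<epsilon> * t) * c) (1 / \<epsilon> * c)"
    by (rule has_bochner_integral_mult_left)
  then show ?thesis by simp
qed

text \<open>
  Extended by its initial value, a curve on the half line becomes a curve on the whole line.
\<close>

lemma AC2_loc_pos_extension:
  fixes x :: "real \<Rightarrow> 'a::{real_inner,complete_space}"
  assumes x: "AC2_loc_pos x" and lim: "(x \<longlongrightarrow> M) (at_right 0)"
  shows "AC2_loc (\<lambda>t. if t \<le> 0 then M else x t)"
  unfolding AC2_loc_def
proof (intro allI impI)
  fix a b :: real assume ab: "a < b"
  define b' where "b' = \<bar>b\<bar> + 1"
  obtain \<beta> where \<beta>: "set_borel_measurable lebesgue {0<..<b'} \<beta>"
      "set_integrable lebesgue {0<..<b'} (\<lambda>u. (\<beta> u)\<^sup>2)"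
      "\<And>s t. 0 < s \<Longrightarrow> s < t \<Longrightarrow> t < b' \<Longrightarrow> norm (x t - x s) \<le> (LINT u:{s..t}|lebesgue. \<beta> u)"
    using x unfolding AC2_loc_pos_def AC2_def by (metis b'_def abs_ge_zero add_nonneg_pos zero_less_one)
  define f where "f t = indicator {0<..<b'} t *\<^sub>R \<bar>\<beta> t\<bar>" for t
  have f2: "(\<lambda>t. (f t)\<^sup>2) = (\<lambda>t. indicator {0<..<b'} t *\<^sub>R (\<beta> t)\<^sup>2)"
    by (auto simp: f_def fun_eq_iff indicator_def)
  have fL: "loc_L2 f"
    unfolding loc_L2_def
  proof (intro conjI allI)
    have "(\<lambda>t. indicator {0<..<b'} t *\<^sub>R \<beta> t) \<in> borel_measurable lebesgue"
      using \<beta>(1) by (simp add: set_borel_measurable_def)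
    then have "(\<lambda>t. \<bar>indicator {0<..<b'} t *\<^sub>R \<beta> t\<bar>) \<in> borel_measurable lebesgue" by (rule borel_measurable_abs)
    then show "f \<in> borel_measurable lebesgue" by (simp add: f_def[abs_def] abs_mult)
    show "set_integrable lebesgue {c..d} (\<lambda>t. (f t)\<^sup>2)" for c d
      unfolding f2 set_integrable_def
      by (rule integrable_mult_indicator) (use \<beta>(2) in \<open>auto simp: set_integrable_def\<close>)
  qed
  note fi = loc_L2_integrable[OF fL]
  have mono: "(LINT u:{c..d}|lebesgue. f u) \<le> (LINT u:{s..t}|lebesgue. f u)" if "s \<le> c" "c \<le> d" "d \<le> t" for c d s t
  proof -
    have "0 \<le> (LINT u:{c..d}|lebesgue. f u)" for c d
      unfolding set_lebesgue_integral_def by (intro integral_nonneg_AE) (auto simp: f_def)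
    from this[of s c] this[of d t] show ?thesis
      using set_integral_Icc_combine[of s c t, OF _ _ fi] set_integral_Icc_combine[of c d t, OF _ _ fi] that by simp
  qed
  have inner: "norm (x t - x s) \<le> (LINT u:{s..t}|lebesgue. f u)" if "0 < s" "s < t" "t < b'" for s t
  proof -
    have "set_borel_measurable lebesgue {0<..<b'} \<beta>" by fact
    have "(LINT u:{s..t}|lebesgue. \<beta> u) \<le> (LINT u:{s..t}|lebesgue. f u)"
    proof (rule set_integral_Icc_mono[OF _ fi])
      define g where "g t = indicator {0<..<b'} t *\<^sub>R \<beta> t" for t
      have gm: "g \<in> borel_measurable lebesgue" using \<beta>(1) by (simp add: set_borel_measurable_def g_def[abs_def])
      have "set_integrable lebesgue {s..t} g"
        by (rule set_integrable_Icc_bound[OF gm fi[of s t]]) (auto simp: g_def f_def indicator_def)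
      then show "set_integrable lebesgue {s..t} \<beta>"
        by (rule set_integrable_cong[THEN iffD1, rotated -1]) (use that in \<open>auto simp: g_def\<close>)
    qed (use that in \<open>auto simp: f_def\<close>)
    then show ?thesis using \<beta>(3)[OF that] by linarith
  qed
  have from0: "norm (x t - M) \<le> (LINT u:{0..t}|lebesgue. f u)" if "0 < t" "t < b'" for t
  proof (rule tendsto_upperbound)
    show "((\<lambda>s. norm (x t - x s)) \<longlongrightarrow> norm (x t - M)) (at_right 0)" by (intro tendsto_intros lim)
    have "norm (x t - x s) \<le> (LINT u:{0..t}|lebesgue. f u)" if "0 < s" "s < t" for s
      using inner[OF that \<open>t < b'\<close>] mono[of 0 s t t] that by simp
    then show "\<forall>\<^sub>F s in at_right 0. norm (x t - x s) \<le> (LINT u:{0..t}|lebesgue. f u)"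
      using that(1) by (auto simp: eventually_at_right_field)
  qed simp
  have all: "norm ((if t \<le> 0 then M else x t) - (if s \<le> 0 then M else x s)) \<le> (LINT u:{s..t}|lebesgue. f u)"
    if "s < t" "t < b" for s t
  proof -
    have t: "t < b'" using that by (simp add: b'_def)
    have nn: "0 \<le> (LINT u:{s..t}|lebesgue. f u)"
      unfolding set_lebesgue_integral_def by (intro integral_nonneg_AE) (auto simp: f_def)
    consider "t \<le> 0" | "s \<le> 0" "0 < t" | "0 < s" by linarith
    then show ?thesis
    proof cases
      case 2
      then show ?thesis using from0[of t] mono[of s 0 t t] t by simp
    qed (use nn that inner[of s t] t in auto)
  qed
  show "AC2 a b (\<lambda>t. if t \<le> 0 then M else x t)"
    unfolding AC2_def
  proof (intro exI conjI allI impI)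
    show "set_borel_measurable lebesgue {a<..<b} f"
      using fL unfolding loc_L2_def set_borel_measurable_def
      by (intro borel_measurable_scaleR borel_measurable_indicator) auto
    show "set_integrable lebesgue {a<..<b} (\<lambda>u. (f u)\<^sup>2)"
      using fL unfolding loc_L2_def by (meson set_integrable_subset greaterThanLessThan_subseteq_atLeastAtMost_iff order_refl lmeasurable_interval(2) fmeasurableD)
  qed (use all in auto)
qed

text \<open>
  The bound at zero velocity makes the discounted cost of constant curves finite.
\<close>

locale discounted = tonelli +
  fixes C2 :: real
  assumes zero_velocity: "F M 0 \<le> C2"
begin

text \<open>
  The constant \<open>C0\<close> makes the integrand nonnegative; it changes the discounted cost by \<open>C0 / \<epsilon>\<close>.
\<close>

definition discounted_cost :: "real \<Rightarrow> (real \<Rightarrow> 'a) \<Rightarrow> ennreal"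
  where "discounted_cost \<epsilon> x = (\<integral>\<^sup>+t. ennreal (exp (- \<epsilon> * t) * (lag x t + C0)) \<partial>lebesgue_on {0<..})"

definition discounted_cost_upto :: "real \<Rightarrow> (real \<Rightarrow> 'a) \<Rightarrow> real \<Rightarrow> real"
  where "discounted_cost_upto \<epsilon> x T = (LINT t:{0..T}|lebesgue. exp (- \<epsilon> * t) * (lag x t + C0))"

lemma lag_local:
  assumes "\<And>t. a < t \<Longrightarrow> t < b \<Longrightarrow> x t = y t" "a < t" "t < b"
  shows "lag x t = lag y t"
  using assms vector_derivative_Ioo[of a b x y t] by (simp add: lag_def)

lemma discounted_cost_cong:
  assumes "\<And>t. 0 < t \<Longrightarrow> x t = y t" shows "discounted_cost \<epsilon> x = discounted_cost \<epsilon> y"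
  unfolding discounted_cost_def
proof (rule nn_integral_cong)
  fix t :: real assume "t \<in> space (lebesgue_on {0<..})"
  then have "0 < t" by simp
  then have "lag x t = lag y t" using assms by (intro lag_local[of 0 "t + 1"]) auto
  then show "ennreal (exp (- \<epsilon> * t) * (lag x t + C0)) = ennreal (exp (- \<epsilon> * t) * (lag y t + C0))" by simp
qed

lemma ereal_integral_discounted_cost:
  assumes x: "AC2_loc x" and \<epsilon>: "0 < \<epsilon>"
  shows "ereal_integral (lebesgue_on {0<..}) (\<lambda>t. exp (- \<epsilon> * t) * lag x t) = enn2ereal (discounted_cost \<epsilon> x) - ereal (C0 / \<epsilon>)"
proof -
  note e = has_bochner_integral_exp[OF \<epsilon>, of C0]
  have "(\<lambda>t. exp (- \<epsilon> * t)) \<in> borel_measurable lebesgue"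
    by (intro measurable_completion) simp
  then have "(\<lambda>t. exp (- \<epsilon> * t) * lag x t) \<in> borel_measurable lebesgue"
    by (intro borel_measurable_times lag_measurable x)
  then have m: "(\<lambda>t. exp (- \<epsilon> * t) * lag x t) \<in> borel_measurable (lebesgue_on {0<..})"
    by (rule measurable_restrict_space1)
  have nn: "0 \<le> exp (- \<epsilon> * t) * lag x t + exp (- \<epsilon> * t) * C0" for t
    using lag_nonneg[of x t] by (simp flip: distrib_left)
  have "ereal_integral (lebesgue_on {0<..}) (\<lambda>t. exp (- \<epsilon> * t) * lag x t)
    = enn2ereal (\<integral>\<^sup>+t. ennreal (exp (- \<epsilon> * t) * lag x t + exp (- \<epsilon> * t) * C0) \<partial>lebesgue_on {0<..})
      - ereal (integral\<^sup>L (lebesgue_on {0<..}) (\<lambda>t. exp (- \<epsilon> * t) * C0))"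
    using e pos by (intro ereal_integral_shift[OF m]) (auto simp: has_bochner_integral_iff nn[simplified])
  then show ?thesis using e by (simp add: discounted_cost_def has_bochner_integral_iff distrib_left)
qed

lemma discounted_cost_upto_integrable: "AC2_loc x \<Longrightarrow> 0 \<le> \<epsilon> \<Longrightarrow> 0 \<le> T \<Longrightarrow> set_integrable lebesgue {0..T} (\<lambda>t. exp (- \<epsilon> * t) * (lag x t + C0))"
proof (rule set_integrable_Icc_bound)
  assume x: "AC2_loc x" and \<epsilon>: "0 \<le> \<epsilon>"
  show "set_integrable lebesgue {0..T} (\<lambda>t. lag x t + C0)"
    by (intro set_integral_add(1) set_integrable_Icc_const lag_integrable x)
  have "(\<lambda>t. exp (- \<epsilon> * t)) \<in> borel_measurable lebesgue"
    by (intro measurable_completion) simp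
  then show "(\<lambda>t. exp (- \<epsilon> * t) * (lag x t + C0)) \<in> borel_measurable lebesgue"
    using lag_measurable[OF x] by (intro borel_measurable_times borel_measurable_add) auto
  show "AE t in lebesgue. t \<in> {0..T} \<longrightarrow> \<bar>exp (- \<epsilon> * t) * (lag x t + C0)\<bar> \<le> lag x t + C0"
  proof (intro AE_I2 impI)
    fix t assume t: "t \<in> {0..T}"
    have "exp (- \<epsilon> * t) * (lag x t + C0) \<le> 1 * (lag x t + C0)"
      using t \<epsilon> lag_nonneg[of x t] by (intro mult_right_mono) auto
    then show "\<bar>exp (- \<epsilon> * t) * (lag x t + C0)\<bar> \<le> lag x t + C0"
      using lag_nonneg[of x t] by (simp add: abs_mult)
  qed
qed

lemma integral_lag_C0:
  assumes "AC2_loc x" "0 \<le> T"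
  shows "(LINT t:{0..T}|lebesgue. lag x t + C0) = action F x 0 T + C0 * T"
  using set_integral_add(2)[OF lag_integrable[OF assms(1)] set_integrable_Icc_const, of 0 T C0] assms(2)
  by (simp add: set_integral_Icc_const action_lag)

lemma discounted_cost_upto_upper:
  assumes x: "AC2_loc x" and "0 \<le> \<epsilon>" "0 \<le> T"
  shows "discounted_cost_upto \<epsilon> x T \<le> action F x 0 T + C0 * T"
  unfolding integral_lag_C0[OF x assms(3), symmetric] discounted_cost_upto_def
proof (rule set_integral_Icc_mono[OF discounted_cost_upto_integrable[OF assms]])
  show "set_integrable lebesgue {0..T} (\<lambda>t. lag x t + C0)"
    by (intro set_integral_add(1) set_integrable_Icc_const lag_integrable x)
  have "exp (- \<epsilon> * t) * (lag x t + C0) \<le> 1 * (lag x t + C0)" if "0 \<le> t" for t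
    using that assms(2) lag_nonneg[of x t] by (intro mult_right_mono) auto
  then show "AE t in lebesgue. 0 \<le> t \<longrightarrow> t \<le> T \<longrightarrow> exp (- \<epsilon> * t) * (lag x t + C0) \<le> lag x t + C0"
    by simp
qed

lemma discounted_cost_upto_lower:
  assumes x: "AC2_loc x" and "0 \<le> \<epsilon>" "0 \<le> T"
  shows "exp (- \<epsilon> * T) * (action F x 0 T + C0 * T) \<le> discounted_cost_upto \<epsilon> x T"
proof -
  have i: "set_integrable lebesgue {0..T} (\<lambda>t. lag x t + C0)"
    by (intro set_integral_add(1) set_integrable_Icc_const lag_integrable x)
  have "(LINT t:{0..T}|lebesgue. exp (- \<epsilon> * T) * (lag x t + C0)) \<le> discounted_cost_upto \<epsilon> x T"
    unfolding discounted_cost_upto_def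
  proof (rule set_integral_Icc_mono[OF set_integrable_mult_right[OF i] discounted_cost_upto_integrable[OF assms]])
    have "exp (- \<epsilon> * T) * (lag x t + C0) \<le> exp (- \<epsilon> * t) * (lag x t + C0)" if "t \<le> T" for t
      using that assms(2) lag_nonneg[of x t] by (intro mult_right_mono) (auto intro: mult_left_mono)
    then show "AE t in lebesgue. 0 \<le> t \<longrightarrow> t \<le> T \<longrightarrow> exp (- \<epsilon> * T) * (lag x t + C0) \<le> exp (- \<epsilon> * t) * (lag x t + C0)"
      by simp
  qed
  then show ?thesis by (simp only: set_integral_mult_right integral_lag_C0[OF x assms(3)])
qed

lemma discounted_cost_upto_nonneg: "0 \<le> discounted_cost_upto \<epsilon> x T"
  unfolding discounted_cost_upto_def set_lebesgue_integral_def using lag_nonneg by (intro integral_nonneg_AE) auto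

lemma discounted_cost_split:
  assumes x: "AC2_loc x" and \<epsilon>: "0 \<le> \<epsilon>" and T: "0 \<le> T"
  shows "discounted_cost \<epsilon> x = ennreal (discounted_cost_upto \<epsilon> x T) + ennreal (exp (- \<epsilon> * T)) * discounted_cost \<epsilon> (\<lambda>t. x (T + t))"
proof -
  let ?f = "\<lambda>x t. ennreal (exp (- \<epsilon> * t) * (lag x t + C0))"
  have em: "(\<lambda>t. exp (- \<epsilon> * t)) \<in> borel_measurable lebesgue"
    by (intro measurable_completion) simp
  have fm: "?f y \<in> borel_measurable lebesgue" if "AC2_loc y" for y
    using em lag_measurable[OF that] by (intro measurable_compose[OF _ measurable_ennreal] borel_measurable_times borel_measurable_add) auto
  have d: "discounted_cost \<epsilon> y = (\<integral>\<^sup>+t. ?f y t * indicator {0<..} t \<partial>lebesgue)" for y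
    unfolding discounted_cost_def by (simp add: nn_integral_restrict_space)
  have "discounted_cost \<epsilon> x = (\<integral>\<^sup>+t. ?f x t * indicator {0<..T} t + ?f x t * indicator {T<..} t \<partial>lebesgue)"
    unfolding d using T by (intro nn_integral_cong) (auto simp: indicator_def)
  also have "\<dots> = (\<integral>\<^sup>+t. ?f x t * indicator {0<..T} t \<partial>lebesgue) + (\<integral>\<^sup>+t. ?f x t * indicator {T<..} t \<partial>lebesgue)"
    by (intro nn_integral_add borel_measurable_times_ennreal borel_measurable_indicator fm[OF x]) auto
  also have "(\<integral>\<^sup>+t. ?f x t * indicator {0<..T} t \<partial>lebesgue) = (\<integral>\<^sup>+t. ennreal (indicator {0..T} t *\<^sub>R (exp (- \<epsilon> * t) * (lag x t + C0))) \<partial>lebesgue)"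
    using AE_lebesgue_neq[of 0]
    by (intro nn_integral_cong_AE) (auto elim!: eventually_mono simp: indicator_def)
  also have "\<dots> = ennreal (discounted_cost_upto \<epsilon> x T)"
    unfolding discounted_cost_upto_def set_lebesgue_integral_def
    using discounted_cost_upto_integrable[OF x \<epsilon> T] lag_nonneg by (intro nn_integral_eq_integral) (auto simp: set_integrable_def)
  also have "(\<integral>\<^sup>+t. ?f x t * indicator {T<..} t \<partial>lebesgue) = (\<integral>\<^sup>+t. ?f x (T + t) * indicator {T<..} (T + t) \<partial>lebesgue)"
    using nn_integral_real_affine_lebesgue[OF borel_measurable_times_ennreal[OF fm[OF x] borel_measurable_indicator], of "{T<..}" 1 T]
    by simp
  also have "\<dots> = (\<integral>\<^sup>+t. ennreal (exp (- \<epsilon> * T)) * (?f (\<lambda>t. x (T + t)) t * indicator {0<..} t) \<partial>lebesgue)"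
  proof (rule nn_integral_cong)
    fix t
    have "lag x (T + t) = lag (\<lambda>t. x (T + t)) t" by (simp add: lag_def vector_derivative_shift)
    moreover have "exp (- \<epsilon> * (T + t)) = exp (- \<epsilon> * T) * exp (- \<epsilon> * t)"
      by (simp add: exp_add[symmetric] distrib_left)
    ultimately show "?f x (T + t) * indicator {T<..} (T + t) = ennreal (exp (- \<epsilon> * T)) * (?f (\<lambda>t. x (T + t)) t * indicator {0<..} t)"
      by (simp add: indicator_def ennreal_mult'[symmetric] mult.assoc)
  qed
  also have "\<dots> = ennreal (exp (- \<epsilon> * T)) * discounted_cost \<epsilon> (\<lambda>t. x (T + t))"
    unfolding d
    by (intro nn_integral_cmult borel_measurable_times_ennreal borel_measurable_indicator fm AC2_loc_shift x) auto
  finally show ?thesis .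
qed

lemma discounted_cost_const:
  assumes "0 < \<epsilon>"
  shows "discounted_cost \<epsilon> (\<lambda>_. M) \<le> ennreal ((C2 + C0) / \<epsilon>)"
proof -
  have lag: "lag (\<lambda>_. M) t = F M 0" for t by (simp add: lag_def)
  note e = has_bochner_integral_exp[OF assms, of "F M 0 + C0"]
  have nn: "0 \<le> F M 0 + C0" using lag_nonneg[of "\<lambda>_. M" 0] by (simp add: lag)
  have "discounted_cost \<epsilon> (\<lambda>_. M) = ennreal ((F M 0 + C0) / \<epsilon>)"
    unfolding discounted_cost_def lag using e nn
    by (subst nn_integral_eq_integral) (auto simp: has_bochner_integral_iff)
  also have "\<dots> \<le> ennreal ((C2 + C0) / \<epsilon>)"
    using zero_velocity[of M] assms by (intro ennreal_leI divide_right_mono) auto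
  finally show ?thesis .
qed

text \<open>
  The value function of \<open>F + C0\<close>; the value function of \<open>F\<close> is \<open>W \<epsilon> M - C0 / \<epsilon>\<close>
  (\<open>INF_ereal_integral\<close>).
\<close>

definition W :: "real \<Rightarrow> 'a \<Rightarrow> real"
  where "W \<epsilon> M = enn2real (INF x\<in>{x. AC2_loc x \<and> x 0 = M}. discounted_cost \<epsilon> x)"

lemma W_ennreal:
  assumes "0 < \<epsilon>"
  shows "ennreal (W \<epsilon> M) = (INF x\<in>{x. AC2_loc x \<and> x 0 = M}. discounted_cost \<epsilon> x)"
proof -
  have "(INF x\<in>{x. AC2_loc x \<and> x 0 = M}. discounted_cost \<epsilon> x) \<le> discounted_cost \<epsilon> (\<lambda>_. M)"
    by (rule INF_lower) (simp add: AC2_loc_const)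
  also have "\<dots> < \<infinity>" using discounted_cost_const[OF assms, of M] by (simp add: order_le_less_trans)
  finally show ?thesis by (simp add: W_def)
qed

lemma W_nonneg: "0 \<le> W \<epsilon> M" by (simp add: W_def)

lemma W_le: "0 < \<epsilon> \<Longrightarrow> AC2_loc x \<Longrightarrow> ennreal (W \<epsilon> (x 0)) \<le> discounted_cost \<epsilon> x"
  unfolding W_ennreal by (rule INF_lower) simp

lemma W_near:
  assumes "0 < \<epsilon>" "0 < \<eta>"
  obtains x where "AC2_loc x" "x 0 = M" "discounted_cost \<epsilon> x < ennreal (W \<epsilon> M + \<eta>)"
proof -
  have "(INF x\<in>{x. AC2_loc x \<and> x 0 = M}. discounted_cost \<epsilon> x) < ennreal (W \<epsilon> M + \<eta>)"
    unfolding W_ennreal[OF assms(1), symmetric] using assms(2) W_nonneg by (intro ennreal_lessI) (auto simp: add_nonneg_pos)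
  then show thesis using that by (auto simp: INF_less_iff)
qed

lemma W_bound:
  assumes "0 < \<epsilon>" shows "W \<epsilon> M \<le> (C2 + C0) / \<epsilon>"
proof -
  have "ennreal (W \<epsilon> M) \<le> ennreal ((C2 + C0) / \<epsilon>)"
    using W_le[OF assms AC2_loc_const[of M]] discounted_cost_const[OF assms, of M] by simp
  moreover have "0 \<le> C2 + C0"
    using zero_velocity[of M] lag_nonneg[of "\<lambda>_. M" 0] by (simp add: lag_def)
  ultimately show ?thesis using assms by (simp add: ennreal_le_iff)
qed

text \<open>
  Up to time \<open>T\<close> follow \<open>x\<close>, from then on an almost optimal curve that starts at \<open>x T\<close>.
\<close>

lemma W_dynamic_upper:
  assumes x: "AC2_loc x" and \<epsilon>: "0 < \<epsilon>" and T: "0 \<le> T"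
  shows "W \<epsilon> (x 0) \<le> discounted_cost_upto \<epsilon> x T + exp (- \<epsilon> * T) * W \<epsilon> (x T)"
proof (rule field_le_epsilon)
  fix \<eta> :: real assume \<eta>: "0 < \<eta>"
  obtain z where z: "AC2_loc z" "z 0 = x T" "discounted_cost \<epsilon> z < ennreal (W \<epsilon> (x T) + \<eta>)"
    using W_near[OF \<epsilon> \<eta>] by blast
  define g where "g t = (if t \<le> T then x t else z (- T + t))" for t
  have g: "AC2_loc g" unfolding g_def by (rule AC2_loc_glue[OF x AC2_loc_shift[OF z(1)]]) (simp add: z)
  have "g 0 = x 0" using T by (simp add: g_def)
  then have "ennreal (W \<epsilon> (x 0)) \<le> discounted_cost \<epsilon> g" using W_le[OF \<epsilon> g] by simp
  also have "\<dots> = ennreal (discounted_cost_upto \<epsilon> g T) + ennreal (exp (- \<epsilon> * T)) * discounted_cost \<epsilon> (\<lambda>t. g (T + t))"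
    by (rule discounted_cost_split[OF g less_imp_le[OF \<epsilon>] T])
  also have "discounted_cost \<epsilon> (\<lambda>t. g (T + t)) = discounted_cost \<epsilon> z" by (rule discounted_cost_cong) (simp add: g_def)
  also have "discounted_cost_upto \<epsilon> g T = discounted_cost_upto \<epsilon> x T"
    unfolding discounted_cost_upto_def
  proof -
    have "AE t in lebesgue. 0 \<le> t \<longrightarrow> t \<le> T \<longrightarrow> exp (- \<epsilon> * t) * (lag g t + C0) = exp (- \<epsilon> * t) * (lag x t + C0)"
      by (rule AE_Icc_interior) (use lag_local[of 0 T g x] in \<open>auto simp: g_def\<close>)
    then show "(LINT t:{0..T}|lebesgue. exp (- \<epsilon> * t) * (lag g t + C0)) = (LINT t:{0..T}|lebesgue. exp (- \<epsilon> * t) * (lag x t + C0))"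
      by (intro antisym set_integral_Icc_mono discounted_cost_upto_integrable x g T less_imp_le[OF \<epsilon>]) (auto elim!: eventually_mono)
  qed
  also have "ennreal (discounted_cost_upto \<epsilon> x T) + ennreal (exp (- \<epsilon> * T)) * discounted_cost \<epsilon> z
    \<le> ennreal (discounted_cost_upto \<epsilon> x T) + ennreal (exp (- \<epsilon> * T)) * ennreal (W \<epsilon> (x T) + \<eta>)"
    using z(3) by (intro add_left_mono mult_left_mono) auto
  also have "\<dots> = ennreal (discounted_cost_upto \<epsilon> x T + exp (- \<epsilon> * T) * (W \<epsilon> (x T) + \<eta>))"
  proof -
    have "ennreal (exp (- \<epsilon> * T)) * ennreal (W \<epsilon> (x T) + \<eta>) = ennreal (exp (- \<epsilon> * T) * (W \<epsilon> (x T) + \<eta>))"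
      by (rule ennreal_mult'[symmetric]) simp
    moreover have "0 \<le> exp (- \<epsilon> * T) * (W \<epsilon> (x T) + \<eta>)"
      using \<eta> W_nonneg[of \<epsilon> "x T"] by (intro mult_nonneg_nonneg) auto
    ultimately show ?thesis using discounted_cost_upto_nonneg by (simp only: ennreal_plus)
  qed
  finally have "W \<epsilon> (x 0) \<le> discounted_cost_upto \<epsilon> x T + exp (- \<epsilon> * T) * (W \<epsilon> (x T) + \<eta>)"
    using \<eta> W_nonneg discounted_cost_upto_nonneg by (subst (asm) ennreal_le_iff) (auto intro!: add_nonneg_nonneg mult_nonneg_nonneg)
  moreover have "exp (- \<epsilon> * T) * \<eta> \<le> 1 * \<eta>" using \<epsilon> T \<eta> by (intro mult_right_mono) auto
  ultimately show "W \<epsilon> (x 0) \<le> discounted_cost_upto \<epsilon> x T + exp (- \<epsilon> * T) * W \<epsilon> (x T) + \<eta>"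
    by (simp add: distrib_left)
qed

text \<open>
  From time \<open>T\<close> on, an almost optimal curve is a competitor for the problem that starts at \<open>x T\<close>.
\<close>

lemma W_dynamic_lower:
  assumes \<epsilon>: "0 < \<epsilon>" and T: "0 \<le> T" and \<eta>: "0 < \<eta>"
  obtains x where "AC2_loc x" "x 0 = M" "discounted_cost_upto \<epsilon> x T + exp (- \<epsilon> * T) * W \<epsilon> (x T) \<le> W \<epsilon> M + \<eta>"
proof -
  obtain x where x: "AC2_loc x" "x 0 = M" "discounted_cost \<epsilon> x < ennreal (W \<epsilon> M + \<eta>)"
    using W_near[OF \<epsilon> \<eta>] by blast
  have "ennreal (discounted_cost_upto \<epsilon> x T + exp (- \<epsilon> * T) * W \<epsilon> (x T)) = ennreal (discounted_cost_upto \<epsilon> x T) + ennreal (exp (- \<epsilon> * T)) * ennreal (W \<epsilon> (x T))"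
    using W_nonneg discounted_cost_upto_nonneg by (simp add: ennreal_plus ennreal_mult')
  also have "\<dots> \<le> ennreal (discounted_cost_upto \<epsilon> x T) + ennreal (exp (- \<epsilon> * T)) * discounted_cost \<epsilon> (\<lambda>t. x (T + t))"
    using W_le[OF \<epsilon> AC2_loc_shift[OF x(1), of T]] by (intro add_left_mono mult_left_mono) auto
  also have "\<dots> = discounted_cost \<epsilon> x" by (rule discounted_cost_split[OF x(1) less_imp_le[OF \<epsilon>] T, symmetric])
  also have "\<dots> \<le> ennreal (W \<epsilon> M + \<eta>)" using x(3) by simp
  finally have "discounted_cost_upto \<epsilon> x T + exp (- \<epsilon> * T) * W \<epsilon> (x T) \<le> W \<epsilon> M + \<eta>"
    using \<eta> W_nonneg by (subst (asm) ennreal_le_iff) (auto intro!: add_nonneg_nonneg)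
  with x(1,2) show thesis by (rule that)
qed

lemma INF_ereal_integral:
  assumes \<epsilon>: "0 < \<epsilon>"
  shows "real_of_ereal (INF x \<in> {x. AC2_loc_pos x \<and> (x \<longlongrightarrow> M) (at_right 0)}.
      ereal_integral (lebesgue_on {0<..}) (\<lambda>t. exp (- \<epsilon> * t) * F (x t) (vector_derivative x (at t))))
    = W \<epsilon> M - C0 / \<epsilon>"
proof -
  let ?J = "\<lambda>x. ereal_integral (lebesgue_on {0<..}) (\<lambda>t. exp (- \<epsilon> * t) * F (x t) (vector_derivative x (at t)))"
  have J: "?J x = enn2ereal (discounted_cost \<epsilon> x) - ereal (C0 / \<epsilon>)" if "AC2_loc x" for x
    using ereal_integral_discounted_cost[OF that \<epsilon>] by (simp add: lag_def)
  have lim: "(x \<longlongrightarrow> x 0) (at_right 0)" and AP: "AC2_loc_pos x" if "AC2_loc x" for x :: "real \<Rightarrow> 'a"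
  proof -
    have "isCont x 0" using AC2_loc_continuous[OF that] by (simp add: continuous_on_eq_continuous_at)
    then show "(x \<longlongrightarrow> x 0) (at_right 0)" by (simp add: isCont_def filterlim_at_split)
    show "AC2_loc_pos x" using that by (auto simp: AC2_loc_def AC2_loc_pos_def)
  qed
  have "(INF x \<in> {x. AC2_loc_pos x \<and> (x \<longlongrightarrow> M) (at_right 0)}. ?J x) = ereal (W \<epsilon> M - C0 / \<epsilon>)"
  proof (rule antisym)
    show "(INF x \<in> {x. AC2_loc_pos x \<and> (x \<longlongrightarrow> M) (at_right 0)}. ?J x) \<le> ereal (W \<epsilon> M - C0 / \<epsilon>)"
    proof (rule ereal_le_epsilon2)
      fix \<eta> :: real assume \<eta>: "0 < \<eta>"
      obtain x where x: "AC2_loc x" "x 0 = M" "discounted_cost \<epsilon> x < ennreal (W \<epsilon> M + \<eta>)"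
        using W_near[OF \<epsilon> \<eta>] by blast
      have "(INF x \<in> {x. AC2_loc_pos x \<and> (x \<longlongrightarrow> M) (at_right 0)}. ?J x) \<le> ?J x"
        using AP[OF x(1)] lim[OF x(1)] x(2) by (intro INF_lower) auto
      also have "\<dots> \<le> ereal (W \<epsilon> M + \<eta>) - ereal (C0 / \<epsilon>)"
      proof -
        have "enn2ereal (discounted_cost \<epsilon> x) \<le> enn2ereal (ennreal (W \<epsilon> M + \<eta>))"
          using x(3) by (simp add: less_eq_ennreal.rep_eq[symmetric])
        also have "\<dots> = ereal (W \<epsilon> M + \<eta>)" using \<eta> W_nonneg by (intro enn2ereal_ennreal) (simp add: add_nonneg_nonneg)
        finally show ?thesis unfolding J[OF x(1)] by (intro ereal_minus_mono) auto
      qed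
      finally show "(INF x \<in> {x. AC2_loc_pos x \<and> (x \<longlongrightarrow> M) (at_right 0)}. ?J x) \<le> ereal (W \<epsilon> M - C0 / \<epsilon>) + ereal \<eta>"
        by (simp add: algebra_simps)
    qed
    show "ereal (W \<epsilon> M - C0 / \<epsilon>) \<le> (INF x \<in> {x. AC2_loc_pos x \<and> (x \<longlongrightarrow> M) (at_right 0)}. ?J x)"
    proof (rule INF_greatest)
      fix x assume "x \<in> {x. AC2_loc_pos x \<and> (x \<longlongrightarrow> M) (at_right 0)}"
      then have x: "AC2_loc_pos x" "(x \<longlongrightarrow> M) (at_right 0)" by auto
      define y where "y t = (if t \<le> 0 then M else x t)" for t
      have y: "AC2_loc y" unfolding y_def by (rule AC2_loc_pos_extension[OF x])
      have "?J x = ?J y"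
        unfolding ereal_integral_def
      proof -
        have "F (x t) (vector_derivative x (at t)) = F (y t) (vector_derivative y (at t))" if "0 < t" for t
          using lag_local[of 0 "t + 1" x y t] that by (simp add: lag_def y_def)
        then show "enn2ereal (\<integral>\<^sup>+t. ennreal (exp (- \<epsilon> * t) * F (x t) (vector_derivative x (at t))) \<partial>lebesgue_on {0<..})
          - enn2ereal (\<integral>\<^sup>+t. ennreal (- (exp (- \<epsilon> * t) * F (x t) (vector_derivative x (at t)))) \<partial>lebesgue_on {0<..})
         = enn2ereal (\<integral>\<^sup>+t. ennreal (exp (- \<epsilon> * t) * F (y t) (vector_derivative y (at t))) \<partial>lebesgue_on {0<..})
          - enn2ereal (\<integral>\<^sup>+t. ennreal (- (exp (- \<epsilon> * t) * F (y t) (vector_derivative y (at t)))) \<partial>lebesgue_on {0<..})"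
          by (intro arg_cong2[where f="(-)"] arg_cong[where f=enn2ereal] nn_integral_cong) auto
      qed
      moreover have "ereal (W \<epsilon> M) \<le> enn2ereal (discounted_cost \<epsilon> y)"
      proof -
        have "enn2ereal (ennreal (W \<epsilon> M)) \<le> enn2ereal (discounted_cost \<epsilon> y)"
          using W_le[OF \<epsilon> y] by (simp add: less_eq_ennreal.rep_eq[symmetric] y_def)
        then show ?thesis by (simp add: enn2ereal_ennreal W_nonneg)
      qed
      ultimately show "ereal (W \<epsilon> M - C0 / \<epsilon>) \<le> ?J x"
        unfolding J[OF y] using ereal_minus_mono[of "ereal (W \<epsilon> M)" "enn2ereal (discounted_cost \<epsilon> y)" "ereal (C0 / \<epsilon>)" "ereal (C0 / \<epsilon>)"] by simp
    qed
  qed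
  then show ?thesis by simp
qed

end

section \<open>The vanishing discount limit\<close>

lemma tonelli_add_const:
  assumes "tonelli F D \<gamma> K \<kappa> C0 C1"
  shows "tonelli (\<lambda>M N. F M N + h) D \<gamma> K \<kappa> (C0 + \<bar>h\<bar>) (C1 + \<bar>h\<bar>)"
proof -
  interpret tonelli F D \<gamma> K \<kappa> C0 C1 by fact
  show ?thesis
  proof
    show "0 < \<gamma>" "0 < K" "0 < \<kappa>" "0 \<le> C0 + \<bar>h\<bar>" using pos by auto
    have "continuous_on UNIV (\<lambda>p. (\<lambda>(M, N). F M N) p + h)" by (intro continuous_intros cont)
    then show "continuous_on UNIV (\<lambda>(M, N). F M N + h)" by (simp add: case_prod_beta)
    fix M N H\<^sub>1 H\<^sub>2 H\<^sub>1' H\<^sub>2' :: 'a and c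
    show "D M N (H\<^sub>1 + H\<^sub>1') (H\<^sub>2 + H\<^sub>2') = D M N H\<^sub>1 H\<^sub>2 + D M N H\<^sub>1' H\<^sub>2'" by (rule D_add)
    show "D M N (c *\<^sub>R H\<^sub>1) (c *\<^sub>R H\<^sub>2) = c * D M N H\<^sub>1 H\<^sub>2" by (rule D_scale)
    show "\<gamma> * (norm H\<^sub>2)\<^sup>2 - K * (norm H\<^sub>1)\<^sup>2 \<le> F (M + H\<^sub>1) (N + H\<^sub>2) + h - (F M N + h) - D M N H\<^sub>1 H\<^sub>2"
      using lower[of H\<^sub>2 H\<^sub>1 M N] by simp
    show "F (M + H\<^sub>1) (N + H\<^sub>2) + h - (F M N + h) - D M N H\<^sub>1 H\<^sub>2 \<le> K * ((norm H\<^sub>1)\<^sup>2 + (norm H\<^sub>2)\<^sup>2)"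
      using upper[of M H\<^sub>1 N H\<^sub>2] by simp
    show "\<kappa> * (norm N)\<^sup>2 - (C0 + \<bar>h\<bar>) \<le> F M N + h" using coercive[of N M] by linarith
    have "\<bar>h\<bar> * 1 \<le> \<bar>h\<bar> * (1 + (norm M)\<^sup>2 + (norm N)\<^sup>2)" by (intro mult_left_mono) auto
    then show "F M N + h \<le> (C1 + \<bar>h\<bar>) * (1 + (norm M)\<^sup>2 + (norm N)\<^sup>2)"
      using growth[of M N] unfolding distrib_right[of C1] by linarith
  qed
qed

lemma (in tonelli) action_add_const:
  assumes "AC2_loc x" "a \<le> b"
  shows "action (\<lambda>M N. F M N + h) x a b = action F x a b + h * (b - a)"
  using set_integral_add(2)[OF lag_integrable[OF assms(1)] set_integrable_Icc_const, of a b h] assms(2)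
  by (simp add: set_integral_Icc_const action_def lag_def[abs_def])

text \<open>
  The affine isometry \<open>M \<mapsto> \<phi> M + Z\<close> acts on positions, its linear part \<open>\<phi>\<close> on velocities.
  Both are kept separate so that maps of this form compose explicitly.
\<close>

definition semi_symmetry :: "('a::real_inner \<Rightarrow> 'a \<Rightarrow> real) \<Rightarrow> ('a \<Rightarrow> 'a) \<Rightarrow> 'a \<Rightarrow> bool"
  where "semi_symmetry F \<phi> Z \<longleftrightarrow> linear \<phi> \<and> (\<forall>v. norm (\<phi> v) = norm v) \<and> (\<forall>M N. F (\<phi> M + Z) (\<phi> N) = F M N)"

text \<open>
  The left inverse of the same kind turns inequalities between values of \<open>U\<close> into equalities.
\<close>

definition symmetry :: "('a::real_inner \<Rightarrow> 'a \<Rightarrow> real) \<Rightarrow> ('a \<Rightarrow> 'a) \<Rightarrow> 'a \<Rightarrow> bool"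
  where "symmetry F \<phi> Z \<longleftrightarrow> semi_symmetry F \<phi> Z \<and>
    (\<exists>\<psi> Y. semi_symmetry F \<psi> Y \<and> (\<forall>M. \<psi> (\<phi> M + Z) + Y = M))"

lemma semi_symmetry_compose:
  assumes "semi_symmetry F \<phi> Z" "semi_symmetry F \<phi>' Z'"
  shows "semi_symmetry F (\<phi> \<circ> \<phi>') (\<phi> Z' + Z)"
proof -
  have "\<phi> (\<phi>' M) + (\<phi> Z' + Z) = \<phi> (\<phi>' M + Z') + Z" for M
    using assms by (simp add: semi_symmetry_def linear_add add.assoc)
  then have "F ((\<phi> \<circ> \<phi>') M + (\<phi> Z' + Z)) ((\<phi> \<circ> \<phi>') N) = F M N" for M N
    unfolding o_def using assms by (simp only: semi_symmetry_def)
  then show ?thesis using assms by (simp add: semi_symmetry_def linear_compose)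
qed

lemma symmetry_compose:
  assumes "symmetry F \<phi> Z" "symmetry F \<phi>' Z'"
  shows "symmetry F (\<phi> \<circ> \<phi>') (\<phi> Z' + Z)"
proof -
  obtain \<psi> Y \<psi>' Y' where inv: "semi_symmetry F \<psi> Y" "\<And>M. \<psi> (\<phi> M + Z) + Y = M"
    "semi_symmetry F \<psi>' Y'" "\<And>M. \<psi>' (\<phi>' M + Z') + Y' = M"
    using assms unfolding symmetry_def by metis
  have lin: "linear \<phi>" "linear \<psi>'" using assms inv by (auto simp: symmetry_def semi_symmetry_def)
  have "(\<psi>' \<circ> \<psi>) ((\<phi> \<circ> \<phi>') M + (\<phi> Z' + Z)) + (\<psi>' Y + Y') = M" for M
  proof -
    have e: "(\<phi> \<circ> \<phi>') M + (\<phi> Z' + Z) = \<phi> (\<phi>' M + Z') + Z" by (simp add: linear_add[OF lin(1)] add.assoc)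
    have "(\<psi>' \<circ> \<psi>) X + (\<psi>' Y + Y') = \<psi>' (\<psi> X + Y) + Y'" for X
      by (simp add: linear_add[OF lin(2)] add.assoc)
    then show ?thesis unfolding e by (simp only: inv)
  qed
  then show ?thesis
    using semi_symmetry_compose[of F \<phi> Z \<phi>' Z'] semi_symmetry_compose[OF inv(3,1)] assms
    unfolding symmetry_def by blast
qed

context tonelli
begin

lemma semi_symmetry_curve:
  assumes "semi_symmetry F \<phi> Z" and x: "AC2_loc x"
  shows "AC2_loc (\<lambda>t. \<phi> (x t) + Z)" and "AE t in lebesgue. lag (\<lambda>t. \<phi> (x t) + Z) t = lag x t"
proof -
  have s: "linear \<phi>" "\<And>v. norm (\<phi> v) = norm v" "\<And>M N. F (\<phi> M + Z) (\<phi> N) = F M N"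
    using assms by (auto simp: semi_symmetry_def)
  show "AC2_loc (\<lambda>t. \<phi> (x t) + Z)"
    by (intro AC2_loc_add AC2_loc_const AC2_loc_isometry[OF x s(1,2)])
  have "bounded_linear \<phi>"
    using s(1,2) by (intro bounded_linear_intro[of \<phi> 1]) (auto simp: linear_add linear_scale)
  from AE_vector_derivative_isometry[OF x this, of Z]
  show "AE t in lebesgue. lag (\<lambda>t. \<phi> (x t) + Z) t = lag x t"
    by eventually_elim (simp add: lag_def s(3))
qed

lemma action_symmetry:
  assumes "semi_symmetry F \<phi> Z" and x: "AC2_loc x"
  shows "action F (\<lambda>t. \<phi> (x t) + Z) a b = action F x a b"
  unfolding action_lag
  by (intro antisym set_integral_Icc_mono lag_integrable semi_symmetry_curve(1)[OF assms] x)
    (use semi_symmetry_curve(2)[OF assms] in \<open>auto elim!: eventually_mono\<close>)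

lemma action_shift:
  assumes x: "AC2_loc x"
  shows "action F (\<lambda>t. x (r + t)) a b = action F x (r + a) (r + b)"
  using set_integral_shift(2)[OF lag_measurable[OF x], of a b r]
  unfolding action_lag by (simp add: lag_def[abs_def] vector_derivative_shift)

end

lemma one_minus_exp_over_tendsto:
  fixes e :: "nat \<Rightarrow> real"
  assumes "\<And>j. 0 < e j" "e \<longlonglongrightarrow> 0"
  shows "(\<lambda>j. (1 - exp (- e j * T)) / e j) \<longlonglongrightarrow> T"
proof -
  have "((\<lambda>x. 1 - exp (- x * T)) has_real_derivative T) (at 0)"
    by (auto intro!: derivative_eq_intros)
  then have "((\<lambda>h. ((1 - exp (- (0 + h) * T)) - (1 - exp (- 0 * T))) / h) \<longlongrightarrow> T) (at 0)"
    unfolding DERIV_def .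
  moreover have "filterlim e (at 0) sequentially"
    using assms by (intro filterlim_atI) (auto simp: less_imp_neq[symmetric])
  ultimately have "(\<lambda>j. ((1 - exp (- (0 + e j) * T)) - (1 - exp (- 0 * T))) / e j) \<longlonglongrightarrow> T"
    by (rule filterlim_compose)
  then show ?thesis by simp
qed

text \<open>
  The normalization \<open>m j\<close> is arbitrary since only differences of values matter; the infimum of
  the value function is one choice.
\<close>

locale vanishing = discounted +
  fixes \<epsilon> :: "nat \<Rightarrow> real" and U :: "'a \<Rightarrow> real" and h :: real and m :: "nat \<Rightarrow> real"
  assumes \<epsilon>: "0 < \<epsilon> j" "\<epsilon> \<longlonglongrightarrow> 0"
    and limH: "uniform_limit UNIV (\<lambda>j M. \<epsilon> j * (W (\<epsilon> j) M - C0 / \<epsilon> j)) (\<lambda>_. - h) sequentially"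
    and limU: "uniform_limit UNIV (\<lambda>j M. (W (\<epsilon> j) M - C0 / \<epsilon> j) - m j) U sequentially"
    and contU: "continuous_on UNIV U"
begin

text \<open>
  \<open>V j\<close> is the value function of \<open>F\<close> for the discount \<open>\<epsilon> j\<close>, and \<open>q j T\<close> is the integral of
  \<open>exp (- \<epsilon> j * t)\<close> over \<open>[0, T]\<close>.
\<close>

definition "V j M = W (\<epsilon> j) M - C0 / \<epsilon> j"
definition "q j T = (1 - exp (- \<epsilon> j * T)) / \<epsilon> j"

lemma q_tendsto: "(\<lambda>j. q j T) \<longlonglongrightarrow> T"
  unfolding q_def by (rule one_minus_exp_over_tendsto[OF \<epsilon>])

lemma V_limits: "(\<lambda>j. \<epsilon> j * V j M) \<longlonglongrightarrow> - h" "(\<lambda>j. V j M - m j) \<longlonglongrightarrow> U M"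
  using tendsto_uniform_limitI[OF limH, of M] tendsto_uniform_limitI[OF limU, of M] by (simp_all add: V_def)

text \<open>
  The terms of order \<open>1 / \<epsilon> j\<close> in the dynamic programming principle cancel.  What remains is
  expressed by \<open>V j N\<close>, which enters through differences, by \<open>\<epsilon> j * V j N\<close>, which tends to
  \<open>- h\<close>, and by \<open>q j T\<close>, which tends to \<open>T\<close>.
\<close>

lemma V_identity:
  "exp (- \<epsilon> j * T) * W (\<epsilon> j) N = V j N - q j T * (\<epsilon> j * V j N) + C0 / \<epsilon> j - q j T * C0"
proof -
  have e: "\<epsilon> j \<noteq> 0" using \<epsilon>(1)[of j] by simp
  have q: "q j T * \<epsilon> j = 1 - exp (- \<epsilon> j * T)" using e by (simp add: q_def)
  have W: "W (\<epsilon> j) N = V j N + C0 / \<epsilon> j" by (simp add: V_def)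
  have "q j T * C0 = (q j T * \<epsilon> j) * (C0 / \<epsilon> j)" using e by simp
  then have "V j N - q j T * (\<epsilon> j * V j N) + C0 / \<epsilon> j - q j T * C0
    = (1 - q j T * \<epsilon> j) * (V j N + C0 / \<epsilon> j)"
    by (simp add: algebra_simps)
  then show ?thesis unfolding q W by simp
qed

lemma U_dominated_from_0:
  assumes x: "AC2_loc x" and T: "0 \<le> T"
  shows "U (x 0) \<le> action F x 0 T + h * T + U (x T)"
proof -
  have "V j (x 0) - m j - (V j (x T) - m j) \<le> action F x 0 T + C0 * T - q j T * C0 - q j T * (\<epsilon> j * V j (x T))" for j
  proof -
    have "W (\<epsilon> j) (x 0) \<le> discounted_cost_upto (\<epsilon> j) x T + exp (- \<epsilon> j * T) * W (\<epsilon> j) (x T)"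
      by (rule W_dynamic_upper[OF x \<epsilon>(1) T])
    moreover have "discounted_cost_upto (\<epsilon> j) x T \<le> action F x 0 T + C0 * T"
      by (rule discounted_cost_upto_upper[OF x less_imp_le[OF \<epsilon>(1)] T])
    ultimately show ?thesis unfolding V_identity by (simp add: V_def)
  qed
  moreover have "(\<lambda>j. V j (x 0) - m j - (V j (x T) - m j)) \<longlonglongrightarrow> U (x 0) - U (x T)"
    by (intro tendsto_intros V_limits)
  moreover have "(\<lambda>j. action F x 0 T + C0 * T - q j T * C0 - q j T * (\<epsilon> j * V j (x T)))
    \<longlonglongrightarrow> action F x 0 T + C0 * T - T * C0 - T * (- h)"
    by (intro tendsto_intros V_limits q_tendsto)
  ultimately have "U (x 0) - U (x T) \<le> action F x 0 T + C0 * T - T * C0 - T * (- h)"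
    by (intro LIMSEQ_le) auto
  then show ?thesis by (simp add: mult.commute)
qed

lemma U_dominated:
  assumes x: "AC2_loc x" and ab: "a \<le> b"
  shows "U (x a) \<le> action F x a b + h * (b - a) + U (x b)"
  using U_dominated_from_0[OF AC2_loc_shift[OF x, of a], of "b - a"] ab
  by (simp add: action_shift[OF x])

lemma V_diff_bound: "V j M - V j N \<le> (C2 + C0) / \<epsilon> j"
  using W_bound[OF \<epsilon>(1)[of j], of M] W_nonneg[of "\<epsilon> j" N] by (simp add: V_def)

text \<open>
  By uniform convergence the oscillation of \<open>U\<close> is controlled by that of a single \<open>V j\<close>, which is
  at most \<open>(C2 + C0) / \<epsilon> j\<close>.
\<close>

lemma U_bounded: "\<exists>B. \<forall>M N. U M - U N \<le> B"
proof -
  have "eventually (\<lambda>j. \<forall>M\<in>UNIV. dist (V j M - m j) (U M) < 1) sequentially"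
    using limU[unfolded uniform_limit_iff, rule_format, of 1] by (simp add: V_def)
  then obtain j where j: "\<And>M. \<bar>V j M - m j - U M\<bar> < 1"
    by (auto simp: eventually_sequentially dist_real_def)
  have "U M - U N \<le> (C2 + C0) / \<epsilon> j + 2" for M N
    using j[of M] j[of N] V_diff_bound[of j M N] by linarith
  then show ?thesis by blast
qed

text \<open>
  Take an almost optimal curve for a small discount.  Its end point \<open>x T\<close> depends on the
  discount and may escape to infinity, so the convergence of the value functions has to be
  uniform.
\<close>

lemma U_almost_attained:
  assumes T: "0 \<le> T" and \<eta>: "0 < \<eta>"
  shows "\<exists>x. AC2_loc x \<and> action F x 0 T + h * T + U (x T) \<le> U (x 0) + \<eta>"
proof -
  obtain B where B: "\<And>M N. U M - U N \<le> B" using U_bounded by blast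
  define \<rho> where "\<rho> = \<eta> / (8 * (2 + T))"
  have \<rho>: "0 < \<rho>" "(2 + T) * \<rho> = \<eta> / 8" using \<eta> T by (simp_all add: \<rho>_def field_simps)
  \<comment> \<open>a bound, independent of \<open>j\<close>, for the quantity \<open>A\<close> below; it controls the effect of removing the discount factor\<close>
  define R where "R = B + T * \<bar>C0 - h\<bar> + \<eta>"
  have evU: "eventually (\<lambda>j. \<forall>M\<in>UNIV. dist (V j M - m j) (U M) < \<rho>) sequentially"
    using limU[unfolded uniform_limit_iff, rule_format, OF \<rho>(1)] by (simp add: V_def)
  have evH: "eventually (\<lambda>j. \<forall>M\<in>UNIV. dist (\<epsilon> j * V j M) (- h) < \<rho>) sequentially"
    using limH[unfolded uniform_limit_iff, rule_format, OF \<rho>(1)] by (simp add: V_def)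
  have "(\<lambda>j. \<bar>q j T - T\<bar> * \<bar>C0 - h\<bar>) \<longlonglongrightarrow> \<bar>T - T\<bar> * \<bar>C0 - h\<bar>" by (intro tendsto_intros q_tendsto)
  then have evq: "eventually (\<lambda>j. \<bar>q j T - T\<bar> * \<bar>C0 - h\<bar> < \<eta> / 8) sequentially"
    using \<eta> by (intro order_tendstoD(2)) auto
  have "(\<lambda>j. (exp (\<epsilon> j * T) - 1) * \<bar>R\<bar>) \<longlonglongrightarrow> (exp (0 * T) - 1) * \<bar>R\<bar>" by (intro tendsto_intros \<epsilon>(2))
  then have eve: "eventually (\<lambda>j. (exp (\<epsilon> j * T) - 1) * \<bar>R\<bar> < \<eta> / 4) sequentially"
    using \<eta> by (intro order_tendstoD(2)) auto
  from eventually_conj[OF eventually_conj[OF evU evH] eventually_conj[OF evq eve]]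
  obtain j where j: "\<And>M. \<bar>V j M - m j - U M\<bar> < \<rho>" "\<And>M. \<bar>\<epsilon> j * V j M + h\<bar> < \<rho>"
    "\<bar>q j T - T\<bar> * \<bar>C0 - h\<bar> < \<eta> / 8" "(exp (\<epsilon> j * T) - 1) * \<bar>R\<bar> < \<eta> / 4"
    by (auto simp: eventually_sequentially dist_real_def)
  \<comment> \<open>any starting point would do\<close>
  obtain x where x: "AC2_loc x" "x 0 = 0"
    "discounted_cost_upto (\<epsilon> j) x T + exp (- \<epsilon> j * T) * W (\<epsilon> j) (x T) \<le> W (\<epsilon> j) 0 + \<eta> / 4"
    using W_dynamic_lower[OF \<epsilon>(1)[of j] T, where \<eta>="\<eta> / 4" and M=0] \<eta> by auto
  define I where "I = action F x 0 T + C0 * T"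
  define A where "A = V j 0 - V j (x T) + q j T * (\<epsilon> j * V j (x T)) + q j T * C0 + \<eta> / 4"
  define A' where "A' = U 0 - U (x T) + T * (C0 - h)"
  have dA: "exp (- \<epsilon> j * T) * I \<le> A"
    using discounted_cost_upto_lower[OF x(1) less_imp_le[OF \<epsilon>(1)[of j]] T] x(3) unfolding V_identity
    by (simp add: A_def I_def V_def)
  have q: "0 \<le> q j T" "q j T \<le> T"
  proof -
    have "- (\<epsilon> j * T) \<le> 0" using \<epsilon>(1)[of j] T by simp
    then show "0 \<le> q j T" using \<epsilon>(1)[of j] by (simp add: q_def)
    have "1 + - (\<epsilon> j * T) \<le> exp (- (\<epsilon> j * T))" by (rule exp_ge_add_one_self)
    then show "q j T \<le> T" using \<epsilon>(1)[of j] by (simp add: q_def field_simps)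
  qed
  have "q j T * (\<epsilon> j * V j (x T)) + q j T * C0 - T * (C0 - h) = q j T * (\<epsilon> j * V j (x T) + h) + (q j T - T) * (C0 - h)"
    by (simp add: algebra_simps)
  also have "\<dots> \<le> T * \<rho> + \<bar>q j T - T\<bar> * \<bar>C0 - h\<bar>"
  proof (rule add_mono)
    have "q j T * (\<epsilon> j * V j (x T) + h) \<le> q j T * \<rho>" using j(2)[of "x T"] q by (intro mult_left_mono) auto
    also have "\<dots> \<le> T * \<rho>" using q \<rho> by (intro mult_right_mono) auto
    finally show "q j T * (\<epsilon> j * V j (x T) + h) \<le> T * \<rho>" .
    show "(q j T - T) * (C0 - h) \<le> \<bar>q j T - T\<bar> * \<bar>C0 - h\<bar>" by (metis abs_ge_self abs_mult)
  qed
  finally have "A \<le> A' + (2 * \<rho> + T * \<rho>) + \<bar>q j T - T\<bar> * \<bar>C0 - h\<bar> + \<eta> / 4"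
    using j(1)[of 0] j(1)[of "x T"] unfolding A_def A'_def by linarith
  moreover have "2 * \<rho> + T * \<rho> = \<eta> / 8" using \<rho>(2) by (simp add: distrib_right)
  ultimately have AA: "A \<le> A' + \<eta> / 2" using j(3) by linarith
  have I0: "0 \<le> I"
    unfolding I_def integral_lag_C0[OF x(1) T, symmetric] set_lebesgue_integral_def
    using lag_nonneg by (intro integral_nonneg_AE) auto
  have A0: "0 \<le> A" using dA I0 by (meson exp_ge_zero mult_nonneg_nonneg order_trans)
  have "T * (C0 - h) \<le> T * \<bar>C0 - h\<bar>" using T by (intro mult_left_mono) auto
  then have "A \<le> \<bar>R\<bar>" using AA B[of 0 "x T"] \<eta> unfolding A'_def R_def by linarith
  then have "(exp (\<epsilon> j * T) - 1) * A \<le> (exp (\<epsilon> j * T) - 1) * \<bar>R\<bar>"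
    using T \<epsilon>(1)[of j] by (intro mult_left_mono) auto
  then have eA: "exp (\<epsilon> j * T) * A \<le> A + \<eta> / 4" using j(4) by (simp add: left_diff_distrib)
  have "I = exp (\<epsilon> j * T) * (exp (- \<epsilon> j * T) * I)" by (simp add: mult.assoc[symmetric] exp_add[symmetric])
  also have "\<dots> \<le> exp (\<epsilon> j * T) * A" using dA by (intro mult_left_mono) auto
  finally have "I \<le> A' + \<eta>" using eA AA \<eta> by linarith
  then have "action F x 0 T + h * T + U (x T) \<le> U (x 0) + \<eta>"
    by (simp add: I_def A'_def x(2) algebra_simps)
  with x(1) show ?thesis by blast
qed

lemma W_symmetry_le:
  assumes s: "semi_symmetry F \<phi> Z" and e: "0 < e"
  shows "W e (\<phi> M + Z) \<le> W e M"
proof (rule field_le_epsilon)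
  fix \<eta> :: real assume \<eta>: "0 < \<eta>"
  obtain x where x: "AC2_loc x" "x 0 = M" "discounted_cost e x < ennreal (W e M + \<eta>)"
    using W_near[OF e \<eta>] by blast
  let ?y = "\<lambda>t. \<phi> (x t) + Z"
  have "ennreal (W e (\<phi> M + Z)) \<le> discounted_cost e ?y"
    using W_le[OF e semi_symmetry_curve(1)[OF s x(1)]] x(2) by simp
  also have "discounted_cost e ?y = discounted_cost e x"
    unfolding discounted_cost_def
  proof (rule nn_integral_cong_AE)
    have "AE t in lebesgue_on {0<..}. lag ?y t = lag x t"
      using semi_symmetry_curve(2)[OF s x(1)] by (intro AE_restrict_space_iff[THEN iffD2]) auto
    then show "AE t in lebesgue_on {0<..}. ennreal (exp (- e * t) * (lag ?y t + C0)) = ennreal (exp (- e * t) * (lag x t + C0))"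
      by eventually_elim simp
  qed
  also have "\<dots> \<le> ennreal (W e M + \<eta>)" using x(3) by simp
  finally show "W e (\<phi> M + Z) \<le> W e M + \<eta>"
    using \<eta> W_nonneg[of e M] by (subst (asm) ennreal_le_iff) auto
qed

lemma U_semi_symmetry_le:
  assumes s: "semi_symmetry F \<phi> Z"
  shows "U (\<phi> M + Z) \<le> U M"
proof (rule LIMSEQ_le[OF V_limits(2) V_limits(2)])
  show "\<exists>N. \<forall>j\<ge>N. V j (\<phi> M + Z) - m j \<le> V j M - m j"
    using W_symmetry_le[OF s \<epsilon>(1)] by (simp add: V_def)
qed

lemma U_symmetry:
  assumes "symmetry F \<phi> Z" shows "U (\<phi> M + Z) = U M"
proof (rule antisym)
  obtain \<psi> Y where s: "semi_symmetry F \<psi> Y" "\<psi> (\<phi> M + Z) + Y = M"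
    using assms by (auto simp: symmetry_def)
  show "U (\<phi> M + Z) \<le> U M" using assms by (intro U_semi_symmetry_le) (simp add: symmetry_def)
  show "U M \<le> U (\<phi> M + Z)" using U_semi_symmetry_le[OF s(1), of "\<phi> M + Z"] s(2) by simp
qed

text \<open>
  Almost calibrated curves on \<open>[0, 2 n]\<close> are shifted in time so that the midpoint becomes time 0,
  and moved by symmetries so that the values at time 0 converge.  Both operations
  preserve the action, and \<open>U\<close> is invariant under symmetries.
\<close>

theorem calibrated_curve_exists:
  assumes compact: "\<And>M :: nat \<Rightarrow> 'a. \<exists>r \<phi> Z. strict_mono r \<and> (\<forall>n. symmetry F (\<phi> n) (Z n)) \<and>
    convergent (\<lambda>n. \<phi> n (M (r n)) + Z n)"
  shows "\<exists>x. AC2_loc x \<and> (\<forall>a b. a \<le> b \<longrightarrow> U (x a) = action (\<lambda>M N. F M N + h) x a b + U (x b))"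
proof -
  let ?F = "\<lambda>M N. F M N + h"
  interpret H: tonelli ?F D \<gamma> K \<kappa> "C0 + \<bar>h\<bar>" "C1 + \<bar>h\<bar>"
    by (rule tonelli_add_const) unfold_locales
  interpret H: dominated ?F D \<gamma> K \<kappa> "C0 + \<bar>h\<bar>" "C1 + \<bar>h\<bar>" U
  proof
    fix x :: "real \<Rightarrow> 'a" and a b :: real
    assume "AC2_loc x" "a \<le> b"
    then show "U (x a) \<le> action ?F x a b + U (x b)"
      using U_dominated[of x a b] by (simp add: action_add_const)
  qed (fact contU)
  define \<eta> where "\<eta> n = 1 / real (Suc n)" for n
  have "\<exists>x. AC2_loc x \<and> action F x 0 (2 * real n) + h * (2 * real n) + U (x (2 * real n)) \<le> U (x 0) + \<eta> n" for n
    by (rule U_almost_attained) (auto simp: \<eta>_def)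
  then obtain x where x: "\<And>n. AC2_loc (x n)"
    "\<And>n. action F (x n) 0 (2 * real n) + h * (2 * real n) + U (x n (2 * real n)) \<le> U (x n 0) + \<eta> n" by metis
  obtain r \<phi> Z where r: "strict_mono r" and sym: "\<And>n. symmetry F (\<phi> n) (Z n)"
    and conv: "convergent (\<lambda>n. \<phi> n (x (r n) (real (r n))) + Z n)"
    using compact[of "\<lambda>n. x n (real n)"] by blast
  define y where "y n t = \<phi> n (x (r n) (real (r n) + t)) + Z n" for n t
  have semi: "semi_symmetry F (\<phi> n) (Z n)" for n using sym by (simp add: symmetry_def)
  have ACy: "AC2_loc (y n)" for n
    unfolding y_def by (rule semi_symmetry_curve(1)[OF semi AC2_loc_shift[OF x(1)]])
  have "H.almost_calibrated (y n) (- real (r n)) (real (r n)) (\<eta> (r n))" for n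
  proof -
    have "action ?F (y n) (- real (r n)) (real (r n)) = action F (y n) (- real (r n)) (real (r n)) + h * (2 * real (r n))"
      using action_add_const[OF ACy, of "- real (r n)" "real (r n)" h] by simp
    also have "action F (y n) (- real (r n)) (real (r n)) = action F (\<lambda>t. x (r n) (real (r n) + t)) (- real (r n)) (real (r n))"
      unfolding y_def by (rule action_symmetry[OF semi AC2_loc_shift[OF x(1)]])
    also have "\<dots> = action F (x (r n)) 0 (2 * real (r n))"
      unfolding action_shift[OF x(1)] by simp
    finally have 1: "action ?F (y n) (- real (r n)) (real (r n)) = action F (x (r n)) 0 (2 * real (r n)) + h * (2 * real (r n))" .
    have 2: "U (y n (real (r n))) = U (x (r n) (2 * real (r n)))" "U (y n (- real (r n))) = U (x (r n) 0)"
      unfolding y_def U_symmetry[OF sym] by simp_all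
    show ?thesis unfolding H.almost_calibrated_def 1 2 using x(2)[of "r n"] ACy by simp
  qed
  then have cal: "H.almost_calibrated (y n) (- real n) (real n) (\<eta> (r n))" for n
    by (rule H.almost_calibrated_subinterval) (use seq_suble[OF r, of n] in auto)
  have "\<eta> \<longlonglongrightarrow> 0" unfolding \<eta>_def using LIMSEQ_inverse_real_of_nat by (simp add: inverse_eq_divide)
  from LIMSEQ_subseq_LIMSEQ[OF this r] have \<eta>: "(\<lambda>n. \<eta> (r n)) \<longlonglongrightarrow> 0" by (simp add: o_def)
  have "convergent (\<lambda>n. y n 0)" using conv by (simp add: y_def)
  from H.calibrated_limit[OF cal \<eta> this] show ?thesis .
qed

end

section \<open>Integer translations and rearrangements\<close>

lemma emeasure_cube_finite: "emeasure \<lambda>\<^sub>0 (space (\<lambda>\<^sub>0 :: (real^'d) measure)) < \<infinity>"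
  unfolding cube_measure_def cube_def
  by (subst emeasure_restrict_space) (use emeasure_lborel_cbox_finite[of 0 "1 :: real^'d"] in \<open>auto simp: space_restrict_space\<close>)

lemma finite_measure_cube: "finite_measure (\<lambda>\<^sub>0 :: (real^'d) measure)"
  by (rule finite_measureI) (use emeasure_cube_finite[where 'd='d] in auto)

lemma square_integrable_bounded:
  assumes "f \<in> borel_measurable \<lambda>\<^sub>0" "\<And>z. z \<in> cube \<Longrightarrow> norm (f z) \<le> B"
  shows "square_integrable (f :: real^'d \<Rightarrow> real^'d)"
proof -
  interpret finite_measure "\<lambda>\<^sub>0 :: (real^'d) measure" by (rule finite_measure_cube)
  have "integrable \<lambda>\<^sub>0 (\<lambda>z. (norm (f z))\<^sup>2)"
  proof (rule integrable_const_bound[where B="B\<^sup>2"])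
    have "(norm (f z))\<^sup>2 \<le> B\<^sup>2" if "z \<in> cube" for z using assms(2)[OF that] by (intro power_mono) auto
    then show "AE z in \<lambda>\<^sub>0. norm ((norm (f z))\<^sup>2) \<le> B\<^sup>2"
      by (intro AE_I2) (auto simp: cube_measure_def space_restrict_space)
    show "(\<lambda>z. (norm (f z))\<^sup>2) \<in> borel_measurable \<lambda>\<^sub>0" using assms(1) by measurable
  qed
  with assms(1) show ?thesis by (simp add: square_integrable_def)
qed

lemma integral_dot_inner: "integral_dot c N = abs_L2 (\<lambda>_. c) \<bullet> N"
proof -
  have c: "square_integrable (\<lambda>_::real^'a. c)" by (rule square_integrable_bounded[of _ "norm c"]) auto
  have f: "square_integrable (rep_L2 N)" by (rule rep_L2)
  have "integral_dot c (abs_L2 (rep_L2 N)) = (\<integral>z. c \<bullet> rep_L2 N z \<partial>\<lambda>\<^sub>0)"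
    by (rule integral_dot.abs_eq) (simp add: L2_rel_def f)
  moreover have "abs_L2 (\<lambda>_. c) \<bullet> abs_L2 (rep_L2 N) = (\<integral>z. c \<bullet> rep_L2 N z \<partial>\<lambda>\<^sub>0)"
    by (rule inner_L2.abs_eq) (simp_all add: L2_rel_def f c)
  ultimately show ?thesis by (simp add: rep_L2(2))
qed

lemma integral_dot_abs:
  assumes "square_integrable f" shows "integral_dot c (abs_L2 f) = (\<integral>z. c \<bullet> f z \<partial>\<lambda>\<^sub>0)"
  by (rule integral_dot.abs_eq) (simp add: L2_rel_def assms)

lemma square_integrable_comp:
  assumes "G \<in> \<G>" "square_integrable f" shows "square_integrable (f \<circ> G)"
  using L2_rel_comp[OF assms(1), of f f] assms(2) by (simp add: L2_rel_def)

lemma integral_rearrangement: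
  fixes f :: "real^'d \<Rightarrow> real"
  assumes G: "G \<in> \<G>" and f: "f \<in> borel_measurable \<lambda>\<^sub>0"
  shows "(\<integral>z. f (G z) \<partial>\<lambda>\<^sub>0) = (\<integral>z. f z \<partial>\<lambda>\<^sub>0)"
proof -
  have "G \<in> \<lambda>\<^sub>0 \<rightarrow>\<^sub>M \<lambda>\<^sub>0" "distr \<lambda>\<^sub>0 \<lambda>\<^sub>0 G = \<lambda>\<^sub>0" using G by (auto simp: rearrangements_def)
  then show ?thesis using integral_distr[of G "\<lambda>\<^sub>0" "\<lambda>\<^sub>0" f] f by simp
qed

lemma L2_comp_linear:
  assumes G: "G \<in> \<G>" shows "linear (\<lambda>M. M \<circ>\<^sub>L G)"
proof (rule linearI)
  fix M N :: "'a L2" and r :: real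
  note f = rep_L2(1)[of M] and g = rep_L2(1)[of N]
  note c = square_integrable_comp[OF G]
  have "(abs_L2 (rep_L2 M) + abs_L2 (rep_L2 N)) \<circ>\<^sub>L G = abs_L2 (rep_L2 M) \<circ>\<^sub>L G + abs_L2 (rep_L2 N) \<circ>\<^sub>L G"
    unfolding abs_L2_add[OF f g] L2_comp_abs[OF G f] L2_comp_abs[OF G g] L2_comp_abs[OF G square_integrable_add[OF f g]]
      abs_L2_add[OF c[OF f] c[OF g]] by (simp add: o_def)
  then show "(M + N) \<circ>\<^sub>L G = M \<circ>\<^sub>L G + N \<circ>\<^sub>L G" by (simp add: rep_L2)
  have "(r *\<^sub>R abs_L2 (rep_L2 M)) \<circ>\<^sub>L G = r *\<^sub>R (abs_L2 (rep_L2 M) \<circ>\<^sub>L G)"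
    unfolding abs_L2_scaleR[OF f] L2_comp_abs[OF G f] L2_comp_abs[OF G square_integrable_scaleR[OF f]]
      abs_L2_scaleR[OF c[OF f]] by (simp add: o_def)
  then show "(r *\<^sub>R M) \<circ>\<^sub>L G = r *\<^sub>R (M \<circ>\<^sub>L G)" by (simp add: rep_L2)
qed

lemma L2_comp_norm:
  assumes G: "G \<in> \<G>" shows "norm (M \<circ>\<^sub>L G) = norm M"
proof -
  note f = rep_L2(1)[of M]
  have m: "(\<lambda>z. (norm (rep_L2 M z))\<^sup>2) \<in> borel_measurable \<lambda>\<^sub>0"
    using f by (auto simp: square_integrable_def)
  have "(norm (abs_L2 (rep_L2 M) \<circ>\<^sub>L G))\<^sup>2 = (norm (abs_L2 (rep_L2 M)))\<^sup>2"
    unfolding L2_comp_abs[OF G f] norm_abs_L2[OF square_integrable_comp[OF G f]] norm_abs_L2[OF f]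
    using integral_rearrangement[OF G m] by simp
  then show ?thesis by (simp add: rep_L2 power2_eq_iff_nonneg)
qed

lemma L2_comp_integral_dot:
  assumes G: "G \<in> \<G>" shows "integral_dot c (M \<circ>\<^sub>L G) = integral_dot c M"
proof -
  note f = rep_L2(1)[of M]
  have m: "(\<lambda>z. c \<bullet> rep_L2 M z) \<in> borel_measurable \<lambda>\<^sub>0"
    using f by (auto simp: square_integrable_def)
  have "integral_dot c (abs_L2 (rep_L2 M) \<circ>\<^sub>L G) = integral_dot c (abs_L2 (rep_L2 M))"
    unfolding L2_comp_abs[OF G f] integral_dot_abs[OF square_integrable_comp[OF G f]] integral_dot_abs[OF f]
    using integral_rearrangement[OF G m] by simp
  then show ?thesis by (simp add: rep_L2)
qed

lemma L2_comp_inverse: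
  assumes G: "G \<in> \<G>" "G' \<in> \<G>" "\<And>z. z \<in> cube \<Longrightarrow> G (G' z) = z"
  shows "M \<circ>\<^sub>L G \<circ>\<^sub>L G' = M"
proof -
  note f = rep_L2(1)[of M]
  have "abs_L2 (rep_L2 M) \<circ>\<^sub>L G \<circ>\<^sub>L G' = abs_L2 (rep_L2 M \<circ> G \<circ> G')"
    unfolding L2_comp_abs[OF G(1) f] by (rule L2_comp_abs[OF G(2) square_integrable_comp[OF G(1) f]])
  also have "\<dots> = abs_L2 (rep_L2 M)"
  proof (rule Quotient3_rel_abs[OF Quotient3_L2])
    have "AE z in \<lambda>\<^sub>0. (rep_L2 M \<circ> G \<circ> G') z = rep_L2 M z"
      by (rule AE_I2) (auto simp: cube_measure_def space_restrict_space G(3))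
    then show "L2_rel (rep_L2 M \<circ> G \<circ> G') (rep_L2 M)"
      using f square_integrable_comp[OF G(2) square_integrable_comp[OF G(1) f]] by (simp add: L2_rel_def)
  qed
  finally show ?thesis by (simp add: rep_L2)
qed

lemma integer_valued_abs:
  assumes "square_integrable f" shows "integer_valued (abs_L2 f) \<longleftrightarrow> (AE z in \<lambda>\<^sub>0. \<forall>i. f z $ i \<in> \<int>)"
  by (rule integer_valued.abs_eq) (simp add: L2_rel_def assms)

lemma integer_valued_uminus: "integer_valued Z \<Longrightarrow> integer_valued (- Z)"
proof -
  assume "integer_valued Z"
  then have i: "AE z in \<lambda>\<^sub>0. \<forall>i. rep_L2 Z z $ i \<in> \<int>"
    using integer_valued_abs[OF rep_L2(1)[of Z]] by (simp add: rep_L2(2))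
  have "- Z = (-1) *\<^sub>R abs_L2 (rep_L2 Z)" by (simp add: rep_L2(2))
  also have "\<dots> = abs_L2 (\<lambda>z. (-1) *\<^sub>R rep_L2 Z z)" by (rule abs_L2_scaleR[OF rep_L2(1)])
  finally have e: "- Z = abs_L2 (\<lambda>z. (-1) *\<^sub>R rep_L2 Z z)" .
  show "integer_valued (- Z)"
    unfolding e integer_valued_abs[OF square_integrable_scaleR[OF rep_L2(1)]]
    using i by eventually_elim simp
qed

section \<open>Lagrangians\<close>

lemma translation_symmetry:
  assumes L: "lagrangian L" and Z: "integer_valued Z"
  shows "symmetry (shifted_lagrangian L c) (\<lambda>M. M) Z"
proof -
  have s: "semi_symmetry (shifted_lagrangian L c) (\<lambda>M. M) Y" if "integer_valued Y" for Y
    using L that by (simp add: semi_symmetry_def shifted_lagrangian_def lagrangian_def linear_ident)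
  have "\<forall>M. M + Z + - Z = M" by simp
  then show ?thesis unfolding symmetry_def using s[OF Z] s[OF integer_valued_uminus[OF Z]] by blast
qed

lemma rearrangement_symmetry:
  assumes L: "lagrangian L" and G: "G \<in> \<G>" "G' \<in> \<G>" "\<And>z. z \<in> cube \<Longrightarrow> G (G' z) = z"
  shows "symmetry (shifted_lagrangian L c) (\<lambda>M. M \<circ>\<^sub>L G) 0"
proof -
  have s: "semi_symmetry (shifted_lagrangian L c) (\<lambda>M. M \<circ>\<^sub>L H) 0" if "H \<in> \<G>" for H
  proof -
    have "L (M \<circ>\<^sub>L H) (N \<circ>\<^sub>L H) = L M N" for M N using L that by (simp add: lagrangian_def)
    then show ?thesis
      using L2_comp_linear[OF that] L2_comp_norm[OF that] L2_comp_integral_dot[OF that]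
      by (simp add: semi_symmetry_def shifted_lagrangian_def)
  qed
  have "\<forall>M. (M \<circ>\<^sub>L G + 0) \<circ>\<^sub>L G' + 0 = M" using L2_comp_inverse[OF G] by simp
  then show ?thesis unfolding symmetry_def using s[OF G(1)] s[OF G(2)] by blast
qed

text \<open>
  Coercivity follows by expanding at zero velocity, where the Lagrangian and its derivative are
  bounded, and completing the square; the linear term in \<open>c\<close> only changes the constants.
\<close>

theorem lagrangian_discounted:
  fixes L :: "('d::finite) L2 \<Rightarrow> 'd L2 \<Rightarrow> real"
  assumes L: "lagrangian L"
  shows "\<exists>D \<gamma> K \<kappa> C0 C1 C2. discounted (shifted_lagrangian L c) D \<gamma> K \<kappa> C0 C1 C2"
proof -
  let ?P = "\<lambda>(M, N). L M N"
  obtain C K \<gamma> where C: "0 < C" "0 < K" "0 < \<gamma>"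
    and hyps: "\<forall>M N. L M N \<le> C * (1 + (norm M)\<^sup>2 + (norm N)\<^sup>2)" "\<forall>M. \<bar>L M 0\<bar> \<le> C"
      "\<forall>M N. norm (\<D> L (M, N)) \<le> C + C * L M N"
      "\<forall>M N H\<^sub>1 H\<^sub>2. L (M + H\<^sub>1) (N + H\<^sub>2) - L M N - D\<^sub>x L M N H\<^sub>1 - D\<^sub>v L M N H\<^sub>2
          \<ge> \<gamma> * (norm H\<^sub>2)\<^sup>2 - K * (norm H\<^sub>1)\<^sup>2"
      "\<forall>M N H\<^sub>1 H\<^sub>2. L (M + H\<^sub>1) (N + H\<^sub>2) - L M N - D\<^sub>x L M N H\<^sub>1 - D\<^sub>v L M N H\<^sub>2
          \<le> K * (norm H\<^sub>2)\<^sup>2 + K * (norm H\<^sub>1)\<^sup>2"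
  proof -
    from L show ?thesis unfolding lagrangian_def
      by (elim exE conjE) (rule that, assumption, assumption, assumption, assumption, assumption, assumption, assumption, assumption)
  qed
  note v = hyps(1,2)[rule_format] and vi = hyps(3)[rule_format] and vii = hyps(4)[rule_format]
    and viii = hyps(5)[rule_format]
  have diff: "?P differentiable at p" for p
    by (rule L[unfolded lagrangian_def, THEN conjunct2, THEN conjunct2, THEN conjunct2, THEN conjunct1, THEN spec])
  have L0: "0 \<le> L M N" for M N
    by (rule L[unfolded lagrangian_def, THEN conjunct2, THEN conjunct2, THEN conjunct1, THEN spec, THEN spec])
  define f' where "f' p = frechet_derivative ?P (at p)" for p
  have f': "(?P has_derivative f' p) (at p)" for p
    unfolding f'_def using diff[of p] frechet_derivative_works by blast
  then have bl: "bounded_linear (f' p)" for p by (rule has_derivative_bounded_linear)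
  then have lin: "linear (f' p)" for p by (rule bounded_linear.linear)
  have Dx: "D\<^sub>x L M N = (\<lambda>H. f' (M, N) (H, 0))" for M N
  proof -
    have "((\<lambda>M'. (M', N)) has_derivative (\<lambda>H. (H, 0))) (at M)" by (auto intro!: derivative_eq_intros)
    from has_derivative_compose[OF this f'] have "((\<lambda>M'. L M' N) has_derivative (\<lambda>H. f' (M, N) (H, 0))) (at M)"
      by simp
    from frechet_derivative_at[OF this] show ?thesis by (simp add: partial_x_def)
  qed
  have Dv: "D\<^sub>v L M N = (\<lambda>H. f' (M, N) (0, H))" for M N
  proof -
    have "((\<lambda>N'. (M, N')) has_derivative (\<lambda>H. (0, H))) (at N)" by (auto intro!: derivative_eq_intros)
    from has_derivative_compose[OF this f'] have "((\<lambda>N'. L M N') has_derivative (\<lambda>H. f' (M, N) (0, H))) (at N)"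
      by simp
    from frechet_derivative_at[OF this] show ?thesis by (simp add: partial_v_def)
  qed
  have sum: "f' p (H\<^sub>1, 0) + f' p (0, H\<^sub>2) = f' p (H\<^sub>1, H\<^sub>2)" for p H\<^sub>1 H\<^sub>2
    using linear_add[OF lin, of p "(H\<^sub>1, 0)" "(0, H\<^sub>2)"] by simp
  define D where "D M N H\<^sub>1 H\<^sub>2 = f' (M, N) (H\<^sub>1, H\<^sub>2) + integral_dot c H\<^sub>2" for M N H\<^sub>1 H\<^sub>2
  have DL: "L (M + H\<^sub>1) (N + H\<^sub>2) - L M N - D\<^sub>x L M N H\<^sub>1 - D\<^sub>v L M N H\<^sub>2 =
    shifted_lagrangian L c (M + H\<^sub>1) (N + H\<^sub>2) - shifted_lagrangian L c M N - D M N H\<^sub>1 H\<^sub>2" for M N H\<^sub>1 H\<^sub>2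
    using sum[of "(M, N)" H\<^sub>1 H\<^sub>2]
    by (simp add: Dx Dv D_def shifted_lagrangian_def integral_dot_inner inner_add_right)
  \<comment> \<open>a bound for the derivative at zero velocity\<close>
  define A where "A = C + C * C"
  define n where "n = norm (abs_L2 (\<lambda>_. c) :: 'd L2)"
  have dot: "\<bar>integral_dot c N\<bar> \<le> n * norm N" for N :: "'d L2"
    unfolding integral_dot_inner n_def by (rule Cauchy_Schwarz_ineq2)
  have nA: "0 \<le> n" "0 \<le> A" using C by (auto simp: n_def A_def)
  have low: "\<gamma> * (norm N)\<^sup>2 - (A + n) * norm N \<le> shifted_lagrangian L c M N" for M N
  proof -
    have "\<bar>f' (M, 0) (0, N)\<bar> \<le> A * norm N"
    proof -
      have "f' (M, 0) = blinfun_apply (\<D> L (M, 0))"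
        unfolding full_deriv_def f'_def by (rule bounded_linear_Blinfun_apply[symmetric]) (rule bl[unfolded f'_def])
      then have "\<bar>f' (M, 0) (0, N)\<bar> \<le> norm (\<D> L (M, 0)) * norm ((0, N) :: 'd L2 \<times> 'd L2)"
        using norm_blinfun[of "\<D> L (M, 0)" "(0, N)"] by simp
      also have "norm (\<D> L (M, 0)) \<le> A"
      proof -
        have "C * L M 0 \<le> C * C" using v(2)[of M] C by (intro mult_left_mono) auto
        then show ?thesis using vi[of M 0] by (simp add: A_def)
      qed
      then have "norm (\<D> L (M, 0)) * norm ((0, N) :: 'd L2 \<times> 'd L2) \<le> A * norm ((0, N) :: 'd L2 \<times> 'd L2)"
        by (rule mult_right_mono) simp
      finally show ?thesis by (simp add: norm_Pair)
    qed
    moreover have "\<gamma> * (norm N)\<^sup>2 \<le> L M N - L M 0 - f' (M, 0) (0, N)"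
      using vii[where M=M and N=0 and H\<^sub>1=0 and H\<^sub>2=N] linear_0[OF lin[of "(M, 0)"]] by (simp add: Dx Dv flip: zero_prod_def)
    ultimately show ?thesis
      using L0[of M 0] dot[of N] unfolding distrib_right by (simp add: shifted_lagrangian_def abs_le_iff)
  qed
  have "discounted (shifted_lagrangian L c) D \<gamma> K (\<gamma> / 2) ((A + n)\<^sup>2 / (2 * \<gamma>)) (C + n) C"
  proof
    show "0 < \<gamma>" "0 < K" "0 < \<gamma> / 2" "0 \<le> (A + n)\<^sup>2 / (2 * \<gamma>)" using C by auto
    have "continuous_on UNIV ?P"
      using f' by (meson continuous_at_imp_continuous_on has_derivative_continuous)
    then have "continuous_on UNIV (\<lambda>p. ?P p + abs_L2 (\<lambda>_. c) \<bullet> snd p)"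
      by (intro continuous_intros)
    then show "continuous_on UNIV (\<lambda>(M, N). shifted_lagrangian L c M N)"
      by (simp add: shifted_lagrangian_def case_prod_beta integral_dot_inner)
    fix M N H\<^sub>1 H\<^sub>2 H\<^sub>1' H\<^sub>2' :: "'d L2" and r
    show "D M N (H\<^sub>1 + H\<^sub>1') (H\<^sub>2 + H\<^sub>2') = D M N H\<^sub>1 H\<^sub>2 + D M N H\<^sub>1' H\<^sub>2'"
      using linear_add[OF lin, of "(M, N)" "(H\<^sub>1, H\<^sub>2)" "(H\<^sub>1', H\<^sub>2')"]
      by (simp add: D_def integral_dot_inner inner_add_right)
    show "D M N (r *\<^sub>R H\<^sub>1) (r *\<^sub>R H\<^sub>2) = r * D M N H\<^sub>1 H\<^sub>2"
      using linear_scale[OF lin, of "(M, N)" r "(H\<^sub>1, H\<^sub>2)"]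
      by (simp add: D_def integral_dot_inner distrib_left)
    show "\<gamma> * (norm H\<^sub>2)\<^sup>2 - K * (norm H\<^sub>1)\<^sup>2
      \<le> shifted_lagrangian L c (M + H\<^sub>1) (N + H\<^sub>2) - shifted_lagrangian L c M N - D M N H\<^sub>1 H\<^sub>2"
      unfolding DL[symmetric] by (rule vii)
    show "shifted_lagrangian L c (M + H\<^sub>1) (N + H\<^sub>2) - shifted_lagrangian L c M N - D M N H\<^sub>1 H\<^sub>2
      \<le> K * ((norm H\<^sub>1)\<^sup>2 + (norm H\<^sub>2)\<^sup>2)"
      unfolding DL[symmetric] using viii[of M H\<^sub>1 N H\<^sub>2] by (simp add: distrib_left)
    show "\<gamma> / 2 * (norm N)\<^sup>2 - (A + n)\<^sup>2 / (2 * \<gamma>) \<le> shifted_lagrangian L c M N"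
    proof -
      have "0 \<le> (\<gamma> * norm N - (A + n))\<^sup>2 / (2 * \<gamma>)" using C by simp
      also have "\<dots> = \<gamma> / 2 * (norm N)\<^sup>2 - (A + n) * norm N + (A + n)\<^sup>2 / (2 * \<gamma>)"
      proof -
        have "(\<gamma> * x - a)\<^sup>2 / (2 * \<gamma>) = \<gamma> / 2 * x\<^sup>2 - a * x + a\<^sup>2 / (2 * \<gamma>)" for x a
        proof -
          have "(\<gamma> * x - a)\<^sup>2 = (2 * \<gamma>) * (\<gamma> / 2 * x\<^sup>2 - a * x) + a\<^sup>2"
            by (simp add: power2_eq_square algebra_simps)
          then show ?thesis using C by (simp add: add_divide_distrib)
        qed
        then show ?thesis .
      qed
      finally show ?thesis using low[of N M] by (simp add: field_simps)
    qed
    show "shifted_lagrangian L c M N \<le> (C + n) * (1 + (norm M)\<^sup>2 + (norm N)\<^sup>2)"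
    proof -
      have "norm N \<le> 1 + (norm M)\<^sup>2 + (norm N)\<^sup>2"
      proof -
        have "2 * norm N \<le> (norm N)\<^sup>2 + 1" using sum_squares_bound[of "norm N" 1] by simp
        then show ?thesis using norm_ge_zero[of N] zero_le_power2[of "norm M"] by linarith
      qed
      then have "n * norm N \<le> n * (1 + (norm M)\<^sup>2 + (norm N)\<^sup>2)" using nA by (intro mult_left_mono)
      then show ?thesis using v(1)[of M N] dot[of N] unfolding distrib_right[of C] shifted_lagrangian_def
        by (simp add: abs_le_iff)
    qed
    show "shifted_lagrangian L c M 0 \<le> C"
      using v(2)[of M] by (simp add: shifted_lagrangian_def integral_dot_inner abs_le_iff)
  qed
  then show ?thesis by blast
qed

section \<open>Compactness modulo symmetries\<close>

text \<open>
  By the pigeonhole principle and a diagonal argument a subsequence has the same keys at stage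
  \<open>k\<close> from its \<open>k\<close>th term on, so a symmetry brings its term \<open>k + 1\<close> within \<open>2\<^sup>-\<^sup>k\<close> of its
  term \<open>k\<close>.  Composing these symmetries, which are isometries, makes the subsequence Cauchy.
\<close>

lemma convergent_modulo_symmetry:
  fixes M :: "nat \<Rightarrow> 'a::{real_inner,complete_space}"
  assumes tb: "\<And>\<delta>. 0 < \<delta> \<Longrightarrow> \<exists>\<kappa> :: 'a \<Rightarrow> 'b. finite (range \<kappa>) \<and>
    (\<forall>M N. \<kappa> M = \<kappa> N \<longrightarrow> (\<exists>\<phi> Z. symmetry F \<phi> Z \<and> norm (\<phi> M + Z - N) < \<delta>))"
  shows "\<exists>r \<phi> Z. strict_mono r \<and> (\<forall>n. symmetry F (\<phi> n) (Z n)) \<and> convergent (\<lambda>n. \<phi> n (M (r n)) + Z n)"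
proof -
  have "\<exists>\<kappa> :: 'a \<Rightarrow> 'b. finite (range \<kappa>) \<and>
    (\<forall>M N. \<kappa> M = \<kappa> N \<longrightarrow> (\<exists>\<phi> Z. symmetry F \<phi> Z \<and> norm (\<phi> M + Z - N) < (1/2)^k))" for k :: nat
    by (rule tb) simp
  then obtain \<kappa> :: "nat \<Rightarrow> 'a \<Rightarrow> 'b" where fin: "\<And>k. finite (range (\<kappa> k))"
    and \<kappa>: "\<And>k M N. \<kappa> k M = \<kappa> k N \<Longrightarrow> \<exists>\<phi> Z. symmetry F \<phi> Z \<and> norm (\<phi> M + Z - N) < (1/2)^k" by metis
  define P where "P k s \<longleftrightarrow> (\<forall>i j. \<kappa> k (M (s i)) = \<kappa> k (M (s j)))" for k and s :: "nat \<Rightarrow> nat"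
  interpret subseqs P
  proof
    fix k and s :: "nat \<Rightarrow> nat"
    have "finite (range (\<lambda>i. \<kappa> k (M (s i))))" by (rule finite_subset[OF _ fin[of k]]) auto
    then obtain i0 where "infinite {i. \<kappa> k (M (s i)) = \<kappa> k (M (s i0))}"
      using pigeonhole_infinite[of UNIV "\<lambda>i. \<kappa> k (M (s i))"] by auto
    then obtain r' :: "nat \<Rightarrow> nat" where "strict_mono r'" "\<And>n. r' n \<in> {i. \<kappa> k (M (s i)) = \<kappa> k (M (s i0))}"
      using infinite_enumerate by blast
    then show "\<exists>r'. strict_mono r' \<and> P k (s \<circ> r')" by (intro exI[of _ r']) (auto simp: P_def)
  qed
  define u where "u k = diagseq (Suc k)" for k
  have u: "strict_mono u" using subseq_diagseq by (auto simp: u_def strict_mono_def)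
  have "\<kappa> k (M (u (Suc k))) = \<kappa> k (M (u k))" for k
  proof -
    have "P k (diagseq \<circ> (+) (Suc k))" by (rule diagseq_holds) (simp add: P_def)
    then have "\<kappa> k (M ((diagseq \<circ> (+) (Suc k)) 1)) = \<kappa> k (M ((diagseq \<circ> (+) (Suc k)) 0))"
      unfolding P_def by blast
    then show ?thesis by (simp add: u_def)
  qed
  then have "\<exists>\<phi> Z. symmetry F \<phi> Z \<and> norm (\<phi> (M (u (Suc k))) + Z - M (u k)) < (1/2)^k" for k
    by (rule \<kappa>)
  then obtain g z where g: "\<And>k. symmetry F (g k) (z k)" "\<And>k. norm (g k (M (u (Suc k))) + z k - M (u k)) < (1/2)^k"
    by metis
  define \<Phi> where "\<Phi> = rec_nat (\<lambda>v. v, 0) (\<lambda>k p. (fst p \<circ> g k, fst p (z k) + snd p))"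
  define \<phi> Z where "\<phi> k = fst (\<Phi> k)" and "Z k = snd (\<Phi> k)" for k
  have rec: "\<phi> 0 = (\<lambda>v. v)" "Z 0 = 0" "\<phi> (Suc k) = \<phi> k \<circ> g k" "Z (Suc k) = \<phi> k (z k) + Z k" for k
    by (simp_all add: \<phi>_def Z_def \<Phi>_def)
  have sym: "symmetry F (\<phi> k) (Z k)" for k
  proof (induction k)
    case 0
    have "semi_symmetry F (\<lambda>v. v) 0" by (simp add: semi_symmetry_def linear_ident)
    then show ?case unfolding rec symmetry_def by (metis add.right_neutral)
  next
    case (Suc k)
    then show ?case unfolding rec by (rule symmetry_compose[OF _ g(1)])
  qed
  define y where "y k = \<phi> k (M (u k)) + Z k" for k
  have step: "norm (y (Suc k) - y k) < (1/2)^k" for k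
  proof -
    have lin: "linear (\<phi> k)" and iso: "\<And>v. norm (\<phi> k v) = norm v"
      using sym[of k] by (auto simp: symmetry_def semi_symmetry_def)
    have "y (Suc k) - y k = \<phi> k (g k (M (u (Suc k))) + z k - M (u k))"
      by (simp add: y_def rec linear_add[OF lin] linear_diff[OF lin])
    then show ?thesis using g(2)[of k] by (simp add: iso)
  qed
  have "Cauchy y"
  proof (rule metric_CauchyI)
    fix e :: real assume "0 < e"
    have z: "(\<lambda>k. 2 * (1/2::real)^k) \<longlonglongrightarrow> 0"
      using tendsto_mult_right_zero[OF LIMSEQ_realpow_zero[of "1/2::real"]] by simp
    have "eventually (\<lambda>k. 2 * (1/2::real)^k < e / 2) sequentially"
      by (rule order_tendstoD(2)[OF z]) (use \<open>0 < e\<close> in simp)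
    then obtain K where K: "2 * (1/2::real)^K < e / 2" by (auto simp: eventually_sequentially)
    have "norm (y (K + i) - y K) \<le> 2 * (1/2)^K - 2 * (1/2)^(K + i)" for i
    proof (induction i)
      case (Suc i)
      have "norm (y (K + Suc i) - y K) \<le> norm (y (Suc (K + i)) - y (K + i)) + norm (y (K + i) - y K)"
        using norm_triangle_ineq[of "y (Suc (K + i)) - y (K + i)" "y (K + i) - y K"] by simp
      also have "\<dots> \<le> (1/2)^(K + i) + (2 * (1/2)^K - 2 * (1/2)^(K + i))"
        using step[of "K + i"] Suc.IH by simp
      finally show ?case by simp
    qed simp
    then have "norm (y (K + i) - y K) \<le> 2 * (1/2)^K" for i
      by (rule order_trans) simp
    then have near: "norm (y m - y K) < e / 2" if "m \<ge> K" for m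
      using K that by (metis le_add_diff_inverse le_less_trans)
    show "\<exists>N. \<forall>m\<ge>N. \<forall>n\<ge>N. dist (y m) (y n) < e"
    proof (intro exI allI impI)
      fix m n assume "m \<ge> K" "n \<ge> K"
      then show "dist (y m) (y n) < e"
        using near[of m] near[of n] dist_triangle_half_l[of "y m" "y K" e "y n"] by (simp add: dist_norm)
    qed
  qed
  then have "convergent y" by (simp add: Cauchy_convergent_iff)
  with u sym show ?thesis unfolding y_def by blast
qed

section \<open>Rearranging step functions on grids\<close>

definition grid_cell :: "nat \<Rightarrow> real ^ 'd \<Rightarrow> int ^ 'd"
  where "grid_cell n z = (\<chi> i. \<lfloor>real n * z $ i\<rfloor>)"

definition grid_cells :: "nat \<Rightarrow> (int ^ 'd) set"
  where "grid_cells n = {c. \<forall>i. 0 \<le> c $ i \<and> c $ i < int n}"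

definition grid_corner :: "nat \<Rightarrow> int ^ 'd \<Rightarrow> real ^ 'd"
  where "grid_corner n c = (\<chi> i. real_of_int (c $ i) / real n)"

definition open_cube :: "(real ^ 'd) set"
  where "open_cube = {z. \<forall>i. 0 \<le> z $ i \<and> z $ i < 1}"

text \<open>
  Each cell \<open>c\<close> of the half-open cube is translated onto the cell \<open>\<sigma> c\<close>.  The remaining faces of
  the cube are fixed pointwise, so that permutations of the cells give bijections of the
  closed cube.
\<close>

definition grid_map :: "nat \<Rightarrow> (int ^ 'd \<Rightarrow> int ^ 'd) \<Rightarrow> real ^ 'd \<Rightarrow> real ^ 'd"
  where "grid_map n \<sigma> z = (if z \<in> open_cube
    then z + (grid_corner n (\<sigma> (grid_cell n z)) - grid_corner n (grid_cell n z)) else z)"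

lemma finite_vec_set:
  assumes "\<And>i. finite (A i)"
  shows "finite {c :: 'a ^ 'd. \<forall>i. c $ i \<in> A i}"
proof (rule finite_subset)
  show "{c :: 'a ^ 'd. \<forall>i. c $ i \<in> A i} \<subseteq> vec_lambda ` (PiE UNIV A)"
  proof
    fix c :: "'a ^ 'd" assume "c \<in> {c. \<forall>i. c $ i \<in> A i}"
    then have "vec_nth c \<in> PiE UNIV A" by (auto simp: PiE_def)
    then show "c \<in> vec_lambda ` (PiE UNIV A)" by (metis imageI vec_nth_inverse)
  qed
  show "finite (vec_lambda ` (PiE UNIV A) :: ('a ^ 'd) set)"
    using assms by (intro finite_imageI finite_PiE) auto
qed

lemma finite_grid_cells: "finite (grid_cells n)"
  using finite_vec_set[of "\<lambda>_. {0..<int n}"] by (simp add: grid_cells_def)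

lemma grid_cell_in: "0 < n \<Longrightarrow> grid_cell n z \<in> grid_cells n \<longleftrightarrow> z \<in> open_cube"
proof -
  assume n: "0 < n"
  have "0 \<le> \<lfloor>real n * r\<rfloor> \<and> \<lfloor>real n * r\<rfloor> < int n \<longleftrightarrow> 0 \<le> r \<and> r < 1" for r
  proof -
    have "0 \<le> real n * r \<longleftrightarrow> 0 \<le> r" using n by (simp add: zero_le_mult_iff)
    moreover have "real n * r < real n \<longleftrightarrow> r < 1" using n by (simp add: mult_less_cancel_left1)
    ultimately show ?thesis by (simp add: floor_less_iff)
  qed
  then show ?thesis by (simp add: grid_cell_def grid_cells_def open_cube_def)
qed

lemma open_cube_subset: "open_cube \<subseteq> cube"
  by (auto simp: open_cube_def mem_cube less_imp_le)

lemma measurable_vec_nth_borel: "(\<lambda>z :: real ^ 'd. z $ i) \<in> borel_measurable borel"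
  by (intro borel_measurable_continuous_onI continuous_intros)

lemma measurable_grid_cell: "grid_cell n \<in> borel \<rightarrow>\<^sub>M count_space (UNIV :: (int ^ 'd) set)"
proof (subst measurable_count_space_eq_countable)
  show "countable (UNIV :: (int ^ 'd) set)" by simp
  have "grid_cell n -` {c} \<in> sets borel" for c :: "int ^ 'd"
  proof -
    have "grid_cell n -` {c} = (\<Inter>i\<in>UNIV. {z. \<lfloor>real n * z $ i\<rfloor> = c $ i})"
      by (auto simp: grid_cell_def vec_eq_iff)
    moreover have "{z :: real ^ 'd. \<lfloor>real n * z $ i\<rfloor> = c $ i} \<in> sets borel" for i
    proof -
      have "{z :: real ^ 'd. \<lfloor>real n * z $ i\<rfloor> = c $ i} = {z. real_of_int (c $ i) \<le> real n * z $ i} \<inter> {z. real n * z $ i < real_of_int (c $ i) + 1}"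
        by (auto simp: floor_eq_iff)
      moreover have "closed {z :: real ^ 'd. real_of_int (c $ i) \<le> real n * z $ i}" "open {z :: real ^ 'd. real n * z $ i < real_of_int (c $ i) + 1}"
        by (intro closed_Collect_le open_Collect_less continuous_intros)+
      ultimately show ?thesis by auto
    qed
    ultimately show ?thesis by (simp add: sets.finite_INT)
  qed
  then show "grid_cell n \<in> space borel \<rightarrow> UNIV \<and> (\<forall>a\<in>(UNIV :: (int ^ 'd) set). grid_cell n -` {a} \<inter> space borel \<in> sets borel)"
    by simp
qed

lemma cell_sets [measurable]: "grid_cell n -` {c} \<in> sets borel"
  using measurable_sets[OF measurable_grid_cell[of n], of "{c}"] by simp

lemma open_cube_sets [measurable]: "open_cube \<in> sets borel"
proof -
  have "open_cube = (\<Union>c\<in>grid_cells 1. grid_cell 1 -` {c :: int ^ 'd})"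
    using grid_cell_in[of 1] by auto
  then show ?thesis using finite_grid_cells[of 1] cell_sets by (metis sets.finite_UN)
qed

lemma cube_sets [measurable]: "(cube :: (real ^ 'd) set) \<in> sets borel"
  by (simp add: cube_def)

lemma measurable_of_cell: "(\<lambda>z. f (grid_cell n z)) \<in> borel \<rightarrow>\<^sub>M (borel :: 'b::topological_space measure)"
  by (rule measurable_compose[OF measurable_grid_cell]) simp

lemma grid_map_measurable: "grid_map n \<sigma> \<in> borel \<rightarrow>\<^sub>M borel"
  unfolding grid_map_def[abs_def]
proof (rule measurable_If_set)
  show "(\<lambda>z. z + (grid_corner n (\<sigma> (grid_cell n z)) - grid_corner n (grid_cell n z))) \<in> borel \<rightarrow>\<^sub>M borel"
    by (intro borel_measurable_add measurable_ident_sets refl measurable_of_cell[of "\<lambda>c. grid_corner n (\<sigma> c) - grid_corner n c"])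
qed auto

lemma grid_cell_translate:
  assumes "0 < n"
  shows "grid_cell n (z + (grid_corner n d - grid_corner n c)) = grid_cell n z + d - c"
proof -
  have "real n * (r + (real_of_int a / real n - real_of_int b / real n)) = real n * r + real_of_int (a - b)" for r a b
    using assms by (simp add: algebra_simps)
  then show ?thesis by (simp add: grid_cell_def grid_corner_def vec_eq_iff)
qed

lemma grid_map_cell:
  assumes n: "0 < n" and \<sigma>: "\<And>c. c \<in> grid_cells n \<Longrightarrow> \<sigma> c \<in> grid_cells n" and z: "z \<in> open_cube"
  shows "grid_cell n (grid_map n \<sigma> z) = \<sigma> (grid_cell n z)" "grid_map n \<sigma> z \<in> open_cube"
proof -
  show e: "grid_cell n (grid_map n \<sigma> z) = \<sigma> (grid_cell n z)"
    using z by (simp add: grid_map_def grid_cell_translate[OF n])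
  show "grid_map n \<sigma> z \<in> open_cube"
    using grid_cell_in[OF n, of "grid_map n \<sigma> z"] grid_cell_in[OF n, of z] z \<sigma> unfolding e by blast
qed

lemma grid_map_inverse:
  assumes n: "0 < n" and \<sigma>: "\<And>c. c \<in> grid_cells n \<Longrightarrow> \<sigma> c \<in> grid_cells n"
    and \<tau>: "\<And>c. c \<in> grid_cells n \<Longrightarrow> \<tau> (\<sigma> c) = c"
  shows "grid_map n \<tau> (grid_map n \<sigma> z) = z"
proof (cases "z \<in> open_cube")
  case True
  note m = grid_map_cell[OF n \<sigma> True]
  have c: "\<tau> (\<sigma> (grid_cell n z)) = grid_cell n z" using \<tau> True grid_cell_in[OF n] by blast
  show ?thesis
    using m True by (simp add: grid_map_def[of n \<tau>] c) (simp add: grid_map_def)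
qed (simp add: grid_map_def)

lemma emeasure_lborel_translate:
  fixes v :: "real ^ 'd"
  assumes "S \<in> sets borel"
  shows "emeasure lborel {z. z + v \<in> S} = emeasure lborel S"
proof -
  have "emeasure lborel S = emeasure (distr lborel borel ((+) v)) S" by (simp add: lborel_distr_plus)
  also have "\<dots> = emeasure lborel ((+) v -` S \<inter> space lborel)" using assms by (intro emeasure_distr) auto
  also have "(+) v -` S \<inter> space lborel = {z. z + v \<in> S}" by (auto simp: add.commute)
  finally show ?thesis by simp
qed

text \<open>
  On each cell the map is a translation, and these preserve Lebesgue measure.
\<close>

lemma grid_map_preserves:
  assumes n: "0 < n" and \<sigma>: "bij_betw \<sigma> (grid_cells n) (grid_cells n)"
    and A: "A \<in> sets (borel :: (real ^ 'd) measure)" "A \<subseteq> cube"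
  shows "emeasure lborel (grid_map n \<sigma> -` A \<inter> cube) = emeasure lborel A"
proof -
  have \<sigma>C: "\<And>c. c \<in> grid_cells n \<Longrightarrow> \<sigma> c \<in> grid_cells n" using \<sigma> by (auto simp: bij_betw_def)
  let ?C = "grid_cells n :: (int ^ 'd) set"
  let ?B = "\<lambda>c. A \<inter> grid_cell n -` {c}"
  let ?v = "\<lambda>c. grid_corner n (\<sigma> c) - grid_corner n c"
  have cell_z: "z \<in> open_cube" if "grid_cell n z \<in> ?C" for z using that grid_cell_in[OF n] by blast
  have eqc: "{z. z + ?v c \<in> ?B (\<sigma> c)} = grid_cell n -` {c} \<inter> grid_map n \<sigma> -` A" if c: "c \<in> ?C" for c
  proof (intro set_eqI)
    fix z
    have "grid_cell n (z + ?v c) = \<sigma> c \<longleftrightarrow> grid_cell n z = c"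
      unfolding grid_cell_translate[OF n] by (simp add: algebra_simps)
    moreover have "grid_map n \<sigma> z = z + ?v c" if "grid_cell n z = c"
      using cell_z[of z] c that by (simp add: grid_map_def)
    ultimately show "z \<in> {z. z + ?v c \<in> ?B (\<sigma> c)} \<longleftrightarrow> z \<in> grid_cell n -` {c} \<inter> grid_map n \<sigma> -` A" by auto
  qed
  have union: "(\<Union>c\<in>?C. grid_cell n -` {c}) = open_cube" using grid_cell_in[OF n] by auto
  have split: "emeasure lborel S = (\<Sum>c\<in>?C. emeasure lborel (S \<inter> grid_cell n -` {c})) + emeasure lborel (S - open_cube)"
    if S: "S \<in> sets borel" for S
  proof -
    have "emeasure lborel S = emeasure lborel ((S \<inter> open_cube) \<union> (S - open_cube))" by (rule arg_cong[where f="emeasure lborel"]) auto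
    also have "\<dots> = emeasure lborel (S \<inter> open_cube) + emeasure lborel (S - open_cube)"
      using S open_cube_sets by (intro plus_emeasure[symmetric]) auto
    also have "S \<inter> open_cube = (\<Union>c\<in>?C. S \<inter> grid_cell n -` {c})" using union by auto
    also have "emeasure lborel (\<Union>c\<in>?C. S \<inter> grid_cell n -` {c}) = (\<Sum>c\<in>?C. emeasure lborel (S \<inter> grid_cell n -` {c}))"
      using S cell_sets finite_grid_cells by (intro sum_emeasure[symmetric]) (auto simp: disjoint_family_on_def)
    finally show ?thesis .
  qed
  have pre: "grid_map n \<sigma> -` A \<inter> cube \<in> sets borel"
    using measurable_sets[OF grid_map_measurable A(1), of n \<sigma>] cube_sets by simp
  have "emeasure lborel (grid_map n \<sigma> -` A \<inter> cube \<inter> grid_cell n -` {c}) = emeasure lborel (?B (\<sigma> c))" if c: "c \<in> ?C" for c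
  proof -
    have "grid_map n \<sigma> -` A \<inter> cube \<inter> grid_cell n -` {c} = {z. z + ?v c \<in> ?B (\<sigma> c)}"
      unfolding eqc[OF c] using cell_z c open_cube_subset by auto
    then show ?thesis using emeasure_lborel_translate[of "?B (\<sigma> c)" "?v c"] A(1) cell_sets by simp
  qed
  moreover have "(\<Sum>c\<in>?C. emeasure lborel (?B (\<sigma> c))) = (\<Sum>c\<in>?C. emeasure lborel (?B c))"
    by (rule sum.reindex_bij_betw[OF \<sigma>])
  moreover have "grid_map n \<sigma> -` A \<inter> cube - open_cube = A - open_cube"
    using A(2) by (auto simp: grid_map_def)
  ultimately show ?thesis by (subst split[OF pre], subst split[OF A(1)]) simp
qed

lemma sets_cube_measure: "S \<in> sets \<lambda>\<^sub>0 \<longleftrightarrow> S \<subseteq> cube \<and> S \<in> sets borel"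
  unfolding cube_measure_def by (subst sets_restrict_space_iff) auto

lemma space_cube_measure: "space \<lambda>\<^sub>0 = cube"
  by (simp add: cube_measure_def space_restrict_space)

lemma emeasure_cube_measure: "S \<in> sets \<lambda>\<^sub>0 \<Longrightarrow> emeasure \<lambda>\<^sub>0 S = emeasure lborel S"
  unfolding cube_measure_def
  by (subst emeasure_restrict_space) (auto simp: sets_restrict_space)

lemma grid_map_cube:
  assumes n: "0 < n" and \<sigma>: "\<And>c. c \<in> grid_cells n \<Longrightarrow> \<sigma> c \<in> grid_cells n" and z: "z \<in> cube"
  shows "grid_map n \<sigma> z \<in> cube"
  using grid_map_cell(2)[where \<sigma>=\<sigma>, OF n \<sigma>] z open_cube_subset by (cases "z \<in> open_cube") (blast, simp add: grid_map_def)

lemma grid_map_rearrangement: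
  fixes \<sigma> :: "int ^ 'd \<Rightarrow> int ^ 'd"
  assumes n: "0 < n" and \<sigma>: "bij_betw \<sigma> (grid_cells n) (grid_cells n)"
    and \<tau>: "bij_betw \<tau> (grid_cells n) (grid_cells n)"
    and inv: "\<And>c. c \<in> grid_cells n \<Longrightarrow> \<tau> (\<sigma> c) = c" "\<And>c. c \<in> grid_cells n \<Longrightarrow> \<sigma> (\<tau> c) = c"
  shows "grid_map n \<sigma> \<in> \<G>"
proof -
  have \<sigma>C: "\<And>c. c \<in> grid_cells n \<Longrightarrow> \<sigma> c \<in> grid_cells n" and \<tau>C: "\<And>c. c \<in> grid_cells n \<Longrightarrow> \<tau> c \<in> grid_cells n"
    using \<sigma> \<tau> by (auto simp: bij_betw_def)
  have bij: "bij_betw (grid_map n \<sigma>) cube cube"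
    by (rule bij_betw_byWitness[where f'="grid_map n \<tau>"])
      (auto simp: grid_map_inverse[OF n \<sigma>C inv(1)] grid_map_inverse[OF n \<tau>C inv(2)]
        grid_map_cube[OF n \<sigma>C] grid_map_cube[OF n \<tau>C])
  have the_inv: "the_inv_into cube (grid_map n \<sigma>) z = grid_map n \<tau> z" if "z \<in> cube" for z
  proof (rule the_inv_into_f_eq)
    show "inj_on (grid_map n \<sigma>) cube" using bij by (rule bij_betw_imp_inj_on)
  qed (auto simp: grid_map_inverse[OF n \<tau>C inv(2)] grid_map_cube[OF n \<tau>C that])
  have meas: "grid_map n \<rho> \<in> \<lambda>\<^sub>0 \<rightarrow>\<^sub>M \<lambda>\<^sub>0" if "\<And>c. c \<in> grid_cells n \<Longrightarrow> \<rho> c \<in> grid_cells n" for \<rho> :: "int ^ 'd \<Rightarrow> int ^ 'd"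
  proof (rule measurableI)
    show "grid_map n \<rho> z \<in> space \<lambda>\<^sub>0" if "z \<in> space \<lambda>\<^sub>0" for z
      using that grid_map_cube[OF n \<open>\<And>c. c \<in> grid_cells n \<Longrightarrow> \<rho> c \<in> grid_cells n\<close>] by (simp add: space_cube_measure)
    show "grid_map n \<rho> -` A \<inter> space \<lambda>\<^sub>0 \<in> sets \<lambda>\<^sub>0" if "A \<in> sets \<lambda>\<^sub>0" for A
      using that measurable_sets[OF grid_map_measurable, of A n \<rho>] cube_sets
      by (auto simp: sets_cube_measure space_cube_measure)
  qed
  have distr: "distr \<lambda>\<^sub>0 \<lambda>\<^sub>0 (grid_map n \<rho>) = \<lambda>\<^sub>0" if \<rho>: "bij_betw \<rho> (grid_cells n) (grid_cells n)" for \<rho> :: "int ^ 'd \<Rightarrow> int ^ 'd"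
  proof (rule measure_eqI)
    have \<rho>C: "\<And>c. c \<in> grid_cells n \<Longrightarrow> \<rho> c \<in> grid_cells n" using \<rho> by (auto simp: bij_betw_def)
    fix A assume "A \<in> sets (distr \<lambda>\<^sub>0 \<lambda>\<^sub>0 (grid_map n \<rho>))"
    then have A: "A \<in> sets \<lambda>\<^sub>0" by simp
    have "emeasure (distr \<lambda>\<^sub>0 \<lambda>\<^sub>0 (grid_map n \<rho>)) A = emeasure \<lambda>\<^sub>0 (grid_map n \<rho> -` A \<inter> space \<lambda>\<^sub>0)"
      by (rule emeasure_distr[OF meas[OF \<rho>C] A])
    also have "\<dots> = emeasure lborel (grid_map n \<rho> -` A \<inter> cube)"
      using emeasure_cube_measure[OF measurable_sets[OF meas[OF \<rho>C] A]] by (simp add: space_cube_measure)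
    also have "\<dots> = emeasure \<lambda>\<^sub>0 A"
      using grid_map_preserves[OF n \<rho>, of A] A emeasure_cube_measure[OF A] by (simp add: sets_cube_measure)
    finally show "emeasure (distr \<lambda>\<^sub>0 \<lambda>\<^sub>0 (grid_map n \<rho>)) A = emeasure \<lambda>\<^sub>0 A" .
  qed simp
  have "the_inv_into cube (grid_map n \<sigma>) \<in> \<lambda>\<^sub>0 \<rightarrow>\<^sub>M \<lambda>\<^sub>0"
  proof -
    have "the_inv_into cube (grid_map n \<sigma>) \<in> \<lambda>\<^sub>0 \<rightarrow>\<^sub>M \<lambda>\<^sub>0 \<longleftrightarrow> grid_map n \<tau> \<in> \<lambda>\<^sub>0 \<rightarrow>\<^sub>M \<lambda>\<^sub>0"
      by (rule measurable_cong) (simp add: the_inv space_cube_measure)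
    then show ?thesis using meas[OF \<tau>C] by simp
  qed
  moreover have "distr \<lambda>\<^sub>0 \<lambda>\<^sub>0 (the_inv_into cube (grid_map n \<sigma>)) = distr \<lambda>\<^sub>0 \<lambda>\<^sub>0 (grid_map n \<tau>)"
    by (rule distr_cong) (simp_all add: the_inv space_cube_measure)
  ultimately show ?thesis
    using bij meas[OF \<sigma>C] distr[OF \<sigma>] distr[OF \<tau>] by (simp add: rearrangements_def)
qed

lemma cell_measure_eq:
  fixes c d :: "int ^ 'd"
  assumes "0 < n" "c \<in> grid_cells n" "d \<in> grid_cells n"
  shows "emeasure lborel (grid_cell n -` {c}) = emeasure lborel (grid_cell n -` {d})"
proof -
  have "{z. z + (grid_corner n d - grid_corner n c) \<in> grid_cell n -` {d}} = grid_cell n -` {c}"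
  proof -
    have "grid_cell n (z + (grid_corner n d - grid_corner n c)) = d \<longleftrightarrow> grid_cell n z = c" for z
      unfolding grid_cell_translate[OF assms(1)] by (simp add: algebra_simps)
    then show ?thesis by auto
  qed
  then show ?thesis using emeasure_lborel_translate[OF cell_sets, of "grid_corner n d - grid_corner n c" n d] by simp
qed

text \<open>
  For each value \<open>a\<close>, inject as many points with \<open>g s = a\<close> as possible into the points with
  \<open>f s = a\<close>.  The complements of the domain and of the image of the resulting partial
  injection have the same size; any bijection between them completes it to a permutation.
\<close>

lemma permutation_matching:
  fixes f g :: "'s \<Rightarrow> 'v"
  assumes S: "finite S" and A: "finite A" "f ` S \<subseteq> A" "g ` S \<subseteq> A"
  shows "\<exists>\<sigma>. bij_betw \<sigma> S S \<and>
    card {s \<in> S. f (\<sigma> s) \<noteq> g s} \<le> (\<Sum>a\<in>A. card {s \<in> S. g s = a} - card {s \<in> S. f s = a})"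
proof -
  let ?F = "\<lambda>a. {s \<in> S. f s = a}" and ?G = "\<lambda>a. {s \<in> S. g s = a}"
  define P where "P a T h \<longleftrightarrow> T \<subseteq> ?G a \<and> card (?G a - T) = card (?G a) - card (?F a) \<and> inj_on h T \<and> h ` T \<subseteq> ?F a"
    for a T and h :: "'s \<Rightarrow> 's"
  have ex: "\<exists>T h. P a T h" for a
  proof -
    have fin: "finite (?F a)" "finite (?G a)" using S by auto
    show ?thesis
    proof (cases "card (?G a) \<le> card (?F a)")
      case True
      then obtain h where "h ` ?G a \<subseteq> ?F a" "inj_on h (?G a)" using card_le_inj[OF fin(2,1)] by auto
      then show ?thesis using True by (intro exI[of _ "?G a"] exI[of _ h]) (auto simp: P_def)
    next
      case False
      then have "card (?F a) \<le> card (?G a)" by linarith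
      then obtain T where T: "T \<subseteq> ?G a" "card T = card (?F a)" and finT: "finite T"
        by (rule obtain_subset_with_card_n)
      obtain h where "h ` T \<subseteq> ?F a" "inj_on h T"
        using card_le_inj[OF finT fin(1)] unfolding T(2) by blast
      moreover have "card (?G a - T) = card (?G a) - card (?F a)"
        using card_Diff_subset[OF finT T(1)] T(2) by simp
      ultimately show ?thesis using T(1) unfolding P_def by blast
    qed
  qed
  obtain T h where Th: "\<And>a. P a (T a) (h a)" using ex by metis
  have T: "T a \<subseteq> ?G a" "card (?G a - T a) = card (?G a) - card (?F a)"
    and h: "inj_on (h a) (T a)" "h a ` T a \<subseteq> ?F a" for a using Th[of a] unfolding P_def by blast+
  define U where "U = (\<Union>a\<in>A. T a)"
  define k where "k s = h (g s) s" for s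
  have US: "U \<subseteq> S" using T(1) by (auto simp: U_def)
  have gT: "s \<in> T (g s)" if "s \<in> U" for s using that T(1) by (auto simp: U_def)
  have kf: "f (k s) = g s" "k s \<in> S" if "s \<in> U" for s
    using h(2)[of "g s"] gT[OF that] by (auto simp: k_def)
  have inj: "inj_on k U"
  proof (rule inj_onI)
    fix s t assume st: "s \<in> U" "t \<in> U" "k s = k t"
    then have "g s = g t" using kf by metis
    then have "s \<in> T (g s)" "t \<in> T (g s)" "h (g s) s = h (g s) t" using st gT by (metis, metis, metis k_def)
    then show "s = t" using inj_onD[OF h(1)[of "g s"]] by blast
  qed
  have fin: "finite (S - U)" "finite (S - k ` U)" using S by auto
  have "card (k ` U) = card U" by (rule card_image[OF inj])
  moreover have "finite U" using US S finite_subset by blast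
  ultimately have "card (S - U) = card (S - k ` U)"
    using US kf(2) by (simp add: card_Diff_subset image_subset_iff)
  then obtain l where l: "bij_betw l (S - U) (S - k ` U)" using finite_same_card_bij[OF fin] by blast
  define \<sigma> where "\<sigma> s = (if s \<in> U then k s else l s)" for s
  have "bij_betw \<sigma> (U \<union> (S - U)) (k ` U \<union> (S - k ` U))"
  proof (rule bij_betw_combine)
    show "bij_betw \<sigma> U (k ` U)"
      using inj by (auto simp: bij_betw_def \<sigma>_def inj_on_def)
    show "bij_betw \<sigma> (S - U) (S - k ` U)"
      using l by (subst bij_betw_cong[of _ _ l]) (auto simp: \<sigma>_def)
  qed auto
  moreover have "U \<union> (S - U) = S" "k ` U \<union> (S - k ` U) = S" using US kf(2) by auto
  ultimately have \<sigma>: "bij_betw \<sigma> S S" by simp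
  have "{s \<in> S. f (\<sigma> s) \<noteq> g s} \<subseteq> (\<Union>a\<in>A. ?G a - T a)"
  proof
    fix s assume s: "s \<in> {s \<in> S. f (\<sigma> s) \<noteq> g s}"
    then have "s \<notin> U" using kf(1)[of s] by (auto simp: \<sigma>_def)
    moreover have "g s \<in> A" using s A(3) by auto
    ultimately have "s \<in> ?G (g s) - T (g s)" using s by (auto simp: U_def)
    then show "s \<in> (\<Union>a\<in>A. ?G a - T a)" using \<open>g s \<in> A\<close> by blast
  qed
  then have "card {s \<in> S. f (\<sigma> s) \<noteq> g s} \<le> card (\<Union>a\<in>A. ?G a - T a)"
    using A(1) S by (intro card_mono) auto
  also have "\<dots> \<le> (\<Sum>a\<in>A. card (?G a - T a))" by (rule card_UN_le[OF A(1)])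
  finally show ?thesis using \<sigma> unfolding T(2) by blast
qed

definition cell_fun :: "nat \<Rightarrow> (int ^ 'd \<Rightarrow> 'v) \<Rightarrow> real ^ 'd \<Rightarrow> 'v"
  where "cell_fun n a z = a (grid_cell n z)"

lemma cell_fun_square_integrable:
  assumes n: "0 < n" shows "square_integrable (cell_fun n a)"
proof -
  \<comment> \<open>the closed cube also meets the cells with an index equal to \<open>n\<close>\<close>
  let ?K = "{c :: int ^ 'a. \<forall>i. c $ i \<in> {0..int n}}"
  have K: "finite ?K" by (rule finite_vec_set) simp
  show ?thesis
  proof (rule square_integrable_bounded)
    have "cell_fun n a \<in> borel_measurable lborel"
      using measurable_of_cell[of a n] by (simp add: cell_fun_def[abs_def])
    then show "cell_fun n a \<in> borel_measurable \<lambda>\<^sub>0"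
      unfolding cube_measure_def by (rule measurable_restrict_space1)
    fix z :: "real ^ 'a" assume "z \<in> cube"
    then have "0 \<le> real n * z $ i \<and> real n * z $ i \<le> real n" for i
      using n by (simp add: mem_cube mult_left_le)
    then have "grid_cell n z \<in> ?K" by (simp add: grid_cell_def floor_le_iff) (smt (verit))
    then show "norm (cell_fun n a z) \<le> (\<Sum>c\<in>?K. norm (a c))"
      unfolding cell_fun_def by (intro member_le_sum K) auto
  qed
qed

lemma AE_open_cube: "AE z in \<lambda>\<^sub>0. z \<in> (open_cube :: (real ^ 'd) set)"
proof -
  have "cube - open_cube \<subseteq> (\<Union>i\<in>UNIV. {z :: real ^ 'd. z $ i = 1})"
    by (auto simp: mem_cube open_cube_def) (meson less_eq_real_def)
  moreover have "negligible (\<Union>i\<in>UNIV. {z :: real ^ 'd. z $ i = 1})"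
    by (intro negligible_Union) (auto simp: cart_eq_inner_axis negligible_standard_hyperplane axis_in_Basis_iff)
  ultimately have "negligible (cube - open_cube :: (real ^ 'd) set)" by (rule negligible_subset[rotated])
  then have "emeasure lborel (cube - open_cube :: (real ^ 'd) set) = 0"
    using cube_sets open_cube_sets by (simp add: negligible_iff_null_sets null_sets_def emeasure_completion)
  then have "emeasure \<lambda>\<^sub>0 (cube - open_cube :: (real ^ 'd) set) = 0"
    by (subst emeasure_cube_measure) (auto simp: sets_cube_measure cube_sets open_cube_sets)
  then have "cube - open_cube \<in> null_sets (\<lambda>\<^sub>0 :: (real ^ 'd) measure)"
    by (auto simp: null_sets_def sets_cube_measure cube_sets open_cube_sets)
  from AE_not_in[OF this] show ?thesis
    using AE_space[of "\<lambda>\<^sub>0 :: (real ^ 'd) measure"] by eventually_elim (simp add: space_cube_measure)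
qed

lemma cell_sets_cube:
  assumes "0 < n" "c \<in> grid_cells n" shows "grid_cell n -` {c} \<in> sets \<lambda>\<^sub>0"
  using grid_cell_in[OF assms(1)] assms(2) open_cube_subset cell_sets by (auto simp: sets_cube_measure)

definition cell_measure :: "('d::finite) itself \<Rightarrow> nat \<Rightarrow> real"
  where "cell_measure _ n = measure \<lambda>\<^sub>0 (grid_cell n -` {0 :: int ^ 'd})"

lemma measure_cell:
  fixes c :: "int ^ 'd"
  assumes "0 < n" "c \<in> grid_cells n"
  shows "measure \<lambda>\<^sub>0 (grid_cell n -` {c}) = cell_measure TYPE('d) n"
proof -
  have z: "(0 :: int ^ 'd) \<in> grid_cells n" using assms(1) by (simp add: grid_cells_def)
  show ?thesis
    unfolding cell_measure_def measure_def
    using emeasure_cube_measure[OF cell_sets_cube[OF assms]] emeasure_cube_measure[OF cell_sets_cube[OF assms(1) z]]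
      cell_measure_eq[OF assms z] by simp
qed

lemma measure_cells:
  fixes C :: "(int ^ 'd) set"
  assumes n: "0 < n" and C: "C \<subseteq> grid_cells n"
  shows "measure \<lambda>\<^sub>0 {z \<in> open_cube. grid_cell n z \<in> C} = real (card C) * cell_measure TYPE('d) n"
proof -
  interpret finite_measure "\<lambda>\<^sub>0 :: (real^'d) measure" by (rule finite_measure_cube)
  have fin: "finite C" using C finite_grid_cells by (rule finite_subset)
  have "{z \<in> open_cube. grid_cell n z \<in> C} = (\<Union>c\<in>C. grid_cell n -` {c})"
    using grid_cell_in[OF n] C by auto
  then have "measure \<lambda>\<^sub>0 {z \<in> open_cube. grid_cell n z \<in> C} = (\<Sum>c\<in>C. measure \<lambda>\<^sub>0 (grid_cell n -` {c}))"
    using finite_measure_finite_Union[OF fin, of "\<lambda>c. grid_cell n -` {c}"] C cell_sets_cube[OF n]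
    by (auto simp: disjoint_family_on_def)
  also have "\<dots> = (\<Sum>c\<in>C. cell_measure TYPE('d) n)"
    using C by (intro sum.cong refl measure_cell[OF n]) auto
  finally show ?thesis by simp
qed

lemma grid_cell_refine:
  assumes "0 < k" shows "grid_cell n z = (\<chi> i. grid_cell (n * k) z $ i div int k)"
proof -
  have "\<lfloor>real n * r\<rfloor> = \<lfloor>real (n * k) * r\<rfloor> div int k" for r
  proof -
    have "real n * r = (real (n * k) * r) / real_of_int (int k)" using assms by simp
    then show ?thesis using floor_divide_real_eq_div[of "int k" "real (n * k) * r"] by simp
  qed
  then show ?thesis by (simp add: grid_cell_def vec_eq_iff)
qed

lemma refine_in_cells:
  assumes "0 < k" "c \<in> grid_cells (n * k)" shows "(\<chi> i. c $ i div int k) \<in> grid_cells n"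
proof -
  have "0 \<le> c $ i div int k \<and> c $ i div int k < int n" for i
  proof -
    have c: "0 \<le> c $ i" "c $ i < int n * int k" using assms(2) by (auto simp: grid_cells_def)
    have "(c $ i div int k) * int k \<le> c $ i" using div_mult_mod_eq[of "c $ i" "int k"] assms(1) by (simp add: minus_mod_eq_div_mult[symmetric])
    then have "(c $ i div int k) * int k < int n * int k" using c(2) by linarith
    then have "c $ i div int k < int n" using assms(1) by (simp add: mult_less_cancel_right)
    then show ?thesis using c(1) assms(1) by (simp add: pos_imp_zdiv_nonneg_iff)
  qed
  then show ?thesis by (simp add: grid_cells_def)
qed

text \<open>
  On the common refinement both functions are constant on cells of equal measure.  So the
  measures of level sets are multiples of the numbers of cells, and the permutation of
  \<open>permutation_matching\<close> mismatches at most the sum of the excesses.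
\<close>

lemma rearrange_to_match:
  fixes a\<^sub>1 a\<^sub>2 :: "int ^ 'd \<Rightarrow> 'v"
  assumes n: "0 < n\<^sub>1" "0 < n\<^sub>2" and A: "finite A" "a\<^sub>1 ` grid_cells n\<^sub>1 \<subseteq> A" "a\<^sub>2 ` grid_cells n\<^sub>2 \<subseteq> A"
    and \<rho>: "0 \<le> \<rho>" "\<And>\<alpha>. \<alpha> \<in> A \<Longrightarrow> measure \<lambda>\<^sub>0 {z \<in> open_cube. cell_fun n\<^sub>2 a\<^sub>2 z = \<alpha>}
      - measure \<lambda>\<^sub>0 {z \<in> open_cube. cell_fun n\<^sub>1 a\<^sub>1 z = \<alpha>} \<le> \<rho>"
  shows "\<exists>G\<in>\<G>. \<exists>G'\<in>\<G>. (\<forall>z\<in>cube. G (G' z) = z) \<and>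
    {z \<in> open_cube. cell_fun n\<^sub>1 a\<^sub>1 (G z) \<noteq> cell_fun n\<^sub>2 a\<^sub>2 z} \<in> sets \<lambda>\<^sub>0 \<and>
    measure \<lambda>\<^sub>0 {z \<in> open_cube. cell_fun n\<^sub>1 a\<^sub>1 (G z) \<noteq> cell_fun n\<^sub>2 a\<^sub>2 z} \<le> real (card A) * \<rho>"
proof -
  define n where "n = n\<^sub>1 * n\<^sub>2"
  have n0: "0 < n" using n by (simp add: n_def)
  define b\<^sub>1 b\<^sub>2 :: "int ^ 'd \<Rightarrow> 'v" where "b\<^sub>1 c = a\<^sub>1 (\<chi> i. c $ i div int n\<^sub>2)" and "b\<^sub>2 c = a\<^sub>2 (\<chi> i. c $ i div int n\<^sub>1)" for c
  have b: "cell_fun n\<^sub>1 a\<^sub>1 z = b\<^sub>1 (grid_cell n z)" "cell_fun n\<^sub>2 a\<^sub>2 z = b\<^sub>2 (grid_cell n z)" for z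
    using grid_cell_refine[OF n(2), of n\<^sub>1 z] grid_cell_refine[OF n(1), of n\<^sub>2 z]
    by (simp_all add: cell_fun_def b\<^sub>1_def b\<^sub>2_def n_def mult.commute)
  let ?S = "grid_cells n :: (int ^ 'd) set"
  have bA: "b\<^sub>1 ` ?S \<subseteq> A" "b\<^sub>2 ` ?S \<subseteq> A"
    using refine_in_cells[OF n(2), of _ n\<^sub>1] refine_in_cells[OF n(1), of _ n\<^sub>2] A(2,3)
    by (auto simp: b\<^sub>1_def b\<^sub>2_def n_def mult.commute image_subset_iff)
  obtain \<sigma> where \<sigma>: "bij_betw \<sigma> ?S ?S"
    and card: "card {c \<in> ?S. b\<^sub>1 (\<sigma> c) \<noteq> b\<^sub>2 c} \<le> (\<Sum>\<alpha>\<in>A. card {c \<in> ?S. b\<^sub>2 c = \<alpha>} - card {c \<in> ?S. b\<^sub>1 c = \<alpha>})"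
    using permutation_matching[OF finite_grid_cells A(1) bA] by blast
  define \<tau> where "\<tau> = the_inv_into ?S \<sigma>"
  have \<tau>: "bij_betw \<tau> ?S ?S" unfolding \<tau>_def by (rule bij_betw_the_inv_into[OF \<sigma>])
  have inv: "\<tau> (\<sigma> c) = c" "\<sigma> (\<tau> c) = c" if "c \<in> ?S" for c
    using that \<sigma> by (auto simp: \<tau>_def the_inv_into_f_f bij_betw_def f_the_inv_into_f)
  have \<tau>C: "\<And>c. c \<in> ?S \<Longrightarrow> \<tau> c \<in> ?S" and \<sigma>C: "\<And>c. c \<in> ?S \<Longrightarrow> \<sigma> c \<in> ?S" using \<sigma> \<tau> by (auto simp: bij_betw_def)
  define G G' where "G = grid_map n \<sigma>" and "G' = grid_map n \<tau>"
  have G: "G \<in> \<G>" "G' \<in> \<G>" unfolding G_def G'_def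
    by (rule grid_map_rearrangement[OF n0 \<sigma> \<tau> inv], assumption+)
      (rule grid_map_rearrangement[OF n0 \<tau> \<sigma> inv(2,1)], assumption+)
  have GG: "G (G' z) = z" for z unfolding G_def G'_def by (rule grid_map_inverse[OF n0 \<tau>C inv(2)])
  have count: "measure \<lambda>\<^sub>0 {z \<in> open_cube. f (grid_cell n z) = \<alpha>} = real (card {c \<in> ?S. f c = \<alpha>}) * cell_measure TYPE('d) n"
    for f :: "int ^ 'd \<Rightarrow> 'v" and \<alpha>
  proof -
    have "{z \<in> open_cube. f (grid_cell n z) = \<alpha>} = {z \<in> open_cube. grid_cell n z \<in> {c \<in> ?S. f c = \<alpha>}}"
      using grid_cell_in[OF n0] by auto
    then show ?thesis using measure_cells[OF n0, of "{c \<in> ?S. f c = \<alpha>}"] by simp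
  qed
  let ?m = "cell_measure TYPE('d) n"
  have m0: "0 \<le> ?m" by (simp add: cell_measure_def)
  have set: "{z \<in> open_cube. cell_fun n\<^sub>1 a\<^sub>1 (G z) \<noteq> cell_fun n\<^sub>2 a\<^sub>2 z}
    = {z \<in> open_cube. grid_cell n z \<in> {c \<in> ?S. b\<^sub>1 (\<sigma> c) \<noteq> b\<^sub>2 c}}"
    using grid_map_cell(1)[OF n0 \<sigma>C] grid_cell_in[OF n0] unfolding b G_def by auto
  have "{z \<in> open_cube. grid_cell n z \<in> {c \<in> ?S. b\<^sub>1 (\<sigma> c) \<noteq> b\<^sub>2 c}} = (\<Union>c\<in>{c \<in> ?S. b\<^sub>1 (\<sigma> c) \<noteq> b\<^sub>2 c}. grid_cell n -` {c})"
    using grid_cell_in[OF n0] by auto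
  moreover have "\<dots> \<in> sets \<lambda>\<^sub>0"
    using finite_grid_cells[of n] cell_sets_cube[OF n0] by (intro sets.finite_UN) auto
  ultimately have meas: "{z \<in> open_cube. cell_fun n\<^sub>1 a\<^sub>1 (G z) \<noteq> cell_fun n\<^sub>2 a\<^sub>2 z} \<in> sets \<lambda>\<^sub>0"
    unfolding set by simp
  have "measure \<lambda>\<^sub>0 {z \<in> open_cube. cell_fun n\<^sub>1 a\<^sub>1 (G z) \<noteq> cell_fun n\<^sub>2 a\<^sub>2 z}
    = real (card {c \<in> ?S. b\<^sub>1 (\<sigma> c) \<noteq> b\<^sub>2 c}) * ?m"
    unfolding set by (rule measure_cells[OF n0]) auto
  also have "\<dots> \<le> real (\<Sum>\<alpha>\<in>A. card {c \<in> ?S. b\<^sub>2 c = \<alpha>} - card {c \<in> ?S. b\<^sub>1 c = \<alpha>}) * ?m"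
    by (rule mult_right_mono[OF of_nat_mono[OF card] m0])
  also have "\<dots> = (\<Sum>\<alpha>\<in>A. real (card {c \<in> ?S. b\<^sub>2 c = \<alpha>} - card {c \<in> ?S. b\<^sub>1 c = \<alpha>}) * ?m)"
    by (simp add: sum_distrib_right)
  also have "\<dots> \<le> (\<Sum>\<alpha>\<in>A. \<rho>)"
  proof (rule sum_mono)
    fix \<alpha> assume \<alpha>: "\<alpha> \<in> A"
    let ?x = "card {c \<in> ?S. b\<^sub>2 c = \<alpha>}" and ?y = "card {c \<in> ?S. b\<^sub>1 c = \<alpha>}"
    have le: "real ?x * ?m - real ?y * ?m \<le> \<rho>" using \<rho>(2)[OF \<alpha>] unfolding b count .
    show "real (?x - ?y) * ?m \<le> \<rho>"
    proof (cases "?y \<le> ?x")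
      case True
      then show ?thesis using le by (simp add: of_nat_diff left_diff_distrib)
    qed (use \<rho>(1) in simp)
  qed
  also have "\<dots> = real (card A) * \<rho>" by simp
  finally show ?thesis using G GG meas by blast
qed

section \<open>Total boundedness modulo symmetries\<close>

lemma measurable_vec_lambda:
  assumes "\<And>i. g i \<in> borel_measurable M"
  shows "(\<lambda>z. (\<chi> i. g i z) :: real ^ 'd) \<in> borel_measurable M"
proof (subst borel_measurable_euclidean_space, intro ballI)
  fix b :: "real ^ 'd" assume "b \<in> Basis"
  then obtain i where "b = axis i 1" by (auto simp: Basis_vec_def)
  then show "(\<lambda>z. (\<chi> i. g i z) \<bullet> b) \<in> borel_measurable M" using assms[of i] by (simp add: inner_axis)
qed

lemma norm_le_dim:
  fixes v :: "real ^ 'd"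
  assumes "\<And>i. \<bar>v $ i\<bar> \<le> r" shows "norm v \<le> real CARD('d) * r"
proof -
  have "norm v \<le> (\<Sum>i\<in>UNIV. \<bar>v $ i\<bar>)" by (rule norm_le_l1_cart)
  also have "\<dots> \<le> (\<Sum>i\<in>(UNIV :: 'd set). r)" by (intro sum_mono assms)
  finally show ?thesis by simp
qed

text \<open>
  The fractional parts of the coordinates differ from the coordinates by integers.
\<close>

lemma reduce_mod_integers:
  fixes M :: "('d::finite) L2"
  shows "\<exists>Z f. integer_valued Z \<and> f \<in> borel_measurable \<lambda>\<^sub>0 \<and> (\<forall>z i. 0 \<le> f z $ i \<and> f z $ i \<le> 1) \<and>
    square_integrable f \<and> M + Z = abs_L2 f"
proof -
  let ?f0 = "rep_L2 M"
  have m0[measurable]: "?f0 \<in> borel_measurable \<lambda>\<^sub>0" using rep_L2(1)[of M] by (simp add: square_integrable_def)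
  define f where "f z = (\<chi> i. frac (?f0 z $ i))" for z
  have comp[measurable]: "(\<lambda>z. ?f0 z $ i) \<in> borel_measurable \<lambda>\<^sub>0" for i
    by (rule measurable_compose[OF m0 measurable_vec_nth_borel])
  have fm: "f \<in> borel_measurable \<lambda>\<^sub>0"
    unfolding f_def by (intro measurable_vec_lambda) (unfold frac_def, measurable)
  have f01: "0 \<le> f z $ i \<and> f z $ i \<le> 1" for z i
    using frac_lt_1[of "?f0 z $ i"] by (simp add: f_def less_imp_le)
  have fs: "square_integrable f"
  proof (rule square_integrable_bounded[OF fm])
    show "norm (f z) \<le> real CARD('d) * 1" for z using f01[of z] by (intro norm_le_dim) auto
  qed
  define Z where "Z = abs_L2 (\<lambda>z. f z - ?f0 z)"
  have zs: "square_integrable (\<lambda>z. f z - ?f0 z)" by (rule square_integrable_diff[OF fs rep_L2(1)])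
  have "integer_valued Z"
    unfolding Z_def integer_valued_abs[OF zs] by (intro AE_I2 allI) (simp add: f_def frac_def)
  moreover have "M + Z = abs_L2 f"
  proof -
    have "M + Z = abs_L2 ?f0 + abs_L2 (\<lambda>z. f z - ?f0 z)" by (simp add: Z_def rep_L2(2))
    also have "\<dots> = abs_L2 f" unfolding abs_L2_add[OF rep_L2(1) zs] by simp
    finally show ?thesis .
  qed
  ultimately show ?thesis using fm f01 fs by blast
qed

text \<open>
  A Lebesgue measurable function is an almost everywhere limit of continuous functions.  After
  truncating these to the unit cube, dominated convergence applies.
\<close>

lemma continuous_approximation:
  fixes f :: "real ^ 'd \<Rightarrow> real ^ 'd"
  assumes f: "f \<in> borel_measurable \<lambda>\<^sub>0" and f01: "\<And>z i. 0 \<le> f z $ i \<and> f z $ i \<le> 1" and e: "0 < e"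
  shows "\<exists>g. continuous_on UNIV g \<and> (\<forall>z i. 0 \<le> g z $ i \<and> g z $ i \<le> 1) \<and>
    integrable \<lambda>\<^sub>0 (\<lambda>z. (norm (f z - g z))\<^sup>2) \<and> (\<integral>z. (norm (f z - g z))\<^sup>2 \<partial>\<lambda>\<^sub>0) < e"
proof -
  interpret finite_measure "\<lambda>\<^sub>0 :: (real^'d) measure" by (rule finite_measure_cube)
  have "(\<lambda>z. indicator cube z *\<^sub>R f z) \<in> borel_measurable lborel"
    using f cube_sets unfolding cube_measure_def by (subst (asm) borel_measurable_restrict_space_iff) auto
  then have "(\<lambda>z. indicator cube z *\<^sub>R f z) \<in> borel_measurable lebesgue" by (rule measurable_completion)
  then have "(\<lambda>z. indicator cube z *\<^sub>R f z) measurable_on UNIV"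
    by (rule lebesgue_measurable_imp_measurable_on) simp
  then obtain N h where N: "negligible N" and h: "\<And>n. continuous_on UNIV (h n)"
    and lim: "\<And>z. z \<notin> N \<Longrightarrow> (\<lambda>n :: nat. h n z) \<longlonglongrightarrow> indicator cube z *\<^sub>R f z"
    unfolding measurable_on_def by auto
  define g where "g n z = (\<chi> i. max 0 (min 1 (h n z $ i)))" for n z
  have g: "continuous_on UNIV (g n)" for n unfolding g_def
    by (intro continuous_intros h)
  have g01: "0 \<le> g n z $ i \<and> g n z $ i \<le> 1" for n z i by (simp add: g_def)
  have gm: "g n \<in> borel_measurable \<lambda>\<^sub>0" for n
    unfolding cube_measure_def by (rule measurable_restrict_space1) (simp add: borel_measurable_continuous_onI g)
  have "AE z in lborel. z \<notin> N"
  proof -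
    have "AE z in lebesgue. z \<notin> N" using N by (intro AE_not_in) (simp add: negligible_iff_null_sets)
    then show ?thesis by (simp add: AE_completion_iff)
  qed
  then have "AE z in \<lambda>\<^sub>0. z \<notin> N"
    unfolding cube_measure_def by (subst AE_restrict_space_iff) (auto simp: cube_sets elim!: eventually_mono)
  then have AE: "AE z in \<lambda>\<^sub>0. (\<lambda>n. (norm (f z - g n z))\<^sup>2) \<longlonglongrightarrow> 0"
    using AE_space
  proof eventually_elim
    case (elim z)
    then have "(\<lambda>n. h n z) \<longlonglongrightarrow> f z" using lim[of z] by (simp add: space_cube_measure)
    then have "(\<lambda>n. g n z) \<longlonglongrightarrow> (\<chi> i. max 0 (min 1 (f z $ i)))"
      unfolding g_def by (intro tendsto_intros)
    also have "(\<chi> i. max 0 (min 1 (f z $ i))) = f z" using f01[of z] by (simp add: vec_eq_iff max_absorb2 min_absorb2)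
    finally have "(\<lambda>n. (norm (f z - g n z))\<^sup>2) \<longlonglongrightarrow> (norm (f z - f z))\<^sup>2" by (intro tendsto_intros)
    then show ?case by simp
  qed
  have bound: "(norm (f z - g n z))\<^sup>2 \<le> (real CARD('d) * 1)\<^sup>2" for n z
  proof -
    have "\<bar>(f z - g n z) $ i\<bar> \<le> 1" for i using f01[of z i] g01[of n z i] by simp linarith
    then show ?thesis by (intro power_mono norm_le_dim) auto
  qed
  have um: "(\<lambda>z. (norm (f z - g n z))\<^sup>2) \<in> borel_measurable \<lambda>\<^sub>0" for n
    using f gm[of n] by measurable
  have int: "integrable \<lambda>\<^sub>0 (\<lambda>z. (norm (f z - g n z))\<^sup>2)" for n
    by (rule integrable_const_bound[OF _ um, where B="(real CARD('d) * 1)\<^sup>2"]) (use bound in auto)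
  have "(\<lambda>n. \<integral>z. (norm (f z - g n z))\<^sup>2 \<partial>\<lambda>\<^sub>0) \<longlonglongrightarrow> (\<integral>z. 0 \<partial>(\<lambda>\<^sub>0 :: (real^'d) measure))"
    by (rule integral_dominated_convergence[where w="\<lambda>_. (real CARD('d) * 1)\<^sup>2"])
      (use AE um bound in auto)
  then have "eventually (\<lambda>n. (\<integral>z. (norm (f z - g n z))\<^sup>2 \<partial>\<lambda>\<^sub>0) < e) sequentially"
    using e by (intro order_tendstoD(2)) auto
  then obtain n where "(\<integral>z. (norm (f z - g n z))\<^sup>2 \<partial>\<lambda>\<^sub>0) < e" by (auto simp: eventually_sequentially)
  then show ?thesis using g g01 int by blast
qed

definition value_grid :: "nat \<Rightarrow> (real ^ 'd) set"
  where "value_grid P = {v. \<forall>i. v $ i \<in> (\<lambda>k. real k / real P) ` {..P}}"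

lemma finite_value_grid: "finite (value_grid P)"
  unfolding value_grid_def by (rule finite_vec_set) simp

text \<open>
  After reduction modulo integers and approximation by a continuous \<open>g\<close>, sample \<open>g\<close> at the corners
  of a fine grid and round its coordinates down to multiples of \<open>1 / P\<close>.  Sampling and
  rounding each cost at most \<open>\<eta> = d / P\<close> in the supremum norm, where \<open>d\<close> is the dimension.
\<close>

lemma grid_approximation:
  fixes M :: "('d::finite) L2"
  assumes \<delta>: "0 < \<delta>" and P: "0 < P" "12 * (measure \<lambda>\<^sub>0 (cube :: (real^'d) set) + 1) * (real CARD('d) / real P)\<^sup>2 \<le> \<delta>\<^sup>2"
  shows "\<exists>Z n a. integer_valued Z \<and> 0 < n \<and> a ` grid_cells n \<subseteq> value_grid P \<and>
    norm (M + Z - abs_L2 (cell_fun n a)) \<le> \<delta>"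
proof -
  interpret finite_measure "\<lambda>\<^sub>0 :: (real^'d) measure" by (rule finite_measure_cube)
  define W where "W = measure \<lambda>\<^sub>0 (cube :: (real^'d) set)"
  define \<eta> where "\<eta> = real CARD('d) / real P"
  have \<eta>: "0 < \<eta>" "12 * (W + 1) * \<eta>\<^sup>2 \<le> \<delta>\<^sup>2" using P by (simp_all add: \<eta>_def W_def)
  obtain Z f where Z: "integer_valued Z" "M + Z = abs_L2 f" and f: "f \<in> borel_measurable \<lambda>\<^sub>0"
    "\<And>z i. 0 \<le> f z $ i \<and> f z $ i \<le> 1" "square_integrable f" using reduce_mod_integers[of M] by blast
  have "0 < \<delta>\<^sup>2 / 6" using \<delta> by simp
  then obtain g where g: "continuous_on UNIV g" "\<And>z i. 0 \<le> g z $ i \<and> g z $ i \<le> 1"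
    "integrable \<lambda>\<^sub>0 (\<lambda>z. (norm (f z - g z))\<^sup>2)" "(\<integral>z. (norm (f z - g z))\<^sup>2 \<partial>\<lambda>\<^sub>0) < \<delta>\<^sup>2 / 6"
    using continuous_approximation[OF f(1,2)] by blast
  have "uniformly_continuous_on cube g"
    using g(1) by (intro compact_uniformly_continuous continuous_on_subset[OF g(1)]) (auto simp: cube_def)
  then obtain d where d: "0 < d" "\<And>z z'. z \<in> cube \<Longrightarrow> z' \<in> cube \<Longrightarrow> dist z' z < d \<Longrightarrow> dist (g z') (g z) < \<eta>"
    unfolding uniformly_continuous_on_def using \<eta>(1) by metis
  obtain n :: nat where "real CARD('d) / d < real n" using reals_Archimedean2 by blast
  moreover have "0 < real CARD('d) / d" using d(1) by simp
  ultimately have n: "0 < n" "real CARD('d) * (1 / real n) < d"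
    using d(1) by (auto simp: divide_less_eq mult.commute intro: gr0I)
  define a where "a c = (\<chi> i. real_of_int \<lfloor>real P * g (grid_corner n c) $ i\<rfloor> / real P)" for c
  have a: "a c \<in> value_grid P" for c
    unfolding value_grid_def
  proof (intro CollectI allI)
    fix i
    let ?k = "\<lfloor>real P * g (grid_corner n c) $ i\<rfloor>"
    have "0 \<le> real P * g (grid_corner n c) $ i" "real P * g (grid_corner n c) $ i \<le> real P"
      using g(2)[of "grid_corner n c" i] by (auto simp: mult_left_le)
    then have "0 \<le> ?k" "?k \<le> int P" by linarith+
    then have "real_of_int ?k = real (nat ?k)" "nat ?k \<in> {..P}" by auto
    then show "a c $ i \<in> (\<lambda>k. real k / real P) ` {..P}" unfolding a_def by auto
  qed
  have near: "norm (f z - cell_fun n a z) \<le> norm (f z - g z) + 2 * \<eta>" if z: "z \<in> open_cube" for z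
  proof -
    let ?c = "grid_corner n (grid_cell n z)"
    have cz: "\<bar>(z - ?c) $ i\<bar> \<le> 1 / real n" and c0: "0 \<le> ?c $ i" "?c $ i \<le> z $ i" for i
    proof -
      let ?u = "real n * z $ i"
      have zi: "z $ i = ?u / real n" using n(1) by simp
      have ci: "?c $ i = real_of_int \<lfloor>?u\<rfloor> / real n" by (simp add: grid_corner_def grid_cell_def)
      have fl: "real_of_int \<lfloor>?u\<rfloor> \<le> ?u" "?u \<le> real_of_int \<lfloor>?u\<rfloor> + 1" "0 \<le> \<lfloor>?u\<rfloor>"
        using z by (auto simp: open_cube_def)
      show "?c $ i \<le> z $ i" unfolding ci by (subst zi) (rule divide_right_mono[OF fl(1)], simp)
      show "0 \<le> ?c $ i" unfolding ci using fl(3) by simp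
      have "z $ i \<le> (real_of_int \<lfloor>?u\<rfloor> + 1) / real n" by (subst zi) (rule divide_right_mono[OF fl(2)], simp)
      then show "\<bar>(z - ?c) $ i\<bar> \<le> 1 / real n"
        using \<open>?c $ i \<le> z $ i\<close> unfolding vector_minus_component ci by (simp add: add_divide_distrib)
    qed
    have "z \<in> cube" using z open_cube_subset by blast
    moreover have "?c \<in> cube"
      unfolding mem_cube
    proof
      fix i
      have "z $ i < 1" using z by (simp add: open_cube_def)
      then show "0 \<le> ?c $ i \<and> ?c $ i \<le> 1" using c0[of i] by linarith
    qed
    moreover have "dist z ?c < d"
      unfolding dist_norm using norm_le_dim[of "z - ?c", OF cz] n(2) by linarith
    ultimately have 1: "norm (g z - g ?c) < \<eta>" using d(2) by (simp add: dist_norm)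
    have "\<bar>(g ?c - cell_fun n a z) $ i\<bar> \<le> 1 / real P" for i
    proof -
      let ?u = "real P * g ?c $ i"
      have gi: "g ?c $ i = ?u / real P" using P(1) by simp
      have ai: "cell_fun n a z $ i = real_of_int \<lfloor>?u\<rfloor> / real P" by (simp add: cell_fun_def a_def)
      have fl: "real_of_int \<lfloor>?u\<rfloor> \<le> ?u" "?u \<le> real_of_int \<lfloor>?u\<rfloor> + 1" by linarith+
      have "g ?c $ i \<le> (real_of_int \<lfloor>?u\<rfloor> + 1) / real P" by (subst gi) (rule divide_right_mono[OF fl(2)], simp)
      moreover have "real_of_int \<lfloor>?u\<rfloor> / real P \<le> g ?c $ i" by (subst (2) gi) (rule divide_right_mono[OF fl(1)], simp)
      ultimately show ?thesis by (simp add: ai add_divide_distrib)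
    qed
    from norm_le_dim[OF this] have 2: "norm (g ?c - cell_fun n a z) \<le> \<eta>" by (simp add: \<eta>_def)
    have "f z - cell_fun n a z = (f z - g z) + ((g z - g ?c) + (g ?c - cell_fun n a z))" by simp
    then have "norm (f z - cell_fun n a z) \<le> norm (f z - g z) + (norm (g z - g ?c) + norm (g ?c - cell_fun n a z))"
      by (metis norm_triangle_le add_left_mono norm_triangle_ineq)
    then show ?thesis using 1 2 by linarith
  qed
  have cs: "square_integrable (cell_fun n a)" by (rule cell_fun_square_integrable[OF n(1)])
  have ds: "square_integrable (\<lambda>z. f z - cell_fun n a z)" by (rule square_integrable_diff[OF f(3) cs])
  have "(norm (M + Z - abs_L2 (cell_fun n a)))\<^sup>2 = (\<integral>z. (norm (f z - cell_fun n a z))\<^sup>2 \<partial>\<lambda>\<^sub>0)"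
    unfolding Z(2) abs_L2_diff[OF f(3) cs] by (rule norm_abs_L2[OF ds])
  also have "\<dots> \<le> (\<integral>z. 2 * (norm (f z - g z))\<^sup>2 + 8 * \<eta>\<^sup>2 \<partial>\<lambda>\<^sub>0)"
  proof (rule integral_mono_AE)
    show "integrable \<lambda>\<^sub>0 (\<lambda>z. (norm (f z - cell_fun n a z))\<^sup>2)" using ds by (simp add: square_integrable_def)
    show "integrable \<lambda>\<^sub>0 (\<lambda>z. 2 * (norm (f z - g z))\<^sup>2 + 8 * \<eta>\<^sup>2)" using g(3) by auto
    show "AE z in \<lambda>\<^sub>0. (norm (f z - cell_fun n a z))\<^sup>2 \<le> 2 * (norm (f z - g z))\<^sup>2 + 8 * \<eta>\<^sup>2"
      using AE_open_cube
    proof eventually_elim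
      case (elim z)
      have "(norm (f z - cell_fun n a z))\<^sup>2 \<le> (norm (f z - g z) + 2 * \<eta>)\<^sup>2"
        using near[OF elim] by (intro power_mono) auto
      also have "\<dots> \<le> 2 * (norm (f z - g z))\<^sup>2 + 2 * (2 * \<eta>)\<^sup>2"
        using sum_squares_bound[of "norm (f z - g z)" "2 * \<eta>"] unfolding power2_sum by linarith
      finally show ?case by (simp add: power_mult_distrib)
    qed
  qed
  also have "\<dots> = 2 * (\<integral>z. (norm (f z - g z))\<^sup>2 \<partial>\<lambda>\<^sub>0) + 8 * \<eta>\<^sup>2 * W"
    using g(3) by (simp add: W_def space_cube_measure mult.commute)
  also have "\<dots> \<le> \<delta>\<^sup>2"
  proof -
    have "0 \<le> \<eta>\<^sup>2 * W" "0 \<le> \<eta>\<^sup>2" by (auto simp: W_def)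
    moreover have "12 * (\<eta>\<^sup>2 * W) + 12 * \<eta>\<^sup>2 \<le> \<delta>\<^sup>2" using \<eta>(2) by (simp add: algebra_simps)
    ultimately show ?thesis using g(4) unfolding mult.assoc by linarith
  qed
  finally have "norm (M + Z - abs_L2 (cell_fun n a)) \<le> \<delta>" by (rule power2_le_imp_le) (use \<delta> in simp)
  then show ?thesis using Z(1) n(1) a by blast
qed

text \<open>
  The key of \<open>M\<close> records, up to a rounding error, how much measure a grid approximation of \<open>M\<close>
  gives to each of finitely many values.  If two keys agree, a rearrangement matches the two
  approximations except on a set of small measure.
\<close>

lemma lagrangian_totally_bounded_modulo_symmetry:
  fixes L :: "('d::finite) L2 \<Rightarrow> 'd L2 \<Rightarrow> real"
  assumes L: "lagrangian L" and \<delta>: "0 < \<delta>"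
  shows "\<exists>\<kappa> :: 'd L2 \<Rightarrow> (real ^ 'd \<Rightarrow> nat). finite (range \<kappa>) \<and>
    (\<forall>M N. \<kappa> M = \<kappa> N \<longrightarrow> (\<exists>\<phi> Z. symmetry (shifted_lagrangian L c) \<phi> Z \<and> norm (\<phi> M + Z - N) < \<delta>))"
proof -
  interpret finite_measure "\<lambda>\<^sub>0 :: (real^'d) measure" by (rule finite_measure_cube)
  define W where "W = measure \<lambda>\<^sub>0 (cube :: (real^'d) set)"
  define q where "q = \<delta> / 4"
  have q: "0 < q" using \<delta> by (simp add: q_def)
  define D where "D = real CARD('d)"
  have D: "0 < D" by (simp add: D_def)
  have W: "0 \<le> W" by (simp add: W_def)
  have "\<exists>P. 0 < P \<and> 12 * (W + 1) * (D / real P)\<^sup>2 \<le> q\<^sup>2"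
  proof -
    have "(\<lambda>P. 12 * (W + 1) * (D / real P)\<^sup>2) \<longlonglongrightarrow> 12 * (W + 1) * 0\<^sup>2"
      by (intro tendsto_intros lim_const_over_n)
    then have "eventually (\<lambda>P. 12 * (W + 1) * (D / real P)\<^sup>2 < q\<^sup>2) sequentially"
      using q by (intro order_tendstoD(2)) auto
    then have "eventually (\<lambda>P. 0 < P \<and> 12 * (W + 1) * (D / real P)\<^sup>2 \<le> q\<^sup>2) sequentially"
      using eventually_gt_at_top[of 0] by eventually_elim simp
    then show ?thesis by (auto simp: eventually_sequentially)
  qed
  then obtain P where P: "0 < P" "12 * (W + 1) * (D / real P)\<^sup>2 \<le> q\<^sup>2" by blast
  define A where "A = (value_grid P :: (real^'d) set)"
  have A: "finite A" unfolding A_def by (rule finite_value_grid)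
  have A01: "0 \<le> v $ i \<and> v $ i \<le> 1" if "v \<in> A" for v i
  proof -
    have "v $ i \<in> (\<lambda>k. real k / real P) ` {..P}" using that by (simp add: A_def value_grid_def)
    then show ?thesis using P(1) by auto
  qed
  have "\<exists>Z n a. integer_valued Z \<and> 0 < n \<and> a ` grid_cells n \<subseteq> A \<and> norm (M + Z - abs_L2 (cell_fun n a)) \<le> q"
    for M :: "'d L2"
    unfolding A_def by (rule grid_approximation[OF q P(1) P(2)[unfolded W_def D_def]])
  then obtain Z n a where Z: "\<And>M :: 'd L2. integer_valued (Z M)" and n: "\<And>M :: 'd L2. 0 < n M"
    and a: "\<And>M :: 'd L2. a M ` grid_cells (n M) \<subseteq> A"
    and app: "\<And>M :: 'd L2. norm (M + Z M - abs_L2 (cell_fun (n M) (a M))) \<le> q" by metis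
  define s where "s M = cell_fun (n M) (a M)" for M :: "'d L2"
  have sA: "s M z \<in> A" if "z \<in> open_cube" for M z
    using grid_cell_in[OF n[of M], of z] that a[of M] by (auto simp: s_def cell_fun_def)
  have sq: "square_integrable (s M)" for M unfolding s_def by (rule cell_fun_square_integrable[OF n])
  \<comment> \<open>measures are rounded to multiples of \<open>1 / R\<close>; a mismatch on a set of measure \<open>card A / R\<close> is then affordable since the values differ by at most \<open>D\<close> in norm\<close>
  define R where "R = D\<^sup>2 * real (card A) / q\<^sup>2 + 1"
  have R: "0 < R" by (simp add: R_def add_nonneg_pos)
  have Rq: "D\<^sup>2 * (real (card A) * (1 / R)) \<le> q\<^sup>2"
  proof -
    have "D\<^sup>2 * real (card A) \<le> q\<^sup>2 * R" using q by (simp add: R_def distrib_left)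
    then show ?thesis using R by (simp add: divide_le_eq)
  qed
  define \<mu> where "\<mu> M \<alpha> = measure \<lambda>\<^sub>0 {z \<in> open_cube. s M z = \<alpha>}" for M \<alpha>
  define \<kappa> where "\<kappa> M = restrict (\<lambda>\<alpha>. nat \<lfloor>R * \<mu> M \<alpha>\<rfloor>) A" for M
  have \<mu>: "0 \<le> \<mu> M \<alpha>" "\<mu> M \<alpha> \<le> W" for M \<alpha>
    using bounded_measure[of "{z \<in> open_cube. s M z = \<alpha>}"] by (auto simp: \<mu>_def W_def space_cube_measure)
  have "range \<kappa> \<subseteq> PiE A (\<lambda>_. {..nat \<lfloor>R * W\<rfloor>})"
  proof (rule image_subsetI)
    fix M
    have "nat \<lfloor>R * \<mu> M \<alpha>\<rfloor> \<le> nat \<lfloor>R * W\<rfloor>" for \<alpha>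
      using \<mu>(2)[of M \<alpha>] R by (intro nat_mono floor_mono mult_left_mono) auto
    then show "\<kappa> M \<in> PiE A (\<lambda>_. {..nat \<lfloor>R * W\<rfloor>})" by (simp add: \<kappa>_def)
  qed
  moreover have "finite (PiE A (\<lambda>_. {..nat \<lfloor>R * W\<rfloor>}))" using A by (intro finite_PiE) auto
  ultimately have fin: "finite (range \<kappa>)" by (rule finite_subset)
  have "\<exists>\<phi> Y. symmetry (shifted_lagrangian L c) \<phi> Y \<and> norm (\<phi> M + Y - N) < \<delta>" if eq: "\<kappa> M = \<kappa> N" for M N
  proof -
    have close: "\<mu> N \<alpha> - \<mu> M \<alpha> \<le> 1 / R" if "\<alpha> \<in> A" for \<alpha>
    proof -
      have "nat \<lfloor>R * \<mu> M \<alpha>\<rfloor> = nat \<lfloor>R * \<mu> N \<alpha>\<rfloor>" using fun_cong[OF eq, of \<alpha>] that by (simp add: \<kappa>_def)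
      moreover have "0 \<le> R * \<mu> M \<alpha>" "0 \<le> R * \<mu> N \<alpha>" using R \<mu>(1) by simp_all
      ultimately have "\<lfloor>R * \<mu> M \<alpha>\<rfloor> = \<lfloor>R * \<mu> N \<alpha>\<rfloor>"
        by (metis nat_0_le zero_le_floor)
      then have "R * \<mu> N \<alpha> - R * \<mu> M \<alpha> \<le> 1" by linarith
      then have "(\<mu> N \<alpha> - \<mu> M \<alpha>) * R \<le> 1" by (simp add: algebra_simps)
      then show ?thesis using R by (simp add: le_divide_eq)
    qed
    obtain G G' where G: "G \<in> \<G>" "G' \<in> \<G>" "\<And>z. z \<in> cube \<Longrightarrow> G (G' z) = z"
      and E: "{z \<in> open_cube. s M (G z) \<noteq> s N z} \<in> sets \<lambda>\<^sub>0"
        "measure \<lambda>\<^sub>0 {z \<in> open_cube. s M (G z) \<noteq> s N z} \<le> real (card A) * (1 / R)"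
      using rearrange_to_match[OF n[of M] n[of N] A a[of M] a[of N], of "1 / R"] close R
      unfolding \<mu>_def s_def by auto
    let ?E = "{z \<in> open_cube. s M (G z) \<noteq> s N z}"
    have sG: "square_integrable (s M \<circ> G)" by (rule square_integrable_comp[OF G(1) sq])
    have dG: "square_integrable (\<lambda>z. (s M \<circ> G) z - s N z)" by (rule square_integrable_diff[OF sG sq])
    have "norm (abs_L2 (s M) \<circ>\<^sub>L G - abs_L2 (s N)) \<le> q"
    proof -
      have Gcube: "AE z in \<lambda>\<^sub>0. G z \<in> open_cube"
      proof -
        have Gm: "G \<in> \<lambda>\<^sub>0 \<rightarrow>\<^sub>M \<lambda>\<^sub>0" "distr \<lambda>\<^sub>0 \<lambda>\<^sub>0 G = \<lambda>\<^sub>0" using G(1) by (auto simp: rearrangements_def)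
        show ?thesis by (rule AE_distrD[OF Gm(1)]) (unfold Gm(2), rule AE_open_cube)
      qed
      have "(norm (abs_L2 (s M) \<circ>\<^sub>L G - abs_L2 (s N)))\<^sup>2 = (\<integral>z. (norm ((s M \<circ> G) z - s N z))\<^sup>2 \<partial>\<lambda>\<^sub>0)"
        unfolding L2_comp_abs[OF G(1) sq] abs_L2_diff[OF sG sq] by (rule norm_abs_L2[OF dG])
      also have "\<dots> \<le> (\<integral>z. D\<^sup>2 * indicator ?E z \<partial>\<lambda>\<^sub>0)"
      proof (rule integral_mono_AE)
        show "integrable \<lambda>\<^sub>0 (\<lambda>z. (norm ((s M \<circ> G) z - s N z))\<^sup>2)" using dG by (simp add: square_integrable_def)
        show "integrable \<lambda>\<^sub>0 (\<lambda>z. D\<^sup>2 * indicator ?E z)"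
          by (intro integrable_mult_right integrable_real_indicator E(1)) (simp add: less_top[symmetric] emeasure_finite)
        show "AE z in \<lambda>\<^sub>0. (norm ((s M \<circ> G) z - s N z))\<^sup>2 \<le> D\<^sup>2 * indicator ?E z"
          using AE_open_cube Gcube
        proof eventually_elim
          case (elim z)
          have "\<bar>(s M (G z) - s N z) $ i\<bar> \<le> 1" for i
            using A01[OF sA[OF elim(2)], of M i] A01[OF sA[OF elim(1)], of N i] by simp linarith
          from norm_le_dim[OF this] have "(norm (s M (G z) - s N z))\<^sup>2 \<le> D\<^sup>2"
            by (intro power_mono) (auto simp: D_def)
          then show ?case using elim by (cases "s M (G z) = s N z") auto
        qed
      qed
      also have "\<dots> = D\<^sup>2 * measure \<lambda>\<^sub>0 ?E" using E(1) by (simp add: sets.sets_into_space Int_absorb2)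
      also have "\<dots> \<le> D\<^sup>2 * (real (card A) * (1 / R))" using E(2) by (intro mult_left_mono) auto
      also have "\<dots> \<le> q\<^sup>2" by (rule Rq)
      finally show ?thesis by (rule power2_le_imp_le) (use q in simp)
    qed
    note match = this
    let ?F = "shifted_lagrangian L c"
    have lin: "linear (\<lambda>M. M \<circ>\<^sub>L G)" by (rule L2_comp_linear[OF G(1)])
    \<comment> \<open>translate \<open>M\<close> by \<open>Z M\<close>, rearrange, and translate back by \<open>Z N\<close>\<close>
    define \<phi> where "\<phi> = ((\<lambda>v. v) \<circ> (\<lambda>M. M \<circ>\<^sub>L G)) \<circ> (\<lambda>v :: 'd L2. v)"
    define Y where "Y = ((\<lambda>v. v) \<circ> (\<lambda>M. M \<circ>\<^sub>L G)) (Z M) + ((\<lambda>v. v) 0 + - Z N)"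
    have "symmetry ?F \<phi> Y" unfolding \<phi>_def Y_def
      by (rule symmetry_compose[OF symmetry_compose[OF translation_symmetry[OF L integer_valued_uminus[OF Z]]
        rearrangement_symmetry[OF L G]] translation_symmetry[OF L Z]])
    moreover have "norm (\<phi> M + Y - N) < \<delta>"
    proof -
      have "\<phi> M + Y - N = (M + Z M - abs_L2 (s M)) \<circ>\<^sub>L G + (abs_L2 (s M) \<circ>\<^sub>L G - abs_L2 (s N))
        - (N + Z N - abs_L2 (s N))"
        by (simp add: \<phi>_def Y_def linear_add[OF lin] linear_diff[OF lin])
      moreover have "norm (u + v - w) \<le> norm u + norm v + norm w" for u v w :: "'d L2"
        using norm_triangle_ineq[of u v] norm_triangle_ineq4[of "u + v" w] by linarith
      ultimately have "norm (\<phi> M + Y - N) \<le> norm ((M + Z M - abs_L2 (s M)) \<circ>\<^sub>L G)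
        + norm (abs_L2 (s M) \<circ>\<^sub>L G - abs_L2 (s N)) + norm (N + Z N - abs_L2 (s N))"
        by (simp only:)
      also have "\<dots> \<le> q + q + q"
        using app[of M] app[of N] match unfolding L2_comp_norm[OF G(1)] s_def by (intro add_mono)
      also have "\<dots> < \<delta>" using \<delta> by (simp add: q_def)
      finally show ?thesis .
    qed
    ultimately show ?thesis by blast
  qed
  with fin show ?thesis by blast
qed

section \<open>Calibrated curves\<close>

theorem corollary1p1:
  fixes L :: "('d::finite) L2 \<Rightarrow> 'd L2 \<Rightarrow> real"
    and c :: "real ^ 'd"
    and U :: "'d L2 \<Rightarrow> real"
    and H :: real
  assumes "lagrangian L"
    and "vanishing_discount_limit L c U H"
  shows "\<exists>x :: real \<Rightarrow> 'd L2. AC2_loc x \<and> calibrated U c L H x"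
proof -
  let ?F = "shifted_lagrangian L c"
  obtain D \<gamma> K \<kappa> C0 C1 C2 where disc: "discounted ?F D \<gamma> K \<kappa> C0 C1 C2"
    using lagrangian_discounted[OF assms(1)] by blast
  interpret discounted ?F D \<gamma> K \<kappa> C0 C1 C2 by (rule disc)
  obtain \<epsilon> B where \<epsilon>: "\<And>j. 0 < \<epsilon> j" "\<epsilon> \<longlonglongrightarrow> 0"
    and limH: "uniform_limit UNIV (\<lambda>j M. \<epsilon> j * value_fun L c (\<epsilon> j) M) (\<lambda>_. - H) sequentially"
    and limU: "uniform_limit UNIV (\<lambda>j M. value_fun L c (\<epsilon> j) M - (INF N. value_fun L c (\<epsilon> j) N)) U sequentially"
    and lip: "B-lipschitz_on UNIV U"
    using assms(2) unfolding vanishing_discount_limit_def by blast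
  have val: "value_fun L c (\<epsilon> j) M = W (\<epsilon> j) M - C0 / \<epsilon> j" for j M
    unfolding value_fun_def by (rule INF_ereal_integral[OF \<epsilon>(1)])
  have van: "vanishing ?F D \<gamma> K \<kappa> C0 C1 C2 \<epsilon> U H (\<lambda>j. INF N. value_fun L c (\<epsilon> j) N)"
  proof (intro vanishing.intro disc vanishing_axioms.intro)
    show "continuous_on UNIV U" by (rule lipschitz_on_continuous_on[OF lip])
  qed (use \<epsilon> limH limU in \<open>simp_all add: val\<close>)
  obtain x where x: "AC2_loc x" "\<And>a b. a \<le> b \<Longrightarrow> U (x a) = action (\<lambda>M N. ?F M N + H) x a b + U (x b)"
    using vanishing.calibrated_curve_exists[OF van convergent_modulo_symmetry[OF lagrangian_totally_bounded_modulo_symmetry[OF assms(1)]]]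
    by blast
  interpret T: tonelli "\<lambda>M N. ?F M N + H" D \<gamma> K \<kappa> "C0 + \<bar>H\<bar>" "C1 + \<bar>H\<bar>"
    by (rule tonelli_add_const) unfold_locales
  have "calibrated U c L H x"
    unfolding calibrated_def using x T.lag_integrable[OF x(1)] by (simp add: action_def T.lag_def[abs_def])
  with x(1) show ?thesis by blast
qed

end
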